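(* Fix an integer $M\ge 1$. Consider the family of generalized Jackson networks (GJNs) indexed by $r\in(0,1)$ described in the context, under the multi-scale heavy traffic condition $\mu_j^{(r)}=\lambda_j+r^j$ for $j=1,\dots,J$, and assume the stability assumption holds. Suppose \[ \mathbb{E}\big[T_{e,j}(1)^{M+1}\big]<\infty \ \text{ for } 1\le j\le M\wedge J,\qquad \mathbb{E}\big[T_{s,j}(1)^{M+1}\big]<\infty \ \text{ for } 1\le j\le J . \] Let $r_0$ be the constant \[ r_0=\min_{\{1\le k<j\le J:\ w_{jk}\neq 0\}}\left(\frac{1-w_{kk}}{J\,w_{jk}}\right)^{1/(j-k)} \] (taken to be $1$ if the index set is empty), where $(w_{jk})$ is the matrix defined in the context. Then for each $1\le k\le M\wedge J$ there is a finite constant $C_k>0$ such that for all $r\in(0,1)$ with $r<r_0$, \[ \mathbb{E}_\pi\Big[\big(r^k Z_k^{(r)}\big)^M\Big]\le C_k . \]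
   Context: Network model: there are $J$ single-server FCFS stations $\mathcal J=\{1,\dots,J\}$ with infinite buffers. On a probability space there are $3J$ mutually independent i.i.d. sequences $\{T_{e,j}(i)\}_{i\ge1}$, $\{T_{s,j}(i)\}_{i\ge1}$, $\{\phi^{j}(i)\}_{i\ge1}$, $j\in\mathcal J$, with $T_{e,j}(i),T_{s,j}(i)\ge 0$ and $\mathbb{E}[T_{e,j}(1)]=\mathbb{E}[T_{s,j}(1)]=1$. Constants $\alpha_j\ge0$ (external arrival rates) and $\mu_j>0$ (service rates) are given; $T_{e,j}(i)/\alpha_j$ is the $i$th external interarrival time to station $j$ and $T_{s,j}(i)/\mu_j$ the $i$th service time at station $j$. The routing vector $\phi^j(i)$ equals the unit vector $e^{(k)}\in\mathbb{R}^J$ with probability $P_{jk}$ (job goes to station $k$) and equals $0$ with probability $1-\sum_k P_{jk}$ (job leaves). $P=(P_{jk})$ is substochastic and $I-P$ is invertible (open network). The nominal arrival rates $\lambda_j$ solve $\lambda_j=\alpha_j+\sum_{\ell}\lambda_\ell P_{\ell j}$; they are assumed positive. State: $Z_j(t)$ = number of jobs at station $j$, $R_{e,j}(t)$ = residual time to next external arrival at $j$, $R_{s,j}(t)$ = residual service time of the job in service at $j$ (or service time of next job if $Z_j(t)=0$); $X(t)=(Z(t),R_e(t),R_s(t))\in\mathbb{Z}_+^J\times\mathbb{R}_+^J\times\mathbb{R}_+^J$ is a Markov process with RCLL paths. Multi-scale family: for $r\in(0,1)$ the $r$th network has the same $\alpha_j$, unitized times, and routing, but service rates $\mu_j^{(r)}=\lambda_j+r^j$.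 Stability assumption: for each $r\in(0,1)$, $X^{(r)}$ is positive Harris recurrent with unique stationary distribution $\pi^{(r)}$; $X^{(r)}=(Z^{(r)},R_e^{(r)},R_s^{(r)})$ denotes a random vector with law $\pi^{(r)}$ and $\mathbb{E}_\pi$ denotes expectation under it. The matrix $(w_{jk})_{j,k\in\mathcal J}$ is the unique solution in $[0,1]^{J\times J}$ of $w_{jk}=P_{jk}+\sum_{\ell=1}^{k-1}P_{j\ell}w_{\ell k}$ for all $j,k$; it satisfies $w_{kk}<1$. $a\wedge b=\min(a,b)$. *)

theory Defs
  imports "HOL-Probability.Probability"
begin

text \<open>Generalized Jackson network (GJN). Stations are the natural numbers 1..J.
  The primitives of one sample point are given as functions:
  te j i = T_{e,j}(i), ts j i = T_{s,j}(i) (unitized), rt j i = destination of the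
  i-th job completing service at station j (0 = leaves the network), i >= 1.
  A network state is an extensional function on {1..J} giving, for station j,
  the triple (Z_j, R_{e,j}, R_{s,j}).\<close>

record gjn_cfg =
  cz  :: "nat \<Rightarrow> nat"
  cre :: "nat \<Rightarrow> real"
  crs :: "nat \<Rightarrow> real"
  cne :: "nat \<Rightarrow> nat"
  cns :: "nat \<Rightarrow> nat"
  cnr :: "nat \<Rightarrow> nat"
  ctime :: real

text \<open>One event of the discrete-event dynamics (None if no clock is running).
  Simultaneous events are processed one at a time (zero time apart): external
  arrivals first, lowest station index first.\<close>
definition gjn_step ::
  "nat \<Rightarrow> (nat \<Rightarrow> real) \<Rightarrow> (nat \<Rightarrow> real) \<Rightarrow> (nat \<Rightarrow> nat \<Rightarrow> real) \<Rightarrow> (nat \<Rightarrow> nat \<Rightarrow> real)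
    \<Rightarrow> (nat \<Rightarrow> nat \<Rightarrow> nat) \<Rightarrow> gjn_cfg \<Rightarrow> gjn_cfg option" where
  "gjn_step J \<alpha> \<mu> te ts rt c =
    (let A = {j\<in>{1..J}. 0 < \<alpha> j}; S = {j\<in>{1..J}. 0 < cz c j} in
     if A = {} \<and> S = {} then None else
     let \<delta> = Min (cre c ` A \<union> crs c ` S);
         re' = (\<lambda>j. if j \<in> A then cre c j - \<delta> else cre c j);
         rs' = (\<lambda>j. if j \<in> S then crs c j - \<delta> else crs c j);
         t' = ctime c + \<delta> in
     if (\<exists>j\<in>A. cre c j = \<delta>) then
       (let j = Min {j\<in>A. cre c j = \<delta>} in
        Some (c\<lparr>cz := (cz c)(j := cz c j + 1),
                 cre := re'(j := te j (cne c j) / \<alpha> j),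
                 crs := rs',
                 cne := (cne c)(j := cne c j + 1),
                 ctime := t'\<rparr>))
     else
       (let j = Min {j\<in>S. crs c j = \<delta>};
            k = rt j (cnr c j);
            z1 = (cz c)(j := cz c j - 1);
            z2 = (if k \<in> {1..J} then z1(k := z1 k + 1) else z1) in
        Some (c\<lparr>cz := z2,
                 cre := re',
                 crs := rs'(j := ts j (cns c j) / \<mu> j),
                 cns := (cns c)(j := cns c j + 1),
                 cnr := (cnr c)(j := cnr c j + 1),
                 ctime := t'\<rparr>)))"

definition gjn_init :: "(nat \<Rightarrow> nat \<times> real \<times> real) \<Rightarrow> gjn_cfg" where
  "gjn_init x = \<lparr>cz = (\<lambda>j. fst (x j)), cre = (\<lambda>j. fst (snd (x j))),
                 crs = (\<lambda>j. snd (snd (x j))), cne = (\<lambda>_. 1), cns = (\<lambda>_. 1),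
                 cnr = (\<lambda>_. 1), ctime = 0\<rparr>"

definition gjn_cfgs ::
  "nat \<Rightarrow> (nat \<Rightarrow> real) \<Rightarrow> (nat \<Rightarrow> real) \<Rightarrow> (nat \<Rightarrow> nat \<Rightarrow> real) \<Rightarrow> (nat \<Rightarrow> nat \<Rightarrow> real)
    \<Rightarrow> (nat \<Rightarrow> nat \<Rightarrow> nat) \<Rightarrow> (nat \<Rightarrow> nat \<times> real \<times> real) \<Rightarrow> nat \<Rightarrow> gjn_cfg option" where
  "gjn_cfgs J \<alpha> \<mu> te ts rt x n =
     ((\<lambda>oc. Option.bind oc (gjn_step J \<alpha> \<mu> te ts rt)) ^^ n) (Some (gjn_init x))"

text \<open>The state X(t) = (Z(t), R_e(t), R_s(t)) of the network started in x (RCLL: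
  all events at times <= t have been processed).  For stations with alpha_j = 0
  the meaningless component R_{e,j}(t) is set to 0 for t > 0.  On the null event
  that event times accumulate, the value is irrelevant (set to x).\<close>
definition gjn_X ::
  "nat \<Rightarrow> (nat \<Rightarrow> real) \<Rightarrow> (nat \<Rightarrow> real) \<Rightarrow> (nat \<Rightarrow> nat \<Rightarrow> real) \<Rightarrow> (nat \<Rightarrow> nat \<Rightarrow> real)
    \<Rightarrow> (nat \<Rightarrow> nat \<Rightarrow> nat) \<Rightarrow> (nat \<Rightarrow> nat \<times> real \<times> real) \<Rightarrow> real \<Rightarrow> (nat \<Rightarrow> nat \<times> real \<times> real)" where
  "gjn_X J \<alpha> \<mu> te ts rt x t =
    (let ev = {n. 1 \<le> n \<and> (\<exists>c. gjn_cfgs J \<alpha> \<mu> te ts rt x n = Some c \<and> ctime c \<le> t)} in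
     if t = 0 \<or> infinite ev then x else
     let c = the (gjn_cfgs J \<alpha> \<mu> te ts rt x (card ev)); s = t - ctime c in
     restrict (\<lambda>j. (cz c j,
                    if 0 < \<alpha> j then cre c j - s else 0,
                    if 0 < cz c j then crs c j - s else crs c j)) {1..J})"

definition gjn_space :: "nat \<Rightarrow> (nat \<Rightarrow> nat \<times> real \<times> real) measure" where
  "gjn_space J = restrict_space
     (Pi\<^sub>M {1..J} (\<lambda>_. count_space UNIV \<Otimes>\<^sub>M (borel \<Otimes>\<^sub>M borel)))
     {x. \<forall>j\<in>{1..J}. 0 \<le> fst (snd (x j)) \<and> 0 \<le> snd (snd (x j))}"

definition gjn_kernel ::
  "'a measure \<Rightarrow> nat \<Rightarrow> (nat \<Rightarrow> real) \<Rightarrow> (nat \<Rightarrow> real) \<Rightarrow> (nat \<Rightarrow> nat \<Rightarrow> 'a \<Rightarrow> real)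
    \<Rightarrow> (nat \<Rightarrow> nat \<Rightarrow> 'a \<Rightarrow> real) \<Rightarrow> (nat \<Rightarrow> nat \<Rightarrow> 'a \<Rightarrow> nat)
    \<Rightarrow> (nat \<Rightarrow> nat \<times> real \<times> real) \<Rightarrow> real \<Rightarrow> (nat \<Rightarrow> nat \<times> real \<times> real) set \<Rightarrow> ennreal" where
  "gjn_kernel \<Omega> J \<alpha> \<mu> Te Ts rt x t A =
     emeasure \<Omega> {\<omega>\<in>space \<Omega>.
        gjn_X J \<alpha> \<mu> (\<lambda>j i. Te j i \<omega>) (\<lambda>j i. Ts j i \<omega>) (\<lambda>j i. rt j i \<omega>) x t \<in> A}"

definition gjn_stationary ::
  "'a measure \<Rightarrow> nat \<Rightarrow> (nat \<Rightarrow> real) \<Rightarrow> (nat \<Rightarrow> real) \<Rightarrow> (nat \<Rightarrow> nat \<Rightarrow> 'a \<Rightarrow> real)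
    \<Rightarrow> (nat \<Rightarrow> nat \<Rightarrow> 'a \<Rightarrow> real) \<Rightarrow> (nat \<Rightarrow> nat \<Rightarrow> 'a \<Rightarrow> nat)
    \<Rightarrow> (nat \<Rightarrow> nat \<times> real \<times> real) measure \<Rightarrow> bool" where
  "gjn_stationary \<Omega> J \<alpha> \<mu> Te Ts rt \<pi> \<longleftrightarrow>
     sets \<pi> = sets (gjn_space J) \<and> prob_space \<pi> \<and>
     (\<forall>t\<ge>0. \<forall>A\<in>sets (gjn_space J).
        (\<integral>\<^sup>+ x. gjn_kernel \<Omega> J \<alpha> \<mu> Te Ts rt x t A \<partial>\<pi>) = emeasure \<pi> A)"

text \<open>Harris recurrence (continuous time, occupation-time form): there is a nontrivial
  sigma-finite measure phi such that every set A with phi(A) > 0 is visited for an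
  infinite amount of time almost surely, from every initial state.\<close>
definition gjn_harris_recurrent ::
  "'a measure \<Rightarrow> nat \<Rightarrow> (nat \<Rightarrow> real) \<Rightarrow> (nat \<Rightarrow> real) \<Rightarrow> (nat \<Rightarrow> nat \<Rightarrow> 'a \<Rightarrow> real)
    \<Rightarrow> (nat \<Rightarrow> nat \<Rightarrow> 'a \<Rightarrow> real) \<Rightarrow> (nat \<Rightarrow> nat \<Rightarrow> 'a \<Rightarrow> nat) \<Rightarrow> bool" where
  "gjn_harris_recurrent \<Omega> J \<alpha> \<mu> Te Ts rt \<longleftrightarrow>
     (\<exists>\<phi>. sets \<phi> = sets (gjn_space J) \<and> sigma_finite_measure \<phi> \<and> 0 < emeasure \<phi> (space \<phi>) \<and>
        (\<forall>A\<in>sets (gjn_space J). 0 < emeasure \<phi> A \<longrightarrow>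
           (\<forall>x\<in>space (gjn_space J). AE \<omega> in \<Omega>.
              (\<integral>\<^sup>+ t. indicator A (gjn_X J \<alpha> \<mu> (\<lambda>j i. Te j i \<omega>) (\<lambda>j i. Ts j i \<omega>)
                                        (\<lambda>j i. rt j i \<omega>) x t) * indicator {0..} t \<partial>lborel) = \<infinity>)))"

definition gjn_positive_harris_recurrent ::
  "'a measure \<Rightarrow> nat \<Rightarrow> (nat \<Rightarrow> real) \<Rightarrow> (nat \<Rightarrow> real) \<Rightarrow> (nat \<Rightarrow> nat \<Rightarrow> 'a \<Rightarrow> real)
    \<Rightarrow> (nat \<Rightarrow> nat \<Rightarrow> 'a \<Rightarrow> real) \<Rightarrow> (nat \<Rightarrow> nat \<Rightarrow> 'a \<Rightarrow> nat) \<Rightarrow> bool" where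
  "gjn_positive_harris_recurrent \<Omega> J \<alpha> \<mu> Te Ts rt \<longleftrightarrow>
     gjn_harris_recurrent \<Omega> J \<alpha> \<mu> Te Ts rt \<and> (\<exists>\<pi>. gjn_stationary \<Omega> J \<alpha> \<mu> Te Ts rt \<pi>)"

definition gjn_r0 :: "nat \<Rightarrow> (nat \<Rightarrow> nat \<Rightarrow> real) \<Rightarrow> real" where
  "gjn_r0 J w =
    (let S = {(k, j). 1 \<le> k \<and> k < j \<and> j \<le> J \<and> w j k \<noteq> 0} in
     if S = {} then 1
     else Min ((\<lambda>(k, j). ((1 - w k k) / (real J * w j k)) powr (1 / real (j - k))) ` S))"

end

theory Submission
  imports Defs
begin

text \<open>
  Fix \<open>k\<close> and put \<open>u\<^sub>j = w\<^sub>j\<^sub>k\<close> for \<open>j < k\<close>, \<open>u\<^sub>k = 1\<close>, \<open>u\<^sub>j = 0\<close> for \<open>j > k\<close>, and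
  \<open>d = P u - u\<close>. The functional \<open>F = \<Sum> u\<^sub>j Z\<^sub>j - \<Sum> \<alpha>\<^sub>j u\<^sub>j R\<^sub>e\<^sub>,\<^sub>j - \<Sum> d\<^sub>j \<mu>\<^sub>j R\<^sub>s\<^sub>,\<^sub>j\<close>
  jumps only by centred amounts that are independent of the past, and between jumps it has slope at most
  \<open>- (1 - w\<^sub>k\<^sub>k) / J * r\<^sup>k\<close> while station \<open>k\<close> is busy: the traffic equations cancel everything
  except the terms \<open>d\<^sub>j r\<^sup>j\<close>, and \<open>r < r\<^sub>0\<close> makes the term \<open>j = k\<close> dominate. While
  station \<open>k\<close> is idle, \<open>F\<close> is bounded by \<open>\<Sum>\<^bsub>j<k\<^esub> Z\<^sub>j + \<mu>\<^sub>k R\<^sub>s\<^sub>,\<^sub>k\<close>.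

  The Lyapunov function \<open>V = max F 0 ^ (M + 1)\<close> is compared over one unit of time rather than through Palm
  measures: all changes of the state within \<open>[0, 1]\<close> are dominated by one random variable \<open>S\<close> with finite
  moment of order \<open>M + 1\<close> that depends neither on the initial state nor on \<open>r\<close>. This gives
  \<open>E V(X\<^sub>1) \<le> V - c r\<^sup>k F\<^sub>+ ^ M + C (W\<^sup>M + r ^ (- k (M - 1)))\<close> with
  \<open>W = \<Sum>\<^bsub>j<k\<^esub> Z\<^sub>j + \<mu>\<^sub>k R\<^sub>s\<^sub>,\<^sub>k\<close>, and stationarity turns it into a bound on
  \<open>E (r\<^sup>k F\<^sub>+) ^ M\<close>. Since \<open>j M \<le> k (M - 1)\<close> for \<open>j < k \<le> M\<close>, the moments of
  \<open>Z\<^sub>j\<close>, \<open>j < k\<close>, are controlled by induction on \<open>k\<close>.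

  The residual times of busy clocks are bounded by the same comparison with \<open>R ^ (M + 1)\<close>. An idle server
  keeps a residual time drawn at its last service completion, which is independent of the idle period; that a
  completion has occurred is where Harris recurrence enters, because a station that stays empty for ever would
  remember its initial residual service time.
\<close>

subsection \<open>The chain of events\<close>

text \<open>The recursion for \<open>w\<close> lets \<open>u_j\<close> be read as the chance that a
  job at \<open>j\<close> reaches \<open>k\<close> through stations below \<open>k\<close> only, and
  it gives \<open>(P u)_j = w_jk\<close> for every \<open>j\<close>. Hence \<open>d\<close> vanishes
  below \<open>k\<close>, is nonnegative above \<open>k\<close> and equals \<open>w_kk - 1\<close>
  at \<open>k\<close>. The slope of \<open>F\<close> asks for just this: idleness of a lower station
  does not enter it, idleness of an upper station only lowers it, and only an idle station
  \<open>k\<close> can spoil it.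

  The obstacle is uniformity: no moment of a stationary queue is known beforehand, and every
  constant must be free of the initial state and of \<open>r\<close>. Within one unit of time the
  state affects the number of draws only through the first residual of each clock; all fresh draws
  except the last one read per clock have run out by then. The count is therefore dominated by a
  renewal count at the fixed levels \<open>\<alpha> j\<close> and \<open>lam j + 1\<close>, whose
  exponential tails come from the unit means. Moments of order \<open>M + 1\<close> pay for the
  overshooting last draws.

  The power \<open>r ^ (- k (M - 1))\<close> is born when a multiple of
  \<open>F\<^sub>+ ^ (M - 1)\<close> is absorbed into half of the drift
  \<open>r ^ k * F\<^sub>+ ^ M\<close>, which works above a level of order
  \<open>r ^ (- k)\<close>.\<close>

locale gjn_rates =
  fixes J :: nat and \<alpha> \<mu> :: "nat \<Rightarrow> real"
  assumes \<alpha>_nonneg: "j \<in> {1..J} \<Longrightarrow> 0 \<le> \<alpha> j"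
    and \<alpha>_pos: "\<exists>j\<in>{1..J}. 0 < \<alpha> j"
    and \<mu>_pos: "j \<in> {1..J} \<Longrightarrow> 0 < \<mu> j"
begin

text \<open>Pointwise comparisons replace the minimum over all clocks, so that measurability reduces
  to finite conjunctions. Comparisons are weak here and strict against arrival clocks in
  \<open>next_srv\<close>, which encodes that arrivals win ties.\<close>

definition next_ext :: "gjn_cfg \<Rightarrow> nat \<Rightarrow> bool" where
  "next_ext c j \<longleftrightarrow> j \<in> {1..J} \<and> 0 < \<alpha> j \<and> (\<forall>i\<in>{1..J}. 0 < \<alpha> i \<longrightarrow> cre c j \<le> cre c i) \<and>
     (\<forall>i\<in>{1..J}. 0 < cz c i \<longrightarrow> cre c j \<le> crs c i)"

definition next_srv :: "gjn_cfg \<Rightarrow> nat \<Rightarrow> bool" where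
  "next_srv c j \<longleftrightarrow> j \<in> {1..J} \<and> 0 < cz c j \<and> (\<forall>i\<in>{1..J}. 0 < \<alpha> i \<longrightarrow> crs c j < cre c i) \<and>
     (\<forall>i\<in>{1..J}. 0 < cz c i \<longrightarrow> crs c j \<le> crs c i)"

definition evt :: "gjn_cfg \<Rightarrow> nat \<times> nat" where
  "evt c = (if \<exists>j. next_ext c j then (0, LEAST j. next_ext c j) else (1, LEAST j. next_srv c j))"

definition delay :: "gjn_cfg \<Rightarrow> real" where
  "delay c = (if fst (evt c) = 0 then cre c (snd (evt c)) else crs c (snd (evt c)))"

text \<open>The primitives of a sample point are packed into one function p: unitized interarrival
  times p (0, j, i), unitized service times p (1, j, i), routing destinations p (2, j, i).\<close>

definition upd :: "nat \<times> nat \<Rightarrow> (nat \<times> nat \<times> nat \<Rightarrow> real) \<Rightarrow> gjn_cfg \<Rightarrow> gjn_cfg" where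
  "upd e p c = (let j = snd e; \<delta> = delay c;
      re' = (\<lambda>i. if i \<in> {1..J} \<and> 0 < \<alpha> i then cre c i - \<delta> else cre c i);
      rs' = (\<lambda>i. if i \<in> {1..J} \<and> 0 < cz c i then crs c i - \<delta> else crs c i) in
      if fst e = 0 then
        c\<lparr>cz := (cz c)(j := cz c j + 1), cre := re'(j := p (0, j, cne c j) / \<alpha> j), crs := rs',
          cne := (cne c)(j := cne c j + 1), ctime := ctime c + \<delta>\<rparr>
      else
        c\<lparr>cz := (\<lambda>i. cz c i - (if i = j then 1 else 0) +
                   (if i \<in> {1..J} \<and> i = nat \<lfloor>p (2, j, cnr c j)\<rfloor> then 1 else 0)),
          cre := re', crs := rs'(j := p (1, j, cns c j) / \<mu> j),
          cns := (cns c)(j := cns c j + 1), cnr := (cnr c)(j := cnr c j + 1),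
          ctime := ctime c + \<delta>\<rparr>)"

definition nstep :: "(nat \<times> nat \<times> nat \<Rightarrow> real) \<Rightarrow> gjn_cfg \<Rightarrow> gjn_cfg" where
  "nstep p c = upd (evt c) p c"

definition chain :: "(nat \<times> nat \<times> nat \<Rightarrow> real) \<Rightarrow> (nat \<Rightarrow> nat \<times> real \<times> real) \<Rightarrow> nat \<Rightarrow> gjn_cfg" where
  "chain p x n = (nstep p ^^ n) (gjn_init x)"

lemma chain_0 [simp]: "chain p x 0 = gjn_init x"
  by (simp add: chain_def)

lemma chain_Suc: "chain p x (Suc n) = nstep p (chain p x n)"
  by (simp add: chain_def)

lemma Min_eq_Least_nat: "finite A \<Longrightarrow> A \<noteq> {} \<Longrightarrow> Min A = (LEAST j::nat. j \<in> A)"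
  by (intro Min_eqI) (auto intro: Least_le LeastI)

text \<open>Some \<alpha> is positive, so at least one arrival clock always runs and a next event
  exists: either the smallest arrival clock beats every busy server, or the smallest busy service
  clock is strictly earlier than all arrivals.\<close>

lemma evt_cases:
  obtains (ext) j where "evt c = (0, j)" "next_ext c j" "delay c = cre c j"
  | (srv) j where "evt c = (1, j)" "next_srv c j" "delay c = crs c j" "\<not> (\<exists>j. next_ext c j)"
proof (cases "\<exists>j. next_ext c j")
  case True
  then have "next_ext c (LEAST j. next_ext c j)" by (rule LeastI_ex)
  with True show ?thesis by (intro ext) (auto simp: evt_def delay_def)
next
  case False
  define A where "A = {j\<in>{1..J}. 0 < \<alpha> j}"
  define S where "S = {j\<in>{1..J}. 0 < cz c j}"
  have finA: "finite A" "A \<noteq> {}" "finite S" using \<alpha>_pos by (auto simp: A_def S_def)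
  define a where "a = arg_min_on (cre c) A"
  have a: "a \<in> A" "\<And>i. i \<in> A \<Longrightarrow> cre c a \<le> cre c i"
    using arg_min_if_finite(1)[OF finA(1,2)] arg_min_least[OF finA(1,2)] by (auto simp: a_def)
  have "\<exists>i\<in>S. crs c i < cre c a"
  proof (rule ccontr)
    assume "\<not> (\<exists>i\<in>S. crs c i < cre c a)"
    with a have "next_ext c a" by (auto simp: next_ext_def A_def S_def not_less)
    with False show False by blast
  qed
  then obtain i0 where i0: "i0 \<in> S" "crs c i0 < cre c a" by auto
  define s where "s = arg_min_on (crs c) S"
  have s: "s \<in> S" "\<And>i. i \<in> S \<Longrightarrow> crs c s \<le> crs c i"
    using arg_min_if_finite(1)[OF finA(3)] arg_min_least[OF finA(3)] i0 by (auto simp: s_def)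
  have "next_srv c s"
    using s a i0 by (fastforce simp: next_srv_def A_def S_def)
  then have "next_srv c (LEAST j. next_srv c j)" by (rule LeastI)
  with False show ?thesis by (intro srv) (auto simp: evt_def delay_def)
qed

text \<open>Links the given dynamics to the total function \<open>nstep\<close>: the minimum over
  running clocks is \<open>delay\<close>, and the minimal index among the winners is the
  \<open>LEAST\<close> in \<open>evt\<close>. Counters must be at least 1 because the primitives are
  matched only from index 1 on.\<close>

lemma gjn_step_eq:
  assumes te: "\<And>j i. j \<in> {1..J} \<Longrightarrow> 1 \<le> i \<Longrightarrow> te j i = p (0, j, i)"
    and ts: "\<And>j i. j \<in> {1..J} \<Longrightarrow> 1 \<le> i \<Longrightarrow> ts j i = p (1, j, i)"
    and rt: "\<And>j i. j \<in> {1..J} \<Longrightarrow> 1 \<le> i \<Longrightarrow> rt j i = nat \<lfloor>p (2, j, i)\<rfloor>"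
    and cnt: "\<And>j. j \<in> {1..J} \<Longrightarrow> 1 \<le> cne c j \<and> 1 \<le> cns c j \<and> 1 \<le> cnr c j"
  shows "gjn_step J \<alpha> \<mu> te ts rt c = Some (nstep p c)"
proof -
  define A where "A = {j\<in>{1..J}. 0 < \<alpha> j}"
  define S where "S = {j\<in>{1..J}. 0 < cz c j}"
  have finA: "finite A" "A \<noteq> {}" "finite S" using \<alpha>_pos by (auto simp: A_def S_def)
  have inA: "i \<in> A \<longleftrightarrow> i \<in> {1..J} \<and> 0 < \<alpha> i" for i by (auto simp: A_def)
  have inS: "i \<in> S \<longleftrightarrow> i \<in> {1..J} \<and> 0 < cz c i" for i by (auto simp: S_def)
  define \<delta> where "\<delta> = Min (cre c ` A \<union> crs c ` S)"
  have delta_le: "\<delta> \<le> cre c i" if "i \<in> A" for i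
    unfolding \<delta>_def using finA that by (intro Min_le) auto
  have delta_le': "\<delta> \<le> crs c i" if "i \<in> S" for i
    unfolding \<delta>_def using finA that by (intro Min_le) auto
  have delta_eq: "v = \<delta>" if "v \<in> cre c ` A \<union> crs c ` S"
    "\<And>i. i \<in> A \<Longrightarrow> v \<le> cre c i" "\<And>i. i \<in> S \<Longrightarrow> v \<le> crs c i" for v
    unfolding \<delta>_def using finA that by (intro Min_eqI[symmetric]) auto
  have ext_iff: "next_ext c j \<longleftrightarrow> j \<in> A \<and> cre c j = \<delta>" for j
  proof
    assume *: "next_ext c j"
    then show "j \<in> A \<and> cre c j = \<delta>"
      by (intro conjI delta_eq) (auto simp: next_ext_def inA inS)
  next
    assume "j \<in> A \<and> cre c j = \<delta>"
    then show "next_ext c j"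
      using delta_le delta_le' by (auto simp: next_ext_def inA inS)
  qed
  have srv_iff: "next_srv c j \<longleftrightarrow> j \<in> S \<and> crs c j = \<delta>" if no: "\<not> (\<exists>j. next_ext c j)" for j
  proof
    assume *: "next_srv c j"
    then show "j \<in> S \<and> crs c j = \<delta>"
      by (intro conjI delta_eq) (auto simp: next_srv_def inA inS)
  next
    assume j: "j \<in> S \<and> crs c j = \<delta>"
    have "crs c j < cre c i" if "i \<in> A" for i
      using no that delta_le[OF that] j by (auto simp: ext_iff less_le)
    then show "next_srv c j"
      using delta_le' j by (auto simp: next_srv_def inA inS)
  qed
  show ?thesis
  proof (cases rule: evt_cases[of c])
    case (ext j)
    have j: "j \<in> A" "cre c j = \<delta>" using ext by (auto simp: ext_iff)
    have m: "Min {j \<in> A. cre c j = \<delta>} = j"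
    proof -
      have "Min {j \<in> A. cre c j = \<delta>} = (LEAST i. next_ext c i)"
        using j finA by (subst Min_eq_Least_nat) (auto simp: ext_iff[abs_def])
      also have "\<dots> = j" using ext(1) by (auto simp: evt_def split: if_splits)
      finally show ?thesis .
    qed
    have "delay c = \<delta>" using ext j by simp
    then show ?thesis
      unfolding gjn_step_def Let_def nstep_def upd_def ext(1)
      unfolding A_def[symmetric] S_def[symmetric] \<delta>_def[symmetric]
      using j finA m cnt te[of j "cne c j"] by (auto simp: inA inS fun_eq_iff)
  next
    case (srv j)
    have j: "j \<in> S" "crs c j = \<delta>" using srv by (auto simp: srv_iff)
    have no: "\<not> (\<exists>j\<in>A. cre c j = \<delta>)" using srv(4) by (auto simp: ext_iff)
    have m: "Min {j \<in> S. crs c j = \<delta>} = j"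
    proof -
      have "Min {j \<in> S. crs c j = \<delta>} = (LEAST i. next_srv c i)"
        using j finA srv(4) by (subst Min_eq_Least_nat) (auto simp: srv_iff[OF srv(4), abs_def])
      also have "\<dots> = j" using srv(1) by (auto simp: evt_def split: if_splits)
      finally show ?thesis .
    qed
    have "delay c = \<delta>" using srv j by simp
    then show ?thesis
      unfolding gjn_step_def Let_def nstep_def upd_def srv(1)
      unfolding A_def[symmetric] S_def[symmetric] \<delta>_def[symmetric]
      using j finA m no cnt ts[of j "cns c j"] rt[of j "cnr c j"] by (auto simp: inA inS fun_eq_iff)
  qed
qed

lemma counters_pos: "1 \<le> cne (chain p x n) j \<and> 1 \<le> cns (chain p x n) j \<and> 1 \<le> cnr (chain p x n) j"
  by (induction n) (auto simp: gjn_init_def chain_Suc nstep_def upd_def Let_def)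

lemma gjn_cfgs_eq:
  assumes "\<And>j i. j \<in> {1..J} \<Longrightarrow> 1 \<le> i \<Longrightarrow> te j i = p (0, j, i)"
    and "\<And>j i. j \<in> {1..J} \<Longrightarrow> 1 \<le> i \<Longrightarrow> ts j i = p (1, j, i)"
    and "\<And>j i. j \<in> {1..J} \<Longrightarrow> 1 \<le> i \<Longrightarrow> rt j i = nat \<lfloor>p (2, j, i)\<rfloor>"
  shows "gjn_cfgs J \<alpha> \<mu> te ts rt x n = Some (chain p x n)"
proof (induction n)
  case 0
  show ?case by (simp add: gjn_cfgs_def)
next
  case (Suc n)
  have "gjn_cfgs J \<alpha> \<mu> te ts rt x (Suc n) = Option.bind (gjn_cfgs J \<alpha> \<mu> te ts rt x n) (gjn_step J \<alpha> \<mu> te ts rt)"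
    by (simp add: gjn_cfgs_def)
  also have "\<dots> = gjn_step J \<alpha> \<mu> te ts rt (chain p x n)"
    by (simp add: Suc)
  also have "\<dots> = Some (nstep p (chain p x n))"
    using assms counters_pos by (intro gjn_step_eq) blast+
  finally show ?case by (simp add: chain_Suc)
qed

definition prim_ok :: "(nat \<times> nat \<times> nat \<Rightarrow> real) \<Rightarrow> bool" where
  "prim_ok p \<longleftrightarrow> (\<forall>j\<in>{1..J}. \<forall>i\<ge>1. 0 \<le> p (0, j, i) \<and> 0 \<le> p (1, j, i))"

definition state_ok :: "(nat \<Rightarrow> nat \<times> real \<times> real) \<Rightarrow> bool" where
  "state_ok x \<longleftrightarrow> (\<forall>j\<in>{1..J}. 0 \<le> fst (snd (x j)) \<and> 0 \<le> snd (snd (x j)))"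

definition cfg_ok :: "gjn_cfg \<Rightarrow> bool" where
  "cfg_ok c \<longleftrightarrow> (\<forall>j\<in>{1..J}. 0 \<le> cre c j \<and> 0 \<le> crs c j)"

lemma delay_le:
  assumes "i \<in> {1..J}"
  shows "0 < \<alpha> i \<Longrightarrow> delay c \<le> cre c i" "0 < cz c i \<Longrightarrow> delay c \<le> crs c i"
proof -
  show "delay c \<le> cre c i" if "0 < \<alpha> i"
    using assms that by (cases rule: evt_cases[of c]) (force simp: next_ext_def next_srv_def)+
  show "delay c \<le> crs c i" if "0 < cz c i"
    using assms that by (cases rule: evt_cases[of c]) (force simp: next_ext_def next_srv_def)+
qed

lemma delay_nonneg: "cfg_ok c \<Longrightarrow> 0 \<le> delay c"
  by (cases rule: evt_cases[of c]) (auto simp: next_ext_def next_srv_def cfg_ok_def)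

lemma step_cases:
  obtains (ext) j where "evt c = (0, j)" "j \<in> {1..J}" "0 < \<alpha> j" "cre c j = delay c"
      "nstep p c = c\<lparr>cz := (cz c)(j := cz c j + 1),
          cre := (\<lambda>i. if i \<in> {1..J} \<and> 0 < \<alpha> i then cre c i - delay c else cre c i)(j := p (0, j, cne c j) / \<alpha> j),
          crs := (\<lambda>i. if i \<in> {1..J} \<and> 0 < cz c i then crs c i - delay c else crs c i),
          cne := (cne c)(j := cne c j + 1), ctime := ctime c + delay c\<rparr>"
  | (srv) j where "evt c = (1, j)" "j \<in> {1..J}" "0 < cz c j" "crs c j = delay c"
      "nstep p c = c\<lparr>cz := (\<lambda>i. cz c i - (if i = j then 1 else 0) +
                   (if i \<in> {1..J} \<and> i = nat \<lfloor>p (2, j, cnr c j)\<rfloor> then 1 else 0)),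
          cre := (\<lambda>i. if i \<in> {1..J} \<and> 0 < \<alpha> i then cre c i - delay c else cre c i),
          crs := (\<lambda>i. if i \<in> {1..J} \<and> 0 < cz c i then crs c i - delay c else crs c i)(j := p (1, j, cns c j) / \<mu> j),
          cns := (cns c)(j := cns c j + 1), cnr := (cnr c)(j := cnr c j + 1),
          ctime := ctime c + delay c\<rparr>"
proof (cases rule: evt_cases[of c])
  case (ext j)
  then show ?thesis
    by (intro that(1)[of j]) (simp_all add: nstep_def upd_def Let_def next_ext_def cong: if_cong)
next
  case (srv j)
  then show ?thesis
    by (intro that(2)[of j]) (simp_all add: nstep_def upd_def Let_def next_srv_def cong: if_cong)
qed

lemma ctime_nstep [simp]: "ctime (nstep p c) = ctime c + delay c"
  by (simp add: nstep_def upd_def Let_def)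

lemma cfg_ok_nstep:
  assumes "cfg_ok c" "prim_ok p" "\<And>j. 1 \<le> cne c j" "\<And>j. 1 \<le> cns c j"
  shows "cfg_ok (nstep p c)"
proof (cases rule: step_cases[of c p])
  case (ext j)
  have "0 \<le> p (0, j, cne c j) / \<alpha> j"
    using assms ext by (auto simp: prim_ok_def)
  then show ?thesis
    using assms(1) delay_le[of _ c] unfolding ext(5) by (auto simp: cfg_ok_def)
next
  case (srv j)
  have "0 \<le> p (1, j, cns c j) / \<mu> j"
    using assms srv \<mu>_pos[of j] by (auto simp: prim_ok_def intro!: divide_nonneg_pos)
  then show ?thesis
    using assms(1) delay_le[of _ c] unfolding srv(5) by (auto simp: cfg_ok_def)
qed

lemma cfg_ok_chain:
  assumes "state_ok x" "prim_ok p"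
  shows "cfg_ok (chain p x n)"
proof (induction n)
  case 0
  then show ?case using assms by (auto simp: cfg_ok_def state_ok_def gjn_init_def)
next
  case (Suc n)
  then show ?case
    using assms counters_pos unfolding chain_Suc by (intro cfg_ok_nstep) blast+
qed

abbreviation etime :: "(nat \<times> nat \<times> nat \<Rightarrow> real) \<Rightarrow> (nat \<Rightarrow> nat \<times> real \<times> real) \<Rightarrow> nat \<Rightarrow> real" where
  "etime p x n \<equiv> ctime (chain p x n)"

lemma etime_Suc: "etime p x (Suc n) = etime p x n + delay (chain p x n)"
  by (simp add: chain_Suc)

lemma ctime_gjn_init [simp]: "ctime (gjn_init x) = 0"
  by (simp add: gjn_init_def)

lemma etime_mono:
  assumes "state_ok x" "prim_ok p" "m \<le> n"
  shows "etime p x m \<le> etime p x n"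
proof -
  have "incseq (etime p x)"
    using delay_nonneg[OF cfg_ok_chain[OF assms(1,2)]] by (intro incseq_SucI) (simp add: etime_Suc)
  from incseqD[OF this assms(3)] show ?thesis .
qed

definition obs :: "gjn_cfg \<Rightarrow> real \<Rightarrow> nat \<Rightarrow> nat \<times> real \<times> real" where
  "obs c s = restrict (\<lambda>j. (cz c j, if 0 < \<alpha> j then cre c j - s else 0,
                    if 0 < cz c j then crs c j - s else crs c j)) {1..J}"

text \<open>Selects the inter-event interval containing \<open>t\<close> by a \<open>LEAST\<close>
  over a countable family of conditions, a form in which joint measurability in the primitives and
  the initial state is direct. The fallback \<open>x\<close> covers accumulating event
  times.\<close>

definition netX :: "(nat \<times> nat \<times> nat \<Rightarrow> real) \<Rightarrow> (nat \<Rightarrow> nat \<times> real \<times> real) \<Rightarrow> real \<Rightarrow> nat \<Rightarrow> nat \<times> real \<times> real" where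
  "netX p x t = (if \<exists>n. etime p x n \<le> t \<and> t < etime p x (Suc n)
     then (let n = (LEAST n. etime p x n \<le> t \<and> t < etime p x (Suc n)) in obs (chain p x n) (t - etime p x n))
     else x)"

lemma netX_eq:
  assumes "state_ok x" "prim_ok p" "etime p x n \<le> t" "t < etime p x (Suc n)"
  shows "netX p x t = obs (chain p x n) (t - etime p x n)"
proof -
  have "(LEAST n. etime p x n \<le> t \<and> t < etime p x (Suc n)) = n"
  proof (rule Least_equality)
    fix m assume m: "etime p x m \<le> t \<and> t < etime p x (Suc m)"
    show "n \<le> m"
    proof (rule ccontr)
      assume "\<not> n \<le> m"
      then have "etime p x (Suc m) \<le> etime p x n" using assms by (intro etime_mono) auto
      with m assms show False by linarith
    qed
  qed (use assms in auto)
  then show ?thesis using assms by (auto simp: netX_def)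
qed

lemma last_event_exists:
  assumes "state_ok x" "prim_ok p" "0 \<le> t" "\<not> (\<forall>n. etime p x n \<le> t)"
  obtains n where "etime p x n \<le> t" "t < etime p x (Suc n)"
proof -
  define m where "m = (LEAST m. t < etime p x m)"
  have m: "t < etime p x m" using assms(4) unfolding m_def by (metis LeastI not_le)
  have "m \<noteq> 0" using m assms(3) by (metis chain_0 ctime_gjn_init not_le)
  then obtain n where n: "m = Suc n" by (cases m) auto
  have "etime p x n \<le> t"
    using not_less_Least[of n "\<lambda>m. t < etime p x m"] n by (auto simp: m_def)
  with m n that show ?thesis by auto
qed

text \<open>At \<open>t = 0\<close> the two sides may differ: \<open>gjn_X\<close> returns
  \<open>x\<close> itself, whereas \<open>netX\<close> has already processed events of zero delay
  and erased meaningless arrival clocks. For positive \<open>t\<close> the number of events up to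
  \<open>t\<close> is the index of the interval containing \<open>t\<close>.\<close>

lemma gjn_X_eq_netX:
  assumes ok: "state_ok x" "prim_ok p" and t: "0 < t"
    and "\<And>j i. j \<in> {1..J} \<Longrightarrow> 1 \<le> i \<Longrightarrow> te j i = p (0, j, i)"
    and "\<And>j i. j \<in> {1..J} \<Longrightarrow> 1 \<le> i \<Longrightarrow> ts j i = p (1, j, i)"
    and "\<And>j i. j \<in> {1..J} \<Longrightarrow> 1 \<le> i \<Longrightarrow> rt j i = nat \<lfloor>p (2, j, i)\<rfloor>"
  shows "gjn_X J \<alpha> \<mu> te ts rt x t = netX p x t"
proof -
  have cf: "gjn_cfgs J \<alpha> \<mu> te ts rt x n = Some (chain p x n)" for n
    using assms by (intro gjn_cfgs_eq) blast+
  define ev where "ev = {n. 1 \<le> n \<and> etime p x n \<le> t}"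
  have ev: "{n. 1 \<le> n \<and> (\<exists>c. gjn_cfgs J \<alpha> \<mu> te ts rt x n = Some c \<and> ctime c \<le> t)} = ev"
    by (auto simp: ev_def cf)
  show ?thesis
  proof (cases "\<forall>n. etime p x n \<le> t")
    case True
    then have "ev = {1..}" by (auto simp: ev_def)
    then have "infinite ev" by (simp add: infinite_Ici)
    moreover have "netX p x t = x" using True by (force simp: netX_def not_less[symmetric])
    ultimately show ?thesis using t unfolding gjn_X_def ev by (simp add: Let_def)
  next
    case False
    then obtain N where N: "etime p x N \<le> t" "t < etime p x (Suc N)"
      using last_event_exists ok t by (metis less_eq_real_def)
    have "ev = {1..N}"
    proof -
      have "n \<le> N" if "etime p x n \<le> t" for n
        using etime_mono[OF ok, of "Suc N" n] that N by (metis leD le_trans not_less_eq_eq order_trans)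
      moreover have "etime p x n \<le> t" if "n \<le> N" for n
        using etime_mono[OF ok that] N by simp
      ultimately show ?thesis by (auto simp: ev_def)
    qed
    then have "finite ev" "card ev = N" by auto
    then show ?thesis
      using t netX_eq[OF ok N] unfolding gjn_X_def ev by (simp add: Let_def cf obs_def)
  qed
qed

end

subsection \<open>Counters, clocks and unconsumed primitives\<close>

context gjn_rates
begin

text \<open>Each event advances exactly one of these counters, and all \<open>2 * J\<close> of them
  start at 1. Bounded counters therefore bound the number of events, which is how accumulation of
  event times is excluded.\<close>

lemma counter_sum: "(\<Sum>j\<in>{1..J}. cne (chain p x n) j + cns (chain p x n) j) = n + 2 * J"
proof (induction n)
  case 0
  show ?case by (simp add: gjn_init_def)
next
  case (Suc n)
  define c where "c = chain p x n"
  have "(\<Sum>j\<in>{1..J}. cne (nstep p c) j + cns (nstep p c) j) = Suc (\<Sum>j\<in>{1..J}. cne c j + cns c j)"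
  proof (cases rule: step_cases[of c p])
    case (ext j)
    have "(\<Sum>i\<in>{1..J}. cne (nstep p c) i + cns (nstep p c) i) =
          (\<Sum>i\<in>{1..J}. cne c i + cns c i + (if i = j then 1 else 0))"
      unfolding ext(5) by (intro sum.cong) auto
    also have "\<dots> = (\<Sum>i\<in>{1..J}. cne c i + cns c i) + 1"
      using ext(2) by (subst sum.distrib) simp
    finally show ?thesis by simp
  next
    case (srv j)
    have "(\<Sum>i\<in>{1..J}. cne (nstep p c) i + cns (nstep p c) i) =
          (\<Sum>i\<in>{1..J}. cne c i + cns c i + (if i = j then 1 else 0))"
      unfolding srv(5) by (intro sum.cong) auto
    also have "\<dots> = (\<Sum>i\<in>{1..J}. cne c i + cns c i) + 1"
      using srv(2) by (subst sum.distrib) simp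
    finally show ?thesis by simp
  qed
  with Suc show ?case by (simp add: chain_Suc c_def)
qed

definition psum :: "(nat \<times> nat \<times> nat \<Rightarrow> real) \<Rightarrow> nat \<Rightarrow> nat \<Rightarrow> nat \<Rightarrow> real" where
  "psum p e j m = (\<Sum>i\<in>{1..<m}. p (e, j, i))"

lemma psum_Suc: "1 \<le> m \<Longrightarrow> psum p e j (Suc m) = psum p e j m + p (e, j, m)"
  by (simp add: psum_def)

lemma psum_mono:
  assumes "prim_ok p" "j \<in> {1..J}" "e \<le> 1" "m \<le> n"
  shows "psum p e j m \<le> psum p e j n"
proof -
  have "e = 0 \<or> e = 1" using assms by auto
  then show ?thesis
    unfolding psum_def using assms by (intro sum_mono2) (auto simp: prim_ok_def)
qed

text \<open>The induction carries both halves. The first says that all draws read so far fit into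
  elapsed time plus current residual, the nonnegative initial residual being spare room; at an
  arrival the residual equals \<open>delay\<close>, and the first half turns into the second. The
  second half drops the last draw read, and with it every trace of the initial state.\<close>

lemma psum_ext_le:
  assumes ok: "state_ok x" "prim_ok p" and j: "j \<in> {1..J}" "0 < \<alpha> j"
  shows "psum p 0 j (cne (chain p x n) j) \<le> \<alpha> j * (etime p x n + cre (chain p x n) j) \<and>
         psum p 0 j (cne (chain p x n) j - 1) \<le> \<alpha> j * etime p x n"
proof (induction n)
  case 0
  then show ?case using ok j by (auto simp: psum_def gjn_init_def state_ok_def)
next
  case (Suc n)
  define c where "c = chain p x n"
  have d: "0 \<le> delay c" using delay_nonneg cfg_ok_chain[OF ok] by (simp add: c_def)
  have cnt: "1 \<le> cne c j" using counters_pos by (simp add: c_def)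
  have IH: "psum p 0 j (cne c j) \<le> \<alpha> j * (ctime c + cre c j)"
    "psum p 0 j (cne c j - 1) \<le> \<alpha> j * ctime c" using Suc by (auto simp: c_def)
  have t: "psum p 0 j (cne c j - 1) \<le> \<alpha> j * (ctime c + delay c)"
    using IH(2) by (rule order_trans) (use j d in simp)
  show ?case
  proof (cases rule: step_cases[of c p])
    case (ext i)
    show ?thesis
    proof (cases "i = j")
      case True
      have "psum p 0 j (Suc (cne c j)) \<le> \<alpha> j * (ctime c + delay c + p (0, j, cne c j) / \<alpha> j)"
        using IH(1) ext(4) True j by (simp add: psum_Suc[OF cnt] distrib_left)
      then show ?thesis
        using IH ext(4) True unfolding chain_Suc c_def[symmetric] ext(5) by simp
    next
      case False
      then show ?thesis using IH j t unfolding chain_Suc c_def[symmetric] ext(5) by auto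
    qed
  next
    case (srv i)
    then show ?thesis using IH j t unfolding chain_Suc c_def[symmetric] srv(5) by auto
  qed
qed

text \<open>Same mechanism as for arrivals. A frozen clock at an idle station only helps, since time
  advances while the residual stays.\<close>

lemma psum_srv_le:
  assumes ok: "state_ok x" "prim_ok p" and j: "j \<in> {1..J}"
  shows "psum p 1 j (cns (chain p x n) j) \<le> \<mu> j * (etime p x n + crs (chain p x n) j) \<and>
         psum p 1 j (cns (chain p x n) j - 1) \<le> \<mu> j * etime p x n"
proof (induction n)
  case 0
  then show ?case using ok j \<mu>_pos[OF j] by (auto simp: psum_def gjn_init_def state_ok_def)
next
  case (Suc n)
  define c where "c = chain p x n"
  have d: "0 \<le> delay c" using delay_nonneg cfg_ok_chain[OF ok] by (simp add: c_def)
  have cnt: "1 \<le> cns c j" using counters_pos by (simp add: c_def)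
  have IH: "psum p 1 j (cns c j) \<le> \<mu> j * (ctime c + crs c j)"
    "psum p 1 j (cns c j - 1) \<le> \<mu> j * ctime c" using Suc by (auto simp: c_def)
  have t: "psum p 1 j (cns c j - 1) \<le> \<mu> j * (ctime c + delay c)"
    using IH(2) by (rule order_trans) (use \<mu>_pos[OF j] d in simp)
  have t': "psum p 1 j (cns c j) \<le> \<mu> j * (ctime c + delay c + crs c j)"
    using IH(1) by (rule order_trans) (use \<mu>_pos[OF j] d in simp)
  show ?case
  proof (cases rule: step_cases[of c p])
    case (ext i)
    then show ?thesis using IH j t t' unfolding chain_Suc c_def[symmetric] ext(5) by auto
  next
    case (srv i)
    show ?thesis
    proof (cases "i = j")
      case True
      have "psum p 1 j (Suc (cns c j)) \<le> \<mu> j * (ctime c + delay c + p (1, j, cns c j) / \<mu> j)"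
        using IH(1) srv(4) True \<mu>_pos[OF j] by (simp add: psum_Suc[OF cnt, of p 1, simplified] distrib_left)
      then show ?thesis
        using IH srv(4) True unfolding chain_Suc c_def[symmetric] srv(5) by simp
    next
      case False
      then show ?thesis using IH j t t' unfolding chain_Suc c_def[symmetric] srv(5) by auto
    qed
  qed
qed

lemma cne_eq_1_if_no_arrivals:
  assumes "\<not> 0 < \<alpha> j"
  shows "cne (chain p x n) j = 1"
proof (induction n)
  case (Suc n)
  then show ?case
    by (cases rule: step_cases[of "chain p x n" p]) (use assms in \<open>auto simp: chain_Suc\<close>)
qed (simp add: gjn_init_def)

text \<open>Thresholds are natural numbers so that almost sure validity follows from a countable
  intersection.\<close>

definition prim_div :: "(nat \<times> nat \<times> nat \<Rightarrow> real) \<Rightarrow> bool" where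
  "prim_div p \<longleftrightarrow> (\<forall>j\<in>{1..J}. \<forall>K::nat. (\<exists>m. real K < psum p 0 j m) \<and> (\<exists>m. real K < psum p 1 j m))"

text \<open>If event times stayed below \<open>t\<close>, the partial sums of all completed draws
  would stay below rate times \<open>t\<close>. Divergence of these sums then bounds every counter,
  contradicting \<open>counter_sum\<close>.\<close>

lemma etime_unbounded:
  assumes ok: "state_ok x" "prim_ok p" and dv: "prim_div p"
  shows "\<exists>n. t < etime p x n"
proof (rule ccontr)
  assume "\<not> (\<exists>n. t < etime p x n)"
  then have le: "etime p x n \<le> t" for n by (auto simp: not_less)
  have "\<exists>m. \<forall>n. cne (chain p x n) j + cns (chain p x n) j \<le> m" if j: "j \<in> {1..J}" for j
  proof -
    have big: "\<exists>m. a < psum p 0 j m" "\<exists>m. a < psum p 1 j m" for a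
    proof -
      obtain K :: nat where K: "a < real K" using reals_Archimedean2 by blast
      obtain m m' where "real K < psum p 0 j m" "real K < psum p 1 j m'"
        using dv j unfolding prim_div_def by blast
      with K show "\<exists>m. a < psum p 0 j m" "\<exists>m. a < psum p 1 j m" by (meson less_trans)+
    qed
    obtain m1 where m1: "\<alpha> j * t < psum p 0 j m1" using big by blast
    obtain m2 where m2: "\<mu> j * t < psum p 1 j m2" using big by blast
    have "cne (chain p x n) j \<le> m1 + 1" for n
    proof (cases "0 < \<alpha> j")
      case True
      have "psum p 0 j (cne (chain p x n) j - 1) \<le> \<alpha> j * t"
        using psum_ext_le[OF ok j True, of n] le[of n] True
        by (meson mult_left_mono less_eq_real_def order_trans)
      then have "\<not> m1 \<le> cne (chain p x n) j - 1"
        using psum_mono[OF ok(2) j, of 0 m1 "cne (chain p x n) j - 1"] m1 by auto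
      then show ?thesis by simp
    qed (simp add: cne_eq_1_if_no_arrivals)
    moreover have "cns (chain p x n) j \<le> m2 + 1" for n
    proof -
      have "psum p 1 j (cns (chain p x n) j - 1) \<le> \<mu> j * t"
        using psum_srv_le[OF ok j, of n] le[of n] \<mu>_pos[OF j]
        by (meson mult_left_mono less_eq_real_def order_trans)
      then have "\<not> m2 \<le> cns (chain p x n) j - 1"
        using psum_mono[OF ok(2) j, of 1 m2 "cns (chain p x n) j - 1"] m2 by auto
      then show ?thesis by simp
    qed
    ultimately show ?thesis using add_mono[of _ "m1 + 1" _ "m2 + 1"] by blast
  qed
  then obtain m where m: "cne (chain p x n) j + cns (chain p x n) j \<le> m j" if "j \<in> {1..J}" for n j
    by metis
  have "n + 2 * J \<le> (\<Sum>j\<in>{1..J}. m j)" for n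
    using m unfolding counter_sum[of p x n, symmetric] by (intro sum_mono) auto
  from this[of "Suc (\<Sum>j\<in>{1..J}. m j)"] show False by simp
qed

lemma last_event_exists':
  assumes "state_ok x" "prim_ok p" "prim_div p" "0 \<le> t"
  obtains n where "etime p x n \<le> t" "t < etime p x (Suc n)"
  using last_event_exists[of x p t] etime_unbounded[of x p t] assms by (metis not_less)

definition counter :: "nat \<Rightarrow> nat \<Rightarrow> gjn_cfg \<Rightarrow> nat" where
  "counter e j c = (if e = 0 then cne c j else if e = 1 then cns c j else cnr c j)"

lemma counter_mono: "counter e j c \<le> counter e j (nstep p c)"
  by (cases rule: step_cases[of c p]) (auto simp: counter_def)

lemma nstep_cong:
  assumes "\<And>j. evt c = (0, j) \<Longrightarrow> p (0, j, cne c j) = p' (0, j, cne c j)"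
    and "\<And>j. evt c = (1, j) \<Longrightarrow> p (1, j, cns c j) = p' (1, j, cns c j) \<and> p (2, j, cnr c j) = p' (2, j, cnr c j)"
  shows "nstep p c = nstep p' c"
  by (cases rule: evt_cases[of c]) (use assms in \<open>simp_all add: nstep_def upd_def Let_def\<close>)

text \<open>A counter holds the index of the next draw to be read and never decreases. A final value
  of at most \<open>i\<close> therefore means that draw \<open>i\<close> was read in none of the
  first \<open>n\<close> steps.\<close>

lemma chain_unconsumed:
  assumes "\<And>q. q \<noteq> (e, j, i) \<Longrightarrow> p q = p' q" "e \<le> 2"
  shows "counter e j (chain p x n) \<le> i \<Longrightarrow> chain p' x n = chain p x n"
proof (induction n)
  case (Suc n)
  define c where "c = chain p x n"
  have "counter e j c \<le> i" using Suc.prems counter_mono[of e j c p] by (simp add: chain_Suc c_def)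
  with Suc.IH have eq: "chain p' x n = c" by (simp add: c_def)
  have le: "counter e j (nstep p c) \<le> i" using Suc.prems by (simp add: chain_Suc c_def)
  have "nstep p c = nstep p' c"
  proof (rule nstep_cong)
    fix l assume "evt c = (0, l)"
    then show "p (0, l, cne c l) = p' (0, l, cne c l)"
      using le by (intro assms(1)) (auto simp: nstep_def upd_def Let_def counter_def)
  next
    fix l assume "evt c = (1, l)"
    then show "p (1, l, cns c l) = p' (1, l, cns c l) \<and> p (2, l, cnr c l) = p' (2, l, cnr c l)"
      using le by (intro conjI assms(1)) (auto simp: nstep_def upd_def Let_def counter_def)
  qed
  with eq show ?case by (simp add: chain_Suc c_def)
qed simp

lemma counter_le: "counter e j (chain p x n) \<le> Suc n"
proof (induction n)
  case (Suc n)
  have "counter e j (nstep p c) \<le> Suc (counter e j c)" for c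
    by (cases rule: step_cases[of c p]) (auto simp: counter_def)
  from this[of "chain p x n"] Suc show ?case by (simp add: chain_Suc)
qed (simp add: counter_def gjn_init_def)

text \<open>The service clock of an empty station is consulted neither in \<open>next_ext\<close>
  nor in \<open>next_srv\<close>.\<close>

lemma evt_idle:
  assumes "cz c j = 0" "c' = c\<lparr>crs := (crs c)(j := v)\<rparr>"
  shows "evt c' = evt c" "delay c' = delay c"
proof -
  have [simp]: "next_ext c' = next_ext c"
  proof
    fix i
    have "(\<forall>i\<in>{1..J}. 0 < cz c' i \<longrightarrow> a \<le> crs c' i) \<longleftrightarrow> (\<forall>i\<in>{1..J}. 0 < cz c i \<longrightarrow> a \<le> crs c i)" for a
      using assms by auto
    then show "next_ext c' i = next_ext c i" using assms(2) by (simp add: next_ext_def)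
  qed
  have [simp]: "next_srv c' = next_srv c"
  proof
    fix i
    have "(\<forall>i\<in>{1..J}. 0 < cz c' i \<longrightarrow> a \<le> crs c' i) \<longleftrightarrow> (\<forall>i\<in>{1..J}. 0 < cz c i \<longrightarrow> a \<le> crs c i)" for a
      using assms by auto
    moreover have "0 < cz c i \<Longrightarrow> i \<noteq> j" using assms(1) by auto
    ultimately show "next_srv c' i = next_srv c i" using assms(2) by (auto simp: next_srv_def)
  qed
  show e: "evt c' = evt c" by (simp add: evt_def)
  show "delay c' = delay c"
  proof (cases rule: evt_cases[of c])
    case (ext i)
    then show ?thesis by (simp add: delay_def e) (simp add: assms(2))
  next
    case (srv i)
    then have "i \<noteq> j" using assms(1) by (auto simp: next_srv_def)
    with srv show ?thesis by (simp add: delay_def e) (simp add: assms(2))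
  qed
qed

lemma nstep_idle:
  assumes "cz c j = 0" "c' = c\<lparr>crs := (crs c)(j := v)\<rparr>"
  shows "nstep p c' = (nstep p c)\<lparr>crs := (crs (nstep p c))(j := v)\<rparr>"
proof -
  note e = evt_idle[OF assms]
  have C: "cz c' = cz c" "cre c' = cre c" "crs c' = (crs c)(j := v)" "cne c' = cne c"
    "cns c' = cns c" "cnr c' = cnr c" "ctime c' = ctime c" "gjn_cfg.more c' = gjn_cfg.more c"
    by (simp_all add: assms(2))
  show ?thesis
  proof (cases rule: evt_cases[of c])
    case (ext i)
    then show ?thesis using assms(1)
      by (intro gjn_cfg.equality) (auto simp: nstep_def e upd_def Let_def fun_eq_iff C)
  next
    case (srv i)
    then have "i \<noteq> j" using assms by (auto simp: next_srv_def)
    then show ?thesis using srv assms(1)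
      by (intro gjn_cfg.equality) (auto simp: nstep_def e upd_def Let_def fun_eq_iff C)
  qed
qed

lemma cz_nstep_zeroD: "cz (nstep p c) j = 0 \<Longrightarrow> evt c \<noteq> (1, j) \<Longrightarrow> cz c j = 0"
  by (cases rule: step_cases[of c p]) (auto split: if_splits)

lemma cns_nstep: "cns (nstep p c) j = cns c j + (if evt c = (1, j) then 1 else 0)"
  by (cases rule: step_cases[of c p]) auto

text \<open>An empty station whose last event was not its own completion was empty before that
  event. Going back in this way reaches the completion number \<open>i\<close>, since which the
  station has stayed empty; the draw made there sits in a frozen clock and influences nothing
  else.\<close>

lemma chain_idle_unconsumed:
  assumes p: "\<And>q. q \<noteq> (1, j, i) \<Longrightarrow> p q = p' q" and i: "1 \<le> i"
  shows "cns (chain p x n) j = Suc i \<Longrightarrow> cz (chain p x n) j = 0 \<Longrightarrow>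
    crs (chain p x n) j = p (1, j, i) / \<mu> j \<and>
    chain p' x n = (chain p x n)\<lparr>crs := (crs (chain p x n))(j := p' (1, j, i) / \<mu> j)\<rparr>"
proof (induction n)
  case 0
  then show ?case using i by (simp add: gjn_init_def)
next
  case (Suc n)
  define c where "c = chain p x n"
  show ?case
  proof (cases "evt c = (1, j)")
    case True
    \<comment> \<open>This is the completion at which draw \<open>i\<close> is read, so before it
      the counter is still \<open>i\<close> and both chains agree.\<close>
    then have ci: "cns c j = i" using Suc.prems(1) by (simp add: chain_Suc c_def cns_nstep)
    have eq: "chain p' x n = c"
      unfolding c_def by (rule chain_unconsumed[OF p]) (use ci in \<open>auto simp: counter_def c_def\<close>)
    have "p (2, j, cnr c j) = p' (2, j, cnr c j)" by (rule p) simp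
    with True ci show ?thesis
      unfolding chain_Suc eq c_def[symmetric]
      by (intro conjI gjn_cfg.equality) (auto simp: nstep_def upd_def Let_def)
  next
    case False
    then have ci: "cns c j = Suc i" "cz c j = 0"
      using Suc.prems cz_nstep_zeroD[of p c j] by (auto simp: chain_Suc c_def cns_nstep)
    define c' where "c' = chain p' x n"
    note IH' = Suc.IH[OF ci[unfolded c_def]]
    have IH: "crs c j = p (1, j, i) / \<mu> j" "c' = c\<lparr>crs := (crs c)(j := p' (1, j, i) / \<mu> j)\<rparr>"
      using conjunct1[OF IH'] conjunct2[OF IH'] unfolding c_def c'_def .
    have e: "evt c' = evt c" by (rule evt_idle[OF ci(2) IH(2)])
    have "nstep p' c' = nstep p c'"
    proof (rule nstep_cong[symmetric])
      fix l assume "evt c' = (1, l)"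
      with False e have "l \<noteq> j" by auto
      then show "p (1, l, cns c' l) = p' (1, l, cns c' l) \<and> p (2, l, cnr c' l) = p' (2, l, cnr c' l)"
        by (intro conjI p) auto
    next
      fix l show "p (0, l, cne c' l) = p' (0, l, cne c' l)" by (rule p) simp
    qed
    also have "\<dots> = (nstep p c)\<lparr>crs := (crs (nstep p c))(j := p' (1, j, i) / \<mu> j)\<rparr>"
      by (rule nstep_idle[OF ci(2) IH(2)])
    finally have 1: "nstep p' c' = (nstep p c)\<lparr>crs := (crs (nstep p c))(j := p' (1, j, i) / \<mu> j)\<rparr>" .
    have 2: "crs (nstep p c) j = crs c j"
      by (cases rule: step_cases[of c p]) (use ci False in auto)
    show ?thesis
      unfolding chain_Suc c_def[symmetric] c'_def[symmetric] 1 2 by (intro conjI IH(1) refl)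
  qed
qed

lemma chain_always_idle:
  assumes "\<And>n. cz (chain p x n) j = 0"
  shows "chain p (x(j := (fst (x j), fst (snd (x j)), a))) n = (chain p x n)\<lparr>crs := (crs (chain p x n))(j := a)\<rparr>"
proof (induction n)
  case 0
  then show ?case by (auto simp: gjn_init_def fun_eq_iff)
next
  case (Suc n)
  show ?case unfolding chain_Suc by (rule nstep_idle[OF assms Suc])
qed

text \<open>A station that is busy once and never completes a service stays busy, so its clock falls
  at unit rate for ever; since time is unbounded, the clock would become negative.\<close>

lemma first_service_or_idle:
  assumes ok: "state_ok x" "prim_ok p" and dv: "prim_div p" and j: "j \<in> {1..J}"
    and no: "\<And>n. cns (chain p x n) j = 1"
  shows "cz (chain p x n) j = 0"
proof (rule ccontr)
  assume nz: "cz (chain p x n) j \<noteq> 0"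
  have ne: "evt (chain p x m) \<noteq> (1, j)" for m
    using no[of m] no[of "Suc m"] by (auto simp: chain_Suc cns_nstep)
  have *: "0 < cz (chain p x (n + m)) j \<and>
      crs (chain p x (n + m)) j + etime p x (n + m) = crs (chain p x n) j + etime p x n" for m
  proof (induction m)
    case 0
    then show ?case using nz by simp
  next
    case (Suc m)
    then show ?case using ne[of "n + m"] j
      by (cases rule: step_cases[of "chain p x (n + m)" p]) (auto simp: chain_Suc)
  qed
  obtain N where N: "crs (chain p x n) j + etime p x n < etime p x N"
    using etime_unbounded[OF ok dv] by blast
  have "etime p x N \<le> etime p x (n + N)" by (rule etime_mono[OF ok]) simp
  moreover have "0 \<le> crs (chain p x (n + N)) j" using cfg_ok_chain[OF ok] j by (auto simp: cfg_ok_def)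
  ultimately show False using N *[of N] by linarith
qed

end

subsection \<open>Path bounds for the test functional\<close>

lemma power_diff_le_tangent:
  fixes a b :: real
  assumes "0 \<le> a" "0 \<le> b"
  shows "b ^ Suc n - a ^ Suc n \<le> real (Suc n) * b ^ n * (b - a)"
proof (induction n)
  case (Suc n)
  have "a ^ Suc n * (b - a) \<le> b ^ Suc n * (b - a)"
  proof (cases "a \<le> b")
    case True
    then show ?thesis using assms by (intro mult_right_mono power_mono) auto
  next
    case False
    then show ?thesis using assms by (intro mult_right_mono_neg power_mono) auto
  qed
  moreover have "b * (b ^ Suc n - a ^ Suc n) \<le> b * (real (Suc n) * b ^ n * (b - a))"
    using Suc assms by (intro mult_left_mono) auto
  ultimately show ?case by (simp add: algebra_simps)
qed simp

lemma abs_power_diff_le: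
  fixes a b :: real
  assumes "0 \<le> a" "0 \<le> b"
  shows "\<bar>b ^ Suc n - a ^ Suc n\<bar> \<le> real (Suc n) * (max a b) ^ n * \<bar>b - a\<bar>"
proof -
  have *: "y ^ Suc n - x ^ Suc n \<le> real (Suc n) * (max x y) ^ n * \<bar>y - x\<bar>" if "0 \<le> x" "0 \<le> y" for x y :: real
  proof -
    have "real (Suc n) * y ^ n * (y - x) \<le> real (Suc n) * (max x y) ^ n * \<bar>y - x\<bar>"
    proof (cases "x \<le> y")
      case True
      then show ?thesis by (simp add: max_def)
    next
      case False
      then have "real (Suc n) * y ^ n * (y - x) \<le> 0"
        using that by (intro mult_nonneg_nonpos) auto
      also have "0 \<le> real (Suc n) * (max x y) ^ n * \<bar>y - x\<bar>" using that by simp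
      finally show ?thesis .
    qed
    with power_diff_le_tangent[OF that] show ?thesis by (rule order_trans)
  qed
  show ?thesis using *[OF assms] *[OF assms(2,1)] by (auto simp: abs_le_iff max.commute abs_minus_commute)
qed

definition ppow :: "nat \<Rightarrow> real \<Rightarrow> real" where
  "ppow n y = (max y 0) ^ n"

lemma ppow_nonneg [simp]: "0 \<le> ppow n y"
  by (simp add: ppow_def)

lemma ppow_mono: "x \<le> y \<Longrightarrow> ppow n x \<le> ppow n y"
  unfolding ppow_def by (intro power_mono) auto

text \<open>The tangent is taken at the end point \<open>b\<close>. In the drift estimate this puts
  the derivative at the current value of the functional, where the bounds for busy and idle phases
  are available.\<close>

lemma ppow_tangent:
  assumes "1 \<le> n"
  shows "ppow (Suc n) b - ppow (Suc n) a \<le> (b - a) * (real (Suc n) * ppow n b)"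
proof -
  have "ppow (Suc n) b - ppow (Suc n) a \<le> real (Suc n) * ppow n b * (max b 0 - max a 0)"
    unfolding ppow_def by (rule power_diff_le_tangent) auto
  also have "real (Suc n) * ppow n b * (max b 0 - max a 0) \<le> (b - a) * (real (Suc n) * ppow n b)"
  proof (cases "0 \<le> b")
    case True
    then have "real (Suc n) * ppow n b * (max b 0 - max a 0) \<le> real (Suc n) * ppow n b * (b - a)"
      by (intro mult_left_mono) auto
    then show ?thesis by (simp only: mult.commute)
  next
    case False
    then show ?thesis using assms by (cases n) (auto simp: ppow_def max_def)
  qed
  finally show ?thesis .
qed

text \<open>Second-order Taylor remainder without second derivatives: the tangent inequality at the
  end point leaves the increment of the derivative over the jump, and this is of order
  \<open>h\<close> because the exponent of the derivative is still at least 1.\<close>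

lemma ppow_jump:
  "ppow (Suc (Suc n)) (a + h) - ppow (Suc (Suc n)) a - real (Suc (Suc n)) * ppow (Suc n) a * h
   \<le> real (Suc (Suc n)) * real (Suc n) * (max a 0 + \<bar>h\<bar>) ^ n * h\<^sup>2"
proof -
  have "ppow (Suc (Suc n)) (a + h) - ppow (Suc (Suc n)) a - real (Suc (Suc n)) * ppow (Suc n) a * h
     \<le> h * (real (Suc (Suc n)) * ppow (Suc n) (a + h)) - real (Suc (Suc n)) * ppow (Suc n) a * h"
    using ppow_tangent[of "Suc n" "a + h" a] by simp
  also have "\<dots> = real (Suc (Suc n)) * (h * (ppow (Suc n) (a + h) - ppow (Suc n) a))"
    by (simp add: algebra_simps)
  also have "\<dots> \<le> real (Suc (Suc n)) * (\<bar>h\<bar> * (real (Suc n) * (max a 0 + \<bar>h\<bar>) ^ n * \<bar>h\<bar>))"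
  proof (rule mult_left_mono)
    have "\<bar>ppow (Suc n) (a + h) - ppow (Suc n) a\<bar>
        \<le> real (Suc n) * (max (max a 0) (max (a + h) 0)) ^ n * \<bar>max (a + h) 0 - max a 0\<bar>"
      unfolding ppow_def by (rule abs_power_diff_le) auto
    also have "\<dots> \<le> real (Suc n) * (max a 0 + \<bar>h\<bar>) ^ n * \<bar>h\<bar>"
      by (intro mult_mono mult_left_mono power_mono) auto
    finally have "\<bar>h\<bar> * \<bar>ppow (Suc n) (a + h) - ppow (Suc n) a\<bar> \<le> \<bar>h\<bar> * (real (Suc n) * (max a 0 + \<bar>h\<bar>) ^ n * \<bar>h\<bar>)"
      by (intro mult_left_mono) auto
    then show "h * (ppow (Suc n) (a + h) - ppow (Suc n) a) \<le> \<bar>h\<bar> * (real (Suc n) * (max a 0 + \<bar>h\<bar>) ^ n * \<bar>h\<bar>)"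
      by (metis abs_ge_self abs_mult order_trans)
  qed simp
  also have "\<dots> = real (Suc (Suc n)) * real (Suc n) * (max a 0 + \<bar>h\<bar>) ^ n * h\<^sup>2"
    by (simp only: power2_abs[of h, symmetric]) (simp only: power2_eq_square mult_ac)
  finally show ?thesis .
qed

text \<open>Path estimates use only signs and sizes of \<open>u\<close> and \<open>d\<close> and the
  total slope. The identity \<open>d = P u - u\<close>, which centres the jumps, is added in
  \<open>gjn_drift\<close>.\<close>

locale gjn_test = gjn_rates +
  fixes k M :: nat and u d :: "nat \<Rightarrow> real" and B eps :: real
  assumes k: "k \<in> {1..J}" and M: "1 \<le> M"
    and u: "j \<in> {1..J} \<Longrightarrow> 0 \<le> u j \<and> u j \<le> 1" and u_above: "k < j \<Longrightarrow> u j = 0"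
    and d: "j \<in> {1..J} \<Longrightarrow> \<bar>d j\<bar> \<le> 1" and d_below: "j < k \<Longrightarrow> d j = 0"
    and d_above: "k < j \<Longrightarrow> j \<le> J \<Longrightarrow> 0 \<le> d j"
    and B: "(\<Sum>j\<in>{1..J}. \<alpha> j) + (\<Sum>j\<in>{1..J}. \<mu> j) \<le> B"
    and eps: "0 \<le> eps"
    and drift: "(\<Sum>j\<in>{1..J}. \<alpha> j * u j) + (\<Sum>j\<in>{k..J}. d j * \<mu> j) \<le> - eps"
begin

definition Fz :: "(nat \<Rightarrow> nat) \<Rightarrow> (nat \<Rightarrow> real) \<Rightarrow> (nat \<Rightarrow> real) \<Rightarrow> real" where
  "Fz z re rs = (\<Sum>j\<in>{1..J}. u j * real (z j)) - (\<Sum>j\<in>{1..J}. \<alpha> j * u j * re j) - (\<Sum>j\<in>{1..J}. d j * \<mu> j * rs j)"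

definition FC :: "gjn_cfg \<Rightarrow> real" where
  "FC c = Fz (cz c) (cre c) (crs c)"

definition FX :: "(nat \<Rightarrow> nat \<times> real \<times> real) \<Rightarrow> real" where
  "FX x = Fz (\<lambda>j. fst (x j)) (\<lambda>j. fst (snd (x j))) (\<lambda>j. snd (snd (x j)))"

text \<open>Slope of the functional between events: every arrival clock with a nonzero weight runs,
  and service clocks run only at busy stations.\<close>

definition bz :: "(nat \<Rightarrow> nat) \<Rightarrow> real" where
  "bz z = (\<Sum>j\<in>{1..J}. \<alpha> j * u j) + (\<Sum>j\<in>{1..J}. if 0 < z j then d j * \<mu> j else 0)"

lemma FC_init: "FC (gjn_init x) = FX x"
  by (simp add: FC_def FX_def gjn_init_def)

text \<open>Value of the functional \<open>s\<close> time units after \<open>c\<close> as long as no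
  event intervenes.\<close>

definition flow :: "gjn_cfg \<Rightarrow> real \<Rightarrow> real" where
  "flow c s = Fz (cz c) (\<lambda>i. if i \<in> {1..J} \<and> 0 < \<alpha> i then cre c i - s else cre c i)
                 (\<lambda>i. if i \<in> {1..J} \<and> 0 < cz c i then crs c i - s else crs c i)"

lemma flow_eq: "flow c s = FC c + bz (cz c) * s"
proof -
  \<comment> \<open>An arrival clock with \<alpha> equal to 0 does not run, but its weight vanishes
    as well, so the linear formula holds for every station.\<close>
  have 1: "(\<Sum>j\<in>{1..J}. \<alpha> j * u j * (if j \<in> {1..J} \<and> 0 < \<alpha> j then cre c j - s else cre c j)) =
        (\<Sum>j\<in>{1..J}. \<alpha> j * u j * cre c j - \<alpha> j * u j * s)"
    by (intro sum.cong) (use \<alpha>_nonneg in \<open>auto simp: algebra_simps not_less dest!: antisym\<close>)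
  have 2: "(\<Sum>j\<in>{1..J}. d j * \<mu> j * (if j \<in> {1..J} \<and> 0 < cz c j then crs c j - s else crs c j)) =
        (\<Sum>j\<in>{1..J}. d j * \<mu> j * crs c j - (if 0 < cz c j then d j * \<mu> j else 0) * s)"
    by (intro sum.cong) (auto simp: algebra_simps)
  show ?thesis
    unfolding flow_def FC_def Fz_def bz_def 1 2 sum_subtractf
    by (simp add: sum_distrib_right distrib_right)
qed

lemma FX_obs: "FX (obs c s) = flow c s"
proof -
  have "(\<Sum>j\<in>{1..J}. \<alpha> j * u j * fst (snd (obs c s j))) =
      (\<Sum>j\<in>{1..J}. \<alpha> j * u j * (if j \<in> {1..J} \<and> 0 < \<alpha> j then cre c j - s else cre c j))"
    by (intro sum.cong) (use \<alpha>_nonneg in \<open>auto simp: obs_def not_less dest!: antisym\<close>)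
  moreover have "(\<Sum>j\<in>{1..J}. d j * \<mu> j * snd (snd (obs c s j))) =
      (\<Sum>j\<in>{1..J}. d j * \<mu> j * (if j \<in> {1..J} \<and> 0 < cz c j then crs c j - s else crs c j))"
    by (intro sum.cong) (auto simp: obs_def)
  moreover have "(\<Sum>j\<in>{1..J}. u j * real (fst (obs c s j))) = (\<Sum>j\<in>{1..J}. u j * real (cz c j))"
    by (intro sum.cong) (auto simp: obs_def)
  ultimately show ?thesis unfolding FX_def flow_def Fz_def by simp
qed

definition pre :: "gjn_cfg \<Rightarrow> real" where
  "pre c = flow c (delay c)"

definition udest :: "nat \<Rightarrow> real" where
  "udest l = (if l \<in> {1..J} then u l else 0)"

text \<open>Jump of the functional at an event. The expiring clock stands at zero just before, so
  only the change of the queue lengths and the fresh draw contribute. With unit mean draws and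
  \<open>d = P u - u\<close> the jump is centred given the past.\<close>

definition xi :: "(nat \<times> nat \<times> nat \<Rightarrow> real) \<Rightarrow> gjn_cfg \<Rightarrow> real" where
  "xi p c = (let j = snd (evt c) in
     if fst (evt c) = 0 then u j * (1 - p (0, j, cne c j))
     else udest (nat \<lfloor>p (2, j, cnr c j)\<rfloor>) - u j - d j * p (1, j, cns c j))"

lemma udest: "0 \<le> udest l" "udest l \<le> 1"
  using u by (auto simp: udest_def)

lemma FC_nstep: "FC (nstep p c) = pre c + xi p c"
proof (cases rule: step_cases[of c p])
  case (ext j)
  have 1: "(\<Sum>i\<in>{1..J}. u i * real (cz (nstep p c) i)) = (\<Sum>i\<in>{1..J}. u i * real (cz c i)) + u j"
  proof -
    have "(\<Sum>i\<in>{1..J}. u i * real (cz (nstep p c) i)) = (\<Sum>i\<in>{1..J}. u i * real (cz c i) + (if i = j then u j else 0))"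
      by (intro sum.cong) (auto simp: ext(5) algebra_simps)
    then show ?thesis using ext(2) by (simp add: sum.distrib)
  qed
  have 2: "(\<Sum>i\<in>{1..J}. \<alpha> i * u i * cre (nstep p c) i) =
     (\<Sum>i\<in>{1..J}. \<alpha> i * u i * (if i \<in> {1..J} \<and> 0 < \<alpha> i then cre c i - delay c else cre c i)) + u j * p (0, j, cne c j)"
  proof -
    have "(\<Sum>i\<in>{1..J}. \<alpha> i * u i * cre (nstep p c) i) =
     (\<Sum>i\<in>{1..J}. \<alpha> i * u i * (if i \<in> {1..J} \<and> 0 < \<alpha> i then cre c i - delay c else cre c i) + (if i = j then u j * p (0, j, cne c j) else 0))"
      using ext(3,4) by (intro sum.cong) (auto simp: ext(5))
    then show ?thesis using ext(2) by (simp add: sum.distrib)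
  qed
  have 3: "crs (nstep p c) = (\<lambda>i. if i \<in> {1..J} \<and> 0 < cz c i then crs c i - delay c else crs c i)"
    by (simp add: ext(5))
  show ?thesis
    unfolding FC_def pre_def flow_def Fz_def 1 2 3 xi_def ext(1) by (simp add: algebra_simps)
next
  case (srv j)
  define l where "l = nat \<lfloor>p (2, j, cnr c j)\<rfloor>"
  have 1: "(\<Sum>i\<in>{1..J}. u i * real (cz (nstep p c) i)) = (\<Sum>i\<in>{1..J}. u i * real (cz c i)) - u j + udest l"
  proof -
    have "(\<Sum>i\<in>{1..J}. u i * real (cz (nstep p c) i)) =
        (\<Sum>i\<in>{1..J}. u i * real (cz c i) - (if i = j then u j else 0) + (if i = l then u l else 0))"
      using srv(3) by (intro sum.cong) (auto simp: srv(5) l_def algebra_simps of_nat_diff)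
    then show ?thesis using srv(2) by (simp add: sum.distrib sum_subtractf udest_def)
  qed
  have 2: "(\<Sum>i\<in>{1..J}. d i * \<mu> i * crs (nstep p c) i) =
     (\<Sum>i\<in>{1..J}. d i * \<mu> i * (if i \<in> {1..J} \<and> 0 < cz c i then crs c i - delay c else crs c i)) + d j * p (1, j, cns c j)"
  proof -
    have "(\<Sum>i\<in>{1..J}. d i * \<mu> i * crs (nstep p c) i) =
     (\<Sum>i\<in>{1..J}. d i * \<mu> i * (if i \<in> {1..J} \<and> 0 < cz c i then crs c i - delay c else crs c i) + (if i = j then d j * p (1, j, cns c j) else 0))"
      using srv(2,3,4) \<mu>_pos[OF srv(2)] by (intro sum.cong) (auto simp: srv(5))
    then show ?thesis using srv(2) by (simp add: sum.distrib)
  qed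
  have 3: "cre (nstep p c) = (\<lambda>i. if i \<in> {1..J} \<and> 0 < \<alpha> i then cre c i - delay c else cre c i)"
    by (simp add: srv(5))
  show ?thesis
    unfolding FC_def pre_def flow_def Fz_def 1 2 3 xi_def srv(1) by (simp add: algebra_simps l_def)
qed

lemma abs_bz_le: "\<bar>bz z\<bar> \<le> B"
proof -
  have "\<bar>bz z\<bar> \<le> \<bar>\<Sum>j\<in>{1..J}. \<alpha> j * u j\<bar> + \<bar>\<Sum>j\<in>{1..J}. if 0 < z j then d j * \<mu> j else 0\<bar>"
    unfolding bz_def by (rule abs_triangle_ineq)
  also have "\<dots> \<le> (\<Sum>j\<in>{1..J}. \<alpha> j) + (\<Sum>j\<in>{1..J}. \<mu> j)"
  proof (intro add_mono order_trans[OF sum_abs] sum_mono)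
    fix j assume j: "j \<in> {1..J}"
    show "\<bar>\<alpha> j * u j\<bar> \<le> \<alpha> j"
      using \<alpha>_nonneg[OF j] u[OF j] by (simp add: abs_mult mult_left_le)
    show "\<bar>if 0 < z j then d j * \<mu> j else 0\<bar> \<le> \<mu> j"
      using \<mu>_pos[OF j] d[OF j] by (auto simp: abs_mult mult_left_le_one_le)
  qed
  finally show ?thesis using B by linarith
qed

lemma B_nonneg: "0 \<le> B"
  using abs_bz_le[of "\<lambda>_. 0"] by linarith

text \<open>Terms below \<open>k\<close> are zero and terms above \<open>k\<close> are nonnegative,
  so switching on all upper stations only increases the slope; the negative term of station
  \<open>k\<close> is present because that station is busy.\<close>

lemma bz_busy: "0 < z k \<Longrightarrow> bz z \<le> - eps"
proof -
  assume z: "0 < z k"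
  have "(\<Sum>j\<in>{1..J}. if 0 < z j then d j * \<mu> j else 0) \<le> (\<Sum>j\<in>{1..J}. if k \<le> j then d j * \<mu> j else 0)"
  proof (rule sum_mono)
    fix j assume j: "j \<in> {1..J}"
    then show "(if 0 < z j then d j * \<mu> j else 0) \<le> (if k \<le> j then d j * \<mu> j else 0)"
      using d_below[of j] d_above[of j] \<mu>_pos[OF j] z by (cases j k rule: linorder_cases) auto
  qed
  also have "\<dots> = (\<Sum>j\<in>{k..J}. d j * \<mu> j)"
    using k by (intro sum.mono_neutral_cong_right) auto
  finally show ?thesis using drift unfolding bz_def by linarith
qed

text \<open>Dominates at once the total variation of the jumps, the growth of the lower queues and
  the fresh residual at station \<open>k\<close>. Arrivals count only up to station
  \<open>k\<close>, where \<open>u\<close> may be nonzero; this is why arrival moments are assumed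
  only for the first stations.\<close>

definition Ucount :: "(nat \<times> nat \<times> nat \<Rightarrow> real) \<Rightarrow> gjn_cfg \<Rightarrow> real" where
  "Ucount p c = (\<Sum>j\<in>{1..k}. \<Sum>m\<in>{1..<cne c j}. 1 + p (0, j, m)) + (\<Sum>j\<in>{1..J}. \<Sum>m\<in>{1..<cns c j}. 1 + p (1, j, m))"

lemma Ucount_init [simp]: "Ucount p (gjn_init x) = 0"
  by (simp add: Ucount_def gjn_init_def)

lemma Ucount_ext:
  assumes "evt c = (0, j)" "1 \<le> cne c j"
  shows "Ucount p (nstep p c) = Ucount p c + (if j \<in> {1..k} then 1 + p (0, j, cne c j) else 0)"
proof -
  have "(\<Sum>i\<in>{1..k}. \<Sum>m\<in>{1..<cne (nstep p c) i}. 1 + p (0, i, m)) =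
    (\<Sum>i\<in>{1..k}. (\<Sum>m\<in>{1..<cne c i}. 1 + p (0, i, m)) + (if i = j then 1 + p (0, j, cne c j) else 0))"
    using assms by (intro sum.cong) (auto simp: nstep_def upd_def Let_def)
  moreover have "cns (nstep p c) = cns c" using assms by (simp add: nstep_def upd_def Let_def)
  ultimately show ?thesis by (simp add: Ucount_def sum.distrib)
qed

lemma Ucount_srv:
  assumes "evt c = (1, j)" "1 \<le> cns c j" "j \<in> {1..J}"
  shows "Ucount p (nstep p c) = Ucount p c + 1 + p (1, j, cns c j)"
proof -
  have "(\<Sum>i\<in>{1..J}. \<Sum>m\<in>{1..<cns (nstep p c) i}. 1 + p (1, i, m)) =
    (\<Sum>i\<in>{1..J}. (\<Sum>m\<in>{1..<cns c i}. 1 + p (1, i, m)) + (if i = j then 1 + p (1, j, cns c j) else 0))"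
    using assms by (intro sum.cong) (auto simp: nstep_def upd_def Let_def)
  also have "\<dots> = (\<Sum>i\<in>{1..J}. (\<Sum>m\<in>{1..<cns c i}. 1 + p (1, i, m))) + 1 + p (1, j, cns c j)"
    using assms(3) by (simp add: sum.distrib)
  moreover have "cne (nstep p c) = cne c" using assms by (simp add: nstep_def upd_def Let_def)
  ultimately show ?thesis by (simp add: Ucount_def)
qed

lemma abs_xi_le:
  assumes "prim_ok p" "\<And>j. 1 \<le> cne c j" "\<And>j. 1 \<le> cns c j"
  shows "\<bar>xi p c\<bar> \<le> Ucount p (nstep p c) - Ucount p c"
proof (cases rule: step_cases[of c p])
  case (ext j)
  have p: "0 \<le> p (0, j, cne c j)" using assms ext(2) by (auto simp: prim_ok_def)
  show ?thesis
  proof (cases "j \<in> {1..k}")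
    case True
    have "\<bar>xi p c\<bar> = u j * \<bar>1 - p (0, j, cne c j)\<bar>"
      using u[OF ext(2)] by (simp add: xi_def ext(1) abs_mult)
    also have "\<dots> \<le> 1 * (1 + p (0, j, cne c j))"
      using u[OF ext(2)] p by (intro mult_mono) auto
    finally show ?thesis using True Ucount_ext[OF ext(1) assms(2)] by simp
  next
    case False
    then have "u j = 0" using ext(2) u_above[of j] by auto
    then show ?thesis using False Ucount_ext[OF ext(1) assms(2), of p] by (simp add: xi_def ext(1) del: atLeastAtMost_iff)
  qed
next
  case (srv j)
  have p: "0 \<le> p (1, j, cns c j)" using assms srv(2) by (auto simp: prim_ok_def)
  have "\<bar>d j * p (1, j, cns c j)\<bar> \<le> 1 * p (1, j, cns c j)"
    unfolding abs_mult using d[OF srv(2)] p by (intro mult_mono) auto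
  moreover have "\<bar>udest l - u j\<bar> \<le> 1" for l using u[OF srv(2)] udest[of l] by linarith
  moreover have "\<bar>a - b - e\<bar> \<le> 1 + q" if "\<bar>a - b\<bar> \<le> 1" "\<bar>e\<bar> \<le> 1 * q" for a b e q :: real
    using that by linarith
  ultimately have "\<bar>xi p c\<bar> \<le> 1 + p (1, j, cns c j)"
    unfolding xi_def srv(1) by (simp only: Let_def fst_conv snd_conv one_neq_zero if_False)
  then show ?thesis using Ucount_srv[OF srv(1) assms(3) srv(2)] by simp
qed

lemma Ucount_nstep_mono:
  assumes "prim_ok p" "\<And>j. 1 \<le> cne c j" "\<And>j. 1 \<le> cns c j"
  shows "Ucount p c \<le> Ucount p (nstep p c)"
  using abs_xi_le[OF assms] by linarith

lemma Ucount_chain_mono: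
  assumes "prim_ok p" "m \<le> n"
  shows "Ucount p (chain p x m) \<le> Ucount p (chain p x n)"
proof -
  have "incseq (\<lambda>n. Ucount p (chain p x n))"
    using Ucount_nstep_mono[OF assms(1)] counters_pos by (intro incseq_SucI) (simp add: chain_Suc)
  from incseqD[OF this assms(2)] show ?thesis .
qed

lemma FC_chain_bound:
  assumes ok: "state_ok x" "prim_ok p"
  shows "\<bar>FC (chain p x n) - FX x\<bar> \<le> B * etime p x n + Ucount p (chain p x n)"
proof (induction n)
  case 0
  show ?case by (simp add: FC_init)
next
  case (Suc n)
  define c where "c = chain p x n"
  have "\<bar>bz (cz c) * delay c\<bar> \<le> B * delay c"
    using abs_bz_le[of "cz c"] delay_nonneg[OF cfg_ok_chain[OF ok, of n]]
    by (simp add: abs_mult c_def mult_right_mono)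
  moreover have "\<bar>xi p c\<bar> \<le> Ucount p (nstep p c) - Ucount p c"
    using counters_pos by (intro abs_xi_le[OF ok(2)]) (auto simp: c_def)
  moreover have "FC (nstep p c) = FC c + bz (cz c) * delay c + xi p c"
    by (simp add: FC_nstep pre_def flow_eq)
  moreover have "\<bar>FC c - FX x\<bar> \<le> B * ctime c + Ucount p c" using Suc by (simp add: c_def)
  ultimately show ?case by (simp add: chain_Suc c_def[symmetric] distrib_left)
qed

lemma flow_chain_bound:
  assumes ok: "state_ok x" "prim_ok p" and s: "0 \<le> s" "etime p x n + s \<le> 1"
    and S: "B + Ucount p (chain p x n) \<le> S"
  shows "\<bar>flow (chain p x n) s - FX x\<bar> \<le> S"
proof -
  define c where "c = chain p x n"
  have "\<bar>bz (cz c) * s\<bar> \<le> B * s"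
    using abs_bz_le[of "cz c"] s by (simp add: abs_mult mult_right_mono)
  moreover have "\<bar>FC c - FX x\<bar> \<le> B * ctime c + Ucount p c"
    using FC_chain_bound[OF ok] by (simp add: c_def)
  moreover have "B * (ctime c + s) \<le> B * 1"
    using s B_nonneg by (intro mult_left_mono) (auto simp: c_def)
  ultimately show ?thesis using S unfolding c_def[symmetric] flow_eq distrib_left by linarith
qed

text \<open>A lower queue grows by at most one per event, either through an arrival at one of these
  stations or through routing at some completion; both kinds of event raise \<open>Ucount\<close> by
  at least 1.\<close>

lemma queue_chain_bound:
  assumes ok: "state_ok x" "prim_ok p"
  shows "(\<Sum>j\<in>{1..<k}. real (cz (chain p x n) j)) \<le> (\<Sum>j\<in>{1..<k}. real (fst (x j))) + Ucount p (chain p x n)"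
proof (induction n)
  case 0
  show ?case using Ucount_init[of p x] by (simp add: gjn_init_def)
next
  case (Suc n)
  define c where "c = chain p x n"
  have cnt: "1 \<le> cne c j" "1 \<le> cns c j" for j using counters_pos by (auto simp: c_def)
  have "(\<Sum>j\<in>{1..<k}. real (cz (nstep p c) j)) \<le> (\<Sum>j\<in>{1..<k}. real (cz c j)) + (Ucount p (nstep p c) - Ucount p c)"
  proof (cases rule: step_cases[of c p])
    case (ext j)
    have p: "0 \<le> p (0, j, cne c j)" using ok ext(2) cnt by (auto simp: prim_ok_def)
    have "(\<Sum>i\<in>{1..<k}. real (cz (nstep p c) i)) = (\<Sum>i\<in>{1..<k}. real (cz c i) + (if i = j then 1 else 0))"
      by (intro sum.cong) (auto simp: ext(5))
    also have "\<dots> = (\<Sum>i\<in>{1..<k}. real (cz c i)) + (if j \<in> {1..<k} then 1 else 0)"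
      by (simp add: sum.distrib)
    also have "\<dots> \<le> (\<Sum>i\<in>{1..<k}. real (cz c i)) + (if j \<in> {1..k} then 1 + p (0, j, cne c j) else 0)"
      using p by auto
    finally show ?thesis using Ucount_ext[OF ext(1) cnt(1), of p] by simp
  next
    case (srv j)
    have p: "0 \<le> p (1, j, cns c j)" using ok srv(2) cnt by (auto simp: prim_ok_def)
    define l where "l = nat \<lfloor>p (2, j, cnr c j)\<rfloor>"
    have "(\<Sum>i\<in>{1..<k}. real (cz (nstep p c) i)) \<le> (\<Sum>i\<in>{1..<k}. real (cz c i) + (if i = l then 1 else 0))"
      by (intro sum_mono) (auto simp: srv(5) l_def)
    also have "\<dots> \<le> (\<Sum>i\<in>{1..<k}. real (cz c i)) + 1"
      by (simp add: sum.distrib)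
    finally show ?thesis using Ucount_srv[OF srv(1) cnt(2) srv(2), of p] p by simp
  qed
  with Suc show ?case by (simp add: chain_Suc c_def)
qed

text \<open>The clock either decreases, or stays frozen, or is replaced by a draw that
  \<open>Ucount\<close> has already counted.\<close>

lemma resid_chain_bound:
  assumes ok: "state_ok x" "prim_ok p"
  shows "\<mu> k * crs (chain p x n) k \<le> \<mu> k * snd (snd (x k)) + Ucount p (chain p x n)"
proof (induction n)
  case 0
  show ?case using Ucount_init[of p x] by (simp add: gjn_init_def)
next
  case (Suc n)
  define c where "c = chain p x n"
  have cnt: "1 \<le> cne c j" "1 \<le> cns c j" for j using counters_pos by (auto simp: c_def)
  have d: "0 \<le> \<mu> k * delay c" using delay_nonneg[OF cfg_ok_chain[OF ok, of n]] \<mu>_pos[OF k] by (simp add: c_def)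
  have U: "Ucount p c \<le> Ucount p (nstep p c)" using cnt by (rule Ucount_nstep_mono[OF ok(2)])
  have IH: "\<mu> k * crs c k \<le> \<mu> k * snd (snd (x k)) + Ucount p c" using Suc by (simp add: c_def)
  have "\<mu> k * crs (nstep p c) k \<le> \<mu> k * snd (snd (x k)) + Ucount p (nstep p c)"
  proof (cases "evt c = (1, k)")
    case True
    have p: "0 \<le> p (1, k, cns c k)" using ok k cnt by (auto simp: prim_ok_def)
    have "crs (nstep p c) k = p (1, k, cns c k) / \<mu> k" using True by (simp add: nstep_def upd_def Let_def)
    then have "\<mu> k * crs (nstep p c) k = p (1, k, cns c k)" using \<mu>_pos[OF k] by simp
    also have "\<dots> \<le> Ucount p (nstep p c)"
      using Ucount_srv[OF True cnt(2) k, of p] Ucount_chain_mono[OF ok(2), of 0 n x] by (simp add: c_def)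
    also have "\<dots> \<le> \<mu> k * snd (snd (x k)) + Ucount p (nstep p c)"
      using ok k \<mu>_pos[OF k] by (auto simp: state_ok_def)
    finally show ?thesis .
  next
    case False
    have "crs (nstep p c) k = crs c k - (if 0 < cz c k then delay c else 0)"
      using False k by (cases rule: step_cases[of c p]) auto
    then have "\<mu> k * crs (nstep p c) k \<le> \<mu> k * crs c k" using d by (simp add: right_diff_distrib)
    with IH U show ?thesis by linarith
  qed
  then show ?case by (simp add: chain_Suc c_def)
qed

text \<open>With an empty station \<open>k\<close> and \<open>u = 0\<close> above it, only the lower
  queues contribute positively; among the clock terms only the one of station \<open>k\<close> can
  have a negative \<open>d\<close>, and \<open>d k\<close> is at least -1. The condition
  \<open>s \<le> delay c\<close> keeps the running clocks nonnegative.\<close>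

lemma flow_idle:
  assumes ok: "cfg_ok c" and z: "cz c k = 0" and s: "s \<le> delay c"
  shows "flow c s \<le> (\<Sum>j\<in>{1..<k}. real (cz c j)) + \<mu> k * crs c k"
proof -
  define re where "re = (\<lambda>i. if i \<in> {1..J} \<and> 0 < \<alpha> i then cre c i - s else cre c i)"
  define rs where "rs = (\<lambda>i. if i \<in> {1..J} \<and> 0 < cz c i then crs c i - s else crs c i)"
  have re: "0 \<le> re j" if "j \<in> {1..J}" for j
    using ok that s delay_le[OF that, of c] by (force simp: re_def cfg_ok_def)
  have rs: "0 \<le> rs j" if "j \<in> {1..J}" for j
    using ok that s delay_le[OF that, of c] by (force simp: rs_def cfg_ok_def)
  have "(\<Sum>j\<in>{1..J}. u j * real (cz c j)) \<le> (\<Sum>j\<in>{1..J}. if j < k then real (cz c j) else 0)"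
  proof (rule sum_mono)
    fix j assume j: "j \<in> {1..J}"
    show "u j * real (cz c j) \<le> (if j < k then real (cz c j) else 0)"
      using u[OF j] u_above[of j] z by (cases j k rule: linorder_cases) (auto simp: mult_left_le_one_le)
  qed
  also have "\<dots> = (\<Sum>j\<in>{1..<k}. real (cz c j))"
    using k by (intro sum.mono_neutral_cong_right) auto
  finally have 1: "(\<Sum>j\<in>{1..J}. u j * real (cz c j)) \<le> (\<Sum>j\<in>{1..<k}. real (cz c j))" .
  have 2: "0 \<le> (\<Sum>j\<in>{1..J}. \<alpha> j * u j * re j)"
    using \<alpha>_nonneg u re by (intro sum_nonneg mult_nonneg_nonneg) auto
  have "- (\<mu> k * crs c k) = (\<Sum>j\<in>{1..J}. if j = k then - (\<mu> k * crs c k) else 0)"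
    using k by simp
  also have "\<dots> \<le> (\<Sum>j\<in>{1..J}. d j * \<mu> j * rs j)"
  proof (rule sum_mono)
    fix j assume j: "j \<in> {1..J}"
    have m: "0 \<le> \<mu> j * rs j" using \<mu>_pos[OF j] rs[OF j] by simp
    show "(if j = k then - (\<mu> k * crs c k) else 0) \<le> d j * \<mu> j * rs j"
    proof (cases j k rule: linorder_cases)
      case equal
      have "- 1 * (\<mu> j * rs j) \<le> d j * (\<mu> j * rs j)"
        using d[OF j] m by (intro mult_right_mono) auto
      then show ?thesis using equal z by (simp add: rs_def mult.assoc)
    next
      case greater
      then have "0 \<le> d j * (\<mu> j * rs j)" using d_above[of j] j m by simp
      then show ?thesis using greater by (simp add: mult.assoc)
    qed (use d_below[of j] in auto)
  qed
  finally show ?thesis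
    using 1 2 unfolding flow_def Fz_def re_def[symmetric] rs_def[symmetric] by linarith
qed

definition f0 :: "(nat \<Rightarrow> nat \<times> real \<times> real) \<Rightarrow> real" where
  "f0 x = max (FX x) 0"

definition W0 :: "(nat \<Rightarrow> nat \<times> real \<times> real) \<Rightarrow> real" where
  "W0 x = (\<Sum>j\<in>{1..<k}. real (fst (x j))) + \<mu> k * snd (snd (x k))"

text \<open>Bound for the time derivative of the Lyapunov function throughout the unit interval,
  expressed by the initial state and the total activity \<open>S\<close>. The extra
  \<open>eps\<close> in front of the first power pays, in idle phases, for the negative term, which
  is earned only in busy phases.\<close>

definition driftb :: "(nat \<Rightarrow> nat \<times> real \<times> real) \<Rightarrow> real \<Rightarrow> real" where
  "driftb x S = real (Suc M) * ((B + eps) * (W0 x + S) ^ M - eps * ppow M (f0 x - S))"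

lemma f0_nonneg: "0 \<le> f0 x" by (simp add: f0_def)

lemma W0_nonneg: "state_ok x \<Longrightarrow> 0 \<le> W0 x"
  using k \<mu>_pos[OF k] by (auto simp: W0_def state_ok_def intro!: add_nonneg_nonneg sum_nonneg)

text \<open>While \<open>k\<close> is busy the slope is at most \<open>- eps\<close> and the
  functional is within \<open>S\<close> of its initial value. While \<open>k\<close> is idle the
  functional itself is at most \<open>W0 x + S\<close>, so both its positive slope and the unearned
  negative term are absorbed by \<open>(W0 x + S) ^ M\<close>.\<close>

lemma drift_step:
  assumes ok: "state_ok x" "prim_ok p" and s: "0 \<le> s" "etime p x n + s \<le> 1" "s \<le> delay (chain p x n)"
    and S: "B + 2 * Ucount p (chain p x n) \<le> S"
  shows "ppow (Suc M) (flow (chain p x n) s) - ppow (Suc M) (FC (chain p x n)) \<le> s * driftb x S"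
proof -
  define c where "c = chain p x n"
  define y where "y = flow c s"
  have U0: "0 \<le> Ucount p c" using Ucount_chain_mono[OF ok(2), of 0 n x] by (simp add: c_def)
  have yb: "\<bar>y - FX x\<bar> \<le> S"
    unfolding y_def c_def using U0 S by (intro flow_chain_bound[OF ok s(1,2)]) (simp add: c_def)
  have S0: "0 \<le> S" using yb by linarith
  have lower: "ppow M (f0 x - S) \<le> ppow M y"
  proof (cases "0 \<le> FX x")
    case True
    then show ?thesis using yb by (intro ppow_mono) (auto simp: f0_def)
  next
    case False
    then have "ppow M (f0 x - S) = 0" using S0 M by (simp add: f0_def ppow_def)
    then show ?thesis by simp
  qed
  have key: "bz (cz c) * ppow M y \<le> (B + eps) * (W0 x + S) ^ M - eps * ppow M (f0 x - S)"
  proof (cases "0 < cz c k")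
    case True
    have "bz (cz c) * ppow M y \<le> - eps * ppow M y"
      using bz_busy[of "cz c", OF True] by (intro mult_right_mono) auto
    also have "\<dots> \<le> - eps * ppow M (f0 x - S)"
      using eps lower by (simp add: mult_left_mono)
    moreover have "0 \<le> (B + eps) * (W0 x + S) ^ M"
      using B_nonneg eps W0_nonneg[OF ok(1)] S0 by simp
    ultimately show ?thesis by linarith
  next
    case False
    have "y \<le> (\<Sum>j\<in>{1..<k}. real (cz c j)) + \<mu> k * crs c k"
      unfolding y_def using cfg_ok_chain[OF ok] False s(3) by (intro flow_idle) (auto simp: c_def)
    \<comment> \<open>One \<open>Ucount\<close> covers the growth of the lower queues, the other a
      fresh service draw at \<open>k\<close>. This is the origin of the factor 2 in the hypothesis
      on \<open>S\<close>.\<close>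
    also have "\<dots> \<le> W0 x + 2 * Ucount p c"
      using queue_chain_bound[OF ok, of n] resid_chain_bound[OF ok, of n]
      unfolding W0_def c_def by linarith
    also have "\<dots> \<le> W0 x + S" using S B_nonneg by (simp add: c_def)
    finally have y: "max y 0 \<le> W0 x + S" using W0_nonneg[OF ok(1)] S0 by simp
    then have le: "ppow M y \<le> (W0 x + S) ^ M" unfolding ppow_def by (intro power_mono) auto
    have "bz (cz c) * ppow M y \<le> B * ppow M y"
      using abs_bz_le[of "cz c"] by (intro mult_right_mono) auto
    also have "\<dots> \<le> B * (W0 x + S) ^ M" using le B_nonneg by (rule mult_left_mono)
    moreover have "eps * ppow M (f0 x - S) \<le> eps * (W0 x + S) ^ M"
      using lower le eps by (intro mult_left_mono) auto
    ultimately show ?thesis by (simp add: distrib_right)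
  qed
  have "ppow (Suc M) y - ppow (Suc M) (FC c) \<le> (y - FC c) * (real (Suc M) * ppow M y)"
    by (rule ppow_tangent[OF M])
  also have "\<dots> = s * (real (Suc M) * (bz (cz c) * ppow M y))"
    by (simp add: y_def flow_eq)
  also have "\<dots> \<le> s * driftb x S"
    unfolding driftb_def using s(1) key by (intro mult_left_mono) auto
  finally show ?thesis by (simp add: y_def c_def)
qed

text \<open>First-order effect of a jump. The derivative is taken just before the event, so it is
  determined by the past and independent of the primitives that the jump reads.\<close>

definition mart :: "(nat \<times> nat \<times> nat \<Rightarrow> real) \<Rightarrow> gjn_cfg \<Rightarrow> real" where
  "mart p c = real (Suc M) * ppow M (pre c) * xi p c"

lemma abs_pre_le:
  assumes ok: "state_ok x" "prim_ok p" and t: "etime p x (Suc n) \<le> 1"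
    and S: "B + 2 * Ucount p (chain p x n) \<le> S"
  shows "max (pre (chain p x n)) 0 \<le> f0 x + S"
proof -
  have U0: "0 \<le> Ucount p (chain p x n)" using Ucount_chain_mono[OF ok(2), of 0 n x] by simp
  have "\<bar>pre (chain p x n) - FX x\<bar> \<le> S"
    unfolding pre_def using t S U0 delay_nonneg[OF cfg_ok_chain[OF ok]]
    by (intro flow_chain_bound[OF ok]) (auto simp: etime_Suc)
  then show ?thesis by (auto simp: f0_def)
qed

text \<open>Each step splits into a flow part, bounded by the drift, and a jump, expanded to second
  order. The squared jumps sum up because each is at most \<open>S\<close> times the increment of
  \<open>Ucount\<close>; before a jump the functional is at most \<open>f0 x + S\<close> and the
  jump is at most \<open>S\<close>, which gives the factor \<open>f0 x + 2 * S\<close>. Fixing the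
  last index \<open>N\<close> provides one \<open>S\<close> for all steps.\<close>

lemma path_bound_chain:
  assumes ok: "state_ok x" "prim_ok p" and S: "B + 2 * Ucount p (chain p x N) \<le> S"
    and t: "etime p x N \<le> 1"
  shows "n \<le> N \<Longrightarrow> ppow (Suc M) (FC (chain p x n)) \<le> ppow (Suc M) (FX x) + etime p x n * driftb x S
     + (\<Sum>m<n. mart p (chain p x m))
     + real (Suc M) * real M * (f0 x + 2 * S) ^ (M - 1) * S * Ucount p (chain p x n)"
proof (induction n)
  case 0
  show ?case by (simp add: FC_init)
next
  case (Suc n)
  define c where "c = chain p x n"
  define E where "E = real (Suc M) * real M * (f0 x + 2 * S) ^ (M - 1)"
  have U0: "0 \<le> Ucount p c" using Ucount_chain_mono[OF ok(2), of 0 n x] by (simp add: c_def)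
  have cnt: "1 \<le> cne c j" "1 \<le> cns c j" for j using counters_pos by (auto simp: c_def)
  have UN: "Ucount p c \<le> Ucount p (chain p x N)" "Ucount p (nstep p c) \<le> Ucount p (chain p x N)"
    using Ucount_chain_mono[OF ok(2), of n N x] Ucount_chain_mono[OF ok(2), of "Suc n" N x] Suc.prems
    by (simp_all add: c_def chain_Suc)
  have tn: "etime p x (Suc n) \<le> 1" using etime_mono[OF ok Suc.prems] t by simp
  have Sn: "B + 2 * Ucount p c \<le> S" using S UN by linarith
  have S0: "0 \<le> S" using Sn U0 B_nonneg by linarith
  have E0: "0 \<le> E" unfolding E_def using f0_nonneg[of x] S0 by simp
  have 1: "ppow (Suc M) (pre c) - ppow (Suc M) (FC c) \<le> delay c * driftb x S"
    unfolding pre_def c_def using tn Sn delay_nonneg[OF cfg_ok_chain[OF ok]]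
    by (intro drift_step[OF ok]) (auto simp: etime_Suc c_def)
  have xi: "\<bar>xi p c\<bar> \<le> Ucount p (nstep p c) - Ucount p c"
    using cnt by (intro abs_xi_le[OF ok(2)]) auto
  have xiS: "\<bar>xi p c\<bar> \<le> S" using xi UN U0 S B_nonneg by linarith
  obtain M' where M': "M = Suc M'" using M by (cases M) auto
  have "ppow (Suc M) (pre c + xi p c) - ppow (Suc M) (pre c) - mart p c
      \<le> real (Suc M) * real M * (max (pre c) 0 + \<bar>xi p c\<bar>) ^ (M - 1) * (xi p c)\<^sup>2"
    using ppow_jump[of M' "pre c" "xi p c"] unfolding mart_def by (simp only: M' diff_Suc_1)
  also have "\<dots> \<le> E * (xi p c)\<^sup>2"
    unfolding E_def using abs_pre_le[OF ok tn Sn[unfolded c_def]] xiS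
    by (intro mult_right_mono mult_left_mono power_mono) (auto simp: c_def)
  also have "\<dots> \<le> E * (S * (Ucount p (nstep p c) - Ucount p c))"
  proof (intro mult_left_mono E0)
    have "(xi p c)\<^sup>2 = \<bar>xi p c\<bar> * \<bar>xi p c\<bar>" by (simp add: power2_eq_square)
    also have "\<dots> \<le> S * (Ucount p (nstep p c) - Ucount p c)"
      using xi xiS S0 by (intro mult_mono) auto
    finally show "(xi p c)\<^sup>2 \<le> S * (Ucount p (nstep p c) - Ucount p c)" .
  qed
  finally have 2: "ppow (Suc M) (FC (nstep p c)) - ppow (Suc M) (pre c) - mart p c
      \<le> E * S * Ucount p (nstep p c) - E * S * Ucount p c"
    by (simp add: FC_nstep algebra_simps)
  have IH: "ppow (Suc M) (FC c) \<le> ppow (Suc M) (FX x) + ctime c * driftb x S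
     + (\<Sum>m<n. mart p (chain p x m)) + E * S * Ucount p c"
    using Suc by (simp add: c_def E_def)
  show ?case
    using 1 2 IH unfolding E_def[symmetric] chain_Suc c_def[symmetric] ctime_nstep distrib_right
    by (simp add: c_def[symmetric])
qed

lemma path_bound:
  assumes ok: "state_ok x" "prim_ok p" and N: "etime p x N \<le> 1" "1 < etime p x (Suc N)"
    and S: "B + 2 * Ucount p (chain p x N) \<le> S"
  shows "ppow (Suc M) (FX (netX p x 1)) \<le> ppow (Suc M) (FX x) + driftb x S
     + (\<Sum>m<N. mart p (chain p x m))
     + real (Suc M) * real M * (f0 x + 2 * S) ^ (M - 1) * S * Ucount p (chain p x N)"
proof -
  have "ppow (Suc M) (flow (chain p x N) (1 - etime p x N)) - ppow (Suc M) (FC (chain p x N))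
      \<le> (1 - etime p x N) * driftb x S"
    using N S by (intro drift_step[OF ok]) (auto simp: etime_Suc)
  then show ?thesis
    using path_bound_chain[OF ok S N(1), of N] netX_eq[OF ok N]
    by (simp add: FX_obs left_diff_distrib)
qed

end

subsection \<open>Measurability of the chain\<close>

abbreviation primM :: "(nat \<times> nat \<times> nat \<Rightarrow> real) measure" where
  "primM \<equiv> Pi\<^sub>M UNIV (\<lambda>_. borel)"

lemma measurable_gjn_space_component:
  assumes "j \<in> {1..J}"
  shows "(\<lambda>x. x j) \<in> gjn_space J \<rightarrow>\<^sub>M count_space UNIV \<Otimes>\<^sub>M (borel \<Otimes>\<^sub>M borel)"
  unfolding gjn_space_def using assms by (intro measurable_restrict_space1 measurable_component_singleton)

lemma measurable_gjn_space_parts: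
  assumes j: "j \<in> {1..J}" and X: "X \<in> N \<rightarrow>\<^sub>M gjn_space J"
  shows "(\<lambda>\<omega>. fst (X \<omega> j)) \<in> N \<rightarrow>\<^sub>M count_space UNIV"
    "(\<lambda>\<omega>. fst (snd (X \<omega> j))) \<in> borel_measurable N"
    "(\<lambda>\<omega>. snd (snd (X \<omega> j))) \<in> borel_measurable N"
proof -
  note * = measurable_compose[OF X measurable_gjn_space_component[OF j]]
  show "(\<lambda>\<omega>. fst (X \<omega> j)) \<in> N \<rightarrow>\<^sub>M count_space UNIV"
    by (rule measurable_compose[OF * measurable_fst])
  show "(\<lambda>\<omega>. fst (snd (X \<omega> j))) \<in> borel_measurable N"
    by (rule measurable_compose[OF measurable_compose[OF * measurable_snd] measurable_fst])
  show "(\<lambda>\<omega>. snd (snd (X \<omega> j))) \<in> borel_measurable N"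
    by (rule measurable_compose[OF measurable_compose[OF * measurable_snd] measurable_snd])
qed

context gjn_rates
begin

text \<open>Configurations are records of functions on all natural numbers, with irrelevant values
  outside the stations. Pulling the product structure back along the finitely many relevant
  coordinates makes exactly those coordinates measurable.\<close>

definition cfgM :: "gjn_cfg measure" where
  "cfgM = vimage_algebra UNIV
     (\<lambda>c. (\<lambda>j\<in>{1..J}. (cz c j, cre c j, crs c j, cne c j, cns c j, cnr c j), ctime c))
     (Pi\<^sub>M {1..J} (\<lambda>_. count_space UNIV \<Otimes>\<^sub>M borel \<Otimes>\<^sub>M borel \<Otimes>\<^sub>M count_space UNIV \<Otimes>\<^sub>M count_space UNIV \<Otimes>\<^sub>M count_space UNIV) \<Otimes>\<^sub>M borel)"

lemma measurable_cfgM: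
  assumes "\<And>j. j \<in> {1..J} \<Longrightarrow> (\<lambda>\<omega>. cz (f \<omega>) j) \<in> N \<rightarrow>\<^sub>M count_space UNIV"
    "\<And>j. j \<in> {1..J} \<Longrightarrow> (\<lambda>\<omega>. cre (f \<omega>) j) \<in> borel_measurable N"
    "\<And>j. j \<in> {1..J} \<Longrightarrow> (\<lambda>\<omega>. crs (f \<omega>) j) \<in> borel_measurable N"
    "\<And>j. j \<in> {1..J} \<Longrightarrow> (\<lambda>\<omega>. cne (f \<omega>) j) \<in> N \<rightarrow>\<^sub>M count_space UNIV"
    "\<And>j. j \<in> {1..J} \<Longrightarrow> (\<lambda>\<omega>. cns (f \<omega>) j) \<in> N \<rightarrow>\<^sub>M count_space UNIV"
    "\<And>j. j \<in> {1..J} \<Longrightarrow> (\<lambda>\<omega>. cnr (f \<omega>) j) \<in> N \<rightarrow>\<^sub>M count_space UNIV"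
    "(\<lambda>\<omega>. ctime (f \<omega>)) \<in> borel_measurable N"
  shows "f \<in> N \<rightarrow>\<^sub>M cfgM"
  unfolding cfgM_def using assms
  by (intro measurable_vimage_algebra2 measurable_Pair measurable_restrict) auto

lemma space_cfgM [simp]: "space cfgM = UNIV"
  by (simp add: cfgM_def)

lemma cfgM_embed: "(\<lambda>c. (\<lambda>j\<in>{1..J}. (cz c j, cre c j, crs c j, cne c j, cns c j, cnr c j), ctime c)) \<in>
    cfgM \<rightarrow>\<^sub>M (Pi\<^sub>M {1..J} (\<lambda>_. count_space UNIV \<Otimes>\<^sub>M borel \<Otimes>\<^sub>M borel \<Otimes>\<^sub>M count_space UNIV \<Otimes>\<^sub>M count_space UNIV \<Otimes>\<^sub>M count_space UNIV) \<Otimes>\<^sub>M borel)"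
  unfolding cfgM_def by (rule measurable_vimage_algebra1) (auto simp: space_pair_measure space_PiM)

lemma measurable_ctime [measurable]: "ctime \<in> borel_measurable cfgM"
  using measurable_compose[OF cfgM_embed measurable_snd] by simp

lemma measurable_cfg_parts:
  assumes j: "j \<in> {1..J}"
  shows "(\<lambda>c. cz c j) \<in> cfgM \<rightarrow>\<^sub>M count_space UNIV"
    "(\<lambda>c. cre c j) \<in> borel_measurable cfgM"
    "(\<lambda>c. crs c j) \<in> borel_measurable cfgM"
    "(\<lambda>c. cne c j) \<in> cfgM \<rightarrow>\<^sub>M count_space UNIV"
    "(\<lambda>c. cns c j) \<in> cfgM \<rightarrow>\<^sub>M count_space UNIV"
    "(\<lambda>c. cnr c j) \<in> cfgM \<rightarrow>\<^sub>M count_space UNIV"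
proof -
  have *: "(\<lambda>c. (cz c j, cre c j, crs c j, cne c j, cns c j, cnr c j)) \<in>
      cfgM \<rightarrow>\<^sub>M count_space UNIV \<Otimes>\<^sub>M borel \<Otimes>\<^sub>M borel \<Otimes>\<^sub>M count_space UNIV \<Otimes>\<^sub>M count_space UNIV \<Otimes>\<^sub>M count_space UNIV"
    using measurable_compose[OF measurable_compose[OF cfgM_embed measurable_fst] measurable_component_singleton[OF j]] j
    by simp
  note 1 = measurable_compose[OF * measurable_snd]
  note 2 = measurable_compose[OF 1 measurable_snd]
  note 3 = measurable_compose[OF 2 measurable_snd]
  note 4 = measurable_compose[OF 3 measurable_snd]
  show "(\<lambda>c. cz c j) \<in> cfgM \<rightarrow>\<^sub>M count_space UNIV" using measurable_compose[OF * measurable_fst] by simp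
  show "(\<lambda>c. cre c j) \<in> borel_measurable cfgM" using measurable_compose[OF 1 measurable_fst] by simp
  show "(\<lambda>c. crs c j) \<in> borel_measurable cfgM" using measurable_compose[OF 2 measurable_fst] by simp
  show "(\<lambda>c. cne c j) \<in> cfgM \<rightarrow>\<^sub>M count_space UNIV" using measurable_compose[OF 3 measurable_fst] by simp
  show "(\<lambda>c. cns c j) \<in> cfgM \<rightarrow>\<^sub>M count_space UNIV" using measurable_compose[OF 4 measurable_fst] by simp
  show "(\<lambda>c. cnr c j) \<in> cfgM \<rightarrow>\<^sub>M count_space UNIV" using measurable_compose[OF 4 measurable_snd] by simp
qed

lemma measurable_next_ext [measurable]: "Measurable.pred cfgM (\<lambda>c. next_ext c j)"
proof (cases "j \<in> {1..J}")
  case True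
  have [measurable]: "(\<lambda>c. cre c j) \<in> borel_measurable cfgM" by (rule measurable_cfg_parts[OF True])
  have "Measurable.pred cfgM (\<lambda>c. \<forall>i\<in>{1..J}. 0 < \<alpha> i \<longrightarrow> cre c j \<le> cre c i)"
  proof (intro pred_intros_finite)
    fix i assume "i \<in> {1..J}"
    note [measurable] = measurable_cfg_parts[OF this]
    show "Measurable.pred cfgM (\<lambda>c. 0 < \<alpha> i \<longrightarrow> cre c j \<le> cre c i)" by measurable
  qed simp
  moreover have "Measurable.pred cfgM (\<lambda>c. \<forall>i\<in>{1..J}. 0 < cz c i \<longrightarrow> cre c j \<le> crs c i)"
  proof (intro pred_intros_finite)
    fix i assume "i \<in> {1..J}"
    note [measurable] = measurable_cfg_parts[OF this]
    show "Measurable.pred cfgM (\<lambda>c. 0 < cz c i \<longrightarrow> cre c j \<le> crs c i)" by measurable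
  qed simp
  ultimately have *: "Measurable.pred cfgM (\<lambda>c. (\<forall>i\<in>{1..J}. 0 < \<alpha> i \<longrightarrow> cre c j \<le> cre c i) \<and>
      (\<forall>i\<in>{1..J}. 0 < cz c i \<longrightarrow> cre c j \<le> crs c i))"
    by (rule pred_intros_logic(3))
  show ?thesis
  proof (cases "0 < \<alpha> j")
    case pos: True
    from * show ?thesis unfolding next_ext_def by (simp only: pos True simp_thms)
  next
    case False
    then show ?thesis unfolding next_ext_def by (simp only: simp_thms) simp
  qed
next
  case False
  then show ?thesis unfolding next_ext_def by (simp only: simp_thms) simp
qed

lemma measurable_next_srv [measurable]: "Measurable.pred cfgM (\<lambda>c. next_srv c j)"
proof (cases "j \<in> {1..J}")
  case True
  have [measurable]: "(\<lambda>c. crs c j) \<in> borel_measurable cfgM" by (rule measurable_cfg_parts[OF True])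
  have "Measurable.pred cfgM (\<lambda>c. \<forall>i\<in>{1..J}. 0 < \<alpha> i \<longrightarrow> crs c j < cre c i)"
  proof (intro pred_intros_finite)
    fix i assume "i \<in> {1..J}"
    note [measurable] = measurable_cfg_parts[OF this]
    show "Measurable.pred cfgM (\<lambda>c. 0 < \<alpha> i \<longrightarrow> crs c j < cre c i)" by measurable
  qed simp
  moreover have "Measurable.pred cfgM (\<lambda>c. \<forall>i\<in>{1..J}. 0 < cz c i \<longrightarrow> crs c j \<le> crs c i)"
  proof (intro pred_intros_finite)
    fix i assume "i \<in> {1..J}"
    note [measurable] = measurable_cfg_parts[OF this]
    show "Measurable.pred cfgM (\<lambda>c. 0 < cz c i \<longrightarrow> crs c j \<le> crs c i)" by measurable
  qed simp
  moreover have "Measurable.pred cfgM (\<lambda>c. 0 < cz c j)"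
    by (rule measurable_compose[OF measurable_cfg_parts(1)[OF True]]) simp
  ultimately have "Measurable.pred cfgM (\<lambda>c. 0 < cz c j \<and> (\<forall>i\<in>{1..J}. 0 < \<alpha> i \<longrightarrow> crs c j < cre c i) \<and>
      (\<forall>i\<in>{1..J}. 0 < cz c i \<longrightarrow> crs c j \<le> crs c i))"
    by (intro pred_intros_logic(3))
  then show ?thesis unfolding next_srv_def by (simp only: True simp_thms)
next
  case False
  then show ?thesis unfolding next_srv_def by (simp only: simp_thms) simp
qed

lemma measurable_evt [measurable]: "evt \<in> cfgM \<rightarrow>\<^sub>M count_space UNIV"
  unfolding evt_def[abs_def] by measurable

lemma snd_evt: "snd (evt c) \<in> {1..J}"
  by (cases rule: evt_cases[of c]) (auto simp: next_ext_def next_srv_def)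

text \<open>The next event has countably many values, so a map may be checked for each fixed event.
  Only events at genuine stations can be checked, because coordinates outside are not measurable;
  the impossible events are patched by an arbitrary genuine one.\<close>

lemma measurable_evt_dispatch:
  assumes f: "\<And>e. snd e \<in> {1..J} \<Longrightarrow> f e \<in> N \<rightarrow>\<^sub>M L" and C: "C \<in> N \<rightarrow>\<^sub>M cfgM"
  shows "(\<lambda>\<omega>. f (evt (C \<omega>)) \<omega>) \<in> N \<rightarrow>\<^sub>M L"
proof -
  obtain j0 where j0: "j0 \<in> {1..J}" using \<alpha>_pos by auto
  define g where "g e = (if snd e \<in> {1..J} then f e else f (0, j0))" for e
  have "(\<lambda>\<omega>. g (evt (C \<omega>)) \<omega>) \<in> N \<rightarrow>\<^sub>M L"
  proof (rule measurable_compose_countable[where f = g])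
    show "(\<lambda>\<omega>. g e \<omega>) \<in> N \<rightarrow>\<^sub>M L" for e
      using f[of e] f[of "(0, j0)"] j0 by (cases "snd e \<in> {1..J}") (simp_all add: g_def)
    show "(\<lambda>\<omega>. evt (C \<omega>)) \<in> N \<rightarrow>\<^sub>M count_space UNIV"
      by (rule measurable_compose[OF C measurable_evt])
  qed
  also have "(\<lambda>\<omega>. g (evt (C \<omega>)) \<omega>) = (\<lambda>\<omega>. f (evt (C \<omega>)) \<omega>)"
    using snd_evt by (intro ext) (simp only: g_def if_True)
  finally show ?thesis .
qed

lemma measurable_delay [measurable]: "delay \<in> borel_measurable cfgM"
proof -
  have "(\<lambda>c. (\<lambda>e c. if fst e = 0 then cre c (snd e) else crs c (snd e)) (evt c) c) \<in> borel_measurable cfgM"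
  proof (rule measurable_evt_dispatch)
    fix e :: "nat \<times> nat" assume "snd e \<in> {1..J}"
    note [measurable] = measurable_cfg_parts[OF this]
    show "(\<lambda>c. if fst e = 0 then cre c (snd e) else crs c (snd e)) \<in> borel_measurable cfgM"
      by measurable
  qed simp
  then show ?thesis by (simp add: delay_def[abs_def])
qed

lemma measurable_prim: "P \<in> N \<rightarrow>\<^sub>M primM \<Longrightarrow> (\<lambda>\<omega>. P \<omega> q) \<in> borel_measurable N"
  by (rule measurable_compose[OF _ measurable_component_singleton]) auto

lemma measurable_prim_index:
  assumes "P \<in> N \<rightarrow>\<^sub>M primM" "g \<in> N \<rightarrow>\<^sub>M count_space UNIV"
  shows "(\<lambda>\<omega>. P \<omega> (e, j, g \<omega> :: nat)) \<in> borel_measurable N"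
  by (rule measurable_compose_countable[OF measurable_prim[OF assms(1)] assms(2)])

lemma measurable_upd:
  assumes P: "P \<in> N \<rightarrow>\<^sub>M primM" and C: "C \<in> N \<rightarrow>\<^sub>M cfgM" and e: "snd e \<in> {1..J}"
  shows "(\<lambda>\<omega>. upd e (P \<omega>) (C \<omega>)) \<in> N \<rightarrow>\<^sub>M cfgM"
proof -
  note parts = measurable_compose[OF C measurable_cfg_parts(1)] measurable_compose[OF C measurable_cfg_parts(2)]
    measurable_compose[OF C measurable_cfg_parts(3)] measurable_compose[OF C measurable_cfg_parts(4)]
    measurable_compose[OF C measurable_cfg_parts(5)] measurable_compose[OF C measurable_cfg_parts(6)]
  note [measurable] = measurable_compose[OF C measurable_delay] measurable_compose[OF C measurable_ctime]
  note ej [measurable] = parts[OF e]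
  note [measurable] = measurable_prim_index[OF P ej(4), of 0 "snd e"] measurable_prim_index[OF P ej(5), of 1 "snd e"]
    measurable_prim_index[OF P ej(6), of 2 "snd e"]
  have eqs: "cz (upd e p c) j = (if fst e = 0 then (if j = snd e then cz c j + 1 else cz c j)
        else cz c j - (if j = snd e then 1 else 0) + (if j = nat \<lfloor>p (2, snd e, cnr c (snd e))\<rfloor> then 1 else 0))"
    "cre (upd e p c) j = (if fst e = 0 \<and> j = snd e then p (0, snd e, cne c (snd e)) / \<alpha> j
        else if 0 < \<alpha> j then cre c j - delay c else cre c j)"
    "crs (upd e p c) j = (if fst e \<noteq> 0 \<and> j = snd e then p (1, snd e, cns c (snd e)) / \<mu> j
        else if 0 < cz c j then crs c j - delay c else crs c j)"
    "cne (upd e p c) j = (if fst e = 0 \<and> j = snd e then cne c j + 1 else cne c j)"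
    "cns (upd e p c) j = (if fst e \<noteq> 0 \<and> j = snd e then cns c j + 1 else cns c j)"
    "cnr (upd e p c) j = (if fst e \<noteq> 0 \<and> j = snd e then cnr c j + 1 else cnr c j)"
    "ctime (upd e p c) = ctime c + delay c"
    if "j \<in> {1..J}" for p c j
    using that by (auto simp: upd_def Let_def)
  show ?thesis
  proof (rule measurable_cfgM)
    fix j assume j: "j \<in> {1..J}"
    note [measurable] = parts[OF j]
    show "(\<lambda>\<omega>. cz (upd e (P \<omega>) (C \<omega>)) j) \<in> N \<rightarrow>\<^sub>M count_space UNIV"
      unfolding eqs[OF j] by measurable
    show "(\<lambda>\<omega>. cre (upd e (P \<omega>) (C \<omega>)) j) \<in> borel_measurable N"
      unfolding eqs[OF j] by measurable
    show "(\<lambda>\<omega>. crs (upd e (P \<omega>) (C \<omega>)) j) \<in> borel_measurable N"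
      unfolding eqs[OF j] by measurable
    show "(\<lambda>\<omega>. cne (upd e (P \<omega>) (C \<omega>)) j) \<in> N \<rightarrow>\<^sub>M count_space UNIV"
      unfolding eqs[OF j] by measurable
    show "(\<lambda>\<omega>. cns (upd e (P \<omega>) (C \<omega>)) j) \<in> N \<rightarrow>\<^sub>M count_space UNIV"
      unfolding eqs[OF j] by measurable
    show "(\<lambda>\<omega>. cnr (upd e (P \<omega>) (C \<omega>)) j) \<in> N \<rightarrow>\<^sub>M count_space UNIV"
      unfolding eqs[OF j] by measurable
  next
    show "(\<lambda>\<omega>. ctime (upd e (P \<omega>) (C \<omega>))) \<in> borel_measurable N"
      unfolding eqs(7)[OF e] by measurable
  qed
qed

lemma measurable_nstep:
  assumes P: "P \<in> N \<rightarrow>\<^sub>M primM" and C: "C \<in> N \<rightarrow>\<^sub>M cfgM"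
  shows "(\<lambda>\<omega>. nstep (P \<omega>) (C \<omega>)) \<in> N \<rightarrow>\<^sub>M cfgM"
  unfolding nstep_def
  by (rule measurable_evt_dispatch[where f = "\<lambda>e \<omega>. upd e (P \<omega>) (C \<omega>)"]) (rule measurable_upd[OF P C] C, assumption?)+

lemma measurable_chain:
  assumes P: "P \<in> N \<rightarrow>\<^sub>M primM" and X: "X \<in> N \<rightarrow>\<^sub>M gjn_space J"
  shows "(\<lambda>\<omega>. chain (P \<omega>) (X \<omega>) n) \<in> N \<rightarrow>\<^sub>M cfgM"
proof (induction n)
  case 0
  show ?case
    using measurable_gjn_space_parts[OF _ X] by (intro measurable_cfgM) (auto simp: gjn_init_def)
next
  case (Suc n)
  show ?case unfolding chain_Suc by (rule measurable_nstep[OF P Suc])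
qed

lemma state_ok_space: "x \<in> space (gjn_space J) \<Longrightarrow> state_ok x"
  by (auto simp: gjn_space_def space_restrict_space state_ok_def)

lemma obs_ok:
  assumes "cfg_ok c" "s \<le> delay c"
  shows "obs c s \<in> space (gjn_space J)"
proof -
  have "0 \<le> fst (snd (obs c s j)) \<and> 0 \<le> snd (snd (obs c s j))" if j: "j \<in> {1..J}" for j
  proof -
    have "0 \<le> cre c j" "0 \<le> crs c j" using assms(1) j by (auto simp: cfg_ok_def)
    moreover have "s \<le> cre c j" if "0 < \<alpha> j" using delay_le(1)[OF j that, of c] assms(2) by linarith
    moreover have "s \<le> crs c j" if "0 < cz c j" using delay_le(2)[OF j, of c] assms(2) that by linarith
    ultimately show ?thesis using j by (simp add: obs_def)
  qed
  then show ?thesis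
    unfolding gjn_space_def space_restrict_space space_PiM space_pair_measure by (simp add: obs_def)
qed

lemma netX_in_space:
  assumes "x \<in> space (gjn_space J)" "prim_ok p"
  shows "netX p x t \<in> space (gjn_space J)"
proof (cases "\<exists>n. etime p x n \<le> t \<and> t < etime p x (Suc n)")
  case True
  then obtain n where n: "etime p x n \<le> t" "t < etime p x (Suc n)" by blast
  note ok = state_ok_space[OF assms(1)] assms(2)
  show ?thesis
    unfolding netX_eq[OF ok n] using n by (intro obs_ok cfg_ok_chain[OF ok]) (simp add: etime_Suc)
next
  case False
  then show ?thesis using assms(1) unfolding netX_def by (simp only: if_False)
qed

lemma measurable_obs:
  assumes C: "C \<in> N \<rightarrow>\<^sub>M cfgM" and s: "s \<in> borel_measurable N"
  shows "(\<lambda>\<omega>. obs (C \<omega>) (s \<omega>)) \<in> N \<rightarrow>\<^sub>M Pi\<^sub>M {1..J} (\<lambda>_. count_space UNIV \<Otimes>\<^sub>M (borel \<Otimes>\<^sub>M borel))"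
  unfolding obs_def
proof (rule measurable_restrict)
  fix j assume j: "j \<in> {1..J}"
  note [measurable] = measurable_compose[OF C measurable_cfg_parts(1)[OF j]] measurable_compose[OF C measurable_cfg_parts(2)[OF j]]
    measurable_compose[OF C measurable_cfg_parts(3)[OF j]] s
  show "(\<lambda>\<omega>. (cz (C \<omega>) j, if 0 < \<alpha> j then cre (C \<omega>) j - s \<omega> else 0,
       if 0 < cz (C \<omega>) j then crs (C \<omega>) j - s \<omega> else crs (C \<omega>) j)) \<in> N \<rightarrow>\<^sub>M count_space UNIV \<Otimes>\<^sub>M (borel \<Otimes>\<^sub>M borel)"
    by measurable
qed

lemma measurable_netX:
  assumes P: "P \<in> N \<rightarrow>\<^sub>M primM" and X: "X \<in> N \<rightarrow>\<^sub>M gjn_space J"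
    and ok: "\<And>\<omega>. \<omega> \<in> space N \<Longrightarrow> prim_ok (P \<omega>)"
  shows "(\<lambda>\<omega>. netX (P \<omega>) (X \<omega>) t) \<in> N \<rightarrow>\<^sub>M gjn_space J"
proof -
  note ch = measurable_chain[OF P X]
  have [measurable]: "(\<lambda>\<omega>. etime (P \<omega>) (X \<omega>) n) \<in> borel_measurable N" for n
    by (rule measurable_compose[OF ch measurable_ctime])
  define L where "L = Pi\<^sub>M {1..J} (\<lambda>_. count_space (UNIV::nat set) \<Otimes>\<^sub>M (borel \<Otimes>\<^sub>M (borel::real measure)) :: (nat \<times> real \<times> real) measure)"
  have X': "X \<in> N \<rightarrow>\<^sub>M L"
    using X unfolding gjn_space_def L_def by (rule measurable_restrict_space2_iff[THEN iffD1, THEN conjunct1])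
  have "(\<lambda>\<omega>. (\<lambda>n \<omega>. obs (chain (P \<omega>) (X \<omega>) n) (t - etime (P \<omega>) (X \<omega>) n))
     (LEAST n. etime (P \<omega>) (X \<omega>) n \<le> t \<and> t < etime (P \<omega>) (X \<omega>) (Suc n)) \<omega>) \<in> N \<rightarrow>\<^sub>M L"
    unfolding L_def
    by (rule measurable_compose_countable[OF measurable_obs[OF ch]]; measurable)
  then have "(\<lambda>\<omega>. netX (P \<omega>) (X \<omega>) t) \<in> N \<rightarrow>\<^sub>M L"
    unfolding netX_def Let_def by (intro measurable_If X') (auto intro: X')
  moreover have "(\<lambda>\<omega>. netX (P \<omega>) (X \<omega>) t) \<in> space N \<rightarrow> {x. \<forall>j\<in>{1..J}. 0 \<le> fst (snd (x j)) \<and> 0 \<le> snd (snd (x j))}"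
  proof
    fix \<omega> assume w: "\<omega> \<in> space N"
    have "netX (P \<omega>) (X \<omega>) t \<in> space (gjn_space J)"
      using measurable_space[OF X w] ok[OF w] by (rule netX_in_space)
    from state_ok_space[OF this] show "netX (P \<omega>) (X \<omega>) t \<in> {x. \<forall>j\<in>{1..J}. 0 \<le> fst (snd (x j)) \<and> 0 \<le> snd (snd (x j))}"
      by (simp add: state_ok_def)
  qed
  ultimately show ?thesis
    unfolding gjn_space_def L_def[symmetric] by (intro measurable_restrict_space2)
qed

end

subsection \<open>Comparison under stationarity and renewal moments\<close>

text \<open>\<open>V\<close> need not be integrable: the drift condition passes to \<open>min V n\<close> with the loss
  \<open>min V n - min (V - f) n\<close>, which equals \<open>f\<close> as soon as \<open>n \<ge> V\<close>.\<close>

lemma stationary_comparison: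
  fixes V f g :: "'b \<Rightarrow> real"
  assumes \<pi>: "prob_space \<pi>" and \<Omega>: "prob_space \<Omega>"
    and X: "(\<lambda>(x, \<omega>). X x \<omega>) \<in> \<pi> \<Otimes>\<^sub>M \<Omega> \<rightarrow>\<^sub>M \<pi>"
    and inv: "\<And>h :: 'b \<Rightarrow> ennreal. h \<in> borel_measurable \<pi> \<Longrightarrow> (\<integral>\<^sup>+x. h x \<partial>\<pi>) = (\<integral>\<^sup>+x. (\<integral>\<^sup>+\<omega>. h (X x \<omega>) \<partial>\<Omega>) \<partial>\<pi>)"
    and meas [measurable]: "V \<in> borel_measurable \<pi>" "f \<in> borel_measurable \<pi>" "g \<in> borel_measurable \<pi>"
    and nn: "\<And>x. x \<in> space \<pi> \<Longrightarrow> 0 \<le> V x" "\<And>x. x \<in> space \<pi> \<Longrightarrow> 0 \<le> f x" "\<And>x. x \<in> space \<pi> \<Longrightarrow> 0 \<le> g x"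
    and drift: "\<And>x. x \<in> space \<pi> \<Longrightarrow> (\<integral>\<^sup>+\<omega>. ennreal (V (X x \<omega>)) \<partial>\<Omega>) + ennreal (f x) \<le> ennreal (V x + g x)"
  shows "(\<integral>\<^sup>+x. ennreal (f x) \<partial>\<pi>) \<le> (\<integral>\<^sup>+x. ennreal (g x) \<partial>\<pi>)"
proof -
  interpret \<pi>: prob_space \<pi> by fact
  interpret \<Omega>: prob_space \<Omega> by fact
  define \<phi> where "\<phi> n x = min (V x) (real n) - min (V x - f x) (real n)" for n x
  have [measurable]: "\<phi> n \<in> borel_measurable \<pi>" for n unfolding \<phi>_def by measurable
  have le: "(\<integral>\<^sup>+x. ennreal (\<phi> n x) \<partial>\<pi>) \<le> (\<integral>\<^sup>+x. ennreal (g x) \<partial>\<pi>)" for n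
  proof -
    define h where "h x = ennreal (min (V x) (real n))" for x
    have [measurable]: "h \<in> borel_measurable \<pi>" unfolding h_def by measurable
    have "(\<lambda>(x, \<omega>). h (X x \<omega>)) \<in> borel_measurable (\<pi> \<Otimes>\<^sub>M \<Omega>)"
      using measurable_compose[OF X \<open>h \<in> borel_measurable \<pi>\<close>] by (simp add: case_prod_beta)
    then have [measurable]: "(\<lambda>x. \<integral>\<^sup>+\<omega>. h (X x \<omega>) \<partial>\<Omega>) \<in> borel_measurable \<pi>"
      by (rule \<Omega>.borel_measurable_nn_integral)
    have pt: "(\<integral>\<^sup>+\<omega>. h (X x \<omega>) \<partial>\<Omega>) + ennreal (\<phi> n x) \<le> h x + ennreal (g x)" if x: "x \<in> space \<pi>" for x
    proof -
      note nnx = nn(1)[OF x] nn(2)[OF x] nn(3)[OF x]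
      have "(\<integral>\<^sup>+\<omega>. h (X x \<omega>) \<partial>\<Omega>) \<le> (\<integral>\<^sup>+\<omega>. ennreal (V (X x \<omega>)) \<partial>\<Omega>)"
        unfolding h_def by (intro nn_integral_mono ennreal_leI) simp
      then have 1: "(\<integral>\<^sup>+\<omega>. h (X x \<omega>) \<partial>\<Omega>) + ennreal (f x) \<le> ennreal (V x + g x)"
        using drift[OF x] by (meson add_right_mono order_trans)
      have "(\<integral>\<^sup>+\<omega>. h (X x \<omega>) \<partial>\<Omega>) \<le> (\<integral>\<^sup>+\<omega>. ennreal (real n) \<partial>\<Omega>)"
        unfolding h_def by (intro nn_integral_mono ennreal_leI) simp
      then have 2: "(\<integral>\<^sup>+\<omega>. h (X x \<omega>) \<partial>\<Omega>) \<le> ennreal (real n)"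
        by (simp add: \<Omega>.emeasure_space_1)
      then obtain a where a: "(\<integral>\<^sup>+\<omega>. h (X x \<omega>) \<partial>\<Omega>) = ennreal a" "0 \<le> a"
        by (cases "\<integral>\<^sup>+\<omega>. h (X x \<omega>) \<partial>\<Omega>") (auto simp: top_unique)
      have an: "a \<le> real n" using 2 a by simp
      have av: "a + f x \<le> V x + g x" using 1 a nnx by (simp add: ennreal_plus[symmetric] del: ennreal_plus)
      \<comment> \<open>Equivalent to \<open>a \<le> min (V x - f x) n + g x\<close>, which holds
        because \<open>a\<close> is below \<open>V x - f x + g x\<close> and below
        \<open>n\<close>.\<close>
      have "a + \<phi> n x \<le> min (V x) (real n) + g x" using an av nnx by (auto simp: \<phi>_def min_def)
      moreover have "0 \<le> \<phi> n x" using nnx by (auto simp: \<phi>_def min_def)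
      ultimately show ?thesis
        using a nnx unfolding a(1) h_def by (simp add: ennreal_plus[symmetric] del: ennreal_plus)
    qed
    have "(\<integral>\<^sup>+x. h x \<partial>\<pi>) + (\<integral>\<^sup>+x. ennreal (\<phi> n x) \<partial>\<pi>) = (\<integral>\<^sup>+x. (\<integral>\<^sup>+\<omega>. h (X x \<omega>) \<partial>\<Omega>) + ennreal (\<phi> n x) \<partial>\<pi>)"
      by (subst inv) (auto simp: nn_integral_add)
    also have "\<dots> \<le> (\<integral>\<^sup>+x. h x + ennreal (g x) \<partial>\<pi>)"
      by (intro nn_integral_mono pt)
    also have "\<dots> = (\<integral>\<^sup>+x. h x \<partial>\<pi>) + (\<integral>\<^sup>+x. ennreal (g x) \<partial>\<pi>)"
      by (intro nn_integral_add) auto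
    finally have "(\<integral>\<^sup>+x. h x \<partial>\<pi>) + (\<integral>\<^sup>+x. ennreal (\<phi> n x) \<partial>\<pi>) \<le> (\<integral>\<^sup>+x. h x \<partial>\<pi>) + (\<integral>\<^sup>+x. ennreal (g x) \<partial>\<pi>)" .
    moreover have "(\<integral>\<^sup>+x. h x \<partial>\<pi>) \<noteq> \<top>"
    proof -
      have "(\<integral>\<^sup>+x. h x \<partial>\<pi>) \<le> (\<integral>\<^sup>+x. ennreal (real n) \<partial>\<pi>)"
        unfolding h_def by (intro nn_integral_mono ennreal_leI) simp
      then show ?thesis by (auto simp: \<pi>.emeasure_space_1 top_unique)
    qed
    ultimately show ?thesis by (simp add: ennreal_add_left_cancel_le)
  qed
  have "(\<integral>\<^sup>+x. ennreal (f x) \<partial>\<pi>) = (\<integral>\<^sup>+x. liminf (\<lambda>n. ennreal (\<phi> n x)) \<partial>\<pi>)"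
  proof (rule nn_integral_cong)
    fix x assume x: "x \<in> space \<pi>"
    obtain N where N: "V x \<le> real N" using real_arch_simple by blast
    have "(\<lambda>n. ennreal (\<phi> n x)) \<longlonglongrightarrow> ennreal (f x)"
    proof (rule tendsto_eventually, rule eventually_sequentiallyI[of N])
      fix n assume "N \<le> n"
      then have "V x \<le> real n" using N by linarith
      then show "ennreal (\<phi> n x) = ennreal (f x)" using nn(2)[OF x] by (simp add: \<phi>_def min_def)
    qed
    then show "ennreal (f x) = liminf (\<lambda>n. ennreal (\<phi> n x))"
      by (simp add: lim_imp_Liminf)
  qed
  also have "\<dots> \<le> liminf (\<lambda>n. \<integral>\<^sup>+x. ennreal (\<phi> n x) \<partial>\<pi>)"
    by (rule nn_integral_liminf) simp
  also have "\<dots> \<le> (\<integral>\<^sup>+x. ennreal (g x) \<partial>\<pi>)"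
    by (rule Liminf_le) (auto simp: le)
  finally show ?thesis .
qed

text \<open>If the sum on the right is \<open>A\<close>, then \<open>a m \<le> q ^ m * root n A\<close> for every \<open>m\<close>.\<close>

lemma power_suminf_le:
  fixes a :: "nat \<Rightarrow> ennreal"
  assumes q: "0 < q" "q < 1" and n: "0 < n"
  shows "(\<Sum>m. a m) ^ n \<le> ennreal ((1 / (1 - q)) ^ n) * (\<Sum>m. ennreal ((1 / q) ^ (m * n)) * a m ^ n)"
proof (cases "(\<Sum>m. ennreal ((1 / q) ^ (m * n)) * a m ^ n) = \<top>")
  case True
  then show ?thesis using q by (simp add: ennreal_mult_top)
next
  case False
  define A where "A = enn2real (\<Sum>m. ennreal ((1 / q) ^ (m * n)) * a m ^ n)"
  have A: "(\<Sum>m. ennreal ((1 / q) ^ (m * n)) * a m ^ n) = ennreal A" "0 \<le> A"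
    using False by (auto simp: A_def ennreal_enn2real_if)
  have am: "a m \<le> ennreal (q ^ m * root n A)" for m
  proof -
    have "ennreal ((1 / q) ^ (m * n)) * a m ^ n \<le> (\<Sum>m. ennreal ((1 / q) ^ (m * n)) * a m ^ n)"
      using sum_le_suminf[of "\<lambda>m. ennreal ((1 / q) ^ (m * n)) * a m ^ n" "{m}"] by simp
    then have le: "ennreal ((1 / q) ^ (m * n)) * a m ^ n \<le> ennreal A" unfolding A(1) .
    have "a m \<noteq> \<top>"
    proof
      assume "a m = \<top>"
      then have "ennreal ((1 / q) ^ (m * n)) * a m ^ n = \<top>"
        using q n by (simp add: ennreal_mult_top power_eq_top_ennreal)
      with le show False by (simp add: top_unique)
    qed
    then obtain b where b: "a m = ennreal b" "0 \<le> b" by (cases "a m") auto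
    have "(1 / q) ^ (m * n) * b ^ n \<le> A"
      using le b q A(2) by (simp add: ennreal_power ennreal_mult[symmetric])
    then have "b ^ n \<le> (q ^ m) ^ n * A"
      using q by (simp add: power_divide field_simps power_mult)
    then have "root n (b ^ n) \<le> root n ((q ^ m) ^ n * A)" using n by simp
    then have "b \<le> q ^ m * root n A"
      using n b q by (simp add: real_root_mult real_root_power_cancel)
    then show ?thesis using b by (simp add: ennreal_leI)
  qed
  have "(\<Sum>m. a m) \<le> (\<Sum>m. ennreal (q ^ m * root n A))"
    by (rule suminf_le) (auto simp: am)
  also have "\<dots> = ennreal (\<Sum>m. q ^ m * root n A)"
    using q A(2) by (intro suminf_ennreal2 summable_mult2 summable_geometric) (auto intro!: mult_nonneg_nonneg simp: n)
  also have "(\<Sum>m. q ^ m * root n A) = 1 / (1 - q) * root n A"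
    using q by (subst suminf_mult2[symmetric]) (auto simp: suminf_geometric summable_geometric)
  finally have "(\<Sum>m. a m) ^ n \<le> ennreal (1 / (1 - q) * root n A) ^ n"
    by (intro power_mono) auto
  also have "\<dots> = ennreal ((1 / (1 - q) * root n A) ^ n)"
    using q A(2) n by (intro ennreal_power) auto
  also have "\<dots> = ennreal ((1 / (1 - q)) ^ n) * ennreal A"
    using q A(2) n by (simp add: power_divide ennreal_mult'[symmetric])
  finally show ?thesis unfolding A(1) .
qed

section \<open>Moments of renewal sums by exponential weights\<close>

context prob_space
begin

text \<open>Equality would force \<open>exp (- T) = 1\<close> almost surely, hence
  \<open>T = 0\<close> almost surely, against the mean 1. The resulting gap below 1 is the ratio of
  the geometric bound for renewal counts.\<close>

lemma exp_neg_mean_less_1: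
  assumes [measurable]: "T \<in> borel_measurable M" and nn: "\<And>\<omega>. \<omega> \<in> space M \<Longrightarrow> 0 \<le> T \<omega>"
    and mean: "(\<integral>\<^sup>+\<omega>. ennreal (T \<omega>) \<partial>M) = 1"
  shows "(\<integral>\<^sup>+\<omega>. ennreal (exp (- T \<omega>)) \<partial>M) < 1"
proof (rule ccontr)
  assume "\<not> ?thesis"
  have le1: "(\<integral>\<^sup>+\<omega>. ennreal (exp (- T \<omega>)) \<partial>M) \<le> 1"
  proof -
    have "(\<integral>\<^sup>+\<omega>. ennreal (exp (- T \<omega>)) \<partial>M) \<le> (\<integral>\<^sup>+\<omega>. 1 \<partial>M)"
      using nn by (intro nn_integral_mono) auto
    then show ?thesis by (simp add: emeasure_space_1)
  qed
  with \<open>\<not> ?thesis\<close> have eq: "(\<integral>\<^sup>+\<omega>. ennreal (exp (- T \<omega>)) \<partial>M) = 1" by simp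
  have "(\<integral>\<^sup>+\<omega>. ennreal (1 - exp (- T \<omega>)) \<partial>M) + (\<integral>\<^sup>+\<omega>. ennreal (exp (- T \<omega>)) \<partial>M)
      = (\<integral>\<^sup>+\<omega>. ennreal (1 - exp (- T \<omega>)) + ennreal (exp (- T \<omega>)) \<partial>M)"
    by (rule nn_integral_add[symmetric]) auto
  also have "\<dots> = (\<integral>\<^sup>+\<omega>. 1 \<partial>M)"
    using nn by (intro nn_integral_cong) (simp add: ennreal_plus[symmetric] del: ennreal_plus)
  also have "\<dots> = 1" by (simp add: emeasure_space_1)
  finally have "1 + (\<integral>\<^sup>+\<omega>. ennreal (1 - exp (- T \<omega>)) \<partial>M) = 1 + 0"
    unfolding eq by (simp add: add.commute)
  then have "(\<integral>\<^sup>+\<omega>. ennreal (1 - exp (- T \<omega>)) \<partial>M) = 0"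
    unfolding ennreal_add_left_cancel by simp
  then have "AE \<omega> in M. ennreal (1 - exp (- T \<omega>)) = 0" by (subst (asm) nn_integral_0_iff_AE) auto
  then have "AE \<omega> in M. ennreal (T \<omega>) = 0"
    using AE_space by eventually_elim (use nn in \<open>auto simp: ennreal_eq_0_iff\<close>)
  then have "(\<integral>\<^sup>+\<omega>. ennreal (T \<omega>) \<partial>M) = (\<integral>\<^sup>+\<omega>. 0 \<partial>M)" by (rule nn_integral_cong_AE)
  with mean show False by simp
qed

text \<open>Chernoff bound: the condition that the first \<open>m\<close> draws sum to at most
  \<kappa> is dominated by \<open>exp \<kappa>\<close> times the product of the weights
  \<open>exp (- T i)\<close>, and the overshooting draw is independent of it. So the
  \<open>n\<close>-th moment of the term \<open>m\<close> decays geometrically, and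
  \<open>power_suminf_le\<close> transfers this to the \<open>n\<close>-th power of the
  series.\<close>

lemma renewal_moment:
  fixes T :: "nat \<Rightarrow> 'a \<Rightarrow> real"
  assumes ind: "indep_vars (\<lambda>_. borel) T {1..}"
    and nn: "\<And>i \<omega>. 1 \<le> i \<Longrightarrow> \<omega> \<in> space M \<Longrightarrow> 0 \<le> T i \<omega>"
    and id: "\<And>i. 1 \<le> i \<Longrightarrow> distr M borel (T i) = distr M borel (T 1)"
    and mean: "(\<integral>\<^sup>+\<omega>. ennreal (T 1 \<omega>) \<partial>M) = 1"
    and mom: "(\<integral>\<^sup>+\<omega>. ennreal (T 1 \<omega> ^ n) \<partial>M) < \<infinity>" and n: "0 < n"
  shows "(\<integral>\<^sup>+\<omega>. (\<Sum>m. if (\<Sum>i\<in>{1..<Suc m}. T i \<omega>) \<le> \<kappa> then ennreal (1 + T (Suc m) \<omega>) else 0) ^ n \<partial>M) < \<infinity>"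
proof -
  have meas: "1 \<le> i \<Longrightarrow> T i \<in> borel_measurable M" for i
    using ind by (auto simp: indep_vars_def)
  have same: "(\<integral>\<^sup>+\<omega>. f (T i \<omega>) \<partial>M) = (\<integral>\<^sup>+\<omega>. f (T 1 \<omega>) \<partial>M)" if i: "1 \<le> i" and [measurable]: "f \<in> borel_measurable borel"
    for i and f :: "real \<Rightarrow> ennreal"
    using nn_integral_distr[OF meas[OF i], of f] nn_integral_distr[OF meas[of 1], of f] id[OF i] by simp
  define \<rho> where "\<rho> = enn2real (\<integral>\<^sup>+\<omega>. ennreal (exp (- T 1 \<omega>)) \<partial>M)"
  have lt: "(\<integral>\<^sup>+\<omega>. ennreal (exp (- T 1 \<omega>)) \<partial>M) < 1"
    using exp_neg_mean_less_1[OF meas[of 1] nn[of 1] mean] by simp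
  then have \<rho>: "(\<integral>\<^sup>+\<omega>. ennreal (exp (- T 1 \<omega>)) \<partial>M) = ennreal \<rho>" "0 \<le> \<rho>" "\<rho> < 1"
  proof -
    show 1: "(\<integral>\<^sup>+\<omega>. ennreal (exp (- T 1 \<omega>)) \<partial>M) = ennreal \<rho>"
      using lt by (auto simp: \<rho>_def ennreal_enn2real_if)
    show "0 \<le> \<rho>" by (simp add: \<rho>_def)
    then show "\<rho> < 1" using lt unfolding 1 by (simp add: ennreal_less_one_iff)
  qed
  define K where "K = (\<integral>\<^sup>+\<omega>. ennreal ((1 + T 1 \<omega>) ^ n) \<partial>M)"
  have K: "K < \<top>"
  proof -
    have "K \<le> (\<integral>\<^sup>+\<omega>. ennreal (2 ^ n) + ennreal (2 ^ n) * ennreal (T 1 \<omega> ^ n) \<partial>M)"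
      unfolding K_def
    proof (rule nn_integral_mono)
      fix \<omega> assume w: "\<omega> \<in> space M"
      have t: "0 \<le> T 1 \<omega>" using nn[of 1, OF _ w] by simp
      have "(1 + T 1 \<omega>) ^ n \<le> (2 * max 1 (T 1 \<omega>)) ^ n" using t by (intro power_mono) auto
      also have "\<dots> \<le> 2 ^ n * (1 + T 1 \<omega> ^ n)"
        unfolding power_mult_distrib using t by (intro mult_left_mono) (auto simp: max_def)
      finally have "ennreal ((1 + T 1 \<omega>) ^ n) \<le> ennreal (2 ^ n + 2 ^ n * T 1 \<omega> ^ n)"
        by (intro ennreal_leI) (simp add: distrib_left)
      also have "\<dots> = ennreal (2 ^ n) + ennreal (2 ^ n) * ennreal (T 1 \<omega> ^ n)"
        using t by (simp add: ennreal_plus ennreal_mult)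
      finally show "ennreal ((1 + T 1 \<omega>) ^ n) \<le> ennreal (2 ^ n) + ennreal (2 ^ n) * ennreal (T 1 \<omega> ^ n)" .
    qed
    also have "\<dots> = ennreal (2 ^ n) + ennreal (2 ^ n) * (\<integral>\<^sup>+\<omega>. ennreal (T 1 \<omega> ^ n) \<partial>M)"
      using meas[of 1] by (subst nn_integral_add) (auto simp: nn_integral_cmult emeasure_space_1)
    also have "\<dots> < \<top>" using mom by (simp add: ennreal_mult_eq_top_iff less_top[symmetric] ennreal_add_eq_top)
    finally show ?thesis .
  qed
  obtain q where q: "0 < q" "q < 1" "\<rho> < q ^ n"
  proof -
    \<comment> \<open>Any \<open>q < 1\<close> with \<rho> below \<open>q ^ n\<close> serves: the
      weights \<open>q ^ m\<close> must be summable while the ratio of \<rho> to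
      \<open>q ^ n\<close> stays below 1. Here \<open>q ^ n\<close> is the midpoint of \<rho> and
      1.\<close>
    define q where "q = root n ((1 + \<rho>) / 2)"
    have "0 < q" "q < 1" using \<rho> n by (auto simp: q_def)
    moreover have "q ^ n = (1 + \<rho>) / 2" using \<rho> n by (simp add: q_def)
    then have "\<rho> < q ^ n" using \<rho> by simp
    ultimately show ?thesis using that by blast
  qed
  define a where "a m \<omega> = (if (\<Sum>i\<in>{1..<Suc m}. T i \<omega>) \<le> \<kappa> then ennreal (1 + T (Suc m) \<omega>) else 0)" for m \<omega>
  have a_meas [measurable]: "a m \<in> borel_measurable M" for m
  proof -
    have [measurable]: "(\<lambda>\<omega>. \<Sum>i\<in>{1..<Suc m}. T i \<omega>) \<in> borel_measurable M"
      by (rule borel_measurable_sum) (rule meas, simp)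
    have [measurable]: "T (Suc m) \<in> borel_measurable M"
      by (rule meas) simp
    show ?thesis unfolding a_def by measurable
  qed
  have am: "(\<integral>\<^sup>+\<omega>. a m \<omega> ^ n \<partial>M) \<le> ennreal (exp \<kappa>) * (ennreal (\<rho> ^ m) * K)" for m
  proof -
    \<comment> \<open>Exponential weight on the first \<open>m\<close> draws and the moment on the
      overshooting draw \<open>Suc m\<close>, arranged as one product so that independence
      factorizes the expectation.\<close>
    define F where "F i t = (if i = Suc m then ennreal ((1 + t) ^ n) else ennreal (exp (- t)))" for i t
    have Fm [measurable]: "F i \<in> borel_measurable borel" for i unfolding F_def by measurable
    have "(\<integral>\<^sup>+\<omega>. a m \<omega> ^ n \<partial>M) \<le> (\<integral>\<^sup>+\<omega>. ennreal (exp \<kappa>) * (\<Prod>i\<in>{1..Suc m}. F i (T i \<omega>)) \<partial>M)"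
    proof (rule nn_integral_mono)
      fix \<omega> assume w: "\<omega> \<in> space M"
      have t: "0 \<le> T i \<omega>" if "1 \<le> i" for i using nn that w by blast
      have "(\<Prod>i\<in>{1..Suc m}. F i (T i \<omega>)) = (\<Prod>i\<in>{1..<Suc m}. F i (T i \<omega>)) * F (Suc m) (T (Suc m) \<omega>)"
        by (simp add: prod.nat_ivl_Suc' atLeastLessThanSuc_atLeastAtMost mult.commute)
      also have "(\<Prod>i\<in>{1..<Suc m}. F i (T i \<omega>)) = (\<Prod>i\<in>{1..<Suc m}. ennreal (exp (- T i \<omega>)))"
        by (intro prod.cong) (auto simp: F_def)
      also have "\<dots> = ennreal (\<Prod>i\<in>{1..<Suc m}. exp (- T i \<omega>))"
        by (rule prod_ennreal) simp
      also have "(\<Prod>i\<in>{1..<Suc m}. exp (- T i \<omega>)) = exp (- (\<Sum>i\<in>{1..<Suc m}. T i \<omega>))"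
        unfolding sum_negf[symmetric] by (rule exp_sum[symmetric]) simp
      finally have prod: "(\<Prod>i\<in>{1..Suc m}. F i (T i \<omega>)) =
          ennreal (exp (- (\<Sum>i\<in>{1..<Suc m}. T i \<omega>))) * ennreal ((1 + T (Suc m) \<omega>) ^ n)"
        by (simp add: F_def)
      show "a m \<omega> ^ n \<le> ennreal (exp \<kappa>) * (\<Prod>i\<in>{1..Suc m}. F i (T i \<omega>))"
      proof (cases "(\<Sum>i\<in>{1..<Suc m}. T i \<omega>) \<le> \<kappa>")
        case True
        have "1 \<le> exp \<kappa> * exp (- (\<Sum>i\<in>{1..<Suc m}. T i \<omega>))"
          using True unfolding exp_add[symmetric] by simp
        then have "1 * (1 + T (Suc m) \<omega>) ^ n \<le> (exp \<kappa> * exp (- (\<Sum>i\<in>{1..<Suc m}. T i \<omega>))) * (1 + T (Suc m) \<omega>) ^ n"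
          using t[of "Suc m"] by (intro mult_right_mono) auto
        then have "ennreal ((1 + T (Suc m) \<omega>) ^ n) \<le> ennreal (exp \<kappa> * exp (- (\<Sum>i\<in>{1..<Suc m}. T i \<omega>)) * (1 + T (Suc m) \<omega>) ^ n)"
          by (intro ennreal_leI) simp
        also have "\<dots> = ennreal (exp \<kappa>) * (\<Prod>i\<in>{1..Suc m}. F i (T i \<omega>))"
          unfolding prod using t[of "Suc m"] by (simp add: ennreal_mult mult.assoc)
        moreover have "a m \<omega> ^ n = ennreal ((1 + T (Suc m) \<omega>) ^ n)"
          unfolding a_def if_P[OF True] by (rule ennreal_power) (use t[of "Suc m"] in simp)
        ultimately show ?thesis by (simp only:)
      next
        case False
        then have "a m \<omega> = 0" unfolding a_def by (rule if_not_P)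
        then have "a m \<omega> ^ n = 0" using n by simp
        then show ?thesis by (simp only: zero_le)
      qed
    qed
    also have "\<dots> = ennreal (exp \<kappa>) * (\<integral>\<^sup>+\<omega>. (\<Prod>i\<in>{1..Suc m}. F i (T i \<omega>)) \<partial>M)"
      by (intro nn_integral_cmult borel_measurable_prod_ennreal measurable_compose[OF meas Fm]) simp
    also have "(\<integral>\<^sup>+\<omega>. (\<Prod>i\<in>{1..Suc m}. F i (T i \<omega>)) \<partial>M) = (\<Prod>i\<in>{1..Suc m}. \<integral>\<^sup>+\<omega>. F i (T i \<omega>) \<partial>M)"
    proof (rule indep_vars_nn_integral)
      show "indep_vars (\<lambda>_. borel) (\<lambda>i \<omega>. F i (T i \<omega>)) {1..Suc m}"
        by (rule indep_vars_compose2[OF indep_vars_subset[OF ind]]) auto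
    qed auto
    also have "\<dots> = (\<Prod>i\<in>{1..<Suc m}. \<integral>\<^sup>+\<omega>. F i (T i \<omega>) \<partial>M) * (\<integral>\<^sup>+\<omega>. F (Suc m) (T (Suc m) \<omega>) \<partial>M)"
      by (simp add: prod.nat_ivl_Suc' atLeastLessThanSuc_atLeastAtMost mult.commute)
    also have "(\<Prod>i\<in>{1..<Suc m}. \<integral>\<^sup>+\<omega>. F i (T i \<omega>) \<partial>M) = (\<Prod>i\<in>{1..<Suc m}. ennreal \<rho>)"
    proof (rule prod.cong[OF refl])
      fix i assume "i \<in> {1..<Suc m}"
      then show "(\<integral>\<^sup>+\<omega>. F i (T i \<omega>) \<partial>M) = ennreal \<rho>"
        using same[of i "F i", OF _ Fm] by (simp add: F_def \<rho>(1)[simplified])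
    qed
    also have "\<dots> = ennreal (\<rho> ^ m)" using \<rho> by (simp add: ennreal_power)
    also have "(\<integral>\<^sup>+\<omega>. F (Suc m) (T (Suc m) \<omega>) \<partial>M) = K"
      using same[of "Suc m" "F (Suc m)", OF _ Fm] by (simp add: F_def K_def)
    finally show ?thesis .
  qed
  have 1: "(\<integral>\<^sup>+\<omega>. (\<Sum>m. a m \<omega>) ^ n \<partial>M) \<le> (\<integral>\<^sup>+\<omega>. ennreal ((1 / (1 - q)) ^ n) * (\<Sum>m. ennreal ((1 / q) ^ (m * n)) * a m \<omega> ^ n) \<partial>M)"
    by (intro nn_integral_mono power_suminf_le q n)
  have 2: "\<dots> = ennreal ((1 / (1 - q)) ^ n) * (\<integral>\<^sup>+\<omega>. (\<Sum>m. ennreal ((1 / q) ^ (m * n)) * a m \<omega> ^ n) \<partial>M)"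
    by (rule nn_integral_cmult) measurable
  have "(\<integral>\<^sup>+\<omega>. (\<Sum>m. ennreal ((1 / q) ^ (m * n)) * a m \<omega> ^ n) \<partial>M) = (\<Sum>m. \<integral>\<^sup>+\<omega>. ennreal ((1 / q) ^ (m * n)) * a m \<omega> ^ n \<partial>M)"
    by (rule nn_integral_suminf) measurable
  also have "\<dots> \<le> (\<Sum>m. ennreal ((\<rho> / q ^ n) ^ m) * (ennreal (exp \<kappa>) * K))"
  proof (rule suminf_le)
    fix m
    have "(\<integral>\<^sup>+\<omega>. ennreal ((1 / q) ^ (m * n)) * a m \<omega> ^ n \<partial>M) = ennreal ((1 / q) ^ (m * n)) * (\<integral>\<^sup>+\<omega>. a m \<omega> ^ n \<partial>M)"
      by (rule nn_integral_cmult) measurable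
    also have "\<dots> \<le> ennreal ((1 / q) ^ (m * n)) * (ennreal (exp \<kappa>) * (ennreal (\<rho> ^ m) * K))"
      by (intro mult_left_mono am) simp
    also have "\<dots> = (ennreal ((1 / q) ^ (m * n)) * ennreal (\<rho> ^ m)) * (ennreal (exp \<kappa>) * K)"
      by (simp only: mult_ac)
    also have "ennreal ((1 / q) ^ (m * n)) * ennreal (\<rho> ^ m) = ennreal ((\<rho> / q ^ n) ^ m)"
      using q \<rho> by (simp add: ennreal_mult[symmetric] power_divide power_mult[symmetric] mult.commute)
    finally show "(\<integral>\<^sup>+\<omega>. ennreal ((1 / q) ^ (m * n)) * a m \<omega> ^ n \<partial>M) \<le> ennreal ((\<rho> / q ^ n) ^ m) * (ennreal (exp \<kappa>) * K)" .
  qed auto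
  also have "\<dots> = (\<Sum>m. ennreal ((\<rho> / q ^ n) ^ m)) * (ennreal (exp \<kappa>) * K)"
    by (rule ennreal_suminf_multc)
  also have "(\<Sum>m. ennreal ((\<rho> / q ^ n) ^ m)) = ennreal (\<Sum>m. (\<rho> / q ^ n) ^ m)"
    using q \<rho> by (intro suminf_ennreal2 summable_geometric) auto
  also have "ennreal (\<Sum>m. (\<rho> / q ^ n) ^ m) * (ennreal (exp \<kappa>) * K) < \<top>"
    using K by (simp add: ennreal_mult_less_top)
  finally have "(\<integral>\<^sup>+\<omega>. (\<Sum>m. a m \<omega>) ^ n \<partial>M) < \<top>"
    using 1 unfolding 2 by (elim order.strict_trans1) (simp add: ennreal_mult_less_top)
  then show ?thesis unfolding a_def infinity_ennreal_def .
qed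

end

subsection \<open>The network on the probability space of its primitives\<close>

text \<open>The draw \<open>Suc m\<close> is counted when it begins at or below level \<kappa>, so
  the one that overshoots is included. A contribution \<open>1 + t\<close> per draw bounds at once
  the number of draws, their total and each single one.\<close>

definition renewal_sum :: "(nat \<Rightarrow> real) \<Rightarrow> real \<Rightarrow> ennreal" where
  "renewal_sum t \<kappa> = (\<Sum>m. if (\<Sum>i\<in>{1..<Suc m}. t i) \<le> \<kappa> then ennreal (1 + t (Suc m)) else 0)"

definition event_total :: "nat \<Rightarrow> nat \<Rightarrow> (nat \<Rightarrow> real) \<Rightarrow> (nat \<Rightarrow> real) \<Rightarrow> (nat \<times> nat \<times> nat \<Rightarrow> real) \<Rightarrow> ennreal" where
  "event_total J k \<kappa>e \<kappa>s p = (\<Sum>j\<in>{1..k}. renewal_sum (\<lambda>i. p (0, j, i)) (\<kappa>e j)) +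
     (\<Sum>j\<in>{1..J}. renewal_sum (\<lambda>i. p (1, j, i)) (\<kappa>s j))"

definition prim_index :: "nat \<Rightarrow> (nat \<times> nat \<times> nat) set" where
  "prim_index J = {(c, j, i). c \<le> 2 \<and> j \<in> {1..J} \<and> 1 \<le> i}"

text \<open>Destinations are cast to reals so that all primitives form one real-valued independent
  family; \<open>nat \<lfloor>_\<rfloor>\<close> in the dynamics decodes them.\<close>

definition prim_var :: "(nat \<Rightarrow> nat \<Rightarrow> 'a \<Rightarrow> real) \<Rightarrow> (nat \<Rightarrow> nat \<Rightarrow> 'a \<Rightarrow> real) \<Rightarrow> (nat \<Rightarrow> nat \<Rightarrow> 'a \<Rightarrow> nat) \<Rightarrow>
    nat \<times> nat \<times> nat \<Rightarrow> 'a \<Rightarrow> real" where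
  "prim_var Te Ts rt = (\<lambda>(c, j, i). if c = (0::nat) then Te j i else if c = 1 then Ts j i else (\<lambda>\<omega>. real (rt j i \<omega>)))"

definition prims :: "nat \<Rightarrow> (nat \<Rightarrow> nat \<Rightarrow> 'a \<Rightarrow> real) \<Rightarrow> (nat \<Rightarrow> nat \<Rightarrow> 'a \<Rightarrow> real) \<Rightarrow> (nat \<Rightarrow> nat \<Rightarrow> 'a \<Rightarrow> nat) \<Rightarrow>
    'a \<Rightarrow> nat \<times> nat \<times> nat \<Rightarrow> real" where
  "prims J Te Ts rt \<omega> q = (if q \<in> prim_index J then prim_var Te Ts rt q \<omega> else 0)"

lemma prims_simps:
  assumes "j \<in> {1..J}" "1 \<le> i"
  shows "prims J Te Ts rt \<omega> (0, j, i) = Te j i \<omega>" "prims J Te Ts rt \<omega> (1, j, i) = Ts j i \<omega>"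
    "prims J Te Ts rt \<omega> (Suc 0, j, i) = Ts j i \<omega>"
    "prims J Te Ts rt \<omega> (2, j, i) = real (rt j i \<omega>)"
  using assms by (simp_all add: prims_def prim_index_def prim_var_def)

lemma borel_measurable_renewal_sum:
  assumes "\<And>i. 1 \<le> i \<Longrightarrow> t i \<in> borel_measurable N"
  shows "(\<lambda>\<omega>. renewal_sum (\<lambda>i. t i \<omega>) \<kappa>) \<in> borel_measurable N"
  unfolding renewal_sum_def
proof (rule borel_measurable_suminf_order)
  fix m
  have [measurable]: "(\<lambda>\<omega>. \<Sum>i\<in>{1..<Suc m}. t i \<omega>) \<in> borel_measurable N"
    by (rule borel_measurable_sum[where f = t and S = "{1..<Suc m}"]) (simp add: assms)
  have [measurable]: "t (Suc m) \<in> borel_measurable N"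
    by (simp add: assms)
  show "(\<lambda>\<omega>. if (\<Sum>i\<in>{1..<Suc m}. t i \<omega>) \<le> \<kappa> then ennreal (1 + t (Suc m) \<omega>) else 0) \<in> borel_measurable N"
    by measurable
qed

text \<open>With \<open>n\<close> as the next index to be read, \<open>n - 1\<close> is the last
  draw read, and the hypothesis says that it begins at or below \<kappa>. All earlier draws begin no
  later.\<close>

lemma sum_le_renewal_sum:
  assumes nn: "\<And>i. 1 \<le> i \<Longrightarrow> 0 \<le> t i" and le: "2 \<le> n \<Longrightarrow> (\<Sum>i\<in>{1..<n - 1}. t i) \<le> \<kappa>"
  shows "ennreal (\<Sum>m\<in>{1..<n}. 1 + t m) \<le> renewal_sum t \<kappa>"
proof -
  have "ennreal (\<Sum>m\<in>{1..<n}. 1 + t m) = (\<Sum>m\<in>{1..<n}. ennreal (1 + t m))"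
    by (rule sum_ennreal[symmetric]) (use nn in force)
  also have "\<dots> = (\<Sum>m\<in>{..<n - 1}. ennreal (1 + t (Suc m)))"
    by (rule sum.reindex_bij_witness[of _ Suc "\<lambda>m. m - 1"]) auto
  also have "\<dots> = (\<Sum>m\<in>{..<n - 1}. if (\<Sum>i\<in>{1..<Suc m}. t i) \<le> \<kappa> then ennreal (1 + t (Suc m)) else 0)"
  proof (rule sum.cong[OF refl])
    fix m assume m: "m \<in> {..<n - 1}"
    have "(\<Sum>i\<in>{1..<Suc m}. t i) \<le> (\<Sum>i\<in>{1..<n - 1}. t i)"
      using m nn by (intro sum_mono2) auto
    also have "\<dots> \<le> \<kappa>" using m by (intro le) auto
    finally show "ennreal (1 + t (Suc m)) = (if (\<Sum>i\<in>{1..<Suc m}. t i) \<le> \<kappa> then ennreal (1 + t (Suc m)) else 0)"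
      by (simp only: if_True)
  qed
  also have "\<dots> \<le> renewal_sum t \<kappa>"
    unfolding renewal_sum_def by (rule sum_le_suminf) auto
  finally show ?thesis .
qed

text \<open>If the partial sums never passed \<kappa>, every term of the series would be at least
  1.\<close>

lemma renewal_sum_finite_imp_unbounded:
  assumes "renewal_sum t \<kappa> < \<top>" and nn: "\<And>i. 1 \<le> i \<Longrightarrow> 0 \<le> t i"
  shows "\<exists>m. \<kappa> < (\<Sum>i\<in>{1..<m}. t i)"
proof (rule ccontr)
  assume "\<not> ?thesis"
  then have le: "(\<Sum>i\<in>{1..<m}. t i) \<le> \<kappa>" for m by (simp add: not_less)
  have "ennreal (real n) \<le> renewal_sum t \<kappa>" for n
  proof -
    have "real n = (\<Sum>m\<in>{1..<Suc n}. 1)" by simp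
    also have "\<dots> \<le> (\<Sum>m\<in>{1..<Suc n}. 1 + t m)" using nn by (intro sum_mono) auto
    finally have "ennreal (real n) \<le> ennreal (\<Sum>m\<in>{1..<Suc n}. 1 + t m)" by (rule ennreal_leI)
    also have "\<dots> \<le> renewal_sum t \<kappa>" by (rule sum_le_renewal_sum[OF nn le])
    finally show ?thesis .
  qed
  then have "renewal_sum t \<kappa> = \<top>"
    by (metis ennreal_of_nat_eq_real_of_nat ennreal_Ex_less_of_nat less_top not_less)
  with assms show False by simp
qed

lemma (in prob_space) indep_vars_reindex:
  assumes ind: "indep_vars M' X I" and f: "inj_on f L" "f ` L \<subseteq> I"
  shows "indep_vars (\<lambda>l. M' (f l)) (\<lambda>l. X (f l)) L"
proof -
  have "indep_vars (\<lambda>l. Pi\<^sub>M {f l} M') (\<lambda>l \<omega>. restrict (\<lambda>i. X i \<omega>) {f l}) L"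
    using f by (intro indep_vars_restrict[OF ind]) (auto simp: disjoint_family_on_def inj_on_def)
  then have "indep_vars (\<lambda>l. M' (f l)) (\<lambda>l \<omega>. (\<lambda>z. z (f l)) (restrict (\<lambda>i. X i \<omega>) {f l})) L"
    by (rule indep_vars_compose2) (rule measurable_component_singleton, simp)
  then show ?thesis by simp
qed

section \<open>Divergence, stationarity and independence for the random primitives\<close>

locale gjn_net = gjn_rates J \<alpha> \<mu> + prob_space \<Omega>
  for J :: nat and \<alpha> \<mu> :: "nat \<Rightarrow> real" and \<Omega> :: "'a measure" +
  fixes Te Ts :: "nat \<Rightarrow> nat \<Rightarrow> 'a \<Rightarrow> real" and rt :: "nat \<Rightarrow> nat \<Rightarrow> 'a \<Rightarrow> nat"
  assumes Te_nonneg: "\<And>j i \<omega>. j \<in> {1..J} \<Longrightarrow> 1 \<le> i \<Longrightarrow> \<omega> \<in> space \<Omega> \<Longrightarrow> 0 \<le> Te j i \<omega>"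
    and Ts_nonneg: "\<And>j i \<omega>. j \<in> {1..J} \<Longrightarrow> 1 \<le> i \<Longrightarrow> \<omega> \<in> space \<Omega> \<Longrightarrow> 0 \<le> Ts j i \<omega>"
    and Te_id: "\<And>j i. j \<in> {1..J} \<Longrightarrow> 1 \<le> i \<Longrightarrow> distr \<Omega> borel (Te j i) = distr \<Omega> borel (Te j 1)"
    and Ts_id: "\<And>j i. j \<in> {1..J} \<Longrightarrow> 1 \<le> i \<Longrightarrow> distr \<Omega> borel (Ts j i) = distr \<Omega> borel (Ts j 1)"
    and rt_id: "\<And>j i. j \<in> {1..J} \<Longrightarrow> 1 \<le> i \<Longrightarrow>
                  distr \<Omega> (count_space UNIV) (rt j i) = distr \<Omega> (count_space UNIV) (rt j 1)"
    and rt_meas: "\<And>j i. j \<in> {1..J} \<Longrightarrow> 1 \<le> i \<Longrightarrow> rt j i \<in> measurable \<Omega> (count_space UNIV)"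
    and indep: "indep_vars (\<lambda>_. borel) (prim_var Te Ts rt) (prim_index J)"
    and Te_mean: "\<And>j. j \<in> {1..J} \<Longrightarrow> (\<integral>\<^sup>+ \<omega>. ennreal (Te j 1 \<omega>) \<partial>\<Omega>) = 1"
    and Ts_mean: "\<And>j. j \<in> {1..J} \<Longrightarrow> (\<integral>\<^sup>+ \<omega>. ennreal (Ts j 1 \<omega>) \<partial>\<Omega>) = 1"
begin

abbreviation Y :: "'a \<Rightarrow> nat \<times> nat \<times> nat \<Rightarrow> real" where
  "Y \<equiv> prims J Te Ts rt"

lemma prim_var_meas: "q \<in> prim_index J \<Longrightarrow> prim_var Te Ts rt q \<in> borel_measurable \<Omega>"
  using indep by (auto simp: indep_vars_def)

lemma Te_meas: "j \<in> {1..J} \<Longrightarrow> 1 \<le> i \<Longrightarrow> Te j i \<in> borel_measurable \<Omega>"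
  using prim_var_meas[of "(0, j, i)"] by (simp add: prim_index_def prim_var_def)

lemma Ts_meas: "j \<in> {1..J} \<Longrightarrow> 1 \<le> i \<Longrightarrow> Ts j i \<in> borel_measurable \<Omega>"
  using prim_var_meas[of "(1, j, i)"] by (simp add: prim_index_def prim_var_def)

lemma Y_meas: "Y \<in> \<Omega> \<rightarrow>\<^sub>M primM"
proof (rule measurable_PiM_single')
  fix q :: "nat \<times> nat \<times> nat"
  show "(\<lambda>\<omega>. Y \<omega> q) \<in> borel_measurable \<Omega>"
    using prim_var_meas[of q] by (cases "q \<in> prim_index J") (simp_all add: prims_def)
qed (auto simp: space_PiM)

lemma Y_q_meas: "(\<lambda>\<omega>. Y \<omega> q) \<in> borel_measurable \<Omega>"
  by (rule measurable_prim[OF Y_meas])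

lemma Y_ok: "\<omega> \<in> space \<Omega> \<Longrightarrow> prim_ok (Y \<omega>)"
  using Te_nonneg Ts_nonneg by (auto simp: prim_ok_def prims_simps)

lemma indep_Te: "j \<in> {1..J} \<Longrightarrow> indep_vars (\<lambda>_. borel) (Te j) {1..}"
proof -
  assume j: "j \<in> {1..J}"
  have "indep_vars (\<lambda>_. borel) (\<lambda>i. prim_var Te Ts rt (0, j, i)) {1..}"
    using j by (intro indep_vars_reindex[OF indep, of "\<lambda>i. (0, j, i)"]) (auto simp: inj_on_def prim_index_def)
  then show ?thesis by (simp add: prim_var_def)
qed

lemma indep_Ts: "j \<in> {1..J} \<Longrightarrow> indep_vars (\<lambda>_. borel) (Ts j) {1..}"
proof -
  assume j: "j \<in> {1..J}"
  have "indep_vars (\<lambda>_. borel) (\<lambda>i. prim_var Te Ts rt (1, j, i)) {1..}"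
    using j by (intro indep_vars_reindex[OF indep, of "\<lambda>i. (1, j, i)"]) (auto simp: inj_on_def prim_index_def)
  then show ?thesis by (simp add: prim_var_def)
qed

lemma AE_renewal_finite:
  fixes T :: "nat \<Rightarrow> 'a \<Rightarrow> real"
  assumes "indep_vars (\<lambda>_. borel) T {1..}"
    and "\<And>i \<omega>. 1 \<le> i \<Longrightarrow> \<omega> \<in> space \<Omega> \<Longrightarrow> 0 \<le> T i \<omega>"
    and "\<And>i. 1 \<le> i \<Longrightarrow> distr \<Omega> borel (T i) = distr \<Omega> borel (T 1)"
    and mean: "(\<integral>\<^sup>+\<omega>. ennreal (T 1 \<omega>) \<partial>\<Omega>) = 1"
  shows "AE \<omega> in \<Omega>. renewal_sum (\<lambda>i. T i \<omega>) \<kappa> < \<top>"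
proof -
  have meas: "1 \<le> i \<Longrightarrow> T i \<in> borel_measurable \<Omega>" for i
    using assms(1) by (auto simp: indep_vars_def)
  have "(\<integral>\<^sup>+\<omega>. renewal_sum (\<lambda>i. T i \<omega>) \<kappa> ^ 1 \<partial>\<Omega>) < \<infinity>"
    unfolding renewal_sum_def by (rule renewal_moment[OF assms]) (simp_all add: mean[simplified])
  then have "(\<integral>\<^sup>+\<omega>. renewal_sum (\<lambda>i. T i \<omega>) \<kappa> \<partial>\<Omega>) \<noteq> \<infinity>" by simp
  with borel_measurable_renewal_sum[of T \<Omega> \<kappa>, OF meas]
  have "AE \<omega> in \<Omega>. renewal_sum (\<lambda>i. T i \<omega>) \<kappa> \<noteq> \<infinity>"
    by (rule nn_integral_PInf_AE)
  then show ?thesis by eventually_elim (simp add: less_top)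
qed

text \<open>The renewal moment bound with exponent 1, which rests on the unit mean alone, makes
  every renewal sum almost surely finite, and finiteness forces the partial sums past every natural
  level.\<close>

lemma AE_prim_div: "AE \<omega> in \<Omega>. prim_div (Y \<omega>)"
proof -
  have "AE \<omega> in \<Omega>. \<forall>j\<in>{1..J}. \<forall>K::nat. renewal_sum (\<lambda>i. Te j i \<omega>) (real K) < \<top> \<and> renewal_sum (\<lambda>i. Ts j i \<omega>) (real K) < \<top>"
  proof (intro AE_finite_allI AE_all_countable[THEN iffD2] allI AE_conjI)
    fix j :: nat and K :: nat assume j: "j \<in> {1..J}"
    show "AE \<omega> in \<Omega>. renewal_sum (\<lambda>i. Te j i \<omega>) (real K) < \<top>"
      using j Te_nonneg Te_id Te_mean indep_Te by (intro AE_renewal_finite) blast+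
    show "AE \<omega> in \<Omega>. renewal_sum (\<lambda>i. Ts j i \<omega>) (real K) < \<top>"
      using j Ts_nonneg Ts_id Ts_mean indep_Ts by (intro AE_renewal_finite) blast+
  qed simp
  then show ?thesis using AE_space
  proof eventually_elim
    case (elim \<omega>)
    show ?case
      unfolding prim_div_def
    proof (intro ballI allI)
      fix j :: nat and K :: nat assume j: "j \<in> {1..J}"
      obtain m where m: "real K < (\<Sum>i\<in>{1..<m}. Te j i \<omega>)"
        using renewal_sum_finite_imp_unbounded[of "\<lambda>i. Te j i \<omega>" "real K"] elim j Te_nonneg by blast
      obtain m' where m': "real K < (\<Sum>i\<in>{1..<m'}. Ts j i \<omega>)"
        using renewal_sum_finite_imp_unbounded[of "\<lambda>i. Ts j i \<omega>" "real K"] elim j Ts_nonneg by blast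
      have "psum (Y \<omega>) 0 j m = (\<Sum>i\<in>{1..<m}. Te j i \<omega>)" "psum (Y \<omega>) 1 j m' = (\<Sum>i\<in>{1..<m'}. Ts j i \<omega>)"
        unfolding psum_def using j by (auto intro!: sum.cong simp: prims_simps)
      with m m' show "(\<exists>m. real K < psum (Y \<omega>) 0 j m) \<and> (\<exists>m. real K < psum (Y \<omega>) 1 j m)" by metis
    qed
  qed
qed

lemma gjn_X_prims:
  assumes "x \<in> space (gjn_space J)" "\<omega> \<in> space \<Omega>" "0 < t"
  shows "gjn_X J \<alpha> \<mu> (\<lambda>j i. Te j i \<omega>) (\<lambda>j i. Ts j i \<omega>) (\<lambda>j i. rt j i \<omega>) x t = netX (Y \<omega>) x t"
  using assms by (intro gjn_X_eq_netX state_ok_space Y_ok) (simp_all add: prims_simps[simplified])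

lemma measurable_netX_pair:
  assumes "sets \<pi> = sets (gjn_space J)"
  shows "(\<lambda>(x, \<omega>). netX (Y \<omega>) x t) \<in> \<pi> \<Otimes>\<^sub>M \<Omega> \<rightarrow>\<^sub>M \<pi>"
proof -
  have "(\<lambda>z. netX (Y (snd z)) (fst z) t) \<in> \<pi> \<Otimes>\<^sub>M \<Omega> \<rightarrow>\<^sub>M gjn_space J"
  proof (rule measurable_netX)
    show "(\<lambda>z. Y (snd z)) \<in> \<pi> \<Otimes>\<^sub>M \<Omega> \<rightarrow>\<^sub>M primM"
      by (rule measurable_compose[OF measurable_snd Y_meas])
    show "fst \<in> \<pi> \<Otimes>\<^sub>M \<Omega> \<rightarrow>\<^sub>M gjn_space J"
      using measurable_fst[of \<pi> \<Omega>] by (subst measurable_cong_sets[OF refl assms[symmetric]])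
    show "prim_ok (Y (snd z))" if "z \<in> space (\<pi> \<Otimes>\<^sub>M \<Omega>)" for z
      using that by (auto simp: space_pair_measure intro: Y_ok)
  qed
  then show ?thesis
    by (subst measurable_cong_sets[OF refl assms]) (simp add: case_prod_beta)
qed

text \<open>The invariance of \<pi> on sets says that the image of the product of \<pi> and the
  primitive space under \<open>netX\<close> is again \<pi>. As an equality of measures it extends to
  all nonnegative functions, without integrability.\<close>

lemma stationary_nn_integral:
  assumes st: "gjn_stationary \<Omega> J \<alpha> \<mu> Te Ts rt \<pi>" and t: "0 < t" and h: "h \<in> borel_measurable \<pi>"
  shows "(\<integral>\<^sup>+x. h x \<partial>\<pi>) = (\<integral>\<^sup>+x. (\<integral>\<^sup>+\<omega>. h (netX (Y \<omega>) x t) \<partial>\<Omega>) \<partial>\<pi>)"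
proof -
  have s: "sets \<pi> = sets (gjn_space J)" and pr: "prob_space \<pi>"
    and st': "\<And>A. A \<in> sets (gjn_space J) \<Longrightarrow> (\<integral>\<^sup>+ x. gjn_kernel \<Omega> J \<alpha> \<mu> Te Ts rt x t A \<partial>\<pi>) = emeasure \<pi> A"
    using st t by (auto simp: gjn_stationary_def)
  interpret \<pi>: prob_space \<pi> by fact
  note X = measurable_netX_pair[OF s, of t]
  have sp: "space \<pi> = space (gjn_space J)" using s by (rule sets_eq_imp_space_eq)
  have "distr (\<pi> \<Otimes>\<^sub>M \<Omega>) \<pi> (\<lambda>(x, \<omega>). netX (Y \<omega>) x t) = \<pi>"
  proof (rule measure_eqI)
    fix A assume "A \<in> sets (distr (\<pi> \<Otimes>\<^sub>M \<Omega>) \<pi> (\<lambda>(x, \<omega>). netX (Y \<omega>) x t))"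
    then have A: "A \<in> sets \<pi>" by simp
    have "emeasure (distr (\<pi> \<Otimes>\<^sub>M \<Omega>) \<pi> (\<lambda>(x, \<omega>). netX (Y \<omega>) x t)) A =
        emeasure (\<pi> \<Otimes>\<^sub>M \<Omega>) ((\<lambda>(x, \<omega>). netX (Y \<omega>) x t) -` A \<inter> space (\<pi> \<Otimes>\<^sub>M \<Omega>))"
      by (rule emeasure_distr[OF X A])
    also have "\<dots> = (\<integral>\<^sup>+x. emeasure \<Omega> (Pair x -` ((\<lambda>(x, \<omega>). netX (Y \<omega>) x t) -` A \<inter> space (\<pi> \<Otimes>\<^sub>M \<Omega>))) \<partial>\<pi>)"
      by (rule emeasure_pair_measure_alt[OF measurable_sets[OF X A]])
    also have "\<dots> = (\<integral>\<^sup>+x. gjn_kernel \<Omega> J \<alpha> \<mu> Te Ts rt x t A \<partial>\<pi>)"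
    proof (rule nn_integral_cong)
      fix x assume x: "x \<in> space \<pi>"
      have "Pair x -` ((\<lambda>(x, \<omega>). netX (Y \<omega>) x t) -` A \<inter> space (\<pi> \<Otimes>\<^sub>M \<Omega>)) =
         {\<omega> \<in> space \<Omega>. gjn_X J \<alpha> \<mu> (\<lambda>j i. Te j i \<omega>) (\<lambda>j i. Ts j i \<omega>) (\<lambda>j i. rt j i \<omega>) x t \<in> A}"
        using gjn_X_prims[OF x[unfolded sp] _ t] x by (auto simp: space_pair_measure)
      then show "emeasure \<Omega> (Pair x -` ((\<lambda>(x, \<omega>). netX (Y \<omega>) x t) -` A \<inter> space (\<pi> \<Otimes>\<^sub>M \<Omega>))) = gjn_kernel \<Omega> J \<alpha> \<mu> Te Ts rt x t A"
        by (simp add: gjn_kernel_def)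
    qed
    also have "\<dots> = emeasure \<pi> A" using A s by (intro st') simp
    finally show "emeasure (distr (\<pi> \<Otimes>\<^sub>M \<Omega>) \<pi> (\<lambda>(x, \<omega>). netX (Y \<omega>) x t)) A = emeasure \<pi> A" .
  qed simp
  then have "(\<integral>\<^sup>+x. h x \<partial>\<pi>) = (\<integral>\<^sup>+x. h x \<partial>distr (\<pi> \<Otimes>\<^sub>M \<Omega>) \<pi> (\<lambda>(x, \<omega>). netX (Y \<omega>) x t))"
    by simp
  also have "\<dots> = (\<integral>\<^sup>+z. h ((\<lambda>(x, \<omega>). netX (Y \<omega>) x t) z) \<partial>(\<pi> \<Otimes>\<^sub>M \<Omega>))"
    by (rule nn_integral_distr[OF X]) (use h in simp)
  also have "\<dots> = (\<integral>\<^sup>+x. (\<integral>\<^sup>+\<omega>. h (netX (Y \<omega>) x t) \<partial>\<Omega>) \<partial>\<pi>)"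
    by (subst nn_integral_fst[symmetric]) (use measurable_compose[OF X h] in \<open>simp_all add: case_prod_beta\<close>)
  finally show ?thesis .
qed

lemma stationary_drift:
  assumes st: "gjn_stationary \<Omega> J \<alpha> \<mu> Te Ts rt \<pi>"
    and meas: "V \<in> borel_measurable (gjn_space J)" "f \<in> borel_measurable (gjn_space J)" "g \<in> borel_measurable (gjn_space J)"
    and nn: "\<And>x. x \<in> space (gjn_space J) \<Longrightarrow> 0 \<le> V x" "\<And>x. x \<in> space (gjn_space J) \<Longrightarrow> 0 \<le> f x"
      "\<And>x. x \<in> space (gjn_space J) \<Longrightarrow> 0 \<le> g x"
    and drift: "\<And>x. x \<in> space (gjn_space J) \<Longrightarrow>
       (\<integral>\<^sup>+\<omega>. ennreal (V (netX (Y \<omega>) x 1)) \<partial>\<Omega>) + ennreal (f x) \<le> ennreal (V x + g x)"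
  shows "(\<integral>\<^sup>+x. ennreal (f x) \<partial>\<pi>) \<le> (\<integral>\<^sup>+x. ennreal (g x) \<partial>\<pi>)"
proof -
  have s: "sets \<pi> = sets (gjn_space J)" and pr: "prob_space \<pi>"
    using st by (auto simp: gjn_stationary_def)
  have sp: "space \<pi> = space (gjn_space J)" using s by (rule sets_eq_imp_space_eq)
  have m: "borel_measurable \<pi> = borel_measurable (gjn_space J)"
    using s by (rule measurable_cong_sets) simp
  show ?thesis
    by (rule stationary_comparison[where V = V and X = "\<lambda>x \<omega>. netX (Y \<omega>) x 1", OF pr prob_space_axioms measurable_netX_pair[OF s]])
       (use assms stationary_nn_integral[OF st, of 1] in \<open>simp_all add: sp m\<close>)
qed

text \<open>Overwriting coordinate \<open>q\<close> by 0 expresses a function of all other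
  primitives as a function on the full product, so it can be applied to the chain as it
  stands.\<close>

lemma indep_prim:
  assumes q: "q \<in> prim_index J" and h: "h \<in> borel_measurable borel" and H: "H \<in> borel_measurable primM"
  shows "indep_var borel (\<lambda>\<omega>. h (Y \<omega> q) :: real) borel (\<lambda>\<omega>. H ((Y \<omega>)(q := 0)) :: real)"
proof -
  let ?I = "prim_index J" and ?X = "prim_var Te Ts rt"
  define \<Phi> where "\<Phi> z p = (if p \<in> ?I - {q} then z p else 0 :: real)" for z p
  have \<Phi>: "\<Phi> \<in> Pi\<^sub>M (?I - {q}) (\<lambda>_. borel) \<rightarrow>\<^sub>M primM"
  proof (rule measurable_PiM_single')
    fix p
    show "(\<lambda>z. \<Phi> z p) \<in> borel_measurable (Pi\<^sub>M (?I - {q}) (\<lambda>_. borel))"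
    proof (cases "p \<in> ?I - {q}")
      case True
      then show ?thesis unfolding \<Phi>_def if_P[OF True] by (rule measurable_component_singleton)
    next
      case False
      then show ?thesis unfolding \<Phi>_def if_not_P[OF False] by simp
    qed
  qed (auto simp: space_PiM)
  have "indep_var (Pi\<^sub>M {q} (\<lambda>_. borel)) (\<lambda>\<omega>. restrict (\<lambda>i. ?X i \<omega>) {q})
      (Pi\<^sub>M (?I - {q}) (\<lambda>_. borel)) (\<lambda>\<omega>. restrict (\<lambda>i. ?X i \<omega>) (?I - {q}))"
    using q by (intro indep_var_restrict[OF indep]) auto
  then have "indep_var borel ((\<lambda>z. h (z q)) \<circ> (\<lambda>\<omega>. restrict (\<lambda>i. ?X i \<omega>) {q}))
      borel ((\<lambda>z. H (\<Phi> z)) \<circ> (\<lambda>\<omega>. restrict (\<lambda>i. ?X i \<omega>) (?I - {q})))"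
    by (rule indep_var_compose)
       (auto intro!: measurable_compose[OF _ h] measurable_compose[OF \<Phi> H] measurable_component_singleton)
  also have "(\<lambda>z. h (z q)) \<circ> (\<lambda>\<omega>. restrict (\<lambda>i. ?X i \<omega>) {q}) = (\<lambda>\<omega>. h (Y \<omega> q))"
    using q by (auto simp: prims_def fun_eq_iff)
  also have "(\<lambda>z. H (\<Phi> z)) \<circ> (\<lambda>\<omega>. restrict (\<lambda>i. ?X i \<omega>) (?I - {q})) = (\<lambda>\<omega>. H ((Y \<omega>)(q := 0)))"
  proof
    fix \<omega>
    have "\<Phi> (restrict (\<lambda>i. ?X i \<omega>) (?I - {q})) = (Y \<omega>)(q := 0)"
      by (auto simp: \<Phi>_def prims_def fun_eq_iff)
    then show "((\<lambda>z. H (\<Phi> z)) \<circ> (\<lambda>\<omega>. restrict (\<lambda>i. ?X i \<omega>) (?I - {q}))) \<omega> = H ((Y \<omega>)(q := 0))" by simp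
  qed
  finally show ?thesis .
qed

lemma measurable_chain_prim:
  assumes "x \<in> space (gjn_space J)" "G \<in> borel_measurable cfgM"
  shows "(\<lambda>p. G (chain p x n)) \<in> borel_measurable primM"
  by (rule measurable_compose[OF measurable_chain[OF measurable_ident_sets[OF refl] measurable_const[OF assms(1)]] assms(2)])

lemma measurable_chain_Y:
  assumes "x \<in> space (gjn_space J)" "G \<in> cfgM \<rightarrow>\<^sub>M L"
  shows "(\<lambda>\<omega>. G (chain (Y \<omega>) x n)) \<in> \<Omega> \<rightarrow>\<^sub>M L"
  by (rule measurable_compose[OF measurable_chain[OF Y_meas measurable_const[OF assms(1)]] assms(2)])

lemma measurable_counter: "j \<in> {1..J} \<Longrightarrow> counter e j \<in> cfgM \<rightarrow>\<^sub>M count_space UNIV"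
  unfolding counter_def[abs_def] using measurable_cfg_parts[of j] by simp

text \<open>A primitive that has not been consumed after n events is independent of the configuration:
  resetting it leaves the configuration unchanged.\<close>

lemma fresh_expectation:
  fixes h :: "real \<Rightarrow> real"
  assumes x: "x \<in> space (gjn_space J)" and q: "(e, j, i) \<in> prim_index J"
    and G: "G \<in> borel_measurable cfgM" and h: "h \<in> borel_measurable borel"
    and iG: "integrable \<Omega> (\<lambda>\<omega>. if counter e j (chain (Y \<omega>) x n) = i then G (chain (Y \<omega>) x n) else 0)"
    and ih: "integrable \<Omega> (\<lambda>\<omega>. h (Y \<omega> (e, j, i)))" and h0: "(\<integral>\<omega>. h (Y \<omega> (e, j, i)) \<partial>\<Omega>) = 0"
  shows "integrable \<Omega> (\<lambda>\<omega>. h (Y \<omega> (e, j, i)) * (if counter e j (chain (Y \<omega>) x n) = i then G (chain (Y \<omega>) x n) else 0)) \<and>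
    (\<integral>\<omega>. h (Y \<omega> (e, j, i)) * (if counter e j (chain (Y \<omega>) x n) = i then G (chain (Y \<omega>) x n) else 0) \<partial>\<Omega>) = 0"
proof -
  have je: "j \<in> {1..J}" "e \<le> 2" using q by (auto simp: prim_index_def)
  define H where "H p = (if counter e j (chain p x n) = i then G (chain p x n) else 0)" for p
  have Gm: "(\<lambda>c. if counter e j c = i then G c else 0) \<in> borel_measurable cfgM"
  proof (rule measurable_If[OF G])
    have "Measurable.pred cfgM (\<lambda>c. counter e j c = i)"
      by (rule measurable_compose[OF measurable_counter[OF je(1)]]) simp
    then show "{c \<in> space cfgM. counter e j c = i} \<in> sets cfgM" by (simp add: pred_def)
  qed simp
  have H: "H \<in> borel_measurable primM"
    unfolding H_def by (rule measurable_chain_prim[OF x Gm])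
  \<comment> \<open>If the counter test succeeds for either of the two chains, draw \<open>i\<close>
    is unread there and the chains coincide; if it fails for both, both values are 0.\<close>
  have eq: "H ((Y \<omega>)((e, j, i) := 0)) = H (Y \<omega>)" for \<omega>
  proof -
    let ?p = "Y \<omega>" and ?p' = "(Y \<omega>)((e, j, i) := 0)"
    have 1: "chain ?p' x n = chain ?p x n" if "counter e j (chain ?p x n) \<le> i"
      by (rule chain_unconsumed[OF _ je(2) that]) simp
    have 2: "chain ?p x n = chain ?p' x n" if "counter e j (chain ?p' x n) \<le> i"
      by (rule chain_unconsumed[OF _ je(2) that]) simp
    show ?thesis unfolding H_def using 1 2 by (metis order_refl)
  qed
  have iH: "integrable \<Omega> (\<lambda>\<omega>. H ((Y \<omega>)((e, j, i) := 0)))"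
    unfolding eq unfolding H_def by (rule iG)
  have "(\<integral>\<omega>. h (Y \<omega> (e, j, i)) * H ((Y \<omega>)((e, j, i) := 0)) \<partial>\<Omega>) =
     (\<integral>\<omega>. h (Y \<omega> (e, j, i)) \<partial>\<Omega>) * (\<integral>\<omega>. H ((Y \<omega>)((e, j, i) := 0)) \<partial>\<Omega>)"
    using ih iH by (intro indep_var_lebesgue_integral indep_prim[OF q h H])
  moreover have "integrable \<Omega> (\<lambda>\<omega>. h (Y \<omega> (e, j, i)) * H ((Y \<omega>)((e, j, i) := 0)))"
    using ih iH by (intro indep_var_integrable indep_prim[OF q h H])
  ultimately show ?thesis unfolding eq h0 by (simp add: H_def)
qed

end

subsection \<open>Expected drift of the test function\<close>

context gjn_rates
begin

text \<open>This is where the initial state drops out: up to time 1 all arrival draws but the last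
  one read have run out, so that last draw begins at or below level \<alpha>. For \<alpha> equal to
  0 nothing is ever read.\<close>

lemma ext_draws_le:
  assumes ok: "state_ok x" "prim_ok p" and t: "etime p x N \<le> 1" and j: "j \<in> {1..J}" and \<kappa>: "\<alpha> j \<le> \<kappa>"
  shows "ennreal (\<Sum>m\<in>{1..<cne (chain p x N) j}. 1 + p (0, j, m)) \<le> renewal_sum (\<lambda>i. p (0, j, i)) \<kappa>"
proof (rule sum_le_renewal_sum)
  assume "2 \<le> cne (chain p x N) j"
  then have a: "0 < \<alpha> j" using cne_eq_1_if_no_arrivals[of j p x N] by (cases "0 < \<alpha> j") auto
  have "(\<Sum>i\<in>{1..<cne (chain p x N) j - 1}. p (0, j, i)) \<le> \<alpha> j * etime p x N"
    using psum_ext_le[OF ok j a, of N] by (simp add: psum_def)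
  also have "\<dots> \<le> \<alpha> j * 1" using a t by (intro mult_left_mono) auto
  finally show "(\<Sum>i\<in>{1..<cne (chain p x N) j - 1}. p (0, j, i)) \<le> \<kappa>" using \<kappa> by simp
qed (use ok j in \<open>auto simp: prim_ok_def\<close>)

lemma srv_draws_le:
  assumes ok: "state_ok x" "prim_ok p" and t: "etime p x N \<le> 1" and j: "j \<in> {1..J}" and \<kappa>: "\<mu> j \<le> \<kappa>"
  shows "ennreal (\<Sum>m\<in>{1..<cns (chain p x N) j}. 1 + p (1, j, m)) \<le> renewal_sum (\<lambda>i. p (1, j, i)) \<kappa>"
proof (rule sum_le_renewal_sum)
  have "(\<Sum>i\<in>{1..<cns (chain p x N) j - 1}. p (1, j, i)) \<le> \<mu> j * etime p x N"
    using psum_srv_le[OF ok j, of N] by (simp add: psum_def)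
  also have "\<dots> \<le> \<mu> j * 1" using \<mu>_pos[OF j] t by (intro mult_left_mono) auto
  finally show "(\<Sum>i\<in>{1..<cns (chain p x N) j - 1}. p (1, j, i)) \<le> \<kappa>" using \<kappa> by simp
qed (use ok j in \<open>auto simp: prim_ok_def\<close>)

end

lemma (in gjn_test) Ucount_le_event_total:
  assumes ok: "state_ok x" "prim_ok p" and t: "etime p x N \<le> 1"
    and \<kappa>: "\<And>j. j \<in> {1..J} \<Longrightarrow> \<alpha> j \<le> \<kappa>e j" "\<And>j. j \<in> {1..J} \<Longrightarrow> \<mu> j \<le> \<kappa>s j"
  shows "ennreal (Ucount p (chain p x N)) \<le> event_total J k \<kappa>e \<kappa>s p"
proof -
  define c where "c = chain p x N"
  have nn: "0 \<le> p (0, j, i)" "0 \<le> p (1, j, i)" if "j \<in> {1..J}" "1 \<le> i" for i j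
    using ok that by (auto simp: prim_ok_def)
  have 1: "ennreal (\<Sum>m\<in>{1..<cne c j}. 1 + p (0, j, m)) \<le> renewal_sum (\<lambda>i. p (0, j, i)) (\<kappa>e j)" if j: "j \<in> {1..J}" for j
    unfolding c_def by (rule ext_draws_le[OF ok t j \<kappa>(1)[OF j]])
  have 2: "ennreal (\<Sum>m\<in>{1..<cns c j}. 1 + p (1, j, m)) \<le> renewal_sum (\<lambda>i. p (1, j, i)) (\<kappa>s j)" if j: "j \<in> {1..J}" for j
    unfolding c_def by (rule srv_draws_le[OF ok t j \<kappa>(2)[OF j]])
  have kJ: "{1..k} \<subseteq> {1..J}" using k by auto
  have s1: "0 \<le> (\<Sum>m\<in>{1..<cne c j}. 1 + p (0, j, m))" if "j \<in> {1..k}" for j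
    using nn that kJ by (intro sum_nonneg add_nonneg_nonneg) auto
  have s2: "0 \<le> (\<Sum>m\<in>{1..<cns c j}. 1 + p (1, j, m))" if "j \<in> {1..J}" for j
    using nn that by (intro sum_nonneg add_nonneg_nonneg) auto
  have "ennreal (Ucount p c) = ennreal (\<Sum>j\<in>{1..k}. \<Sum>m\<in>{1..<cne c j}. 1 + p (0, j, m)) + ennreal (\<Sum>j\<in>{1..J}. \<Sum>m\<in>{1..<cns c j}. 1 + p (1, j, m))"
    unfolding Ucount_def
  proof (rule ennreal_plus)
    show "0 \<le> (\<Sum>j\<in>{1..k}. \<Sum>m\<in>{1..<cne c j}. 1 + p (0, j, m))" by (rule sum_nonneg) (rule s1)
    show "0 \<le> (\<Sum>j\<in>{1..J}. \<Sum>m\<in>{1..<cns c j}. 1 + p (1, j, m))" by (rule sum_nonneg) (rule s2)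
  qed
  also have "ennreal (\<Sum>j\<in>{1..k}. \<Sum>m\<in>{1..<cne c j}. 1 + p (0, j, m)) = (\<Sum>j\<in>{1..k}. ennreal (\<Sum>m\<in>{1..<cne c j}. 1 + p (0, j, m)))"
    by (rule sum_ennreal[symmetric]) (rule s1)
  also have "ennreal (\<Sum>j\<in>{1..J}. \<Sum>m\<in>{1..<cns c j}. 1 + p (1, j, m)) = (\<Sum>j\<in>{1..J}. ennreal (\<Sum>m\<in>{1..<cns c j}. 1 + p (1, j, m)))"
    by (rule sum_ennreal[symmetric]) (rule s2)
  also have "(\<Sum>j\<in>{1..k}. ennreal (\<Sum>m\<in>{1..<cne c j}. 1 + p (0, j, m))) + (\<Sum>j\<in>{1..J}. ennreal (\<Sum>m\<in>{1..<cns c j}. 1 + p (1, j, m)))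
     \<le> event_total J k \<kappa>e \<kappa>s p"
    unfolding event_total_def using kJ by (intro add_mono sum_mono 1 2) auto
  finally show ?thesis by (simp add: c_def)
qed

lemma add_power_le: "0 \<le> a \<Longrightarrow> 0 \<le> b \<Longrightarrow> (a + b) ^ n \<le> 2 ^ n * (a ^ n + b ^ n)" for a b :: real
proof -
  assume ab: "0 \<le> a" "0 \<le> b"
  have "(a + b) ^ n \<le> (2 * max a b) ^ n" using ab by (intro power_mono) auto
  also have "\<dots> = 2 ^ n * max a b ^ n" by (rule power_mult_distrib)
  also have "\<dots> \<le> 2 ^ n * (a ^ n + b ^ n)" using ab by (intro mult_left_mono) (auto simp: max_def)
  finally show ?thesis .
qed

context gjn_rates
begin

lemma measurable_evt_eq: "Measurable.pred cfgM (\<lambda>c. evt c = e)"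
  by (rule measurable_compose[OF measurable_evt]) simp

end

context gjn_test
begin

lemma measurable_FX: "FX \<in> borel_measurable (gjn_space J)"
  unfolding FX_def[abs_def] Fz_def
proof (intro borel_measurable_diff borel_measurable_sum)
  fix j assume j: "j \<in> {1..J}"
  note p = measurable_gjn_space_parts[OF j measurable_ident_sets[OF refl]]
  show "(\<lambda>x. u j * real (fst (x j))) \<in> borel_measurable (gjn_space J)"
    by (intro borel_measurable_times borel_measurable_const measurable_compose[OF p(1)]) simp
  show "(\<lambda>x. \<alpha> j * u j * fst (snd (x j))) \<in> borel_measurable (gjn_space J)"
    by (intro borel_measurable_times borel_measurable_const p(2))
  show "(\<lambda>x. d j * \<mu> j * snd (snd (x j))) \<in> borel_measurable (gjn_space J)"
    by (intro borel_measurable_times borel_measurable_const p(3))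
qed

lemma measurable_FC: "FC \<in> borel_measurable cfgM"
  unfolding FC_def[abs_def] Fz_def
proof (intro borel_measurable_diff borel_measurable_sum)
  fix j assume j: "j \<in> {1..J}"
  note p = measurable_cfg_parts[OF j]
  show "(\<lambda>c. u j * real (cz c j)) \<in> borel_measurable cfgM"
    by (intro borel_measurable_times borel_measurable_const measurable_compose[OF p(1)]) simp
  show "(\<lambda>c. \<alpha> j * u j * cre c j) \<in> borel_measurable cfgM"
    by (intro borel_measurable_times borel_measurable_const p(2))
  show "(\<lambda>c. d j * \<mu> j * crs c j) \<in> borel_measurable cfgM"
    by (intro borel_measurable_times borel_measurable_const p(3))
qed

lemma measurable_pre: "pre \<in> borel_measurable cfgM"
proof -
  have "(\<lambda>c. bz (cz c)) \<in> borel_measurable cfgM"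
    unfolding bz_def
  proof (intro borel_measurable_add borel_measurable_const borel_measurable_sum)
    fix j assume j: "j \<in> {1..J}"
    show "(\<lambda>c. if 0 < cz c j then d j * \<mu> j else 0) \<in> borel_measurable cfgM"
      by (rule measurable_compose[OF measurable_cfg_parts(1)[OF j], of "\<lambda>z. if 0 < z then d j * \<mu> j else 0"]) simp
  qed
  then show ?thesis
    unfolding pre_def[abs_def] flow_eq using measurable_FC measurable_delay
    by (intro borel_measurable_add borel_measurable_times)
qed

lemma measurable_ppow: "f \<in> borel_measurable N \<Longrightarrow> (\<lambda>x. ppow n (f x)) \<in> borel_measurable N"
  unfolding ppow_def by measurable

text \<open>A completion reads two primitives, a service time and a destination. Adding and
  subtracting \<open>d j\<close> splits the jump into pieces that each depend on one primitive and
  have mean zero separately.\<close>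

definition zeta :: "nat \<Rightarrow> nat \<Rightarrow> real \<Rightarrow> real" where
  "zeta e j y = (if e = 0 then u j * (1 - y) else if e = 1 then d j * (1 - y)
     else udest (nat \<lfloor>y\<rfloor>) - u j - d j)"

text \<open>The term \<open>min e 1\<close> sends the kind of a primitive to the kind of event that
  reads it: kinds 1 and 2 both belong to a completion.\<close>

lemma xi_eq_sum:
  "xi p c = (\<Sum>(e, j)\<in>{0, 1, 2} \<times> {1..J}. if evt c = (min e 1, j) then zeta e j (p (e, j, counter e j c)) else 0)"
proof -
  have "(\<Sum>(e, j)\<in>{0, 1, 2} \<times> {1..J}. if evt c = (min e 1, j) then zeta e j (p (e, j, counter e j c)) else 0) =
     (\<Sum>e\<in>{0, 1, 2}. \<Sum>j\<in>{1..J}. if evt c = (min e 1, j) then zeta e j (p (e, j, counter e j c)) else 0)"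
    by (rule sum.cartesian_product[symmetric])
  also have "\<dots> = (\<Sum>e\<in>{0, 1, 2}. if fst (evt c) = min e 1 then zeta e (snd (evt c)) (p (e, snd (evt c), counter e (snd (evt c)) c)) else 0)"
  proof (rule sum.cong[OF refl])
    fix e :: nat
    have "(\<Sum>j\<in>{1..J}. if evt c = (min e 1, j) then zeta e j (p (e, j, counter e j c)) else 0) =
       (\<Sum>j\<in>{1..J}. if j = snd (evt c) then (if fst (evt c) = min e 1 then zeta e j (p (e, j, counter e j c)) else 0) else 0)"
      by (intro sum.cong) (auto simp: prod_eq_iff)
    also have "\<dots> = (if fst (evt c) = min e 1 then zeta e (snd (evt c)) (p (e, snd (evt c), counter e (snd (evt c)) c)) else 0)"
      using snd_evt[of c] by (subst sum.delta) auto
    finally show "(\<Sum>j\<in>{1..J}. if evt c = (min e 1, j) then zeta e j (p (e, j, counter e j c)) else 0) =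
       (if fst (evt c) = min e 1 then zeta e (snd (evt c)) (p (e, snd (evt c), counter e (snd (evt c)) c)) else 0)" .
  qed
  also have "\<dots> = xi p c"
    by (cases rule: evt_cases[of c]) (simp_all add: xi_def zeta_def counter_def algebra_simps)
  finally show ?thesis by simp
qed

end

section \<open>Centred jumps and the one-step drift inequality\<close>

locale gjn_drift = gjn_net J \<alpha> \<mu> \<Omega> Te Ts rt + gjn_test J \<alpha> \<mu> k M u d B eps
  for J :: nat and \<alpha> \<mu> :: "nat \<Rightarrow> real" and \<Omega> :: "'a measure" and Te Ts rt
    and k M :: nat and u d :: "nat \<Rightarrow> real" and B eps :: real +
  fixes P :: "nat \<Rightarrow> nat \<Rightarrow> real" and \<kappa>e \<kappa>s :: "nat \<Rightarrow> real"
  assumes rt_law: "\<And>j l. j \<in> {1..J} \<Longrightarrow> l \<in> {1..J} \<Longrightarrow> measure \<Omega> {\<omega> \<in> space \<Omega>. rt j 1 \<omega> = l} = P j l"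
    and d_eq: "\<And>j. j \<in> {1..J} \<Longrightarrow> d j = (\<Sum>l\<in>{1..J}. P j l * u l) - u j"
    and \<kappa>: "\<And>j. j \<in> {1..J} \<Longrightarrow> \<alpha> j \<le> \<kappa>e j" "\<And>j. j \<in> {1..J} \<Longrightarrow> \<mu> j \<le> \<kappa>s j"
    and eps1: "eps \<le> 1"
    and S_mom: "(\<integral>\<^sup>+\<omega>. event_total J k \<kappa>e \<kappa>s (prims J Te Ts rt \<omega>) ^ (M + 1) \<partial>\<Omega>) < \<infinity>"
begin

text \<open>The summand 1 makes all values at least 1, so lower powers are dominated by higher ones.
  Where the total is infinite, \<open>enn2real\<close> gives 0; that happens only on a null
  set.\<close>

definition Sr :: "'a \<Rightarrow> real" where
  "Sr \<omega> = B + 1 + 2 * enn2real (event_total J k \<kappa>e \<kappa>s (Y \<omega>))"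

lemma measurable_event_total: "(\<lambda>\<omega>. event_total J k \<kappa>e \<kappa>s (Y \<omega>)) \<in> borel_measurable \<Omega>"
  unfolding event_total_def
  by (intro borel_measurable_add borel_measurable_sum borel_measurable_renewal_sum Y_q_meas)

lemma Sr_meas [measurable]: "Sr \<in> borel_measurable \<Omega>"
  unfolding Sr_def[abs_def] using measurable_event_total by measurable

lemma Sr_ge_1: "1 \<le> Sr \<omega>"
  using B_nonneg by (simp add: Sr_def)

lemma AE_event_total: "AE \<omega> in \<Omega>. event_total J k \<kappa>e \<kappa>s (Y \<omega>) < \<top>"
proof -
  have "AE \<omega> in \<Omega>. event_total J k \<kappa>e \<kappa>s (Y \<omega>) ^ (M + 1) \<noteq> \<infinity>"
    using S_mom measurable_event_total by (intro nn_integral_PInf_AE borel_measurable_power_ennreal) auto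
  then show ?thesis by eventually_elim (simp add: less_top power_eq_top_ennreal del: power_Suc)
qed

lemma Sr_integrable: "n \<le> M + 1 \<Longrightarrow> integrable \<Omega> (\<lambda>\<omega>. Sr \<omega> ^ n)"
proof -
  have *: "integrable \<Omega> (\<lambda>\<omega>. Sr \<omega> ^ (M + 1))"
  proof (rule integrableI_bounded)
    let ?E = "\<lambda>\<omega>. event_total J k \<kappa>e \<kappa>s (Y \<omega>)"
    have "(\<integral>\<^sup>+\<omega>. ennreal (norm (Sr \<omega> ^ (M + 1))) \<partial>\<Omega>) \<le>
       (\<integral>\<^sup>+\<omega>. ennreal (2 ^ (M + 1) * (B + 1) ^ (M + 1)) + ennreal (2 ^ (M + 1) * 2 ^ (M + 1)) * ?E \<omega> ^ (M + 1) \<partial>\<Omega>)"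
    proof (rule nn_integral_mono_AE)
      show "AE \<omega> in \<Omega>. ennreal (norm (Sr \<omega> ^ (M + 1))) \<le>
        ennreal (2 ^ (M + 1) * (B + 1) ^ (M + 1)) + ennreal (2 ^ (M + 1) * 2 ^ (M + 1)) * ?E \<omega> ^ (M + 1)"
        using AE_event_total
      proof eventually_elim
        case (elim \<omega>)
        then obtain e where e: "?E \<omega> = ennreal e" "0 \<le> e" by (cases "?E \<omega>") auto
        have "norm (Sr \<omega> ^ (M + 1)) = ((B + 1) + 2 * e) ^ (M + 1)"
          using e B_nonneg by (simp add: Sr_def norm_power del: power_Suc)
        also have "\<dots> \<le> 2 ^ (M + 1) * ((B + 1) ^ (M + 1) + (2 * e) ^ (M + 1))"
          using e B_nonneg by (intro add_power_le) auto
        also have "\<dots> = 2 ^ (M + 1) * (B + 1) ^ (M + 1) + 2 ^ (M + 1) * 2 ^ (M + 1) * e ^ (M + 1)"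
          by (simp only: distrib_left power_mult_distrib mult.assoc)
        finally have "ennreal (norm (Sr \<omega> ^ (M + 1))) \<le> ennreal (2 ^ (M + 1) * (B + 1) ^ (M + 1) + 2 ^ (M + 1) * 2 ^ (M + 1) * e ^ (M + 1))"
          by (rule ennreal_leI)
        also have "\<dots> = ennreal (2 ^ (M + 1) * (B + 1) ^ (M + 1)) + ennreal (2 ^ (M + 1) * 2 ^ (M + 1) * e ^ (M + 1))"
          using e B_nonneg by (intro ennreal_plus) auto
        also have "ennreal (2 ^ (M + 1) * 2 ^ (M + 1) * e ^ (M + 1)) = ennreal (2 ^ (M + 1) * 2 ^ (M + 1)) * ?E \<omega> ^ (M + 1)"
          using e by (simp add: ennreal_mult ennreal_power del: power_Suc)
        finally show ?case .
      qed
    qed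
    also have "\<dots> = ennreal (2 ^ (M + 1) * (B + 1) ^ (M + 1)) + ennreal (2 ^ (M + 1) * 2 ^ (M + 1)) * (\<integral>\<^sup>+\<omega>. ?E \<omega> ^ (M + 1) \<partial>\<Omega>)"
      using measurable_event_total
      by (subst nn_integral_add) (auto simp: nn_integral_cmult emeasure_space_1 simp del: power_Suc)
    also have "\<dots> < \<infinity>" using S_mom by (simp add: ennreal_mult_less_top del: power_Suc)
    finally show "(\<integral>\<^sup>+\<omega>. ennreal (norm (Sr \<omega> ^ (M + 1))) \<partial>\<Omega>) < \<infinity>" .
  qed measurable
  assume n: "n \<le> M + 1"
  show ?thesis
  proof (rule Bochner_Integration.integrable_bound[OF *])
    show "AE \<omega> in \<Omega>. norm (Sr \<omega> ^ n) \<le> norm (Sr \<omega> ^ (M + 1))"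
    proof (rule AE_I2)
      fix \<omega>
      have "Sr \<omega> ^ n \<le> Sr \<omega> ^ (M + 1)" using Sr_ge_1[of \<omega>] n by (intro power_increasing) auto
      then show "norm (Sr \<omega> ^ n) \<le> norm (Sr \<omega> ^ (M + 1))"
        using Sr_ge_1[of \<omega>] by (simp add: norm_power del: power_Suc)
    qed
  qed measurable
qed

lemma add_Sr_integrable:
  assumes "n \<le> M + 1" "0 \<le> a"
  shows "integrable \<Omega> (\<lambda>\<omega>. (a + b * Sr \<omega>) ^ n)"
proof -
  have "(\<lambda>\<omega>. (a + b * Sr \<omega>) ^ n) = (\<lambda>\<omega>. \<Sum>i\<le>n. real (n choose i) * a ^ i * b ^ (n - i) * Sr \<omega> ^ (n - i))"
    by (intro ext) (simp add: binomial_ring power_mult_distrib mult.assoc)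
  moreover have "integrable \<Omega> (\<lambda>\<omega>. \<Sum>i\<le>n. real (n choose i) * a ^ i * b ^ (n - i) * Sr \<omega> ^ (n - i))"
    using assms by (intro Bochner_Integration.integrable_sum integrable_mult_right Sr_integrable) auto
  ultimately show ?thesis by (simp only:)
qed

lemma AE_good:
  assumes x: "x \<in> space (gjn_space J)"
  shows "AE \<omega> in \<Omega>. \<omega> \<in> space \<Omega> \<and> prim_div (Y \<omega>) \<and>
     (\<forall>N. etime (Y \<omega>) x N \<le> 1 \<longrightarrow> B + 2 * Ucount (Y \<omega>) (chain (Y \<omega>) x N) \<le> Sr \<omega> - 1)"
  using AE_prim_div AE_event_total AE_space
proof eventually_elim
  case (elim \<omega>)
  note ok = state_ok_space[OF x] Y_ok[OF elim(3)]
  have "2 * Ucount (Y \<omega>) (chain (Y \<omega>) x N) \<le> 2 * enn2real (event_total J k \<kappa>e \<kappa>s (Y \<omega>))" if "etime (Y \<omega>) x N \<le> 1" for N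
  proof -
    have "ennreal (Ucount (Y \<omega>) (chain (Y \<omega>) x N)) \<le> event_total J k \<kappa>e \<kappa>s (Y \<omega>)"
      by (rule Ucount_le_event_total[OF ok that \<kappa>])
    then show ?thesis
      using elim(2) Ucount_chain_mono[OF ok(2), of 0 N x]
      by (cases "event_total J k \<kappa>e \<kappa>s (Y \<omega>)") auto
  qed
  with elim show ?case by (simp add: Sr_def)
qed

lemma mean_1_integral:
  fixes T :: "'a \<Rightarrow> real"
  assumes T: "T \<in> borel_measurable \<Omega>" "\<And>\<omega>. \<omega> \<in> space \<Omega> \<Longrightarrow> 0 \<le> T \<omega>"
    and T1: "T1 \<in> borel_measurable \<Omega>" and id: "distr \<Omega> borel T = distr \<Omega> borel T1"
    and m: "(\<integral>\<^sup>+\<omega>. ennreal (T1 \<omega>) \<partial>\<Omega>) = 1"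
  shows "integrable \<Omega> T \<and> (\<integral>\<omega>. T \<omega> \<partial>\<Omega>) = 1"
proof -
  have "(\<integral>\<^sup>+\<omega>. ennreal (T \<omega>) \<partial>\<Omega>) = (\<integral>\<^sup>+y. ennreal y \<partial>distr \<Omega> borel T)"
    using T by (subst nn_integral_distr) auto
  also have "\<dots> = 1" unfolding id using T1 m by (subst nn_integral_distr) auto
  finally have 1: "(\<integral>\<^sup>+\<omega>. ennreal (T \<omega>) \<partial>\<Omega>) = 1" .
  have i: "integrable \<Omega> T"
    by (rule integrableI_nonneg[OF T(1)]) (use 1 T(2) in auto)
  have "ennreal (\<integral>\<omega>. T \<omega> \<partial>\<Omega>) = 1"
    using nn_integral_eq_integral[OF i] T(2) 1 by auto
  then show ?thesis using i by (metis ennreal_eq_1)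
qed

lemma zeta_meas: "zeta e j \<in> borel_measurable borel"
proof -
  have "(\<lambda>y::real. nat \<lfloor>y\<rfloor>) \<in> borel \<rightarrow>\<^sub>M count_space UNIV" by measurable
  then have [measurable]: "(\<lambda>y::real. udest (nat \<lfloor>y\<rfloor>)) \<in> borel_measurable borel"
    by (rule measurable_compose) simp
  show ?thesis unfolding zeta_def[abs_def] by measurable
qed

text \<open>Kinds 0 and 1 rest on the unit means. For kind 2 the mean of \<open>udest\<close> is
  \<open>(P u)_j\<close>, which equals \<open>u j + d j\<close> by \<open>d_eq\<close>.\<close>

lemma zeta_mean:
  assumes q: "(e, j, i) \<in> prim_index J"
  shows "integrable \<Omega> (\<lambda>\<omega>. zeta e j (Y \<omega> (e, j, i))) \<and> (\<integral>\<omega>. zeta e j (Y \<omega> (e, j, i)) \<partial>\<Omega>) = 0"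
proof -
  have j: "j \<in> {1..J}" and i: "1 \<le> i" and e: "e \<le> 2" using q by (auto simp: prim_index_def)
  have j1: "(1::nat) \<le> 1" by simp
  consider "e = 0" | "e = 1" | "e = 2" using e by linarith
  then show ?thesis
  proof cases
    case 1
    have m: "integrable \<Omega> (Te j i) \<and> (\<integral>\<omega>. Te j i \<omega> \<partial>\<Omega>) = 1"
      by (rule mean_1_integral[OF Te_meas[OF j i] _ Te_meas[OF j j1] Te_id[OF j i] Te_mean[OF j]]) (rule Te_nonneg[OF j i])
    then show ?thesis using prob_space by (simp add: prims_simps[OF j i] 1 zeta_def)
  next
    case 2
    have m: "integrable \<Omega> (Ts j i) \<and> (\<integral>\<omega>. Ts j i \<omega> \<partial>\<Omega>) = 1"
      by (rule mean_1_integral[OF Ts_meas[OF j i] _ Ts_meas[OF j j1] Ts_id[OF j i] Ts_mean[OF j]]) (rule Ts_nonneg[OF j i])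
    then show ?thesis using prob_space by (simp add: prims_simps[OF j i] 2 zeta_def)
  next
    case 3
    define E where "E l = {\<omega> \<in> space \<Omega>. rt j i \<omega> = l}" for l
    have E: "E l \<in> sets \<Omega>" for l
      using measurable_sets[OF rt_meas[OF j i], of "{l}"] by (simp add: E_def vimage_def Int_def conj_commute)
    have PE: "prob (E l) = P j l" if l: "l \<in> {1..J}" for l
    proof -
      have "prob (E l) = measure (distr \<Omega> (count_space UNIV) (rt j i)) {l}"
        using rt_meas[OF j i] by (subst measure_distr) (auto simp: E_def vimage_def Int_def conj_commute)
      also have "\<dots> = measure \<Omega> {\<omega> \<in> space \<Omega>. rt j 1 \<omega> = l}"
        unfolding rt_id[OF j i] using rt_meas[OF j j1] by (subst measure_distr) (auto simp: vimage_def Int_def conj_commute)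
      finally show ?thesis using rt_law[OF j l] by simp
    qed
    have ud: "udest (rt j i \<omega>) = (\<Sum>l\<in>{1..J}. u l * indicator (E l) \<omega>)" if "\<omega> \<in> space \<Omega>" for \<omega>
    proof -
      have "(\<Sum>l\<in>{1..J}. u l * indicator (E l) \<omega>) = (\<Sum>l\<in>{1..J}. if l = rt j i \<omega> then u l else 0)"
        using that by (intro sum.cong) (auto simp: E_def)
      then show ?thesis by (simp add: udest_def)
    qed
    have iu: "integrable \<Omega> (\<lambda>\<omega>. \<Sum>l\<in>{1..J}. u l * indicator (E l) \<omega>)"
      using E by (intro Bochner_Integration.integrable_sum integrable_mult_right integrable_real_indicator) (auto simp: emeasure_eq_measure)
    have Iu: "(\<integral>\<omega>. (\<Sum>l\<in>{1..J}. u l * indicator (E l) \<omega>) \<partial>\<Omega>) = (\<Sum>l\<in>{1..J}. P j l * u l)"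
    proof -
      have "(\<integral>\<omega>. (\<Sum>l\<in>{1..J}. u l * indicator (E l) \<omega>) \<partial>\<Omega>) = (\<Sum>l\<in>{1..J}. \<integral>\<omega>. u l * indicator (E l) \<omega> \<partial>\<Omega>)"
        using E by (intro Bochner_Integration.integral_sum integrable_mult_right integrable_real_indicator) (auto simp: emeasure_eq_measure)
      also have "\<dots> = (\<Sum>l\<in>{1..J}. P j l * u l)"
        using E PE by (intro sum.cong) (simp_all add: mult.commute)
      finally show ?thesis .
    qed
    have iu': "integrable \<Omega> (\<lambda>\<omega>. udest (rt j i \<omega>))"
      using iu ud by (subst Bochner_Integration.integrable_cong[OF refl ud]) auto
    have Iu': "(\<integral>\<omega>. udest (rt j i \<omega>) \<partial>\<Omega>) = u j + d j"
    proof -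
      have "(\<integral>\<omega>. udest (rt j i \<omega>) \<partial>\<Omega>) = (\<integral>\<omega>. (\<Sum>l\<in>{1..J}. u l * indicator (E l) \<omega>) \<partial>\<Omega>)"
        by (rule Bochner_Integration.integral_cong[OF refl ud])
      also have "\<dots> = u j + d j" unfolding Iu d_eq[OF j] by simp
      finally show ?thesis .
    qed
    show ?thesis using iu' Iu' prob_space by (simp add: prims_simps[OF j i] 3 zeta_def)
  qed
qed

text \<open>Whether event \<open>n\<close> takes place by time 1 is decided by the clocks before any
  primitive of that event is read, so the cutoff does not destroy the centring. The predictable
  factor, cutoff included, is collected in \<open>gate\<close>.\<close>

definition mterm :: "(nat \<Rightarrow> nat \<times> real \<times> real) \<Rightarrow> nat \<Rightarrow> 'a \<Rightarrow> real" where
  "mterm x n \<omega> = (if etime (Y \<omega>) x (Suc n) \<le> 1 then mart (Y \<omega>) (chain (Y \<omega>) x n) else 0)"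

definition gate :: "nat \<Rightarrow> nat \<Rightarrow> gjn_cfg \<Rightarrow> real" where
  "gate e j c = (if ctime c + delay c \<le> 1 \<and> evt c = (min e 1, j) then real (Suc M) * ppow M (pre c) else 0)"

lemma gate_meas: "gate e j \<in> borel_measurable cfgM"
proof -
  note [measurable] = measurable_ppow[OF measurable_pre, of M] measurable_evt_eq
  show ?thesis unfolding gate_def[abs_def] by measurable
qed

lemma gate_bound:
  assumes x: "x \<in> space (gjn_space J)" and w: "\<omega> \<in> space \<Omega>"
    and S: "\<And>N. etime (Y \<omega>) x N \<le> 1 \<Longrightarrow> B + 2 * Ucount (Y \<omega>) (chain (Y \<omega>) x N) \<le> S"
  shows "\<bar>gate e j (chain (Y \<omega>) x n)\<bar> \<le> real (Suc M) * (f0 x + S) ^ M"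
proof -
  note ok = state_ok_space[OF x] Y_ok[OF w]
  have S0: "0 \<le> S" using S[of 0] B_nonneg by simp
  show ?thesis
  proof (cases "etime (Y \<omega>) x (Suc n) \<le> 1")
    case True
    have "etime (Y \<omega>) x n \<le> 1" using etime_mono[OF ok, of n "Suc n"] True by simp
    then have "max (pre (chain (Y \<omega>) x n)) 0 \<le> f0 x + S"
      by (intro abs_pre_le[OF ok True] S)
    then have "ppow M (pre (chain (Y \<omega>) x n)) \<le> (f0 x + S) ^ M"
      unfolding ppow_def by (intro power_mono) auto
    then show ?thesis
      using f0_nonneg[of x] S0 by (auto simp: gate_def abs_mult intro!: mult_left_mono)
  next
    case False
    then show ?thesis using f0_nonneg[of x] S0 by (simp add: gate_def etime_Suc)
  qed
qed

text \<open>The index of the draw that is read is random. Summing over its possible values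
  \<open>i\<close> fixes it in each summand, so that \<open>fresh_expectation\<close> applies to one
  deterministic primitive at a time.\<close>

lemma mterm_eq_sum:
  "mterm x n \<omega> = (\<Sum>(e, j)\<in>{0, 1, 2} \<times> {1..J}. \<Sum>i\<in>{1..Suc n}.
     zeta e j (Y \<omega> (e, j, i)) * (if counter e j (chain (Y \<omega>) x n) = i then gate e j (chain (Y \<omega>) x n) else 0))"
proof -
  define c where "c = chain (Y \<omega>) x n"
  have cnt: "counter e j c \<in> {1..Suc n}" for e j
    using counter_le[of e j "Y \<omega>" x n] counters_pos[of "Y \<omega>" x n j] by (auto simp: c_def counter_def)
  have "(\<Sum>i\<in>{1..Suc n}. zeta e j (Y \<omega> (e, j, i)) * (if counter e j c = i then gate e j c else 0)) =
      (if ctime c + delay c \<le> 1 then real (Suc M) * ppow M (pre c) * (if evt c = (min e 1, j) then zeta e j (Y \<omega> (e, j, counter e j c)) else 0) else 0)" for e j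
  proof -
    have "(\<Sum>i\<in>{1..Suc n}. zeta e j (Y \<omega> (e, j, i)) * (if counter e j c = i then gate e j c else 0)) =
      (\<Sum>i\<in>{1..Suc n}. if i = counter e j c then zeta e j (Y \<omega> (e, j, i)) * gate e j c else 0)"
      by (intro sum.cong) auto
    also have "\<dots> = zeta e j (Y \<omega> (e, j, counter e j c)) * gate e j c"
      using cnt[of e j] by (subst sum.delta) auto
    finally show ?thesis by (simp add: gate_def mult.commute)
  qed
  then have "(\<Sum>(e, j)\<in>{0, 1, 2} \<times> {1..J}. \<Sum>i\<in>{1..Suc n}.
     zeta e j (Y \<omega> (e, j, i)) * (if counter e j c = i then gate e j c else 0)) =
     (\<Sum>(e, j)\<in>{0, 1, 2} \<times> {1..J}. if ctime c + delay c \<le> 1 then real (Suc M) * ppow M (pre c) * (if evt c = (min e 1, j) then zeta e j (Y \<omega> (e, j, counter e j c)) else 0) else 0)"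
    by (simp only:)
  also have "\<dots> = (if ctime c + delay c \<le> 1 then real (Suc M) * ppow M (pre c) * xi (Y \<omega>) c else 0)"
  proof (cases "ctime c + delay c \<le> 1")
    case True
    show ?thesis
      unfolding xi_eq_sum sum_distrib_left if_P[OF True] by (intro sum.cong) (auto simp only: case_prod_beta)
  next
    case False
    then show ?thesis by (auto intro!: sum.neutral)
  qed
  finally show ?thesis by (simp only: mterm_def mart_def etime_Suc c_def)
qed

lemma mterm_zero_mean:
  assumes x: "x \<in> space (gjn_space J)"
  shows "integrable \<Omega> (mterm x n) \<and> (\<integral>\<omega>. mterm x n \<omega> \<partial>\<Omega>) = 0"
proof -
  define D where "D e j i \<omega> = (if counter e j (chain (Y \<omega>) x n) = i then gate e j (chain (Y \<omega>) x n) else 0)" for e j i \<omega>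
  have *: "integrable \<Omega> (\<lambda>\<omega>. zeta e j (Y \<omega> (e, j, i)) * D e j i \<omega>) \<and> (\<integral>\<omega>. zeta e j (Y \<omega> (e, j, i)) * D e j i \<omega> \<partial>\<Omega>) = 0"
    if e: "e \<in> {0, 1, 2}" and j: "j \<in> {1..J}" and i: "i \<in> {1..Suc n}" for e j i
  proof -
    have q: "(e, j, i) \<in> prim_index J" using e j i by (auto simp: prim_index_def)
    have "integrable \<Omega> (D e j i)"
    proof (rule Bochner_Integration.integrable_bound)
      show "integrable \<Omega> (\<lambda>\<omega>. real (Suc M) * (f0 x + 1 * Sr \<omega>) ^ M)"
        using f0_nonneg[of x] by (intro integrable_mult_right add_Sr_integrable) auto
      show "D e j i \<in> borel_measurable \<Omega>"
      proof -
        note [measurable] = measurable_chain_Y[OF x measurable_counter[OF j]] measurable_chain_Y[OF x gate_meas]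
        show ?thesis unfolding D_def[abs_def] by measurable
      qed
      show "AE \<omega> in \<Omega>. norm (D e j i \<omega>) \<le> norm (real (Suc M) * (f0 x + 1 * Sr \<omega>) ^ M)"
        using AE_good[OF x]
      proof eventually_elim
        case (elim \<omega>)
        have "\<bar>gate e j (chain (Y \<omega>) x n)\<bar> \<le> real (Suc M) * (f0 x + Sr \<omega>) ^ M"
          using elim by (intro gate_bound[OF x]) force+
        moreover have "0 \<le> f0 x + Sr \<omega>" using f0_nonneg[of x] Sr_ge_1[of \<omega>] by simp
        ultimately show ?case by (simp add: D_def abs_mult del: of_nat_Suc)
      qed
    qed
    then show ?thesis
      unfolding D_def using zeta_mean[OF q]
      by (intro fresh_expectation[OF x q gate_meas zeta_meas]) auto
  qed
  have eq: "mterm x n = (\<lambda>\<omega>. \<Sum>z\<in>{0, 1, 2} \<times> {1..J}. \<Sum>i\<in>{1..Suc n}. zeta (fst z) (snd z) (Y \<omega> (fst z, snd z, i)) * D (fst z) (snd z) i \<omega>)"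
    by (intro ext) (simp only: mterm_eq_sum D_def case_prod_unfold)
  have i: "integrable \<Omega> (\<lambda>\<omega>. \<Sum>i\<in>{1..Suc n}. zeta (fst z) (snd z) (Y \<omega> (fst z, snd z, i)) * D (fst z) (snd z) i \<omega>)"
    if "z \<in> {0, 1, 2} \<times> {1..J}" for z
    using * that by (intro Bochner_Integration.integrable_sum) auto
  have "(\<integral>\<omega>. mterm x n \<omega> \<partial>\<Omega>) = (\<Sum>z\<in>{0, 1, 2} \<times> {1..J}. \<integral>\<omega>. (\<Sum>i\<in>{1..Suc n}. zeta (fst z) (snd z) (Y \<omega> (fst z, snd z, i)) * D (fst z) (snd z) i \<omega>) \<partial>\<Omega>)"
    unfolding eq by (rule Bochner_Integration.integral_sum) (rule i)
  also have "\<dots> = 0"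
  proof (rule sum.neutral, rule ballI)
    fix z assume z: "z \<in> {0::nat, 1, 2} \<times> {1..J}"
    have "(\<integral>\<omega>. (\<Sum>i\<in>{1..Suc n}. zeta (fst z) (snd z) (Y \<omega> (fst z, snd z, i)) * D (fst z) (snd z) i \<omega>) \<partial>\<Omega>) =
        (\<Sum>i\<in>{1..Suc n}. \<integral>\<omega>. zeta (fst z) (snd z) (Y \<omega> (fst z, snd z, i)) * D (fst z) (snd z) i \<omega> \<partial>\<Omega>)"
      using * z by (intro Bochner_Integration.integral_sum) auto
    also have "\<dots> = 0" using * z by (intro sum.neutral) auto
    finally show "(\<integral>\<omega>. (\<Sum>i\<in>{1..Suc n}. zeta (fst z) (snd z) (Y \<omega> (fst z, snd z, i)) * D (fst z) (snd z) i \<omega>) \<partial>\<Omega>) = 0" .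
  qed
  finally show ?thesis using i unfolding eq by (auto intro!: Bochner_Integration.integrable_sum)
qed

text \<open>The number of events within the unit interval is random and unbounded. This bound on the
  total variation, obtained by telescoping \<open>Ucount\<close>, is what allows expectation and the
  sum over events to be exchanged.\<close>

lemma mterm_abs_sum:
  assumes x: "x \<in> space (gjn_space J)" and w: "\<omega> \<in> space \<Omega>" "prim_div (Y \<omega>)"
    and S: "\<And>N. etime (Y \<omega>) x N \<le> 1 \<Longrightarrow> B + 2 * Ucount (Y \<omega>) (chain (Y \<omega>) x N) \<le> S"
  obtains N where "etime (Y \<omega>) x N \<le> 1" "1 < etime (Y \<omega>) x (Suc N)"
    "\<And>n. N \<le> n \<Longrightarrow> mterm x n \<omega> = 0" "\<And>n. n < N \<Longrightarrow> mterm x n \<omega> = mart (Y \<omega>) (chain (Y \<omega>) x n)"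
    "(\<Sum>n<N. \<bar>mterm x n \<omega>\<bar>) \<le> real (Suc M) * (f0 x + S) ^ M * S"
proof -
  note ok = state_ok_space[OF x] Y_ok[OF w(1)]
  obtain N where N: "etime (Y \<omega>) x N \<le> 1" "1 < etime (Y \<omega>) x (Suc N)"
    using last_event_exists'[OF ok w(2), of 1] by auto
  have early: "etime (Y \<omega>) x (Suc n) \<le> 1" if "n < N" for n
    using etime_mono[OF ok, of "Suc n" N] that N(1) by simp
  have S0: "0 \<le> S" using S[of 0] B_nonneg by simp
  have nn: "0 \<le> real (Suc M) * (f0 x + S) ^ M" using f0_nonneg[of x] S0 by simp
  have late: "mterm x n \<omega> = 0" if "N \<le> n" for n
  proof -
    have "etime (Y \<omega>) x (Suc N) \<le> etime (Y \<omega>) x (Suc n)" using that by (intro etime_mono[OF ok]) simp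
    then show ?thesis using N(2) by (simp add: mterm_def)
  qed
  have bnd: "\<bar>mterm x n \<omega>\<bar> \<le> real (Suc M) * (f0 x + S) ^ M * (Ucount (Y \<omega>) (chain (Y \<omega>) x (Suc n)) - Ucount (Y \<omega>) (chain (Y \<omega>) x n))"
    if n: "n < N" for n
  proof -
    define c where "c = chain (Y \<omega>) x n"
    have xi: "\<bar>xi (Y \<omega>) c\<bar> \<le> Ucount (Y \<omega>) (nstep (Y \<omega>) c) - Ucount (Y \<omega>) c"
      using counters_pos by (intro abs_xi_le[OF ok(2)]) (auto simp: c_def)
    have "etime (Y \<omega>) x n \<le> 1" using etime_mono[OF ok, of n N] n N(1) by simp
    then have "max (pre c) 0 \<le> f0 x + S" unfolding c_def by (intro abs_pre_le[OF ok early[OF n]] S)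
    then have "ppow M (pre c) \<le> (f0 x + S) ^ M" unfolding ppow_def by (intro power_mono) auto
    then have "real (Suc M) * ppow M (pre c) * \<bar>xi (Y \<omega>) c\<bar> \<le> real (Suc M) * (f0 x + S) ^ M * (Ucount (Y \<omega>) (nstep (Y \<omega>) c) - Ucount (Y \<omega>) c)"
      using xi nn by (intro mult_mono mult_left_mono) auto
    moreover have "\<bar>mterm x n \<omega>\<bar> = real (Suc M) * ppow M (pre c) * \<bar>xi (Y \<omega>) c\<bar>"
      using early[OF n] by (simp add: mterm_def mart_def abs_mult c_def)
    ultimately show ?thesis by (simp add: chain_Suc c_def)
  qed
  have "(\<Sum>n<N. \<bar>mterm x n \<omega>\<bar>) \<le> (\<Sum>n<N. real (Suc M) * (f0 x + S) ^ M * (Ucount (Y \<omega>) (chain (Y \<omega>) x (Suc n)) - Ucount (Y \<omega>) (chain (Y \<omega>) x n)))"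
    by (intro sum_mono bnd) simp
  also have "\<dots> = real (Suc M) * (f0 x + S) ^ M * Ucount (Y \<omega>) (chain (Y \<omega>) x N)"
    unfolding sum_distrib_left[symmetric] sum_lessThan_telescope[of "\<lambda>n. Ucount (Y \<omega>) (chain (Y \<omega>) x n)"] by simp
  also have "\<dots> \<le> real (Suc M) * (f0 x + S) ^ M * S"
    using S[OF N(1)] B_nonneg Ucount_chain_mono[OF ok(2), of 0 N x] by (intro mult_left_mono nn) auto
  finally show ?thesis using N late early by (intro that[of N]) (auto simp: mterm_def)
qed

text \<open>The partial sums of absolute values are dominated by a multiple of
  \<open>(f0 x + Sr) ^ (M + 1)\<close>, integrable by the moment of order \<open>M + 1\<close>;
  hence the centred terms may be summed under the integral.\<close>

lemma mterm_suminf: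
  assumes x: "x \<in> space (gjn_space J)"
  shows "integrable \<Omega> (\<lambda>\<omega>. \<Sum>n. mterm x n \<omega>) \<and> (\<integral>\<omega>. (\<Sum>n. mterm x n \<omega>) \<partial>\<Omega>) = 0"
proof -
  have i: "integrable \<Omega> (mterm x n)" for n using mterm_zero_mean[OF x] by blast
  have 1: "AE \<omega> in \<Omega>. summable (\<lambda>n. norm (mterm x n \<omega>))"
    using AE_good[OF x]
  proof eventually_elim
    case (elim \<omega>)
    from elim have w: "\<omega> \<in> space \<Omega>" "prim_div (Y \<omega>)"
      and S: "\<And>N. etime (Y \<omega>) x N \<le> 1 \<Longrightarrow> B + 2 * Ucount (Y \<omega>) (chain (Y \<omega>) x N) \<le> Sr \<omega>" by force+
    obtain N where N: "etime (Y \<omega>) x N \<le> 1" "1 < etime (Y \<omega>) x (Suc N)"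
      "\<And>n. N \<le> n \<Longrightarrow> mterm x n \<omega> = 0" "\<And>n. n < N \<Longrightarrow> mterm x n \<omega> = mart (Y \<omega>) (chain (Y \<omega>) x n)"
      "(\<Sum>n<N. \<bar>mterm x n \<omega>\<bar>) \<le> real (Suc M) * (f0 x + Sr \<omega>) ^ M * Sr \<omega>"
      using mterm_abs_sum[OF x w S] by metis
    show ?case by (rule summable_finite[of "{..<N}"]) (use N(3) in \<open>auto simp: not_less\<close>)
  qed
  define K where "K = (\<integral>\<omega>. real (Suc M) * (f0 x + 1 * Sr \<omega>) ^ (M + 1) \<partial>\<Omega>)"
  have iK: "integrable \<Omega> (\<lambda>\<omega>. real (Suc M) * (f0 x + 1 * Sr \<omega>) ^ (M + 1))"
    using f0_nonneg[of x] by (intro integrable_mult_right add_Sr_integrable) auto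
  have 2: "summable (\<lambda>n. \<integral>\<omega>. norm (mterm x n \<omega>) \<partial>\<Omega>)"
  proof (rule summableI_nonneg_bounded[of _ K])
    fix m
    have "(\<Sum>n<m. \<integral>\<omega>. norm (mterm x n \<omega>) \<partial>\<Omega>) = (\<integral>\<omega>. (\<Sum>n<m. norm (mterm x n \<omega>)) \<partial>\<Omega>)"
      using i by (subst Bochner_Integration.integral_sum) auto
    also have "\<dots> \<le> K"
      unfolding K_def
    proof (rule integral_mono_AE[OF _ iK])
      show "integrable \<Omega> (\<lambda>\<omega>. \<Sum>n<m. norm (mterm x n \<omega>))" using i by auto
      show "AE \<omega> in \<Omega>. (\<Sum>n<m. norm (mterm x n \<omega>)) \<le> real (Suc M) * (f0 x + 1 * Sr \<omega>) ^ (M + 1)"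
        using AE_good[OF x]
      proof eventually_elim
        case (elim \<omega>)
    from elim have w: "\<omega> \<in> space \<Omega>" "prim_div (Y \<omega>)"
      and S: "\<And>N. etime (Y \<omega>) x N \<le> 1 \<Longrightarrow> B + 2 * Ucount (Y \<omega>) (chain (Y \<omega>) x N) \<le> Sr \<omega>" by force+
    obtain N where N: "etime (Y \<omega>) x N \<le> 1" "1 < etime (Y \<omega>) x (Suc N)"
      "\<And>n. N \<le> n \<Longrightarrow> mterm x n \<omega> = 0" "\<And>n. n < N \<Longrightarrow> mterm x n \<omega> = mart (Y \<omega>) (chain (Y \<omega>) x n)"
      "(\<Sum>n<N. \<bar>mterm x n \<omega>\<bar>) \<le> real (Suc M) * (f0 x + Sr \<omega>) ^ M * Sr \<omega>"
      using mterm_abs_sum[OF x w S] by metis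
        have "(\<Sum>n<m. norm (mterm x n \<omega>)) \<le> (\<Sum>n\<in>{..<m} \<union> {..<N}. norm (mterm x n \<omega>))"
          by (intro sum_mono2) auto
        also have "\<dots> = (\<Sum>n<N. \<bar>mterm x n \<omega>\<bar>)"
          using N(3) by (intro sum.mono_neutral_cong_right) (auto simp: not_less)
        also have "\<dots> \<le> real (Suc M) * (f0 x + Sr \<omega>) ^ M * Sr \<omega>" by (rule N(5))
        also have "\<dots> \<le> real (Suc M) * (f0 x + Sr \<omega>) ^ M * (f0 x + Sr \<omega>)"
          using f0_nonneg[of x] Sr_ge_1[of \<omega>] by (intro mult_left_mono) auto
        finally show ?case by (simp add: mult_ac)
      qed
    qed
    finally show "(\<Sum>n<m. \<integral>\<omega>. norm (mterm x n \<omega>) \<partial>\<Omega>) \<le> K" .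
  qed simp
  show ?thesis
    using integrable_suminf[OF i 1 2] integral_suminf[OF i 1 2] mterm_zero_mean[OF x] by simp
qed

text \<open>The three summands come from the idle phases, from the shift of \<open>f\<close> by
  \<open>S\<close> in the negative drift, and from the second-order jump remainder.\<close>

definition Cp :: real where
  "Cp = real (Suc M) * ((B + 1) * 2 ^ M + 1 + real M * 4 ^ M)"

text \<open>Separates the random activity \<open>S\<close> from the state: each term becomes a
  function of the state times at most \<open>S ^ (M + 1)\<close>, so the expectation can be taken
  with the state fixed. In the jump remainder the exponent arises as
  \<open>(M - 1) + 2\<close>.\<close>

lemma remainder_le:
  fixes f W S :: real
  assumes "0 \<le> f" "0 \<le> W" "1 \<le> S"
  shows "real (Suc M) * ((B + eps) * (W + S) ^ M - eps * ppow M (f - S)) + real (Suc M) * real M * (f + 2 * S) ^ (M - 1) * S * S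
    \<le> Cp * (W ^ M + f ^ (M - 1) + 1) * S ^ (M + 1) - real (Suc M) / 2 ^ M * eps * f ^ M"
proof -
  have p1: "1 \<le> S ^ n" for n using assms(3) by simp
  have pm: "S ^ m \<le> S ^ (M + 1)" if "m \<le> M + 1" for m using that assms(3) by (intro power_increasing) auto
  define T where "T = (W ^ M + f ^ (M - 1) + 1) * S ^ (M + 1)"
  have fW: "0 \<le> W ^ M" "0 \<le> f ^ (M - 1)" using assms by auto
  have T1: "(W ^ M + 1) * S ^ (M + 1) \<le> T" "(f ^ (M - 1) + 1) * S ^ (M + 1) \<le> T" "S ^ (M + 1) \<le> T"
  proof -
    have s: "0 \<le> S ^ (M + 1)" using p1[of "M + 1"] by linarith
    show "(W ^ M + 1) * S ^ (M + 1) \<le> T" "(f ^ (M - 1) + 1) * S ^ (M + 1) \<le> T"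
      unfolding T_def using fW by (intro mult_right_mono s; simp)+
    have "1 * S ^ (M + 1) \<le> T" unfolding T_def using fW by (intro mult_right_mono s) simp
    then show "S ^ (M + 1) \<le> T" by simp
  qed
  have a1: "(W + S) ^ M \<le> 2 ^ M * T"
  proof -
    have "(W + S) ^ M \<le> 2 ^ M * (W ^ M + S ^ M)" using assms by (intro add_power_le) auto
    also have "\<dots> \<le> 2 ^ M * ((W ^ M + 1) * S ^ (M + 1))"
    proof (rule mult_left_mono)
      have "W ^ M * 1 \<le> W ^ M * S ^ (M + 1)" using fW p1 by (intro mult_left_mono)
      then show "W ^ M + S ^ M \<le> (W ^ M + 1) * S ^ (M + 1)"
        using pm[of M] unfolding distrib_right by linarith
    qed simp
    also have "\<dots> \<le> 2 ^ M * T" using T1(1) by (intro mult_left_mono) auto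
    finally show ?thesis .
  qed
  have a2: "- ppow M (f - S) \<le> T - f ^ M / 2 ^ M"
  proof -
    have "f ^ M \<le> (max (f - S) 0 + S) ^ M" using assms by (intro power_mono) auto
    also have "\<dots> \<le> 2 ^ M * (max (f - S) 0 ^ M + S ^ M)" using assms by (intro add_power_le) auto
    finally have "f ^ M / 2 ^ M \<le> ppow M (f - S) + S ^ M" by (simp add: ppow_def field_simps)
    then show ?thesis using pm[of M] T1(3) by linarith
  qed
  have a3: "(f + 2 * S) ^ (M - 1) * S * S \<le> 4 ^ M * T"
  proof -
    have S2: "0 \<le> S * S" using assms by simp
    have "(f + 2 * S) ^ (M - 1) * (S * S) \<le> 2 ^ (M - 1) * (f ^ (M - 1) + (2 * S) ^ (M - 1)) * (S * S)"
      using assms by (intro mult_right_mono add_power_le S2) auto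
    also have "\<dots> = 2 ^ (M - 1) * (f ^ (M - 1) * S ^ 2) + 2 ^ (M - 1) * 2 ^ (M - 1) * S ^ (M + 1)"
    proof -
      have "S ^ (M + 1) = S ^ (M - 1) * (S * S)" using M by (cases M) auto
      then show ?thesis by (simp only: power_mult_distrib power2_eq_square) (simp only: algebra_simps)
    qed
    also have "\<dots> \<le> 4 ^ M * (f ^ (M - 1) * S ^ (M + 1)) + 4 ^ M * S ^ (M + 1)"
    proof -
      have "(2::real) ^ (M - 1) \<le> 4 ^ M"
        by (rule order_trans[OF power_increasing[of "M - 1" M 2] power_mono[of 2 4 M]]) auto
      moreover have "f ^ (M - 1) * S ^ 2 \<le> f ^ (M - 1) * S ^ (M + 1)"
        using pm[of 2] M fW by (intro mult_left_mono) auto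
      moreover have "(2::real) ^ (M - 1) * 2 ^ (M - 1) \<le> 4 ^ M"
      proof -
        have "(2::real) ^ (M - 1) * 2 ^ (M - 1) = 4 ^ (M - 1)" unfolding power_mult_distrib[symmetric] by simp
        also have "\<dots> \<le> (4::real) ^ M" by (rule power_increasing) auto
        finally show ?thesis .
      qed
      ultimately have "2 ^ (M - 1) * (f ^ (M - 1) * S ^ 2) \<le> 4 ^ M * (f ^ (M - 1) * S ^ (M + 1))"
        "2 ^ (M - 1) * 2 ^ (M - 1) * S ^ (M + 1) \<le> 4 ^ M * S ^ (M + 1)"
        using assms fW by (rule_tac mult_mono; simp)+
      then show ?thesis by (rule add_mono)
    qed
    also have "\<dots> = 4 ^ M * ((f ^ (M - 1) + 1) * S ^ (M + 1))" by (simp add: distrib_right distrib_left)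
    also have "\<dots> \<le> 4 ^ M * T" using T1(2) by (intro mult_left_mono) auto
    finally show ?thesis by (simp add: mult.assoc)
  qed
  have T0: "0 \<le> T" using T1(3) p1[of "M + 1"] by linarith
  have "(B + eps) * (W + S) ^ M \<le> (B + 1) * (2 ^ M * T)"
    using a1 B_nonneg eps1 eps assms by (intro mult_mono) auto
  moreover have "eps * - ppow M (f - S) \<le> eps * (T - f ^ M / 2 ^ M)"
    using a2 eps by (rule mult_left_mono)
  moreover have "eps * T \<le> 1 * T" using eps1 T0 by (rule mult_right_mono)
  ultimately have "(B + eps) * (W + S) ^ M - eps * ppow M (f - S) \<le> (B + 1) * 2 ^ M * T + T - eps * (f ^ M / 2 ^ M)"
    by (simp add: right_diff_distrib)
  moreover have "real M * ((f + 2 * S) ^ (M - 1) * S * S) \<le> real M * (4 ^ M * T)"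
    using a3 by (rule mult_left_mono) simp
  ultimately have "((B + eps) * (W + S) ^ M - eps * ppow M (f - S)) + real M * ((f + 2 * S) ^ (M - 1) * S * S)
     \<le> ((B + 1) * 2 ^ M + 1 + real M * 4 ^ M) * T - eps * (f ^ M / 2 ^ M)"
    by (simp add: distrib_right)
  then have "real (Suc M) * (((B + eps) * (W + S) ^ M - eps * ppow M (f - S)) + real M * ((f + 2 * S) ^ (M - 1) * S * S))
     \<le> real (Suc M) * (((B + 1) * 2 ^ M + 1 + real M * 4 ^ M) * T - eps * (f ^ M / 2 ^ M))"
    by (rule mult_left_mono) simp
  moreover have "real (Suc M) * (((B + 1) * 2 ^ M + 1 + real M * 4 ^ M) * T - eps * (f ^ M / 2 ^ M)) =
      Cp * (W ^ M + f ^ (M - 1) + 1) * S ^ (M + 1) - real (Suc M) / 2 ^ M * eps * f ^ M"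
    unfolding Cp_def T_def by (simp only: right_diff_distrib mult.assoc times_divide_eq_left times_divide_eq_right)
  ultimately show ?thesis by (simp only: distrib_left mult.assoc)
qed

lemma Cp_nonneg: "0 \<le> Cp"
  using B_nonneg by (simp add: Cp_def)

text \<open>In the path bound the sum of first-order jump terms has mean zero and the powers of
  \<open>Sr\<close> integrate to a constant. The negative drift stands on the left so that no
  subtraction of extended reals occurs.\<close>

lemma drift_expectation:
  assumes x: "x \<in> space (gjn_space J)"
  shows "(\<integral>\<^sup>+\<omega>. ennreal (ppow (Suc M) (FX (netX (Y \<omega>) x 1))) \<partial>\<Omega>) + ennreal (real (Suc M) / 2 ^ M * eps * f0 x ^ M)
    \<le> ennreal (ppow (Suc M) (FX x) + Cp * (\<integral>\<omega>. Sr \<omega> ^ (M + 1) \<partial>\<Omega>) * (W0 x ^ M + f0 x ^ (M - 1) + 1))"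
proof -
  define V where "V = ppow (Suc M) (FX x)"
  define L where "L = W0 x ^ M + f0 x ^ (M - 1) + 1"
  define a where "a = real (Suc M) / 2 ^ M * eps * f0 x ^ M"
  define G where "G \<omega> = V - a + Cp * L * Sr \<omega> ^ (M + 1) + (\<Sum>n. mterm x n \<omega>)" for \<omega>
  have W0: "0 \<le> W0 x" by (rule W0_nonneg[OF state_ok_space[OF x]])
  have a0: "0 \<le> a" using eps f0_nonneg[of x] by (simp add: a_def)
  have iS: "integrable \<Omega> (\<lambda>\<omega>. Sr \<omega> ^ (M + 1))" by (rule Sr_integrable) simp
  have iG: "integrable \<Omega> G"
    unfolding G_def using iS mterm_suminf[OF x]
    by (intro Bochner_Integration.integrable_add integrable_mult_right integrable_const) auto
  have IG: "(\<integral>\<omega>. G \<omega> \<partial>\<Omega>) = V - a + Cp * L * (\<integral>\<omega>. Sr \<omega> ^ (M + 1) \<partial>\<Omega>)"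
    unfolding G_def using iS mterm_suminf[OF x] prob_space by (simp del: power_Suc)
  have le: "AE \<omega> in \<Omega>. ppow (Suc M) (FX (netX (Y \<omega>) x 1)) \<le> G \<omega>"
    using AE_good[OF x]
  proof eventually_elim
    case (elim \<omega>)
    note ok = state_ok_space[OF x] Y_ok[OF conjunct1[OF elim]]
    from elim have w: "\<omega> \<in> space \<Omega>" "prim_div (Y \<omega>)"
      and S: "\<And>N. etime (Y \<omega>) x N \<le> 1 \<Longrightarrow> B + 2 * Ucount (Y \<omega>) (chain (Y \<omega>) x N) \<le> Sr \<omega>" by force+
    obtain N where N: "etime (Y \<omega>) x N \<le> 1" "1 < etime (Y \<omega>) x (Suc N)"
      "\<And>n. N \<le> n \<Longrightarrow> mterm x n \<omega> = 0" "\<And>n. n < N \<Longrightarrow> mterm x n \<omega> = mart (Y \<omega>) (chain (Y \<omega>) x n)"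
      "(\<Sum>n<N. \<bar>mterm x n \<omega>\<bar>) \<le> real (Suc M) * (f0 x + Sr \<omega>) ^ M * Sr \<omega>"
      using mterm_abs_sum[OF x w S] by metis
    have sum: "(\<Sum>n. mterm x n \<omega>) = (\<Sum>m<N. mart (Y \<omega>) (chain (Y \<omega>) x m))"
      using N(3,4) by (subst suminf_finite[of "{..<N}"]) (auto simp: not_less)
    have U: "Ucount (Y \<omega>) (chain (Y \<omega>) x N) \<le> Sr \<omega>"
      using S[OF N(1)] B_nonneg Ucount_chain_mono[OF ok(2), of 0 N x] by simp
    have "ppow (Suc M) (FX (netX (Y \<omega>) x 1)) \<le> V + driftb x (Sr \<omega>) + (\<Sum>n. mterm x n \<omega>)
       + real (Suc M) * real M * (f0 x + 2 * Sr \<omega>) ^ (M - 1) * Sr \<omega> * Ucount (Y \<omega>) (chain (Y \<omega>) x N)"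
      unfolding sum V_def by (rule path_bound[OF ok N(1,2) S[OF N(1)]])
    also have "\<dots> \<le> V + driftb x (Sr \<omega>) + (\<Sum>n. mterm x n \<omega>)
       + real (Suc M) * real M * (f0 x + 2 * Sr \<omega>) ^ (M - 1) * Sr \<omega> * Sr \<omega>"
      using U f0_nonneg[of x] Sr_ge_1[of \<omega>] by (intro add_left_mono mult_left_mono) auto
    also have "\<dots> \<le> G \<omega>"
      using remainder_le[OF f0_nonneg[of x] W0 Sr_ge_1[of \<omega>]] by (simp add: G_def driftb_def L_def a_def)
    finally show ?case .
  qed
  have "(\<integral>\<^sup>+\<omega>. ennreal (ppow (Suc M) (FX (netX (Y \<omega>) x 1))) \<partial>\<Omega>) \<le> (\<integral>\<^sup>+\<omega>. ennreal (G \<omega>) \<partial>\<Omega>)"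
    by (rule nn_integral_mono_AE) (use le in \<open>eventually_elim, auto intro: ennreal_leI\<close>)
  also have "\<dots> = ennreal (\<integral>\<omega>. G \<omega> \<partial>\<Omega>)"
    by (rule nn_integral_eq_integral[OF iG]) (use le in \<open>eventually_elim, auto intro: order_trans[OF ppow_nonneg]\<close>)
  finally have 1: "(\<integral>\<^sup>+\<omega>. ennreal (ppow (Suc M) (FX (netX (Y \<omega>) x 1))) \<partial>\<Omega>) \<le> ennreal (\<integral>\<omega>. G \<omega> \<partial>\<Omega>)" .
  have G0: "0 \<le> (\<integral>\<omega>. G \<omega> \<partial>\<Omega>)"
    by (rule integral_nonneg_AE) (use le in \<open>eventually_elim, auto intro: order_trans[OF ppow_nonneg]\<close>)
  have "(\<integral>\<^sup>+\<omega>. ennreal (ppow (Suc M) (FX (netX (Y \<omega>) x 1))) \<partial>\<Omega>) + ennreal a \<le> ennreal (\<integral>\<omega>. G \<omega> \<partial>\<Omega>) + ennreal a"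
    using 1 by (rule add_right_mono)
  also have "\<dots> = ennreal ((\<integral>\<omega>. G \<omega> \<partial>\<Omega>) + a)" using G0 a0 by simp
  also have "(\<integral>\<omega>. G \<omega> \<partial>\<Omega>) + a = V + Cp * (\<integral>\<omega>. Sr \<omega> ^ (M + 1) \<partial>\<Omega>) * L"
    unfolding IG by simp
  finally show ?thesis by (simp only: V_def a_def L_def)
qed

end

subsection \<open>Residual times\<close>

context gjn_rates
begin

lemma cre_chain:
  assumes ok: "state_ok x" "prim_ok p" and j: "j \<in> {1..J}" "0 < \<alpha> j"
  shows "(cne (chain p x n) j = 1 \<and> cre (chain p x n) j = fst (snd (x j)) - etime p x n) \<or>
     (2 \<le> cne (chain p x n) j \<and> cre (chain p x n) j \<le> p (0, j, cne (chain p x n) j - 1) / \<alpha> j)"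
proof (induction n)
  case 0
  then show ?case by (simp add: gjn_init_def)
next
  case (Suc n)
  define c where "c = chain p x n"
  have d: "0 \<le> delay c" using delay_nonneg[OF cfg_ok_chain[OF ok]] by (simp add: c_def)
  have cnt: "1 \<le> cne c j" using counters_pos by (simp add: c_def)
  have IH: "(cne c j = 1 \<and> cre c j = fst (snd (x j)) - ctime c) \<or> (2 \<le> cne c j \<and> cre c j \<le> p (0, j, cne c j - 1) / \<alpha> j)"
    using Suc by (simp add: c_def)
  show ?case
  proof (cases "evt c = (0, j)")
    case True
    then have "cne (nstep p c) j = cne c j + 1" "cre (nstep p c) j = p (0, j, cne c j) / \<alpha> j"
      by (simp_all add: nstep_def upd_def Let_def)
    then show ?thesis using cnt by (simp add: chain_Suc c_def)
  next
    case False
    then have "cne (nstep p c) j = cne c j" "cre (nstep p c) j = cre c j - delay c"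
      using j by (cases rule: step_cases[of c p]; auto)+
    then show ?thesis using IH d unfolding chain_Suc c_def[symmetric] by auto
  qed
qed

text \<open>Before the first completion only an upper bound is available in general, because the
  clock of an idle station may be frozen. A station busy at time 0 stays busy until its first
  completion, and then the decrease is exact.\<close>

lemma crs_chain:
  assumes ok: "state_ok x" "prim_ok p" and j: "j \<in> {1..J}"
  shows "(cns (chain p x n) j = 1 \<and> crs (chain p x n) j \<le> snd (snd (x j)) \<and>
       (0 < fst (x j) \<longrightarrow> 0 < cz (chain p x n) j \<and> crs (chain p x n) j = snd (snd (x j)) - etime p x n)) \<or>
     (2 \<le> cns (chain p x n) j \<and> crs (chain p x n) j \<le> p (1, j, cns (chain p x n) j - 1) / \<mu> j)"
proof (induction n)
  case 0
  then show ?case by (simp add: gjn_init_def)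
next
  case (Suc n)
  define c where "c = chain p x n"
  have d: "0 \<le> delay c" using delay_nonneg[OF cfg_ok_chain[OF ok]] by (simp add: c_def)
  have cnt: "1 \<le> cns c j" using counters_pos by (simp add: c_def)
  have IH: "(cns c j = 1 \<and> crs c j \<le> snd (snd (x j)) \<and>
       (0 < fst (x j) \<longrightarrow> 0 < cz c j \<and> crs c j = snd (snd (x j)) - ctime c)) \<or>
     (2 \<le> cns c j \<and> crs c j \<le> p (1, j, cns c j - 1) / \<mu> j)"
    using Suc by (simp add: c_def)
  show ?case
  proof (cases "evt c = (1, j)")
    case True
    then have "cns (nstep p c) j = cns c j + 1" "crs (nstep p c) j = p (1, j, cns c j) / \<mu> j"
      by (simp_all add: nstep_def upd_def Let_def)
    then show ?thesis using cnt by (simp add: chain_Suc c_def)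
  next
    case False
    then have 1: "cns (nstep p c) j = cns c j" "crs (nstep p c) j = crs c j - (if 0 < cz c j then delay c else 0)"
      using j by (cases rule: step_cases[of c p]; auto)+
    have 2: "0 < cz c j \<Longrightarrow> 0 < cz (nstep p c) j"
      using False by (cases rule: step_cases[of c p]) auto
    show ?thesis using IH d 2 unfolding chain_Suc c_def[symmetric] 1 by (cases "0 < cz c j") auto
  qed
qed

lemma draw_le_sum:
  fixes t :: "nat \<Rightarrow> real"
  assumes "2 \<le> n" "\<And>i. 1 \<le> i \<Longrightarrow> 0 \<le> t i"
  shows "t (n - 1) \<le> (\<Sum>m\<in>{1..<n}. 1 + t m)"
proof -
  have "1 + t (n - 1) \<le> (\<Sum>m\<in>{1..<n}. 1 + t m)"
    using assms by (intro member_le_sum) auto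
  then show ?thesis by simp
qed

end

text \<open>Drift of the Lyapunov function \<open>R ^ Suc n\<close> for a clock that runs down by
  one unit: the loss \<open>R ^ n\<close> comes from writing \<open>R ^ Suc n - R ^ n\<close> as
  \<open>(R - 1) * R ^ n\<close>.\<close>

lemma power_Suc_drop_le:
  fixes R :: real
  assumes "0 \<le> R"
  shows "max (R - 1) 0 ^ Suc n + R ^ n \<le> R ^ Suc n + 1"
proof (cases "1 \<le> R")
  case True
  have "(R - 1) * (R - 1) ^ n \<le> (R - 1) * R ^ n"
    using True by (intro mult_left_mono power_mono) auto
  then show ?thesis using True by (simp add: algebra_simps)
next
  case False
  then have "R ^ n \<le> 1" using assms by (intro power_le_one) auto
  moreover have "max (R - 1) 0 ^ Suc n = 0" using False by simp
  moreover have "0 \<le> R ^ Suc n" using assms by simp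
  ultimately show ?thesis by linarith
qed

lemma renewal_sum_cong:
  assumes "\<And>i. 1 \<le> i \<Longrightarrow> s i = t i"
  shows "renewal_sum s \<kappa> = renewal_sum t \<kappa>"
proof -
  have "(\<Sum>i\<in>{1..<Suc m}. s i) = (\<Sum>i\<in>{1..<Suc m}. t i)" "s (Suc m) = t (Suc m)" for m
    using assms by (auto intro: sum.cong)
  then show ?thesis unfolding renewal_sum_def by (simp only:)
qed

context gjn_net
begin

lemma resid_moment:
  fixes R1 :: "'a \<Rightarrow> real" and E :: "'a \<Rightarrow> ennreal"
  assumes E: "E \<in> borel_measurable \<Omega>" and l: "0 < l" and A: "0 \<le> A"
    and fin: "(\<integral>\<^sup>+\<omega>. E \<omega> ^ n \<partial>\<Omega>) = ennreal m" "0 \<le> m"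
    and le: "AE \<omega> in \<Omega>. 0 \<le> R1 \<omega> \<and> (R1 \<omega> \<le> A \<or> ennreal (l * R1 \<omega>) \<le> E \<omega>)"
  shows "(\<integral>\<^sup>+\<omega>. ennreal (R1 \<omega> ^ n) \<partial>\<Omega>) \<le> ennreal (A ^ n + m / l ^ n)"
proof -
  have "(\<integral>\<^sup>+\<omega>. ennreal (R1 \<omega> ^ n) \<partial>\<Omega>) \<le> (\<integral>\<^sup>+\<omega>. ennreal (A ^ n) + ennreal (1 / l ^ n) * E \<omega> ^ n \<partial>\<Omega>)"
  proof (rule nn_integral_mono_AE)
    show "AE \<omega> in \<Omega>. ennreal (R1 \<omega> ^ n) \<le> ennreal (A ^ n) + ennreal (1 / l ^ n) * E \<omega> ^ n"
      using le
    proof eventually_elim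
      case (elim \<omega>)
      show ?case
      proof (cases "R1 \<omega> \<le> A")
        case True
        then have "ennreal (R1 \<omega> ^ n) \<le> ennreal (A ^ n)" using elim by (intro ennreal_leI power_mono) auto
        then show ?thesis by (simp add: add_increasing2)
      next
        case False
        then have "ennreal (l * R1 \<omega>) \<le> E \<omega>" using elim by auto
        then have "ennreal (l * R1 \<omega>) ^ n \<le> E \<omega> ^ n" by (intro power_mono) auto
        then have "ennreal (1 / l ^ n) * ennreal (l * R1 \<omega>) ^ n \<le> ennreal (1 / l ^ n) * E \<omega> ^ n"
          by (intro mult_left_mono) auto
        moreover have "ennreal (1 / l ^ n) * ennreal (l * R1 \<omega>) ^ n = ennreal (R1 \<omega> ^ n)"
          using l elim by (simp add: ennreal_power ennreal_mult[symmetric] power_mult_distrib)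
        ultimately show ?thesis by (simp add: add_increasing)
      qed
    qed
  qed
  also have "\<dots> = ennreal (A ^ n) + ennreal (1 / l ^ n) * ennreal m"
    using E fin by (subst nn_integral_add) (auto simp: nn_integral_cmult emeasure_space_1)
  also have "\<dots> = ennreal (A ^ n + m / l ^ n)"
    using A l fin(2) by (simp add: ennreal_mult[symmetric] ennreal_plus)
  finally show ?thesis .
qed

lemma ext_resid_bound:
  assumes st: "gjn_stationary \<Omega> J \<alpha> \<mu> Te Ts rt \<pi>" and j: "j \<in> {1..J}" "0 < \<alpha> j"
    and fin: "(\<integral>\<^sup>+\<omega>. renewal_sum (\<lambda>i. Te j i \<omega>) (\<alpha> j) ^ Suc n \<partial>\<Omega>) = ennreal m" "0 \<le> m"
  shows "(\<integral>\<^sup>+x. ennreal (fst (snd (x j)) ^ n) \<partial>\<pi>) \<le> ennreal (1 + m / \<alpha> j ^ Suc n)"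
proof -
  define K where "K = 1 + m / \<alpha> j ^ Suc n"
  have K: "0 \<le> K" using fin j by (simp add: K_def)
  note parts = measurable_gjn_space_parts[OF j(1) measurable_ident_sets[OF refl]]
  have "(\<integral>\<^sup>+x. ennreal (fst (snd (x j)) ^ n) \<partial>\<pi>) \<le> (\<integral>\<^sup>+x. ennreal K \<partial>\<pi>)"
  proof (rule stationary_drift[OF st, where V = "\<lambda>x. fst (snd (x j)) ^ Suc n"])
    show "(\<lambda>x. fst (snd (x j)) ^ Suc n) \<in> borel_measurable (gjn_space J)"
      "(\<lambda>x. fst (snd (x j)) ^ n) \<in> borel_measurable (gjn_space J)"
      by (rule borel_measurable_power[OF parts(2)])+
    fix x assume x: "x \<in> space (gjn_space J)"
    note sx = state_ok_space[OF x]
    have R: "0 \<le> fst (snd (x j))" using sx j by (auto simp: state_ok_def)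
    then show "0 \<le> fst (snd (x j)) ^ Suc n" "0 \<le> fst (snd (x j)) ^ n" by auto
    have "(\<integral>\<^sup>+\<omega>. ennreal (fst (snd (netX (Y \<omega>) x 1 j)) ^ Suc n) \<partial>\<Omega>) \<le>
        ennreal (max (fst (snd (x j)) - 1) 0 ^ Suc n + m / \<alpha> j ^ Suc n)"
    proof (rule resid_moment[OF _ j(2) _ fin])
      show "(\<lambda>\<omega>. renewal_sum (\<lambda>i. Te j i \<omega>) (\<alpha> j)) \<in> borel_measurable \<Omega>"
        by (rule borel_measurable_renewal_sum) (rule Te_meas[OF j(1)])
      show "AE \<omega> in \<Omega>. 0 \<le> fst (snd (netX (Y \<omega>) x 1 j)) \<and> (fst (snd (netX (Y \<omega>) x 1 j)) \<le> max (fst (snd (x j)) - 1) 0 \<or>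
          ennreal (\<alpha> j * fst (snd (netX (Y \<omega>) x 1 j))) \<le> renewal_sum (\<lambda>i. Te j i \<omega>) (\<alpha> j))"
        using AE_prim_div AE_space
      proof eventually_elim
        case (elim \<omega>)
        define p where "p = Y \<omega>"
        note ok = sx Y_ok[OF elim(2), folded p_def]
        obtain N where N: "etime p x N \<le> 1" "1 < etime p x (Suc N)"
          using last_event_exists'[OF ok, of 1] elim(1) by (auto simp: p_def)
        define c where "c = chain p x N"
        have R1: "fst (snd (netX p x 1 j)) = cre c j - (1 - ctime c)"
          unfolding netX_eq[OF ok N] using j by (simp add: obs_def c_def)
        have nn: "0 \<le> fst (snd (netX p x 1 j))"
          using state_ok_space[OF netX_in_space[OF x ok(2), of 1]] j by (auto simp: state_ok_def)
        consider "cne c j = 1" "cre c j = fst (snd (x j)) - ctime c" | "2 \<le> cne c j" "cre c j \<le> p (0, j, cne c j - 1) / \<alpha> j"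
          using cre_chain[OF ok j, of N] by (auto simp: c_def)
        then have "fst (snd (netX p x 1 j)) \<le> max (fst (snd (x j)) - 1) 0 \<or>
          ennreal (\<alpha> j * fst (snd (netX p x 1 j))) \<le> renewal_sum (\<lambda>i. p (0, j, i)) (\<alpha> j)"
        proof cases
          case 1
          then show ?thesis using R1 by simp
        next
          case 2
          have "fst (snd (netX p x 1 j)) \<le> cre c j" using R1 N(1) by (simp add: c_def)
          also have "\<dots> \<le> p (0, j, cne c j - 1) / \<alpha> j" by (rule 2(2))
          finally have "\<alpha> j * fst (snd (netX p x 1 j)) \<le> p (0, j, cne c j - 1)"
            using j by (simp add: pos_le_divide_eq mult.commute)
          also have "\<dots> \<le> (\<Sum>m\<in>{1..<cne c j}. 1 + p (0, j, m))"
            using 2(1) ok(2) j by (intro draw_le_sum) (auto simp: prim_ok_def)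
          finally have "ennreal (\<alpha> j * fst (snd (netX p x 1 j))) \<le> ennreal (\<Sum>m\<in>{1..<cne c j}. 1 + p (0, j, m))"
            by (rule ennreal_leI)
          also have "\<dots> \<le> renewal_sum (\<lambda>i. p (0, j, i)) (\<alpha> j)"
            unfolding c_def by (rule ext_draws_le[OF ok N(1) j(1) order_refl])
          finally show ?thesis ..
        qed
        moreover have "renewal_sum (\<lambda>i. p (0, j, i)) (\<alpha> j) = renewal_sum (\<lambda>i. Te j i \<omega>) (\<alpha> j)"
          unfolding p_def using j by (intro renewal_sum_cong) (simp add: prims_simps)
        ultimately show ?case using nn unfolding p_def by simp
      qed
    qed simp
    then have "(\<integral>\<^sup>+\<omega>. ennreal (fst (snd (netX (Y \<omega>) x 1 j)) ^ Suc n) \<partial>\<Omega>) + ennreal (fst (snd (x j)) ^ n) \<le>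
        ennreal (max (fst (snd (x j)) - 1) 0 ^ Suc n + m / \<alpha> j ^ Suc n) + ennreal (fst (snd (x j)) ^ n)"
      by (rule add_right_mono)
    also have "\<dots> = ennreal (max (fst (snd (x j)) - 1) 0 ^ Suc n + m / \<alpha> j ^ Suc n + fst (snd (x j)) ^ n)"
      using R fin j by (intro ennreal_plus[symmetric]) auto
    also have "\<dots> \<le> ennreal (fst (snd (x j)) ^ Suc n + K)"
      using power_Suc_drop_le[OF R, of n] by (intro ennreal_leI) (simp add: K_def)
    finally show "(\<integral>\<^sup>+\<omega>. ennreal (fst (snd (netX (Y \<omega>) x 1 j)) ^ Suc n) \<partial>\<Omega>) + ennreal (fst (snd (x j)) ^ n) \<le>
      ennreal (fst (snd (x j)) ^ Suc n + K)" .
  qed (use K in auto)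
  also have "\<dots> = ennreal K"
    using st prob_space.emeasure_space_1[of \<pi>] by (simp add: gjn_stationary_def)
  finally show ?thesis by (simp add: K_def)
qed

text \<open>After one unit of time the residual is either a fresh draw, dominated by the renewal
  sum, or the old one: reduced by the full unit if the station was busy, possibly frozen if it was
  idle. Only busy states therefore earn drift. The rate \<open>l\<close> below
  \<open>\<mu> j\<close> and the level \<kappa> above it make the bound uniform over service
  rates.\<close>

lemma srv_resid_busy_bound:
  assumes st: "gjn_stationary \<Omega> J \<alpha> \<mu> Te Ts rt \<pi>" and j: "j \<in> {1..J}"
    and l: "0 < l" "l \<le> \<mu> j" and \<kappa>: "\<mu> j \<le> \<kappa>"
    and fin: "(\<integral>\<^sup>+\<omega>. renewal_sum (\<lambda>i. Ts j i \<omega>) \<kappa> ^ Suc n \<partial>\<Omega>) = ennreal m" "0 \<le> m"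
  shows "(\<integral>\<^sup>+x. ennreal (if 0 < fst (x j) then snd (snd (x j)) ^ n else 0) \<partial>\<pi>) \<le> ennreal (1 + m / l ^ Suc n)"
proof -
  define K where "K = 1 + m / l ^ Suc n"
  have K: "0 \<le> K" using fin l by (simp add: K_def)
  note parts = measurable_gjn_space_parts[OF j measurable_ident_sets[OF refl]]
  have "(\<integral>\<^sup>+x. ennreal (if 0 < fst (x j) then snd (snd (x j)) ^ n else 0) \<partial>\<pi>) \<le> (\<integral>\<^sup>+x. ennreal K \<partial>\<pi>)"
  proof (rule stationary_drift[OF st, where V = "\<lambda>x. snd (snd (x j)) ^ Suc n"])
    show "(\<lambda>x. snd (snd (x j)) ^ Suc n) \<in> borel_measurable (gjn_space J)"
      using parts(3) by (intro borel_measurable_power)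
    have "Measurable.pred (gjn_space J) (\<lambda>x. 0 < fst (x j))"
      by (rule measurable_compose[OF parts(1)]) simp
    then show "(\<lambda>x. if 0 < fst (x j) then snd (snd (x j)) ^ n else 0) \<in> borel_measurable (gjn_space J)"
      using parts(3) by (intro measurable_If borel_measurable_power) (auto simp: pred_def)
    fix x assume x: "x \<in> space (gjn_space J)"
    note sx = state_ok_space[OF x]
    define R where "R = snd (snd (x j))"
    define b where "b = (if 0 < fst (x j) then max (R - 1) 0 else R)"
    have R: "0 \<le> R" using sx j by (auto simp: state_ok_def R_def)
    then show "0 \<le> snd (snd (x j)) ^ Suc n" "0 \<le> (if 0 < fst (x j) then snd (snd (x j)) ^ n else 0)" by (auto simp: R_def)
    have b: "0 \<le> b" using R by (simp add: b_def)
    have "(\<integral>\<^sup>+\<omega>. ennreal (snd (snd (netX (Y \<omega>) x 1 j)) ^ Suc n) \<partial>\<Omega>) \<le> ennreal (b ^ Suc n + m / l ^ Suc n)"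
    proof (rule resid_moment[OF _ l(1) b fin])
      show "(\<lambda>\<omega>. renewal_sum (\<lambda>i. Ts j i \<omega>) \<kappa>) \<in> borel_measurable \<Omega>"
        by (rule borel_measurable_renewal_sum) (rule Ts_meas[OF j])
      show "AE \<omega> in \<Omega>. 0 \<le> snd (snd (netX (Y \<omega>) x 1 j)) \<and> (snd (snd (netX (Y \<omega>) x 1 j)) \<le> b \<or>
          ennreal (l * snd (snd (netX (Y \<omega>) x 1 j))) \<le> renewal_sum (\<lambda>i. Ts j i \<omega>) \<kappa>)"
        using AE_prim_div AE_space
      proof eventually_elim
        case (elim \<omega>)
        define p where "p = Y \<omega>"
        note ok = sx Y_ok[OF elim(2), folded p_def]
        obtain N where N: "etime p x N \<le> 1" "1 < etime p x (Suc N)"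
          using last_event_exists'[OF ok, of 1] elim(1) by (auto simp: p_def)
        define c where "c = chain p x N"
        define R1 where "R1 = snd (snd (netX p x 1 j))"
        have R1: "R1 = (if 0 < cz c j then crs c j - (1 - ctime c) else crs c j)"
          unfolding R1_def netX_eq[OF ok N] using j by (simp add: obs_def c_def)
        have le: "R1 \<le> crs c j" using R1 N(1) by (simp add: c_def)
        have nn: "0 \<le> R1"
          using state_ok_space[OF netX_in_space[OF x ok(2), of 1]] j by (auto simp: state_ok_def R1_def)
        consider "crs c j \<le> R" "0 < fst (x j) \<longrightarrow> 0 < cz c j \<and> crs c j = R - ctime c" | "2 \<le> cns c j" "crs c j \<le> p (1, j, cns c j - 1) / \<mu> j"
          using crs_chain[OF ok j, of N] by (auto simp: c_def R_def)
        then have "R1 \<le> b \<or> ennreal (l * R1) \<le> renewal_sum (\<lambda>i. p (1, j, i)) \<kappa>"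
        proof cases
          case 1
          then show ?thesis using R1 le by (auto simp: b_def)
        next
          case 2
          have "l * R1 \<le> \<mu> j * R1" using l nn by (intro mult_right_mono)
          also have "\<dots> \<le> p (1, j, cns c j - 1)"
            using order_trans[OF le 2(2)] \<mu>_pos[OF j] by (simp add: pos_le_divide_eq mult.commute)
          also have "\<dots> \<le> (\<Sum>m\<in>{1..<cns c j}. 1 + p (1, j, m))"
            using 2(1) ok(2) j by (intro draw_le_sum) (auto simp: prim_ok_def)
          finally have "ennreal (l * R1) \<le> ennreal (\<Sum>m\<in>{1..<cns c j}. 1 + p (1, j, m))"
            by (rule ennreal_leI)
          also have "\<dots> \<le> renewal_sum (\<lambda>i. p (1, j, i)) \<kappa>"
            unfolding c_def by (rule srv_draws_le[OF ok N(1) j \<kappa>])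
          finally show ?thesis ..
        qed
        moreover have "renewal_sum (\<lambda>i. p (1, j, i)) \<kappa> = renewal_sum (\<lambda>i. Ts j i \<omega>) \<kappa>"
          unfolding p_def using j by (intro renewal_sum_cong) (simp add: prims_simps)
        ultimately show ?case using nn unfolding p_def R1_def by simp
      qed
    qed
    then have "(\<integral>\<^sup>+\<omega>. ennreal (snd (snd (netX (Y \<omega>) x 1 j)) ^ Suc n) \<partial>\<Omega>) + ennreal (if 0 < fst (x j) then R ^ n else 0) \<le>
        ennreal (b ^ Suc n + m / l ^ Suc n) + ennreal (if 0 < fst (x j) then R ^ n else 0)"
      by (rule add_right_mono)
    also have "\<dots> = ennreal (b ^ Suc n + m / l ^ Suc n + (if 0 < fst (x j) then R ^ n else 0))"
      using R b fin l by (intro ennreal_plus[symmetric]) auto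
    also have "\<dots> \<le> ennreal (R ^ Suc n + K)"
      using power_Suc_drop_le[OF R, of n] by (intro ennreal_leI) (auto simp: K_def b_def)
    finally show "(\<integral>\<^sup>+\<omega>. ennreal (snd (snd (netX (Y \<omega>) x 1 j)) ^ Suc n) \<partial>\<Omega>) +
        ennreal (if 0 < fst (x j) then snd (snd (x j)) ^ n else 0) \<le> ennreal (snd (snd (x j)) ^ Suc n + K)"
      unfolding R_def .
  qed (use K in auto)
  also have "\<dots> = ennreal K"
    using st prob_space.emeasure_space_1[of \<pi>] by (simp add: gjn_stationary_def)
  finally show ?thesis by (simp add: K_def)
qed

text \<open>On a sample path without any completion at \<open>j\<close> the station stays empty, and
  so it does from the state \<open>y\<close>, which differs from \<open>x\<close> only in the
  initial residual \<open>a\<close> at \<open>j\<close>. From \<open>y\<close> the residual then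
  equals \<open>a\<close> at all positive times, so the set \<open>A a\<close> of states with
  another residual is occupied for zero time, although it has positive measure under the recurrence
  measure.\<close>

lemma AE_eventually_served:
  assumes harris: "gjn_harris_recurrent \<Omega> J \<alpha> \<mu> Te Ts rt" and j: "j \<in> {1..J}"
    and x: "x \<in> space (gjn_space J)"
  shows "AE \<omega> in \<Omega>. \<exists>n. cns (chain (Y \<omega>) x n) j \<noteq> 1"
proof -
  obtain \<phi> where \<phi>: "sets \<phi> = sets (gjn_space J)" "0 < emeasure \<phi> (space \<phi>)"
    and H: "\<And>A y. A \<in> sets (gjn_space J) \<Longrightarrow> 0 < emeasure \<phi> A \<Longrightarrow> y \<in> space (gjn_space J) \<Longrightarrow>
       AE \<omega> in \<Omega>. (\<integral>\<^sup>+ t. indicator A (gjn_X J \<alpha> \<mu> (\<lambda>j i. Te j i \<omega>) (\<lambda>j i. Ts j i \<omega>)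
                                        (\<lambda>j i. rt j i \<omega>) y t) * indicator {0..} t \<partial>lborel) = \<infinity>"
    using harris unfolding gjn_harris_recurrent_def by blast
  note parts = measurable_gjn_space_parts[OF j measurable_ident_sets[OF refl]]
  define A where "A a = {y \<in> space (gjn_space J). snd (snd (y j)) \<noteq> a}" for a :: real
  have A: "A a \<in> sets (gjn_space J)" for a
    using borel_measurable_neq[OF parts(3) borel_measurable_const[of a]] by (simp add: A_def)
  \<comment> \<open>No residual equals both 0 and 1, so one of the two sets has positive measure;
    this selects \<open>a\<close>.\<close>
  have "space \<phi> = A 0 \<union> A 1"
    using sets_eq_imp_space_eq[OF \<phi>(1)] by (auto simp: A_def)
  then have "emeasure \<phi> (space \<phi>) \<le> emeasure \<phi> (A 0) + emeasure \<phi> (A 1)"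
    using emeasure_subadditive[of "A 0" \<phi> "A 1"] A \<phi>(1) by simp
  then obtain a where a: "0 < emeasure \<phi> (A a)" "0 \<le> a"
    using \<phi>(2) by (metis add.right_neutral not_gr_zero not_le order_refl zero_le_one)
  define y where "y = x(j := (fst (x j), fst (snd (x j)), a))"
  have y: "y \<in> space (gjn_space J)"
  proof -
    have "y \<in> space (Pi\<^sub>M {1..J} (\<lambda>_. count_space UNIV \<Otimes>\<^sub>M (borel \<Otimes>\<^sub>M borel)))"
      using x j by (auto simp: gjn_space_def space_restrict_space space_PiM space_pair_measure y_def PiE_iff extensional_def)
    moreover have "\<forall>i\<in>{1..J}. 0 \<le> fst (snd (y i)) \<and> 0 \<le> snd (snd (y i))"
      using state_ok_space[OF x] a(2) j by (auto simp: state_ok_def y_def)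
    ultimately show ?thesis by (simp add: gjn_space_def space_restrict_space)
  qed
  show ?thesis
    using H[OF A a(1) y] AE_prim_div AE_space
  proof eventually_elim
    case (elim \<omega>)
    define p where "p = Y \<omega>"
    have pok: "prim_ok p" using Y_ok[OF elim(3)] by (simp add: p_def)
    show ?case
    proof (rule ccontr)
      assume "\<not> ?thesis"
      then have no: "\<And>n. cns (chain p x n) j = 1" by (auto simp: p_def)
      have idle: "cz (chain p x n) j = 0" for n
        using first_service_or_idle[OF state_ok_space[OF x] pok _ j no] elim(2) by (simp add: p_def)
      have ch: "chain p y n = (chain p x n)\<lparr>crs := (crs (chain p x n))(j := a)\<rparr>" for n
        unfolding y_def by (rule chain_always_idle[OF idle])
      have never: "gjn_X J \<alpha> \<mu> (\<lambda>j i. Te j i \<omega>) (\<lambda>j i. Ts j i \<omega>) (\<lambda>j i. rt j i \<omega>) y t \<notin> A a" if t: "0 < t" for t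
      proof -
        obtain N where N: "etime p y N \<le> t" "t < etime p y (Suc N)"
          using last_event_exists'[OF state_ok_space[OF y] pok, of t] elim(2) t by (auto simp: p_def)
        have "netX p y t = obs (chain p y N) (t - etime p y N)"
          by (rule netX_eq[OF state_ok_space[OF y] pok N])
        moreover have "cz (chain p y N) j = 0" "crs (chain p y N) j = a" unfolding ch using idle[of N] by simp_all
        ultimately have "snd (snd (netX p y t j)) = a" using j by (simp add: obs_def)
        then show ?thesis using gjn_X_prims[OF y elim(3) t] by (simp add: A_def p_def)
      qed
      have "(\<integral>\<^sup>+ t. indicator (A a) (gjn_X J \<alpha> \<mu> (\<lambda>j i. Te j i \<omega>) (\<lambda>j i. Ts j i \<omega>)
                (\<lambda>j i. rt j i \<omega>) y t) * indicator {0..} t \<partial>lborel) = (\<integral>\<^sup>+ t. 0 \<partial>(lborel :: real measure))"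
      proof (rule nn_integral_cong_AE)
        show "AE t in lborel. indicator (A a) (gjn_X J \<alpha> \<mu> (\<lambda>j i. Te j i \<omega>) (\<lambda>j i. Ts j i \<omega>)
                (\<lambda>j i. rt j i \<omega>) y t) * indicator {0..} t = (0::ennreal)"
          using AE_lborel_singleton[of "0::real"]
        proof eventually_elim
          case (elim t)
          show ?case
          proof (cases "0 < t")
            case True
            then show ?thesis using never by simp
          next
            case False
            with elim have "t \<notin> {0..}" by auto
            then show ?thesis by simp
          qed
        qed
      qed
      with elim(1) show False by simp
    qed
  qed
qed


section \<open>Frozen residual service times at idle stations\<close>

lemma cns_chain_mono: "m \<le> n \<Longrightarrow> cns (chain p x m) j \<le> cns (chain p x n) j"
proof -
  have "incseq (\<lambda>n. cns (chain p x n) j)" by (intro incseq_SucI) (simp add: chain_Suc cns_nstep)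
  then show "m \<le> n \<Longrightarrow> cns (chain p x m) j \<le> cns (chain p x n) j" by (simp add: incseq_def)
qed

text \<open>Indicator that time \<open>t\<close> falls into the inter-event interval starting at the
  configuration, with station \<open>j\<close> empty after exactly \<open>i\<close> completions.
  Counters start at 1, hence \<open>Suc i\<close>.\<close>

definition idle_gate :: "nat \<Rightarrow> real \<Rightarrow> nat \<Rightarrow> gjn_cfg \<Rightarrow> real" where
  "idle_gate j t i c = (if ctime c \<le> t \<and> t < ctime c + delay c \<and> cz c j = 0 \<and> cns c j = Suc i then 1 else 0)"

lemma idle_gate_meas:
  assumes "j \<in> {1..J}"
  shows "idle_gate j t i \<in> borel_measurable cfgM"
proof -
  have [measurable]: "Measurable.pred cfgM (\<lambda>c. cz c j = 0)"
    by (rule measurable_compose[OF measurable_cfg_parts(1)[OF assms]]) simp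
  have [measurable]: "Measurable.pred cfgM (\<lambda>c. cns c j = Suc i)"
    by (rule measurable_compose[OF measurable_cfg_parts(5)[OF assms]]) simp
  show ?thesis unfolding idle_gate_def[abs_def] by measurable
qed

text \<open>While station \<open>j\<close> stays idle after its \<open>i\<close>-th completion, the service time drawn at that
  completion influences nothing but the frozen residual itself.\<close>

lemma idle_gate_reset:
  assumes i: "1 \<le> i"
  shows "idle_gate j t i (chain (p((1, j, i) := v)) x n) = idle_gate j t i (chain p x n)"
proof -
  have *: "idle_gate j t i (chain p' x n) = idle_gate j t i (chain p x n)"
    if p: "\<And>q. q \<noteq> (1, j, i) \<Longrightarrow> p q = p' q" and c: "cns (chain p x n) j = Suc i" "cz (chain p x n) j = 0" for p p'
  proof -
    have ch: "chain p' x n = (chain p x n)\<lparr>crs := (crs (chain p x n))(j := p' (1, j, i) / \<mu> j)\<rparr>"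
      by (rule conjunct2[OF chain_idle_unconsumed[OF p i c]])
    have "delay (chain p' x n) = delay (chain p x n)" by (rule evt_idle(2)[OF c(2) ch])
    moreover have "ctime (chain p' x n) = ctime (chain p x n)" "cz (chain p' x n) j = cz (chain p x n) j"
      "cns (chain p' x n) j = cns (chain p x n) j" by (simp_all add: ch)
    ultimately show ?thesis by (simp only: idle_gate_def)
  qed
  let ?p' = "p((1, j, i) := v)"
  show ?thesis
  proof (cases "cns (chain p x n) j = Suc i \<and> cz (chain p x n) j = 0")
    case True
    show ?thesis by (rule *[OF _ conjunct1[OF True] conjunct2[OF True]]) auto
  next
    case no: False
    show ?thesis
    proof (cases "cns (chain ?p' x n) j = Suc i \<and> cz (chain ?p' x n) j = 0")
      case True
      show ?thesis by (rule *[OF _ conjunct1[OF True] conjunct2[OF True], symmetric]) auto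
    next
      case False
      have z: "idle_gate j t i c = 0" if "\<not> (cns c j = Suc i \<and> cz c j = 0)" for c
        using that by (auto simp: idle_gate_def)
      show ?thesis by (simp only: z[OF no] z[OF False])
    qed
  qed
qed

text \<open>Inter-event intervals are disjoint, so at most one \<open>n\<close> contributes, and the
  counter then determines \<open>i\<close>.\<close>

lemma idle_gate_sum_le:
  assumes ok: "state_ok x" "prim_ok p"
  shows "(\<Sum>n. \<Sum>i\<in>{1..n}. ennreal (idle_gate j t i (chain p x n))) \<le> 1"
proof (cases "\<exists>n. etime p x n \<le> t \<and> t < etime p x (Suc n)")
  case True
  then obtain N where N: "etime p x N \<le> t" "t < etime p x (Suc N)" by blast
  have uniq: "n = N" if "etime p x n \<le> t" "t < etime p x (Suc n)" for n
  proof (rule ccontr)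
    assume "n \<noteq> N"
    then consider "Suc n \<le> N" | "Suc N \<le> n" by linarith
    then show False using etime_mono[OF ok, of "Suc n" N] etime_mono[OF ok, of "Suc N" n] N that by cases auto
  qed
  define F where "F n = (\<Sum>i\<in>{1..n}. ennreal (idle_gate j t i (chain p x n)))" for n
  have "(\<Sum>n. F n) = (\<Sum>n\<in>{N}. F n)"
  proof (rule suminf_finite)
    fix n assume "n \<notin> {N}"
    then have "\<not> (etime p x n \<le> t \<and> t < etime p x n + delay (chain p x n))" using uniq[of n] by (auto simp: etime_Suc)
    then have "idle_gate j t i (chain p x n) = 0" for i by (auto simp: idle_gate_def)
    then show "F n = 0" unfolding F_def by simp
  qed simp
  also have "\<dots> = F N" by simp
  also have "F N \<le> (\<Sum>i\<in>{1..N}. if i = cns (chain p x N) j - 1 then 1 else 0)"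
    unfolding F_def by (rule sum_mono) (simp add: idle_gate_def)
  also have "\<dots> \<le> 1" by simp
  finally show ?thesis by (simp only: F_def)
next
  case False
  then have "idle_gate j t i (chain p x n) = 0" for i n
    by (auto simp: idle_gate_def etime_Suc)
  then show ?thesis by simp
qed

text \<open>By \<open>idle_gate_reset\<close> the gate for \<open>i\<close> is independent of draw
  \<open>i\<close>, so each summand factorizes into the law of one service time and the probability
  of the gate; the gates are disjoint and their probabilities add up to at most 1. Boundedness of
  \<open>h\<close> provides integrability.\<close>

lemma idle_fresh_bound:
  assumes x: "x \<in> space (gjn_space J)" and j: "j \<in> {1..J}" and h: "h \<in> borel_measurable borel"
    and hb: "\<And>y. 0 \<le> h y" "\<And>y. h y \<le> b"
  shows "(\<integral>\<^sup>+\<omega>. (\<Sum>n. \<Sum>i\<in>{1..n}. ennreal (h (Y \<omega> (1, j, i)) * idle_gate j t i (chain (Y \<omega>) x n))) \<partial>\<Omega>)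
     \<le> (\<integral>\<^sup>+\<omega>. ennreal (h (Ts j 1 \<omega>)) \<partial>\<Omega>)"
proof -
  define c where "c = (\<integral>\<^sup>+\<omega>. ennreal (h (Ts j 1 \<omega>)) \<partial>\<Omega>)"
  note gm = idle_gate_meas[OF j, of t]
  have gY: "(\<lambda>\<omega>. idle_gate j t i (chain (Y \<omega>) x n)) \<in> borel_measurable \<Omega>" for i n
    by (rule measurable_chain_Y[OF x gm])
  have hY: "(\<lambda>\<omega>. h (Y \<omega> q)) \<in> borel_measurable \<Omega>" for q
    by (rule measurable_compose[OF Y_q_meas h])
  have g01: "0 \<le> idle_gate j t i c'" "idle_gate j t i c' \<le> 1" for i c' by (auto simp: idle_gate_def)
  have trm: "(\<integral>\<^sup>+\<omega>. ennreal (h (Y \<omega> (1, j, i)) * idle_gate j t i (chain (Y \<omega>) x n)) \<partial>\<Omega>) =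
     c * (\<integral>\<^sup>+\<omega>. ennreal (idle_gate j t i (chain (Y \<omega>) x n)) \<partial>\<Omega>)" if i: "i \<in> {1..n}" for i n
  proof -
    have i1: "1 \<le> i" using i by simp
    have q: "(1, j, i) \<in> prim_index J" using i j by (auto simp: prim_index_def)
    define g where "g \<omega> = idle_gate j t i (chain (Y \<omega>) x n)" for \<omega>
    have H: "(\<lambda>p. idle_gate j t i (chain p x n)) \<in> borel_measurable primM"
      by (rule measurable_chain_prim[OF x gm])
    have "indep_var borel (\<lambda>\<omega>. h (Y \<omega> (1, j, i))) borel (\<lambda>\<omega>. idle_gate j t i (chain ((Y \<omega>)((1, j, i) := 0)) x n))"
      by (rule indep_prim[OF q h H])
    then have ind: "indep_var borel (\<lambda>\<omega>. h (Y \<omega> (1, j, i))) borel g"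
      unfolding idle_gate_reset[OF i1] g_def[abs_def] .
    have ih: "integrable \<Omega> (\<lambda>\<omega>. h (Y \<omega> (1, j, i)))"
      by (rule integrable_const_bound[of _ b, OF _ hY]) (use hb in auto)
    have gm': "g \<in> borel_measurable \<Omega>" unfolding g_def[abs_def] by (rule gY)
    have ig: "integrable \<Omega> g"
      by (rule integrable_const_bound[of _ 1, OF _ gm']) (use g01 in \<open>auto simp: g_def\<close>)
    have "(\<integral>\<^sup>+\<omega>. ennreal (h (Y \<omega> (1, j, i)) * g \<omega>) \<partial>\<Omega>) = ennreal (\<integral>\<omega>. h (Y \<omega> (1, j, i)) * g \<omega> \<partial>\<Omega>)"
      using hb g01 by (intro nn_integral_eq_integral indep_var_integrable[OF ind ih ig]) (auto simp: g_def)
    also have "\<dots> = ennreal ((\<integral>\<omega>. h (Y \<omega> (1, j, i)) \<partial>\<Omega>) * (\<integral>\<omega>. g \<omega> \<partial>\<Omega>))"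
      by (simp only: indep_var_lebesgue_integral[OF ind ih ig])
    also have "\<dots> = ennreal (\<integral>\<omega>. h (Y \<omega> (1, j, i)) \<partial>\<Omega>) * ennreal (\<integral>\<omega>. g \<omega> \<partial>\<Omega>)"
      using hb g01 by (intro ennreal_mult integral_nonneg_AE) (auto simp: g_def)
    also have "ennreal (\<integral>\<omega>. h (Y \<omega> (1, j, i)) \<partial>\<Omega>) = (\<integral>\<^sup>+\<omega>. ennreal (h (Y \<omega> (1, j, i))) \<partial>\<Omega>)"
      using hb by (intro nn_integral_eq_integral[symmetric] ih) auto
    also have "ennreal (\<integral>\<omega>. g \<omega> \<partial>\<Omega>) = (\<integral>\<^sup>+\<omega>. ennreal (g \<omega>) \<partial>\<Omega>)"
      using g01 by (intro nn_integral_eq_integral[symmetric] ig) (auto simp: g_def)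
    also have "(\<integral>\<^sup>+\<omega>. ennreal (h (Y \<omega> (1, j, i))) \<partial>\<Omega>) = c"
    proof -
      have "(\<integral>\<^sup>+\<omega>. ennreal (h (Y \<omega> (1, j, i))) \<partial>\<Omega>) = (\<integral>\<^sup>+y. ennreal (h y) \<partial>distr \<Omega> borel (Ts j i))"
        using h by (subst nn_integral_distr[OF Ts_meas[OF j i1]]) (auto simp: prims_simps[OF j i1])
      also have "\<dots> = c"
        unfolding c_def Ts_id[OF j i1] using h by (subst nn_integral_distr[OF Ts_meas[OF j]]) auto
      finally show ?thesis .
    qed
    finally show ?thesis by (simp only: g_def)
  qed
  have "(\<integral>\<^sup>+\<omega>. (\<Sum>n. \<Sum>i\<in>{1..n}. ennreal (h (Y \<omega> (1, j, i)) * idle_gate j t i (chain (Y \<omega>) x n))) \<partial>\<Omega>) =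
     (\<Sum>n. \<integral>\<^sup>+\<omega>. (\<Sum>i\<in>{1..n}. ennreal (h (Y \<omega> (1, j, i)) * idle_gate j t i (chain (Y \<omega>) x n))) \<partial>\<Omega>)"
    using hY gY by (intro nn_integral_suminf borel_measurable_sum) auto
  also have "\<dots> = (\<Sum>n. \<Sum>i\<in>{1..n}. \<integral>\<^sup>+\<omega>. ennreal (h (Y \<omega> (1, j, i)) * idle_gate j t i (chain (Y \<omega>) x n)) \<partial>\<Omega>)"
    using hY gY by (intro suminf_cong nn_integral_sum) auto
  also have "\<dots> = (\<Sum>n. \<Sum>i\<in>{1..n}. c * (\<integral>\<^sup>+\<omega>. ennreal (idle_gate j t i (chain (Y \<omega>) x n)) \<partial>\<Omega>))"
    by (intro suminf_cong sum.cong refl trm)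
  also have "\<dots> = c * (\<Sum>n. \<Sum>i\<in>{1..n}. \<integral>\<^sup>+\<omega>. ennreal (idle_gate j t i (chain (Y \<omega>) x n)) \<partial>\<Omega>)"
    by (simp only: sum_distrib_left[symmetric] ennreal_suminf_cmult)
  also have "(\<Sum>n. \<Sum>i\<in>{1..n}. \<integral>\<^sup>+\<omega>. ennreal (idle_gate j t i (chain (Y \<omega>) x n)) \<partial>\<Omega>) =
      (\<Sum>n. \<integral>\<^sup>+\<omega>. (\<Sum>i\<in>{1..n}. ennreal (idle_gate j t i (chain (Y \<omega>) x n))) \<partial>\<Omega>)"
    using gY by (intro suminf_cong nn_integral_sum[symmetric]) auto
  also have "\<dots> = (\<integral>\<^sup>+\<omega>. (\<Sum>n. \<Sum>i\<in>{1..n}. ennreal (idle_gate j t i (chain (Y \<omega>) x n))) \<partial>\<Omega>)"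
    using gY by (intro nn_integral_suminf[symmetric] borel_measurable_sum) auto
  also have "\<dots> \<le> (\<integral>\<^sup>+\<omega>. 1 \<partial>\<Omega>)"
    using idle_gate_sum_le[OF state_ok_space[OF x] Y_ok] by (intro nn_integral_mono)
  also have "\<dots> = 1" by (simp add: emeasure_space_1)
  finally have "(\<integral>\<^sup>+\<omega>. (\<Sum>n. \<Sum>i\<in>{1..n}. ennreal (h (Y \<omega> (1, j, i)) * idle_gate j t i (chain (Y \<omega>) x n))) \<partial>\<Omega>) \<le> c * 1"
    by (simp add: mult_left_mono)
  then show ?thesis by (simp add: c_def)
qed

text \<open>Stationarity is used at a large time \<open>T\<close>. Either station \<open>j\<close>
  has completed a service by then, and a frozen residual is a draw covered by
  \<open>idle_fresh_bound\<close>, or not, which is the event \<open>A T\<close> of vanishing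
  probability. Truncation at \<open>L\<close> bounds the contribution of \<open>A T\<close>.\<close>

lemma srv_resid_idle_truncated:
  assumes st: "gjn_stationary \<Omega> J \<alpha> \<mu> Te Ts rt \<pi>" and harris: "gjn_harris_recurrent \<Omega> J \<alpha> \<mu> Te Ts rt"
    and j: "j \<in> {1..J}" and L: "0 \<le> L"
  shows "(\<integral>\<^sup>+x. ennreal (if fst (x j) = 0 then min (snd (snd (x j))) L ^ n else 0) \<partial>\<pi>)
     \<le> (\<integral>\<^sup>+\<omega>. ennreal ((Ts j 1 \<omega> / \<mu> j) ^ n) \<partial>\<Omega>)"
proof -
  have s: "sets \<pi> = sets (gjn_space J)" and pr: "prob_space \<pi>"
    using st by (auto simp: gjn_stationary_def)
  interpret \<pi>: prob_space \<pi> by fact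
  have sp: "space \<pi> = space (gjn_space J)" using s by (rule sets_eq_imp_space_eq)
  define h where "h y = min (max y 0 / \<mu> j) L ^ n" for y
  define f where "f x = ennreal (if fst (x j) = 0 then min (snd (snd (x j))) L ^ n else 0)" for x :: "nat \<Rightarrow> nat \<times> real \<times> real"
  define c where "c = (\<integral>\<^sup>+\<omega>. ennreal ((Ts j 1 \<omega> / \<mu> j) ^ n) \<partial>\<Omega>)"
  have h0: "0 \<le> h y" "h y \<le> L ^ n" for y using L \<mu>_pos[OF j] by (auto simp: h_def intro!: power_mono)
  have hm: "h \<in> borel_measurable borel" unfolding h_def[abs_def] by measurable
  have hc: "(\<integral>\<^sup>+\<omega>. ennreal (h (Ts j 1 \<omega>)) \<partial>\<Omega>) \<le> c"
    unfolding c_def h_def using Ts_nonneg[OF j, of 1] \<mu>_pos[OF j] L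
    by (intro nn_integral_mono ennreal_leI power_mono) auto
  have fm: "f \<in> borel_measurable \<pi>"
  proof -
    have "(\<lambda>x. x) \<in> \<pi> \<rightarrow>\<^sub>M gjn_space J" by (rule measurable_ident_sets[OF s])
    note parts = measurable_gjn_space_parts[OF j this]
    have [measurable]: "Measurable.pred \<pi> (\<lambda>x. fst (x j) = 0)" by (rule measurable_compose[OF parts(1)]) simp
    note [measurable] = parts(3)
    show ?thesis unfolding f_def[abs_def] by measurable
  qed
  define A where "A T = {z \<in> space (\<pi> \<Otimes>\<^sub>M \<Omega>). \<forall>m. etime (Y (snd z)) (fst z) m \<le> real T \<longrightarrow> cns (chain (Y (snd z)) (fst z) m) j = 1}" for T :: nat
  have chm: "(\<lambda>z. chain (Y (snd z)) (fst z) m) \<in> \<pi> \<Otimes>\<^sub>M \<Omega> \<rightarrow>\<^sub>M cfgM" for m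
  proof (rule measurable_chain)
    show "(\<lambda>z. Y (snd z)) \<in> \<pi> \<Otimes>\<^sub>M \<Omega> \<rightarrow>\<^sub>M primM" by (rule measurable_compose[OF measurable_snd Y_meas])
    show "fst \<in> \<pi> \<Otimes>\<^sub>M \<Omega> \<rightarrow>\<^sub>M gjn_space J"
      using measurable_fst[of \<pi> \<Omega>] by (subst measurable_cong_sets[OF refl s[symmetric]])
  qed
  have A: "A T \<in> sets (\<pi> \<Otimes>\<^sub>M \<Omega>)" for T
  proof -
    have [measurable]: "(\<lambda>z. etime (Y (snd z)) (fst z) m) \<in> borel_measurable (\<pi> \<Otimes>\<^sub>M \<Omega>)" for m
      by (rule measurable_compose[OF chm measurable_ctime])
    have [measurable]: "Measurable.pred (\<pi> \<Otimes>\<^sub>M \<Omega>) (\<lambda>z. cns (chain (Y (snd z)) (fst z) m) j = 1)" for m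
      by (rule measurable_compose[OF measurable_compose[OF chm measurable_cfg_parts(5)[OF j]]]) simp
    show ?thesis unfolding A_def by measurable
  qed
  have decA: "decseq A" unfolding A_def by (intro decseq_SucI) force
  have null: "emeasure (\<pi> \<Otimes>\<^sub>M \<Omega>) (\<Inter>T. A T) = 0"
  proof -
    have m: "(\<Inter>T. A T) \<in> sets (\<pi> \<Otimes>\<^sub>M \<Omega>)" using A by (intro sets.countable_INT) auto
    have "emeasure (\<pi> \<Otimes>\<^sub>M \<Omega>) (\<Inter>T. A T) = (\<integral>\<^sup>+x. emeasure \<Omega> (Pair x -` (\<Inter>T. A T)) \<partial>\<pi>)"
      by (rule emeasure_pair_measure_alt[OF m])
    also have "\<dots> = (\<integral>\<^sup>+x. 0 \<partial>\<pi>)"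
    proof (rule nn_integral_cong)
      fix x assume x: "x \<in> space \<pi>"
      have "AE \<omega> in \<Omega>. \<omega> \<notin> Pair x -` (\<Inter>T. A T)"
        using AE_eventually_served[OF harris j x[unfolded sp]]
      proof eventually_elim
        case (elim \<omega>)
        then obtain m where m: "cns (chain (Y \<omega>) x m) j \<noteq> 1" by blast
        obtain T :: nat where "etime (Y \<omega>) x m \<le> real T" using real_arch_simple by blast
        with m have "(x, \<omega>) \<notin> A T" by (auto simp: A_def)
        then show ?case by auto
      qed
      moreover have "Pair x -` (\<Inter>T. A T) \<in> sets \<Omega>" using m by (rule sets_Pair1)
      moreover have "Pair x -` (\<Inter>T. A T) \<subseteq> space \<Omega>" using sets.sets_into_space calculation(2) by blast
      ultimately show "emeasure \<Omega> (Pair x -` (\<Inter>T. A T)) = 0"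
        by (subst (asm) AE_iff_measurable[where N = "Pair x -` (\<Inter>T. A T)"]) auto
    qed
    finally show ?thesis by simp
  qed
  have lim: "(\<lambda>T. emeasure (\<pi> \<Otimes>\<^sub>M \<Omega>) (A T)) \<longlonglongrightarrow> 0"
  proof -
    interpret P: pair_prob_space \<pi> \<Omega> ..
    have "(\<lambda>T. emeasure (\<pi> \<Otimes>\<^sub>M \<Omega>) (A T)) \<longlonglongrightarrow> emeasure (\<pi> \<Otimes>\<^sub>M \<Omega>) (\<Inter>T. A T)"
      using A decA by (intro Lim_emeasure_decseq) (auto simp: P.P.emeasure_eq_measure)
    then show ?thesis by (simp add: null)
  qed
  have main: "(\<integral>\<^sup>+x. f x \<partial>\<pi>) \<le> c + ennreal (L ^ n) * emeasure (\<pi> \<Otimes>\<^sub>M \<Omega>) (A T)" if T: "1 \<le> T" for T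
  proof -
    define t where "t = real T"
    have t: "0 < t" using T by (simp add: t_def)
    define Q where "Q x \<omega> = (\<Sum>n. \<Sum>i\<in>{1..n}. ennreal (h (Y \<omega> (1, j, i)) * idle_gate j t i (chain (Y \<omega>) x n)))" for x \<omega>
    have pt: "AE \<omega> in \<Omega>. f (netX (Y \<omega>) x t) \<le> Q x \<omega> + ennreal (L ^ n) * indicator (A T) (x, \<omega>)"
      if x: "x \<in> space \<pi>" for x
      using AE_prim_div AE_space
    proof eventually_elim
      case (elim \<omega>)
      define p where "p = Y \<omega>"
      have xs: "x \<in> space (gjn_space J)" using x sp by simp
      note ok = state_ok_space[OF xs] Y_ok[OF elim(2), folded p_def]
      obtain N where N: "etime p x N \<le> t" "t < etime p x (Suc N)"
        using last_event_exists'[OF ok, of t] elim(1) t by (auto simp: p_def)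
      define cN where "cN = chain p x N"
      have X: "fst (netX p x t j) = cz cN j" "cz cN j = 0 \<Longrightarrow> snd (snd (netX p x t j)) = crs cN j"
        unfolding netX_eq[OF ok N] using j by (simp_all add: obs_def cN_def)
      have nn: "0 \<le> crs cN j" using cfg_ok_chain[OF ok] j by (auto simp: cfg_ok_def cN_def)
      show ?case
      proof (cases "cz cN j = 0")
        case False
        then show ?thesis using X(1) by (simp add: f_def p_def[symmetric])
      next
        case idle: True
        have fe: "f (netX p x t) = ennreal (min (crs cN j) L ^ n)" using idle X by (simp add: f_def)
        show ?thesis
        proof (cases "cns cN j = 1")
          case True
          have "(x, \<omega>) \<in> A T"
            unfolding A_def
          proof (clarsimp simp: space_pair_measure x elim(2) p_def[symmetric] t_def[symmetric])
            fix m assume m: "etime p x m \<le> t"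
            have "m \<le> N"
              using etime_mono[OF ok, of "Suc N" m] N(2) m by (metis not_less_eq_eq not_le order_trans)
            then have "cns (chain p x m) j \<le> 1" using cns_chain_mono[of m N p x j] True by (simp add: cN_def)
            then show "cns (chain p x m) j = Suc 0" using counters_pos[of p x m j] by simp
          qed
          moreover have "f (netX p x t) \<le> ennreal (L ^ n)"
            unfolding fe using nn L by (intro ennreal_leI power_mono) auto
          ultimately show ?thesis unfolding p_def[symmetric] by (simp add: add_increasing)
        next
          case False
          define i where "i = cns cN j - 1"
          have i: "1 \<le> i" "cns cN j = Suc i" using False counters_pos[of p x N j] by (auto simp: i_def cN_def)
          have crs: "crs cN j = p (1, j, i) / \<mu> j"
            using conjunct1[OF chain_idle_unconsumed[of j i p p, OF _ i(1)]] i(2) idle by (simp add: cN_def)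
          have "0 \<le> p (1, j, i)" using ok(2) j i by (auto simp: prim_ok_def)
          then have "f (netX p x t) = ennreal (h (p (1, j, i)) * idle_gate j t i cN)"
            unfolding fe crs using N idle i by (simp add: h_def idle_gate_def cN_def etime_Suc)
          also have "\<dots> \<le> (\<Sum>i\<in>{1..N}. ennreal (h (p (1, j, i)) * idle_gate j t i (chain p x N)))"
          proof -
            have "i \<in> {1..N}" using i counter_le[of 1 j p x N] by (auto simp: counter_def cN_def)
            then show ?thesis unfolding cN_def by (intro member_le_sum) auto
          qed
          also have "\<dots> \<le> Q x \<omega>"
            using sum_le_suminf[of "\<lambda>n. \<Sum>i\<in>{1..n}. ennreal (h (p (1, j, i)) * idle_gate j t i (chain p x n))" "{N}"]
            by (simp add: Q_def p_def)
          finally show ?thesis unfolding p_def[symmetric] by (simp add: add_increasing2)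
        qed
      qed
    qed
    have "(\<integral>\<^sup>+x. f x \<partial>\<pi>) = (\<integral>\<^sup>+x. (\<integral>\<^sup>+\<omega>. f (netX (Y \<omega>) x t) \<partial>\<Omega>) \<partial>\<pi>)"
      by (rule stationary_nn_integral[OF st t fm])
    also have "\<dots> \<le> (\<integral>\<^sup>+x. c + ennreal (L ^ n) * emeasure \<Omega> (Pair x -` A T) \<partial>\<pi>)"
    proof (rule nn_integral_mono)
      fix x assume x: "x \<in> space \<pi>"
      have xs: "x \<in> space (gjn_space J)" using x sp by simp
      have P: "Pair x -` A T \<in> sets \<Omega>" using A by (rule sets_Pair1)
      have Qm: "Q x \<in> borel_measurable \<Omega>"
        unfolding Q_def[abs_def]
      proof (intro borel_measurable_suminf_order borel_measurable_sum)
        fix n i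
        have [measurable]: "(\<lambda>\<omega>. h (Y \<omega> (1, j, i))) \<in> borel_measurable \<Omega>" by (rule measurable_compose[OF Y_q_meas hm])
        have [measurable]: "(\<lambda>\<omega>. idle_gate j t i (chain (Y \<omega>) x n)) \<in> borel_measurable \<Omega>"
          by (rule measurable_chain_Y[OF xs idle_gate_meas[OF j]])
        show "(\<lambda>\<omega>. ennreal (h (Y \<omega> (1, j, i)) * idle_gate j t i (chain (Y \<omega>) x n))) \<in> borel_measurable \<Omega>" by measurable
      qed
      have ind: "indicator (A T) (x, \<omega>) = (indicator (Pair x -` A T) \<omega> :: ennreal)" for \<omega> by (simp add: indicator_def)
      have "(\<integral>\<^sup>+\<omega>. f (netX (Y \<omega>) x t) \<partial>\<Omega>) \<le> (\<integral>\<^sup>+\<omega>. Q x \<omega> + ennreal (L ^ n) * indicator (Pair x -` A T) \<omega> \<partial>\<Omega>)"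
        using pt[OF x] unfolding ind by (rule nn_integral_mono_AE)
      also have "\<dots> = (\<integral>\<^sup>+\<omega>. Q x \<omega> \<partial>\<Omega>) + ennreal (L ^ n) * emeasure \<Omega> (Pair x -` A T)"
        using Qm P by (subst nn_integral_add) (auto simp: nn_integral_cmult_indicator)
      also have "(\<integral>\<^sup>+\<omega>. Q x \<omega> \<partial>\<Omega>) \<le> c"
        unfolding Q_def by (rule order_trans[OF idle_fresh_bound[OF xs j hm h0] hc])
      finally show "(\<integral>\<^sup>+\<omega>. f (netX (Y \<omega>) x t) \<partial>\<Omega>) \<le> c + ennreal (L ^ n) * emeasure \<Omega> (Pair x -` A T)"
        by (simp add: add_right_mono)
    qed
    also have "\<dots> = c + ennreal (L ^ n) * (\<integral>\<^sup>+x. emeasure \<Omega> (Pair x -` A T) \<partial>\<pi>)"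
      using measurable_emeasure_Pair[OF A]
      by (subst nn_integral_add) (auto simp: nn_integral_cmult \<pi>.emeasure_space_1)
    also have "(\<integral>\<^sup>+x. emeasure \<Omega> (Pair x -` A T) \<partial>\<pi>) = emeasure (\<pi> \<Otimes>\<^sub>M \<Omega>) (A T)"
      by (rule emeasure_pair_measure_alt[OF A, symmetric])
    finally show ?thesis .
  qed
  have "(\<integral>\<^sup>+x. f x \<partial>\<pi>) \<le> c + ennreal (L ^ n) * 0"
  proof (rule tendsto_lowerbound)
    show "(\<lambda>T. c + ennreal (L ^ n) * emeasure (\<pi> \<Otimes>\<^sub>M \<Omega>) (A T)) \<longlonglongrightarrow> c + ennreal (L ^ n) * 0"
      by (intro tendsto_add tendsto_const ennreal_tendsto_cmult lim) simp
    show "eventually (\<lambda>T. (\<integral>\<^sup>+x. f x \<partial>\<pi>) \<le> c + ennreal (L ^ n) * emeasure (\<pi> \<Otimes>\<^sub>M \<Omega>) (A T)) sequentially"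
      using main by (rule eventually_sequentiallyI)
  qed simp
  then show ?thesis by (simp add: f_def c_def)
qed

text \<open>For each state the truncated residual is eventually the residual itself, so Fatou
  removes the truncation.\<close>

lemma srv_resid_idle_bound:
  assumes st: "gjn_stationary \<Omega> J \<alpha> \<mu> Te Ts rt \<pi>" and harris: "gjn_harris_recurrent \<Omega> J \<alpha> \<mu> Te Ts rt"
    and j: "j \<in> {1..J}"
  shows "(\<integral>\<^sup>+x. ennreal (if fst (x j) = 0 then snd (snd (x j)) ^ n else 0) \<partial>\<pi>)
     \<le> (\<integral>\<^sup>+\<omega>. ennreal ((Ts j 1 \<omega> / \<mu> j) ^ n) \<partial>\<Omega>)"
proof -
  have s: "sets \<pi> = sets (gjn_space J)" using st by (auto simp: gjn_stationary_def)
  define g where "g L x = ennreal (if fst (x j) = 0 then min (snd (snd (x j))) (real L) ^ n else 0)" for L :: nat and x :: "nat \<Rightarrow> nat \<times> real \<times> real"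
  have gm: "g L \<in> borel_measurable \<pi>" for L
  proof -
    have "(\<lambda>x. x) \<in> \<pi> \<rightarrow>\<^sub>M gjn_space J" by (rule measurable_ident_sets[OF s])
    note parts = measurable_gjn_space_parts[OF j this]
    have [measurable]: "Measurable.pred \<pi> (\<lambda>x. fst (x j) = 0)" by (rule measurable_compose[OF parts(1)]) simp
    note [measurable] = parts(3)
    show ?thesis unfolding g_def[abs_def] by measurable
  qed
  have "(\<integral>\<^sup>+x. ennreal (if fst (x j) = 0 then snd (snd (x j)) ^ n else 0) \<partial>\<pi>) = (\<integral>\<^sup>+x. liminf (\<lambda>L. g L x) \<partial>\<pi>)"
  proof (rule nn_integral_cong)
    fix x :: "nat \<Rightarrow> nat \<times> real \<times> real"
    obtain N :: nat where N: "snd (snd (x j)) \<le> real N" using real_arch_simple by blast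
    have "(\<lambda>L. g L x) \<longlonglongrightarrow> ennreal (if fst (x j) = 0 then snd (snd (x j)) ^ n else 0)"
    proof (rule tendsto_eventually, rule eventually_sequentiallyI[of N])
      fix L assume "N \<le> L"
      then have "snd (snd (x j)) \<le> real L" using N by linarith
      then show "g L x = ennreal (if fst (x j) = 0 then snd (snd (x j)) ^ n else 0)" by (simp add: g_def min_def)
    qed
    then show "ennreal (if fst (x j) = 0 then snd (snd (x j)) ^ n else 0) = liminf (\<lambda>L. g L x)"
      by (simp add: lim_imp_Liminf)
  qed
  also have "\<dots> \<le> liminf (\<lambda>L. \<integral>\<^sup>+x. g L x \<partial>\<pi>)" by (rule nn_integral_liminf) (rule gm)
  also have "\<dots> \<le> (\<integral>\<^sup>+\<omega>. ennreal ((Ts j 1 \<omega> / \<mu> j) ^ n) \<partial>\<Omega>)"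
  proof -
    have "(\<integral>\<^sup>+x. g L x \<partial>\<pi>) \<le> (\<integral>\<^sup>+\<omega>. ennreal ((Ts j 1 \<omega> / \<mu> j) ^ n) \<partial>\<Omega>)" for L
      unfolding g_def by (rule srv_resid_idle_truncated[OF st harris j]) simp
    then show ?thesis by (intro Liminf_le always_eventually allI) simp_all
  qed
  finally show ?thesis .
qed

end

subsection \<open>Moment bounds for the queue lengths\<close>

lemma sum_power_le_ennreal:
  fixes f :: "'i \<Rightarrow> ennreal"
  assumes "finite I" "0 < n"
  shows "(\<Sum>i\<in>I. f i) ^ n \<le> of_nat (card I) ^ n * (\<Sum>i\<in>I. f i ^ n)"
proof (cases "I = {}")
  case True
  then show ?thesis using assms by simp
next
  case False
  define m where "m = Max (f ` I)"
  have fin: "finite (f ` I)" "f ` I \<noteq> {}" using assms False by auto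
  obtain i where i: "i \<in> I" "m = f i" using Max_in[OF fin] by (auto simp: m_def)
  have "(\<Sum>i\<in>I. f i) \<le> of_nat (card I) * m"
    using fin by (intro sum_bounded_above) (auto simp: m_def)
  then have "(\<Sum>i\<in>I. f i) ^ n \<le> (of_nat (card I) * m) ^ n" by (intro power_mono) auto
  also have "\<dots> = of_nat (card I) ^ n * f i ^ n" by (simp add: power_mult_distrib i)
  also have "\<dots> \<le> of_nat (card I) ^ n * (\<Sum>i\<in>I. f i ^ n)"
    using assms i by (intro mult_left_mono member_le_sum) auto
  finally show ?thesis .
qed

lemma sum_power_le:
  fixes f :: "'i \<Rightarrow> real"
  assumes "finite I" "0 < n" and nn: "\<And>i. i \<in> I \<Longrightarrow> 0 \<le> f i"
  shows "(\<Sum>i\<in>I. f i) ^ n \<le> real (card I) ^ n * (\<Sum>i\<in>I. f i ^ n)"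
proof -
  have s: "(\<Sum>i\<in>I. ennreal (f i)) = ennreal (\<Sum>i\<in>I. f i)" by (rule sum_ennreal) (rule nn)
  have "(\<Sum>i\<in>I. ennreal (f i) ^ n) = (\<Sum>i\<in>I. ennreal (f i ^ n))"
    using nn by (intro sum.cong) (auto simp: ennreal_power)
  also have "\<dots> = ennreal (\<Sum>i\<in>I. f i ^ n)" using nn by (intro sum_ennreal) auto
  finally have s': "(\<Sum>i\<in>I. ennreal (f i) ^ n) = ennreal (\<Sum>i\<in>I. f i ^ n)" .
  have "ennreal ((\<Sum>i\<in>I. f i) ^ n) \<le> ennreal (real (card I) ^ n * (\<Sum>i\<in>I. f i ^ n))"
    using sum_power_le_ennreal[OF assms(1,2), of "\<lambda>i. ennreal (f i)"] nn
    unfolding s s' by (simp add: ennreal_power sum_nonneg ennreal_of_nat_eq_real_of_nat ennreal_mult)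
  then show ?thesis using nn by (simp add: sum_nonneg)
qed

lemma event_total_moment:
  fixes p :: "'a \<Rightarrow> nat \<times> nat \<times> nat \<Rightarrow> real"
  assumes meas: "\<And>q. (\<lambda>\<omega>. p \<omega> q) \<in> borel_measurable N" and n: "0 < n"
    and e: "\<And>j. j \<in> {1..k} \<Longrightarrow> (\<integral>\<^sup>+\<omega>. renewal_sum (\<lambda>i. p \<omega> (0, j, i)) (\<kappa>e j) ^ n \<partial>N) < \<infinity>"
    and s: "\<And>j. j \<in> {1..J} \<Longrightarrow> (\<integral>\<^sup>+\<omega>. renewal_sum (\<lambda>i. p \<omega> (1, j, i)) (\<kappa>s j) ^ n \<partial>N) < \<infinity>"
  shows "(\<integral>\<^sup>+\<omega>. event_total J k \<kappa>e \<kappa>s (p \<omega>) ^ n \<partial>N) < \<infinity>"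
proof -
  define a where "a \<omega> = (\<Sum>j\<in>{1..k}. renewal_sum (\<lambda>i. p \<omega> (0, j, i)) (\<kappa>e j))" for \<omega>
  define b where "b \<omega> = (\<Sum>j\<in>{1..J}. renewal_sum (\<lambda>i. p \<omega> (1, j, i)) (\<kappa>s j))" for \<omega>
  have me: "(\<lambda>\<omega>. renewal_sum (\<lambda>i. p \<omega> (e, j, i)) \<kappa> ^ n) \<in> borel_measurable N" for e j \<kappa>
    by (intro borel_measurable_power_ennreal borel_measurable_renewal_sum meas)
  have pow: "(y + z) ^ n \<le> of_nat 2 ^ n * (y ^ n + z ^ n)" for y z :: ennreal
    using sum_power_le_ennreal[of "UNIV :: bool set" n "\<lambda>i. if i then y else z"] n by (simp add: UNIV_bool add.commute)
  define Ia where "Ia \<omega> = (\<Sum>j\<in>{1..k}. renewal_sum (\<lambda>i. p \<omega> (0, j, i)) (\<kappa>e j) ^ n)" for \<omega>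
  define Ib where "Ib \<omega> = (\<Sum>j\<in>{1..J}. renewal_sum (\<lambda>i. p \<omega> (1, j, i)) (\<kappa>s j) ^ n)" for \<omega>
  have fa: "(\<integral>\<^sup>+\<omega>. Ia \<omega> \<partial>N) < \<top>" unfolding Ia_def using e me by (subst nn_integral_sum) (auto simp: ennreal_sum_less_top)
  have fb: "(\<integral>\<^sup>+\<omega>. Ib \<omega> \<partial>N) < \<top>" unfolding Ib_def using s me by (subst nn_integral_sum) (auto simp: ennreal_sum_less_top)
  have mab: "Ia \<in> borel_measurable N" "Ib \<in> borel_measurable N"
    unfolding Ia_def[abs_def] Ib_def[abs_def] by (intro borel_measurable_sum me)+
  have "(\<integral>\<^sup>+\<omega>. event_total J k \<kappa>e \<kappa>s (p \<omega>) ^ n \<partial>N) \<le> (\<integral>\<^sup>+\<omega>. of_nat 2 ^ n * (of_nat k ^ n * Ia \<omega> + of_nat J ^ n * Ib \<omega>) \<partial>N)"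
  proof (rule nn_integral_mono)
    fix \<omega>
    have "event_total J k \<kappa>e \<kappa>s (p \<omega>) ^ n \<le> of_nat 2 ^ n * (a \<omega> ^ n + b \<omega> ^ n)"
      unfolding event_total_def a_def[symmetric] b_def[symmetric] by (rule pow)
    also have "\<dots> \<le> of_nat 2 ^ n * (of_nat k ^ n * Ia \<omega> + of_nat J ^ n * Ib \<omega>)"
    proof (intro mult_left_mono add_mono)
      show "a \<omega> ^ n \<le> of_nat k ^ n * Ia \<omega>"
        using sum_power_le_ennreal[of "{1..k}" n "\<lambda>j. renewal_sum (\<lambda>i. p \<omega> (0, j, i)) (\<kappa>e j)"] n by (simp add: a_def Ia_def)
      show "b \<omega> ^ n \<le> of_nat J ^ n * Ib \<omega>"
        using sum_power_le_ennreal[of "{1..J}" n "\<lambda>j. renewal_sum (\<lambda>i. p \<omega> (1, j, i)) (\<kappa>s j)"] n by (simp add: b_def Ib_def)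
    qed simp
    finally show "event_total J k \<kappa>e \<kappa>s (p \<omega>) ^ n \<le> of_nat 2 ^ n * (of_nat k ^ n * Ia \<omega> + of_nat J ^ n * Ib \<omega>)" .
  qed
  also have "\<dots> = of_nat 2 ^ n * (of_nat k ^ n * (\<integral>\<^sup>+\<omega>. Ia \<omega> \<partial>N) + of_nat J ^ n * (\<integral>\<^sup>+\<omega>. Ib \<omega> \<partial>N))"
  proof -
    note [measurable] = mab
    show ?thesis by (simp add: nn_integral_cmult nn_integral_add)
  qed
  also have "\<dots> < \<infinity>"
    using fa fb by (simp add: ennreal_mult_less_top power_less_top_ennreal of_nat_less_top)
  finally show ?thesis .
qed

section \<open>Traffic equations, weights and the slope constant\<close>

locale gjn_traffic =
  fixes J :: nat and \<alpha> lam :: "nat \<Rightarrow> real" and P w :: "nat \<Rightarrow> nat \<Rightarrow> real"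
  assumes J: "1 \<le> J"
    and P_open: "\<exists>Q :: nat \<Rightarrow> nat \<Rightarrow> real. \<forall>i\<in>{1..J}. \<forall>k\<in>{1..J}.
        (\<Sum>l\<in>{1..J}. ((if i = l then 1 else 0) - P i l) * Q l k) = (if i = k then 1 else 0) \<and>
        (\<Sum>l\<in>{1..J}. Q i l * ((if l = k then 1 else 0) - P l k)) = (if i = k then 1 else 0)"
    and \<alpha>_nonneg: "\<And>j. j \<in> {1..J} \<Longrightarrow> 0 \<le> \<alpha> j"
    and lam_traffic: "\<And>j. j \<in> {1..J} \<Longrightarrow> lam j = \<alpha> j + (\<Sum>l\<in>{1..J}. lam l * P l j)"
    and lam_pos: "\<And>j. j \<in> {1..J} \<Longrightarrow> 0 < lam j"
    and w_sol: "\<And>j k. j \<in> {1..J} \<Longrightarrow> k \<in> {1..J} \<Longrightarrow>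
        0 \<le> w j k \<and> w j k \<le> 1 \<and> w j k = P j k + (\<Sum>l\<in>{1..k - 1}. P j l * w l k)"
begin

text \<open>Without external arrivals the traffic equations read \<open>lam (I - P) = 0\<close>, and
  invertibility gives \<open>lam = 0\<close>.\<close>

lemma exists_external: "\<exists>j\<in>{1..J}. 0 < \<alpha> j"
proof (rule ccontr)
  assume "\<not> ?thesis"
  then have a0: "\<alpha> j = 0" if "j \<in> {1..J}" for j using \<alpha>_nonneg[OF that] that by force
  obtain Q :: "nat \<Rightarrow> nat \<Rightarrow> real" where Q: "\<And>i k. i \<in> {1..J} \<Longrightarrow> k \<in> {1..J} \<Longrightarrow>
     (\<Sum>l\<in>{1..J}. ((if i = l then 1 else 0) - P i l) * Q l k) = (if i = k then 1 else 0)"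
    using P_open by blast
  have 1: "1 \<in> {1..J}" using J by simp
  have bal: "(\<Sum>i\<in>{1..J}. lam i * ((if i = l then 1 else 0) - P i l)) = 0" if l: "l \<in> {1..J}" for l
  proof -
    have "(\<Sum>i\<in>{1..J}. lam i * ((if i = l then 1 else 0) - P i l)) = (\<Sum>i\<in>{1..J}. (if i = l then lam i else 0) - lam i * P i l)"
      by (intro sum.cong) (auto simp: algebra_simps)
    also have "\<dots> = lam l - (\<Sum>i\<in>{1..J}. lam i * P i l)" using l by (simp add: sum_subtractf)
    finally show ?thesis using lam_traffic[OF l] a0[OF l] by simp
  qed
  have "lam 1 = (\<Sum>i\<in>{1..J}. lam i * (if i = 1 then 1 else 0))"
    using 1 by (simp add: if_distrib[of "\<lambda>y. _ * y"] cong: if_cong)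
  also have "\<dots> = (\<Sum>i\<in>{1..J}. \<Sum>l\<in>{1..J}. lam i * ((if i = l then 1 else 0) - P i l) * Q l 1)"
    using Q 1 by (intro sum.cong) (simp_all add: sum_distrib_left[symmetric] mult.assoc)
  also have "\<dots> = (\<Sum>l\<in>{1..J}. (\<Sum>i\<in>{1..J}. lam i * ((if i = l then 1 else 0) - P i l)) * Q l 1)"
    by (subst sum.swap) (simp add: sum_distrib_right)
  also have "\<dots> = 0" using bal by simp
  finally show False using lam_pos[OF 1] by simp
qed

text \<open>Hitting weights for station \<open>k\<close> when stations above \<open>k\<close> are
  treated as exits: \<open>w j k\<close> is read as the chance that a job leaving \<open>j\<close>
  reaches \<open>k\<close> through stations below \<open>k\<close> only.\<close>

definition tu :: "nat \<Rightarrow> nat \<Rightarrow> real" where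
  "tu k j = (if j < k then w j k else if j = k then 1 else 0)"

text \<open>By \<open>P_tu\<close> this is \<open>P u - u\<close>; the form with \<open>w\<close>
  displays the signs.\<close>

definition td :: "nat \<Rightarrow> nat \<Rightarrow> real" where
  "td k j = w j k - tu k j"

lemma P_tu:
  assumes j: "j \<in> {1..J}" and k: "k \<in> {1..J}"
  shows "(\<Sum>l\<in>{1..J}. P j l * tu k l) = w j k"
proof -
  have "(\<Sum>l\<in>{1..J}. P j l * tu k l) = (\<Sum>l\<in>{1..k}. P j l * tu k l)"
    using k by (intro sum.mono_neutral_right) (auto simp: tu_def)
  also have "{1..k} = insert k {1..k - 1}" using k by auto
  also have "(\<Sum>l\<in>insert k {1..k - 1}. P j l * tu k l) = P j k + (\<Sum>l\<in>{1..k - 1}. P j l * tu k l)"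
    using k by (subst sum.insert) (auto simp: tu_def)
  also have "(\<Sum>l\<in>{1..k - 1}. P j l * tu k l) = (\<Sum>l\<in>{1..k - 1}. P j l * w l k)"
    by (intro sum.cong) (auto simp: tu_def)
  finally show ?thesis using w_sol[OF j k] by simp
qed

lemma td_eq: "j \<in> {1..J} \<Longrightarrow> k \<in> {1..J} \<Longrightarrow> td k j = (\<Sum>l\<in>{1..J}. P j l * tu k l) - tu k j"
  by (simp only: td_def P_tu)

lemma tu_range: "j \<in> {1..J} \<Longrightarrow> k \<in> {1..J} \<Longrightarrow> 0 \<le> tu k j \<and> tu k j \<le> 1"
  using w_sol[of j k] by (auto simp: tu_def)

lemma td_signs:
  assumes "j \<in> {1..J}" "k \<in> {1..J}"
  shows "\<bar>td k j\<bar> \<le> 1" "j < k \<Longrightarrow> td k j = 0" "k < j \<Longrightarrow> td k j = w j k" "td k k = w k k - 1"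
  using w_sol[OF assms] tu_range[OF assms] by (auto simp: td_def tu_def)

text \<open>Pairing \<open>P u - u\<close> with \<open>lam\<close> moves \<open>P\<close> onto
  \<open>lam\<close>, and \<open>lam P - lam = - \<alpha>\<close> by the traffic equations. The
  slope of the functional is thus exactly zero at nominal rates with all stations busy.\<close>

lemma traffic_balance:
  assumes k: "k \<in> {1..J}"
  shows "(\<Sum>j\<in>{1..J}. \<alpha> j * tu k j) + (\<Sum>j\<in>{1..J}. td k j * lam j) = 0"
proof -
  have "(\<Sum>j\<in>{1..J}. td k j * lam j) = (\<Sum>j\<in>{1..J}. (\<Sum>l\<in>{1..J}. lam j * P j l * tu k l) - tu k j * lam j)"
    using k by (intro sum.cong) (auto simp: td_eq left_diff_distrib right_diff_distrib sum_distrib_right sum_distrib_left mult_ac)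
  also have "\<dots> = (\<Sum>j\<in>{1..J}. \<Sum>l\<in>{1..J}. lam j * P j l * tu k l) - (\<Sum>j\<in>{1..J}. tu k j * lam j)"
    by (rule sum_subtractf)
  also have "(\<Sum>j\<in>{1..J}. \<Sum>l\<in>{1..J}. lam j * P j l * tu k l) = (\<Sum>l\<in>{1..J}. (\<Sum>j\<in>{1..J}. lam j * P j l) * tu k l)"
    by (subst sum.swap) (simp add: sum_distrib_right)
  also have "\<dots> = (\<Sum>l\<in>{1..J}. (lam l - \<alpha> l) * tu k l)"
  proof (rule sum.cong[OF refl])
    fix l assume l: "l \<in> {1..J}"
    have "(\<Sum>j\<in>{1..J}. lam j * P j l) = lam l - \<alpha> l" using lam_traffic[OF l] by linarith
    then show "(\<Sum>j\<in>{1..J}. lam j * P j l) * tu k l = (lam l - \<alpha> l) * tu k l" by (simp only:)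
  qed
  also have "\<dots> - (\<Sum>j\<in>{1..J}. tu k j * lam j) = - (\<Sum>j\<in>{1..J}. \<alpha> j * tu k j)"
    unfolding sum_subtractf[symmetric] sum_negf[symmetric] by (intro sum.cong) (auto simp: algebra_simps)
  finally show ?thesis by simp
qed

text \<open>If \<open>w k k\<close> were 1, all \<open>td k j\<close> would be nonnegative; the
  balance with positive \<open>lam\<close> would force them to vanish, so \<open>P u = u\<close>
  with \<open>u\<close> nonzero, against invertibility of \<open>I - P\<close>.\<close>

lemma w_diag_less_1:
  assumes k: "k \<in> {1..J}"
  shows "w k k < 1"
proof (rule ccontr)
  assume "\<not> w k k < 1"
  then have wkk: "w k k = 1" using w_sol[OF k k] by linarith
  have nn: "0 \<le> td k j * lam j" if j: "j \<in> {1..J}" for j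
  proof -
    have "0 \<le> td k j"
      using w_sol[OF j k] wkk td_signs[OF j k] by (cases j k rule: linorder_cases) auto
    then show ?thesis using lam_pos[OF j] by simp
  qed
  have "0 \<le> (\<Sum>j\<in>{1..J}. \<alpha> j * tu k j)"
    using \<alpha>_nonneg tu_range[OF _ k] by (intro sum_nonneg mult_nonneg_nonneg) auto
  then have "(\<Sum>j\<in>{1..J}. td k j * lam j) \<le> 0" using traffic_balance[OF k] by linarith
  then have "(\<Sum>j\<in>{1..J}. td k j * lam j) = 0" using nn by (intro antisym sum_nonneg)
  then have "\<forall>j\<in>{1..J}. td k j * lam j = 0" using nn by (subst (asm) sum_nonneg_eq_0_iff) auto
  then have td0: "td k j = 0" if "j \<in> {1..J}" for j using lam_pos[OF that] that by force
  obtain Q :: "nat \<Rightarrow> nat \<Rightarrow> real" where Q: "\<And>i k. i \<in> {1..J} \<Longrightarrow> k \<in> {1..J} \<Longrightarrow>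
     (\<Sum>l\<in>{1..J}. Q i l * ((if l = k then 1 else 0) - P l k)) = (if i = k then 1 else 0)"
    using P_open by blast
  have "1 = tu k k" by (simp add: tu_def)
  also have "\<dots> = (\<Sum>m\<in>{1..J}. (if k = m then 1 else 0) * tu k m)"
    using k by (simp add: if_distrib[of "\<lambda>y. y * _"] cong: if_cong)
  also have "\<dots> = (\<Sum>m\<in>{1..J}. \<Sum>l\<in>{1..J}. Q k l * (((if l = m then 1 else 0) - P l m) * tu k m))"
    using Q[OF k] by (intro sum.cong) (simp_all add: sum_distrib_right[symmetric] mult.assoc[symmetric])
  also have "\<dots> = (\<Sum>l\<in>{1..J}. Q k l * (\<Sum>m\<in>{1..J}. ((if l = m then 1 else 0) - P l m) * tu k m))"
    by (subst sum.swap) (simp add: sum_distrib_left)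
  also have "\<dots> = (\<Sum>l\<in>{1..J}. Q k l * 0)"
  proof (rule sum.cong[OF refl])
    fix l assume l: "l \<in> {1..J}"
    have "(\<Sum>m\<in>{1..J}. ((if l = m then 1 else 0) - P l m) * tu k m) = (\<Sum>m\<in>{1..J}. (if m = l then tu k m else 0) - P l m * tu k m)"
      by (intro sum.cong) (auto simp: algebra_simps)
    also have "\<dots> = - td k l" using l by (simp add: sum_subtractf td_eq[OF l k])
    finally show "Q k l * (\<Sum>m\<in>{1..J}. ((if l = m then 1 else 0) - P l m) * tu k m) = Q k l * 0" using td0[OF l] by simp
  qed
  finally show False by simp
qed

text \<open>This is \<open>r < gjn_r0 J w\<close> raised to the power \<open>j - k\<close> and
  multiplied by \<open>r ^ k\<close>. Pairs with \<open>w j k = 0\<close> are outside the index set,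
  and for them the claim is the sign of \<open>1 - w k k\<close>.\<close>

lemma r0_bound:
  assumes r: "0 < r" "r < gjn_r0 J w" and k: "k \<in> {1..J}" and j: "j \<in> {1..J}" "k < j"
  shows "w j k * r ^ j \<le> (1 - w k k) / J * r ^ k"
proof (cases "w j k = 0")
  case True
  then show ?thesis using w_diag_less_1[OF k] r by simp
next
  case False
  define S where "S = {(k, j). 1 \<le> k \<and> k < j \<and> j \<le> J \<and> w j k \<noteq> 0}"
  have "S \<subseteq> {1..J} \<times> {1..J}" by (auto simp: S_def)
  then have fin: "finite S" by (rule finite_subset) simp
  have kj: "(k, j) \<in> S" using k j False by (auto simp: S_def)
  define a where "a = (1 - w k k) / (real J * w j k)"
  have w: "0 < w j k" using False w_sol[OF j(1) k] by simp
  have a: "0 < a" using w_diag_less_1[OF k] w J by (simp add: a_def)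
  have "gjn_r0 J w = Min ((\<lambda>(k, j). ((1 - w k k) / (real J * w j k)) powr (1 / real (j - k))) ` S)"
    using kj unfolding gjn_r0_def Let_def S_def[symmetric] by auto
  also have "\<dots> \<le> a powr (1 / real (j - k))"
    using fin kj by (intro Min_le) (auto simp: a_def intro!: image_eqI[of _ _ "(k, j)"])
  finally have "r < a powr (1 / real (j - k))" using r by linarith
  then have "r ^ (j - k) \<le> (a powr (1 / real (j - k))) ^ (j - k)" using r by (intro power_mono) auto
  also have "\<dots> = a"
    using a j by (simp add: powr_realpow[symmetric] powr_powr)
  finally have "w j k * r ^ (j - k) \<le> (1 - w k k) / J"
    using w J by (simp add: a_def field_simps)
  then have "w j k * r ^ (j - k) * r ^ k \<le> (1 - w k k) / J * r ^ k"
    using r by (intro mult_right_mono) auto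
  then show ?thesis using j by (simp add: mult.assoc power_add[symmetric])
qed

text \<open>The nominal part cancels by the balance. Of the perturbation, station \<open>k\<close>
  contributes \<open>- J * a\<close> with \<open>a\<close> the claimed slope, and each of at most
  \<open>J - 1\<close> upper stations contributes at most \<open>a\<close>; one \<open>- a\<close>
  is left over, which explains the \<open>J\<close> in the definition of the threshold for
  \<open>r\<close>.\<close>

lemma drift_bound:
  assumes r: "0 < r" "r < gjn_r0 J w" and k: "k \<in> {1..J}"
  shows "(\<Sum>j\<in>{1..J}. \<alpha> j * tu k j) + (\<Sum>j\<in>{k..J}. td k j * (lam j + r ^ j)) \<le> - ((1 - w k k) / J * r ^ k)"
proof -
  define a where "a = (1 - w k k) / J * r ^ k"
  have a0: "0 \<le> a" using w_diag_less_1[OF k] r by (simp add: a_def)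
  have "(\<Sum>j\<in>{1..J}. td k j * lam j) = (\<Sum>j\<in>{k..J}. td k j * lam j)"
    using k td_signs[OF _ k] by (intro sum.mono_neutral_right) auto
  then have 1: "(\<Sum>j\<in>{1..J}. \<alpha> j * tu k j) + (\<Sum>j\<in>{k..J}. td k j * lam j) = 0"
    using traffic_balance[OF k] by simp
  have split: "{k..J} = insert k {k<..J}" using k by auto
  have "(\<Sum>j\<in>{k..J}. td k j * r ^ j) = (w k k - 1) * r ^ k + (\<Sum>j\<in>{k<..J}. td k j * r ^ j)"
    unfolding split using td_signs(4)[OF k k] by (subst sum.insert) auto
  also have "(\<Sum>j\<in>{k<..J}. td k j * r ^ j) \<le> (\<Sum>j\<in>{k<..J}. a)"
  proof (rule sum_mono)
    fix j assume "j \<in> {k<..J}"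
    then have j: "j \<in> {1..J}" "k < j" using k by auto
    show "td k j * r ^ j \<le> a"
      using r0_bound[OF r k j] td_signs(3)[OF j(1) k j(2)] by (simp add: a_def)
  qed
  also have "(\<Sum>j\<in>{k<..J}. a) = real (J - k) * a" by simp
  also have "\<dots> \<le> (real J - 1) * a" using k a0 by (intro mult_right_mono) auto
  also have "(w k k - 1) * r ^ k = - real J * a" using J by (simp add: a_def field_simps)
  finally have "(\<Sum>j\<in>{k..J}. td k j * r ^ j) \<le> - a" by (simp add: algebra_simps)
  then show ?thesis using 1 by (simp add: a_def distrib_left sum.distrib)
qed

end

context gjn_net
begin

lemma srv_resid_bound:
  assumes st: "gjn_stationary \<Omega> J \<alpha> \<mu> Te Ts rt \<pi>" and harris: "gjn_harris_recurrent \<Omega> J \<alpha> \<mu> Te Ts rt"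
    and j: "j \<in> {1..J}" and l: "0 < l" "l \<le> \<mu> j" and \<kappa>: "\<mu> j \<le> \<kappa>"
    and fin: "(\<integral>\<^sup>+\<omega>. renewal_sum (\<lambda>i. Ts j i \<omega>) \<kappa> ^ Suc n \<partial>\<Omega>) = ennreal m" "0 \<le> m"
  shows "(\<integral>\<^sup>+x. ennreal (snd (snd (x j)) ^ n) \<partial>\<pi>) \<le> ennreal (1 + m / l ^ Suc n) + (\<integral>\<^sup>+\<omega>. ennreal ((Ts j 1 \<omega> / l) ^ n) \<partial>\<Omega>)"
proof -
  have s: "sets \<pi> = sets (gjn_space J)" using st by (auto simp: gjn_stationary_def)
  have "(\<lambda>x. x) \<in> \<pi> \<rightarrow>\<^sub>M gjn_space J" by (rule measurable_ident_sets[OF s])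
  note parts = measurable_gjn_space_parts[OF j this]
  have [measurable]: "Measurable.pred \<pi> (\<lambda>x. fst (x j) = 0)" by (rule measurable_compose[OF parts(1)]) simp
  have [measurable]: "Measurable.pred \<pi> (\<lambda>x. 0 < fst (x j))" by (rule measurable_compose[OF parts(1)]) simp
  note [measurable] = parts(3)
  have "(\<integral>\<^sup>+x. ennreal (snd (snd (x j)) ^ n) \<partial>\<pi>) =
     (\<integral>\<^sup>+x. ennreal (if 0 < fst (x j) then snd (snd (x j)) ^ n else 0) + ennreal (if fst (x j) = 0 then snd (snd (x j)) ^ n else 0) \<partial>\<pi>)"
    by (intro nn_integral_cong) auto
  also have "\<dots> = (\<integral>\<^sup>+x. ennreal (if 0 < fst (x j) then snd (snd (x j)) ^ n else 0) \<partial>\<pi>) +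
      (\<integral>\<^sup>+x. ennreal (if fst (x j) = 0 then snd (snd (x j)) ^ n else 0) \<partial>\<pi>)"
    by (rule nn_integral_add) measurable
  also have "\<dots> \<le> ennreal (1 + m / l ^ Suc n) + (\<integral>\<^sup>+\<omega>. ennreal ((Ts j 1 \<omega> / l) ^ n) \<partial>\<Omega>)"
  proof (rule add_mono[OF srv_resid_busy_bound[OF st j l \<kappa> fin]])
    have "(\<integral>\<^sup>+\<omega>. ennreal ((Ts j 1 \<omega> / \<mu> j) ^ n) \<partial>\<Omega>) \<le> (\<integral>\<^sup>+\<omega>. ennreal ((Ts j 1 \<omega> / l) ^ n) \<partial>\<Omega>)"
      using Ts_nonneg[OF j, of 1] l by (intro nn_integral_mono ennreal_leI power_mono divide_left_mono) auto
    then show "(\<integral>\<^sup>+x. ennreal (if fst (x j) = 0 then snd (snd (x j)) ^ n else 0) \<partial>\<pi>) \<le> (\<integral>\<^sup>+\<omega>. ennreal ((Ts j 1 \<omega> / l) ^ n) \<partial>\<Omega>)"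
      by (rule order_trans[OF srv_resid_idle_bound[OF st harris j]])
  qed
  finally show ?thesis .
qed

end

section \<open>Stationary moments at one station\<close>

context gjn_drift
begin

lemma Sr_mean_nonneg: "0 \<le> (\<integral>\<omega>. Sr \<omega> ^ (M + 1) \<partial>\<Omega>)"
  using Sr_ge_1 by (intro integral_nonneg_AE AE_I2 zero_le_power) (meson order_trans zero_le_one)

text \<open>The drift inequality still has a multiple of \<open>f0 ^ (M - 1)\<close> on its right
  side, whose stationary mean is unknown. Half of the drift is spent on absorbing it pointwise,
  which leaves the factor \<open>c / 2\<close>.\<close>

lemma stationary_f0_moment:
  assumes st: "gjn_stationary \<Omega> J \<alpha> \<mu> Te Ts rt \<pi>" and e: "0 < eps"
    and D: "D = Cp * (\<integral>\<omega>. Sr \<omega> ^ (M + 1) \<partial>\<Omega>)" and c: "c = real (Suc M) / 2 ^ M"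
  shows "(\<integral>\<^sup>+x. ennreal (c / 2 * eps * f0 x ^ M) \<partial>\<pi>) \<le> (\<integral>\<^sup>+x. ennreal (D * (W0 x ^ M + (2 * D / (c * eps)) ^ (M - 1) + 1)) \<partial>\<pi>)"
proof (rule stationary_drift[OF st, where V = "\<lambda>x. ppow (Suc M) (FX x)"])
  have D0: "0 \<le> D" unfolding D by (intro mult_nonneg_nonneg Cp_nonneg Sr_mean_nonneg)
  have c0: "0 < c" by (simp add: c)
  have f0m: "f0 \<in> borel_measurable (gjn_space J)"
    unfolding f0_def[abs_def] using measurable_FX by measurable
  have W0m: "W0 \<in> borel_measurable (gjn_space J)"
    unfolding W0_def[abs_def]
  proof (intro borel_measurable_add borel_measurable_sum borel_measurable_times borel_measurable_const)
    fix j assume "j \<in> {1..<k}"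
    then have j: "j \<in> {1..J}" using k by auto
    show "(\<lambda>x. real (fst (x j))) \<in> borel_measurable (gjn_space J)"
      by (rule measurable_compose[OF measurable_gjn_space_parts(1)[OF j measurable_ident_sets[OF refl]]]) simp
  next
    show "(\<lambda>x. snd (snd (x k))) \<in> borel_measurable (gjn_space J)"
      by (rule measurable_gjn_space_parts(3)[OF k measurable_ident_sets[OF refl]])
  qed
  show "(\<lambda>x. ppow (Suc M) (FX x)) \<in> borel_measurable (gjn_space J)" by (rule measurable_ppow[OF measurable_FX])
  show "(\<lambda>x. c / 2 * eps * f0 x ^ M) \<in> borel_measurable (gjn_space J)" using f0m by measurable
  show "(\<lambda>x. D * (W0 x ^ M + (2 * D / (c * eps)) ^ (M - 1) + 1)) \<in> borel_measurable (gjn_space J)" using W0m by measurable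
  fix x assume x: "x \<in> space (gjn_space J)"
  define a where "a = c * eps * f0 x ^ M"
  define b where "b = (2 * D / (c * eps)) ^ (M - 1)"
  have a0: "0 \<le> a" using c0 e f0_nonneg[of x] by (simp add: a_def)
  have b0: "0 \<le> b" using D0 c0 e by (simp add: b_def)
  have W0: "0 \<le> W0 x" by (rule W0_nonneg[OF state_ok_space[OF x]])
  show "0 \<le> ppow (Suc M) (FX x)" by simp
  show "0 \<le> c / 2 * eps * f0 x ^ M" using a0 by (simp add: a_def)
  show "0 \<le> D * (W0 x ^ M + (2 * D / (c * eps)) ^ (M - 1) + 1)" using D0 W0 b0 by (simp add: b_def)
  \<comment> \<open>Above the level \<open>2 * D / (c * eps)\<close> half of the drift beats the
    term; below it the term is bounded by the power of the level.\<close>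
  have key: "D * f0 x ^ (M - 1) \<le> a / 2 + D * b"
  proof (cases "2 * D / (c * eps) \<le> f0 x")
    case True
    then have "D \<le> c * eps / 2 * f0 x" using c0 e by (simp add: field_simps)
    then have "D * f0 x ^ (M - 1) \<le> c * eps / 2 * f0 x * f0 x ^ (M - 1)"
      using f0_nonneg[of x] by (intro mult_right_mono) auto
    also have "\<dots> = a / 2" using M by (cases M) (auto simp: a_def)
    finally show ?thesis using D0 b0 by (simp add: add_increasing2)
  next
    case False
    then have "f0 x ^ (M - 1) \<le> b" unfolding b_def using f0_nonneg[of x] by (intro power_mono) auto
    then have "D * f0 x ^ (M - 1) \<le> D * b" using D0 by (rule mult_left_mono)
    then show ?thesis using a0 by simp
  qed
  have de: "(\<integral>\<^sup>+\<omega>. ennreal (ppow (Suc M) (FX (netX (Y \<omega>) x 1))) \<partial>\<Omega>) + ennreal a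
    \<le> ennreal (ppow (Suc M) (FX x) + D * (W0 x ^ M + f0 x ^ (M - 1) + 1))"
    using drift_expectation[OF x] by (simp add: a_def c D)
  then obtain v where v: "(\<integral>\<^sup>+\<omega>. ennreal (ppow (Suc M) (FX (netX (Y \<omega>) x 1))) \<partial>\<Omega>) = ennreal v" "0 \<le> v"
    by (cases "\<integral>\<^sup>+\<omega>. ennreal (ppow (Suc M) (FX (netX (Y \<omega>) x 1))) \<partial>\<Omega>") (auto simp: top_unique)
  have nn: "0 \<le> ppow (Suc M) (FX x) + D * (W0 x ^ M + f0 x ^ (M - 1) + 1)"
    using D0 W0 f0_nonneg[of x] by simp
  have "v + a \<le> ppow (Suc M) (FX x) + D * (W0 x ^ M + f0 x ^ (M - 1) + 1)"
    using de nn a0 v(2) unfolding v(1) by (simp add: ennreal_plus[symmetric] del: ennreal_plus)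
  then have "v + a / 2 \<le> ppow (Suc M) (FX x) + D * (W0 x ^ M + b + 1)"
    using key unfolding distrib_left by linarith
  then have "ennreal (v + a / 2) \<le> ennreal (ppow (Suc M) (FX x) + D * (W0 x ^ M + b + 1))" by (rule ennreal_leI)
  moreover have "ennreal v + ennreal (c / 2 * eps * f0 x ^ M) = ennreal (v + a / 2)"
    using v(2) a0 by (simp add: a_def ennreal_plus)
  ultimately show "(\<integral>\<^sup>+\<omega>. ennreal (ppow (Suc M) (FX (netX (Y \<omega>) x 1))) \<partial>\<Omega>) + ennreal (c / 2 * eps * f0 x ^ M)
     \<le> ennreal (ppow (Suc M) (FX x) + D * (W0 x ^ M + (2 * D / (c * eps)) ^ (M - 1) + 1))"
    unfolding v(1) b_def by (simp only:)
qed

lemma Z_le_f0: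
  assumes x: "state_ok x" and uk: "u k = 1"
  shows "real (fst (x k)) \<le> f0 x + (\<Sum>j\<in>{1..k}. \<alpha> j * fst (snd (x j))) + (\<Sum>j\<in>{1..J}. \<mu> j * snd (snd (x j)))"
proof -
  have R: "0 \<le> fst (snd (x j))" "0 \<le> snd (snd (x j))" if "j \<in> {1..J}" for j
    using x that by (auto simp: state_ok_def)
  have "u k * real (fst (x k)) \<le> (\<Sum>j\<in>{1..J}. u j * real (fst (x j)))"
    using k u by (intro member_le_sum) auto
  moreover have "(\<Sum>j\<in>{1..J}. \<alpha> j * u j * fst (snd (x j))) \<le> (\<Sum>j\<in>{1..k}. \<alpha> j * fst (snd (x j)))"
  proof -
    have "(\<Sum>j\<in>{1..J}. \<alpha> j * u j * fst (snd (x j))) = (\<Sum>j\<in>{1..k}. \<alpha> j * u j * fst (snd (x j)))"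
      using k u_above by (intro sum.mono_neutral_right) auto
    also have "\<dots> \<le> (\<Sum>j\<in>{1..k}. \<alpha> j * fst (snd (x j)))"
    proof (rule sum_mono)
      fix j assume "j \<in> {1..k}"
      then have j: "j \<in> {1..J}" using k by auto
      have "u j * (\<alpha> j * fst (snd (x j))) \<le> 1 * (\<alpha> j * fst (snd (x j)))"
        using u[OF j] \<alpha>_nonneg[OF j] R[OF j] by (intro mult_right_mono) auto
      then show "\<alpha> j * u j * fst (snd (x j)) \<le> \<alpha> j * fst (snd (x j))" by (simp add: mult_ac)
    qed
    finally show ?thesis .
  qed
  moreover have "(\<Sum>j\<in>{1..J}. d j * \<mu> j * snd (snd (x j))) \<le> (\<Sum>j\<in>{1..J}. \<mu> j * snd (snd (x j)))"
  proof (rule sum_mono)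
    fix j assume j: "j \<in> {1..J}"
    have "d j * (\<mu> j * snd (snd (x j))) \<le> 1 * (\<mu> j * snd (snd (x j)))"
      using d[OF j] \<mu>_pos[OF j] R[OF j] by (intro mult_right_mono) auto
    then show "d j * \<mu> j * snd (snd (x j)) \<le> \<mu> j * snd (snd (x j))" by (simp add: mult_ac)
  qed
  moreover have "FX x \<le> f0 x" by (simp add: f0_def)
  ultimately show ?thesis unfolding FX_def Fz_def uk by linarith
qed

text \<open>With \<rho> in the role of \<open>r ^ k\<close> and \<open>eps\<close> proportional to
  it, the absorption level is \<open>E\<close> divided by \<rho>. Dividing the drift inequality by
  \<open>eps\<close> and scaling by \<open>\<rho> ^ M\<close> puts \<open>\<rho> ^ (M - 1)\<close>
  in front of \<open>W0 ^ M\<close> and cancels the level exactly, so the bound contains \<rho> only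
  through the hypotheses on \<open>CZ\<close>, \<open>CE\<close> and \<open>CS\<close>.\<close>

lemma stationary_Z_moment:
  assumes st: "gjn_stationary \<Omega> J \<alpha> \<mu> Te Ts rt \<pi>"
    and \<rho>: "0 < \<rho>" "\<rho> \<le> 1" and c0: "0 < c0" "eps = c0 * \<rho>" and uk: "u k = 1"
    and CZ: "\<And>j. j \<in> {1..<k} \<Longrightarrow> 0 \<le> CZ j \<and> (\<integral>\<^sup>+x. ennreal (\<rho> ^ (M - 1) * real (fst (x j)) ^ M) \<partial>\<pi>) \<le> ennreal (CZ j)"
    and CE: "\<And>j. j \<in> {1..k} \<Longrightarrow> 0 \<le> CE j \<and> (\<integral>\<^sup>+x. ennreal ((\<alpha> j * fst (snd (x j))) ^ M) \<partial>\<pi>) \<le> ennreal (CE j)"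
    and CS: "\<And>j. j \<in> {1..J} \<Longrightarrow> 0 \<le> CS j \<and> (\<integral>\<^sup>+x. ennreal ((\<mu> j * snd (snd (x j))) ^ M) \<partial>\<pi>) \<le> ennreal (CS j)"
    and E: "E = 2 * (Cp * (\<integral>\<omega>. Sr \<omega> ^ (M + 1) \<partial>\<Omega>)) / (real (Suc M) / 2 ^ M * c0)"
  shows "(\<integral>\<^sup>+x. ennreal ((\<rho> * real (fst (x k))) ^ M) \<partial>\<pi>)
    \<le> ennreal (4 ^ M * (E * (2 ^ M * (real k ^ M * (\<Sum>j\<in>{1..<k}. CZ j) + CS k) + E ^ (M - 1) + 1)
        + real k ^ M * (\<Sum>j\<in>{1..k}. CE j) + real J ^ M * (\<Sum>j\<in>{1..J}. CS j)))"
proof -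
  have s: "sets \<pi> = sets (gjn_space J)" and pr: "prob_space \<pi>"
    using st by (auto simp: gjn_stationary_def)
  interpret \<pi>: prob_space \<pi> by fact
  have sp: "space \<pi> = space (gjn_space J)" using s by (rule sets_eq_imp_space_eq)
  have idm: "(\<lambda>x. x) \<in> \<pi> \<rightarrow>\<^sub>M gjn_space J" by (rule measurable_ident_sets[OF s])
  have zm: "(\<lambda>x. real (fst (x j))) \<in> borel_measurable \<pi>" if "j \<in> {1..J}" for j
    by (rule measurable_compose[OF measurable_gjn_space_parts(1)[OF that idm]]) simp
  have em: "(\<lambda>x. fst (snd (x j))) \<in> borel_measurable \<pi>" and sm: "(\<lambda>x. snd (snd (x j))) \<in> borel_measurable \<pi>"
    if "j \<in> {1..J}" for j using measurable_gjn_space_parts(2,3)[OF that idm] .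
  have R: "0 \<le> fst (snd (x j))" "0 \<le> snd (snd (x j))" if "x \<in> space \<pi>" "j \<in> {1..J}" for x j
    using state_ok_space[of x] that sp by (auto simp: state_ok_def)
  have M0: "0 < M" using M by simp
  define c where "c = real (Suc M) / 2 ^ M"
  define D where "D = Cp * (\<integral>\<omega>. Sr \<omega> ^ (M + 1) \<partial>\<Omega>)"
  have c: "0 < c" by (simp add: c_def)
  have D: "0 \<le> D" unfolding D_def by (intro mult_nonneg_nonneg Cp_nonneg Sr_mean_nonneg)
  have E': "E = 2 * D / (c * c0)" by (simp add: E D_def c_def)
  have E0: "0 \<le> E" using c c0 D by (simp add: E')
  define sZ where "sZ = (\<lambda>x::nat \<Rightarrow> nat \<times> real \<times> real. \<Sum>j\<in>{1..<k}. \<rho> ^ (M - 1) * real (fst (x j)) ^ M)"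
  define sS where "sS = (\<lambda>x::nat \<Rightarrow> nat \<times> real \<times> real. \<Sum>j\<in>{1..J}. (\<mu> j * snd (snd (x j))) ^ M)"
  define sE where "sE = (\<lambda>x::nat \<Rightarrow> nat \<times> real \<times> real. \<Sum>j\<in>{1..k}. (\<alpha> j * fst (snd (x j))) ^ M)"
  have IZ: "(\<integral>\<^sup>+x. ennreal (sZ x) \<partial>\<pi>) \<le> ennreal (\<Sum>j\<in>{1..<k}. CZ j)"
  proof -
    have "(\<integral>\<^sup>+x. ennreal (sZ x) \<partial>\<pi>) = (\<integral>\<^sup>+x. (\<Sum>j\<in>{1..<k}. ennreal (\<rho> ^ (M - 1) * real (fst (x j)) ^ M)) \<partial>\<pi>)"
      unfolding sZ_def using \<rho> by (intro nn_integral_cong sum_ennreal[symmetric]) auto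
    also have "\<dots> = (\<Sum>j\<in>{1..<k}. \<integral>\<^sup>+x. ennreal (\<rho> ^ (M - 1) * real (fst (x j)) ^ M) \<partial>\<pi>)"
    proof (rule nn_integral_sum)
      fix j assume "j \<in> {1..<k}"
      then have [measurable]: "(\<lambda>x. real (fst (x j))) \<in> borel_measurable \<pi>" using k by (intro zm) auto
      show "(\<lambda>x. ennreal (\<rho> ^ (M - 1) * real (fst (x j)) ^ M)) \<in> borel_measurable \<pi>" by measurable
    qed
    also have "\<dots> \<le> (\<Sum>j\<in>{1..<k}. ennreal (CZ j))" using CZ by (intro sum_mono) auto
    also have "\<dots> = ennreal (\<Sum>j\<in>{1..<k}. CZ j)" using CZ by (intro sum_ennreal) auto
    finally show ?thesis .
  qed
  have IE: "(\<integral>\<^sup>+x. ennreal (sE x) \<partial>\<pi>) \<le> ennreal (\<Sum>j\<in>{1..k}. CE j)"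
  proof -
    have "(\<integral>\<^sup>+x. ennreal (sE x) \<partial>\<pi>) = (\<integral>\<^sup>+x. (\<Sum>j\<in>{1..k}. ennreal ((\<alpha> j * fst (snd (x j))) ^ M)) \<partial>\<pi>)"
      unfolding sE_def
    proof (intro nn_integral_cong sum_ennreal[symmetric])
      fix x j assume "x \<in> space \<pi>" "j \<in> {1..k}"
      then show "0 \<le> (\<alpha> j * fst (snd (x j))) ^ M" using R[of x j] \<alpha>_nonneg[of j] k by auto
    qed
    also have "\<dots> = (\<Sum>j\<in>{1..k}. \<integral>\<^sup>+x. ennreal ((\<alpha> j * fst (snd (x j))) ^ M) \<partial>\<pi>)"
    proof (rule nn_integral_sum)
      fix j assume "j \<in> {1..k}"
      then have [measurable]: "(\<lambda>x. fst (snd (x j))) \<in> borel_measurable \<pi>" using k by (intro em) auto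
      show "(\<lambda>x. ennreal ((\<alpha> j * fst (snd (x j))) ^ M)) \<in> borel_measurable \<pi>" by measurable
    qed
    also have "\<dots> \<le> (\<Sum>j\<in>{1..k}. ennreal (CE j))" using CE by (intro sum_mono) auto
    also have "\<dots> = ennreal (\<Sum>j\<in>{1..k}. CE j)" using CE by (intro sum_ennreal) auto
    finally show ?thesis .
  qed
  have IS: "(\<integral>\<^sup>+x. ennreal (sS x) \<partial>\<pi>) \<le> ennreal (\<Sum>j\<in>{1..J}. CS j)"
  proof -
    have "(\<integral>\<^sup>+x. ennreal (sS x) \<partial>\<pi>) = (\<integral>\<^sup>+x. (\<Sum>j\<in>{1..J}. ennreal ((\<mu> j * snd (snd (x j))) ^ M)) \<partial>\<pi>)"
      unfolding sS_def
    proof (intro nn_integral_cong sum_ennreal[symmetric])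
      fix x j assume "x \<in> space \<pi>" "j \<in> {1..J}"
      then show "0 \<le> (\<mu> j * snd (snd (x j))) ^ M" using R[of x j] \<mu>_pos[of j] by auto
    qed
    also have "\<dots> = (\<Sum>j\<in>{1..J}. \<integral>\<^sup>+x. ennreal ((\<mu> j * snd (snd (x j))) ^ M) \<partial>\<pi>)"
    proof (rule nn_integral_sum)
      fix j assume "j \<in> {1..J}"
      then have [measurable]: "(\<lambda>x. snd (snd (x j))) \<in> borel_measurable \<pi>" by (rule sm)
      show "(\<lambda>x. ennreal ((\<mu> j * snd (snd (x j))) ^ M)) \<in> borel_measurable \<pi>" by measurable
    qed
    also have "\<dots> \<le> (\<Sum>j\<in>{1..J}. ennreal (CS j))" using CS by (intro sum_mono) auto
    also have "\<dots> = ennreal (\<Sum>j\<in>{1..J}. CS j)" using CS by (intro sum_ennreal) auto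
    finally show ?thesis .
  qed
  have mZ: "sZ \<in> borel_measurable \<pi>"
    unfolding sZ_def using k zm by (intro borel_measurable_sum borel_measurable_times borel_measurable_power borel_measurable_const) auto
  have mE: "sE \<in> borel_measurable \<pi>"
    unfolding sE_def using k em by (intro borel_measurable_sum borel_measurable_times borel_measurable_power borel_measurable_const) auto
  have mS: "sS \<in> borel_measurable \<pi>"
    unfolding sS_def using sm by (intro borel_measurable_sum borel_measurable_times borel_measurable_power borel_measurable_const) auto
  have f0m: "f0 \<in> borel_measurable \<pi>"
    using measurable_compose[OF idm measurable_FX] unfolding f0_def[abs_def] by measurable
  have kS: "(\<lambda>x. (\<mu> k * snd (snd (x k))) ^ M) \<in> borel_measurable \<pi>"
    using sm[OF k] by (intro borel_measurable_power borel_measurable_times borel_measurable_const)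
  define KW where "KW = 2 ^ M * (real k ^ M * (\<Sum>j\<in>{1..<k}. CZ j) + CS k)"
  have KW0: "0 \<le> KW" using CZ CS[OF k] by (auto simp: KW_def intro!: mult_nonneg_nonneg add_nonneg_nonneg sum_nonneg)
  have IW: "(\<integral>\<^sup>+x. ennreal (\<rho> ^ (M - 1) * W0 x ^ M) \<partial>\<pi>) \<le> ennreal KW"
  proof -
    have "(\<integral>\<^sup>+x. ennreal (\<rho> ^ (M - 1) * W0 x ^ M) \<partial>\<pi>) \<le>
       (\<integral>\<^sup>+x. ennreal (2 ^ M * real k ^ M) * ennreal (sZ x) + ennreal (2 ^ M) * ennreal ((\<mu> k * snd (snd (x k))) ^ M) \<partial>\<pi>)"
    proof (rule nn_integral_mono)
      fix x assume x: "x \<in> space \<pi>"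
      define z where "z = (\<Sum>j\<in>{1..<k}. real (fst (x j)))"
      define y where "y = \<mu> k * snd (snd (x k))"
      have z0: "0 \<le> z" by (simp add: z_def sum_nonneg)
      have y0: "0 \<le> y" using R[OF x k] \<mu>_pos[OF k] by (simp add: y_def)
      have sz0: "0 \<le> sZ x" using \<rho> by (auto simp: sZ_def intro!: sum_nonneg)
      have z: "z ^ M \<le> real k ^ M * (\<Sum>j\<in>{1..<k}. real (fst (x j)) ^ M)"
      proof -
        have "z ^ M \<le> real (card {1..<k}) ^ M * (\<Sum>j\<in>{1..<k}. real (fst (x j)) ^ M)"
          unfolding z_def by (rule sum_power_le[OF _ M0]) auto
        also have "\<dots> \<le> real k ^ M * (\<Sum>j\<in>{1..<k}. real (fst (x j)) ^ M)"
          by (intro mult_right_mono power_mono sum_nonneg) auto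
        finally show ?thesis .
      qed
      have r1: "0 \<le> \<rho> ^ (M - 1)" "\<rho> ^ (M - 1) \<le> 1" using \<rho> by (auto intro: power_le_one)
      have "\<rho> ^ (M - 1) * W0 x ^ M \<le> \<rho> ^ (M - 1) * (2 ^ M * (z ^ M + y ^ M))"
        unfolding W0_def z_def[symmetric] y_def[symmetric] using z0 y0 r1 by (intro mult_left_mono add_power_le) auto
      also have "\<dots> = 2 ^ M * (\<rho> ^ (M - 1) * z ^ M) + 2 ^ M * (\<rho> ^ (M - 1) * y ^ M)"
        by (simp add: algebra_simps)
      also have "\<dots> \<le> 2 ^ M * (\<rho> ^ (M - 1) * (real k ^ M * (\<Sum>j\<in>{1..<k}. real (fst (x j)) ^ M))) + 2 ^ M * (1 * y ^ M)"
        using r1 z y0 by (intro add_mono mult_left_mono mult_right_mono) auto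
      also have "\<dots> = 2 ^ M * real k ^ M * sZ x + 2 ^ M * y ^ M"
        unfolding sZ_def sum_distrib_left[symmetric] by (simp add: mult_ac)
      finally have "ennreal (\<rho> ^ (M - 1) * W0 x ^ M) \<le> ennreal (2 ^ M * real k ^ M * sZ x + 2 ^ M * y ^ M)" by (rule ennreal_leI)
      also have "\<dots> = ennreal (2 ^ M * real k ^ M) * ennreal (sZ x) + ennreal (2 ^ M) * ennreal (y ^ M)"
        using sz0 y0 by (simp add: ennreal_plus ennreal_mult)
      finally show "ennreal (\<rho> ^ (M - 1) * W0 x ^ M) \<le> ennreal (2 ^ M * real k ^ M) * ennreal (sZ x) + ennreal (2 ^ M) * ennreal ((\<mu> k * snd (snd (x k))) ^ M)"
        by (simp only: y_def)
    qed
    also have "\<dots> = ennreal (2 ^ M * real k ^ M) * (\<integral>\<^sup>+x. ennreal (sZ x) \<partial>\<pi>) + ennreal (2 ^ M) * (\<integral>\<^sup>+x. ennreal ((\<mu> k * snd (snd (x k))) ^ M) \<partial>\<pi>)"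
      using mZ kS by (subst nn_integral_add) (auto simp: nn_integral_cmult)
    also have "\<dots> \<le> ennreal (2 ^ M * real k ^ M) * ennreal (\<Sum>j\<in>{1..<k}. CZ j) + ennreal (2 ^ M) * ennreal (CS k)"
      using IZ CS[OF k] by (intro add_mono mult_left_mono) auto
    also have "\<dots> = ennreal KW"
    proof -
      have z: "0 \<le> (\<Sum>j\<in>{1..<k}. CZ j)" by (rule sum_nonneg) (use CZ in blast)
      have "KW = 2 ^ M * real k ^ M * (\<Sum>j\<in>{1..<k}. CZ j) + 2 ^ M * CS k"
        by (simp add: KW_def distrib_left mult.assoc)
      then show ?thesis using z conjunct1[OF CS[OF k]] by (simp add: ennreal_plus ennreal_mult)
    qed
    finally show ?thesis .
  qed
  define KF where "KF = E * (KW + E ^ (M - 1) + 1)"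
  have KF0: "0 \<le> KF" using E0 KW0 by (simp add: KF_def)
  have IF: "(\<integral>\<^sup>+x. ennreal ((\<rho> * f0 x) ^ M) \<partial>\<pi>) \<le> ennreal KF"
  proof -
    \<comment> \<open>The factor that turns \<open>c / 2 * eps * f0 x ^ M\<close> into
      \<open>(\<rho> * f0 x) ^ M\<close>.\<close>
    define K where "K = 2 * \<rho> ^ (M - 1) / (c * c0)"
    have K0: "0 \<le> K" using \<rho> c c0 by (simp add: K_def)
    have eps0: "0 < eps" using c0 \<rho> by simp
    have rM: "\<rho> ^ M = \<rho> ^ (M - 1) * \<rho>" using M by (cases M) auto
    have "(\<integral>\<^sup>+x. ennreal ((\<rho> * f0 x) ^ M) \<partial>\<pi>) = (\<integral>\<^sup>+x. ennreal K * ennreal (c / 2 * eps * f0 x ^ M) \<partial>\<pi>)"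
    proof (rule nn_integral_cong)
      fix x
      have "(\<rho> * f0 x) ^ M = K * (c / 2 * eps * f0 x ^ M)"
        unfolding power_mult_distrib rM K_def c0(2) using c c0(1) by (simp add: field_simps)
      then show "ennreal ((\<rho> * f0 x) ^ M) = ennreal K * ennreal (c / 2 * eps * f0 x ^ M)"
        by (simp only: ennreal_mult'[OF K0])
    qed
    also have "\<dots> = ennreal K * (\<integral>\<^sup>+x. ennreal (c / 2 * eps * f0 x ^ M) \<partial>\<pi>)"
      using f0m by (intro nn_integral_cmult) measurable
    also have "\<dots> \<le> ennreal K * (\<integral>\<^sup>+x. ennreal (D * (W0 x ^ M + (2 * D / (c * eps)) ^ (M - 1) + 1)) \<partial>\<pi>)"
      by (intro mult_left_mono stationary_f0_moment[OF st eps0 D_def c_def]) simp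
    also have "\<dots> = (\<integral>\<^sup>+x. ennreal K * ennreal (D * (W0 x ^ M + (2 * D / (c * eps)) ^ (M - 1) + 1)) \<partial>\<pi>)"
    proof (rule nn_integral_cmult[symmetric])
      have "W0 \<in> borel_measurable \<pi>"
        unfolding W0_def[abs_def] using k zm sm[OF k]
        by (intro borel_measurable_add borel_measurable_sum borel_measurable_times borel_measurable_const) auto
      then show "(\<lambda>x. ennreal (D * (W0 x ^ M + (2 * D / (c * eps)) ^ (M - 1) + 1))) \<in> borel_measurable \<pi>" by measurable
    qed
    also have "\<dots> \<le> (\<integral>\<^sup>+x. ennreal E * ennreal (\<rho> ^ (M - 1) * W0 x ^ M) + ennreal (E * (E ^ (M - 1) + 1)) \<partial>\<pi>)"
    proof (rule nn_integral_mono)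
      fix x assume x: "x \<in> space \<pi>"
      have W: "0 \<le> W0 x" using x sp by (intro W0_nonneg state_ok_space) simp
      have r1: "0 \<le> \<rho> ^ (M - 1)" "\<rho> ^ (M - 1) \<le> 1" using \<rho> by (auto intro: power_le_one)
      have KD: "K * D = E * \<rho> ^ (M - 1)" by (simp add: K_def E')
      have "2 * D / (c * eps) = E / \<rho>" by (simp add: E' c0(2))
      then have b: "\<rho> ^ (M - 1) * (2 * D / (c * eps)) ^ (M - 1) = E ^ (M - 1)"
        using \<rho> by (simp add: power_divide)
      have "K * (D * (W0 x ^ M + (2 * D / (c * eps)) ^ (M - 1) + 1)) =
          E * (\<rho> ^ (M - 1) * W0 x ^ M) + E * (\<rho> ^ (M - 1) * (2 * D / (c * eps)) ^ (M - 1)) + E * \<rho> ^ (M - 1)"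
        unfolding mult.assoc[symmetric] KD by (simp add: algebra_simps)
      also have "\<dots> \<le> E * (\<rho> ^ (M - 1) * W0 x ^ M) + E * (E ^ (M - 1) + 1)"
        unfolding b distrib_left using E0 r1 by (simp add: mult_left_le)
      finally have "ennreal (K * (D * (W0 x ^ M + (2 * D / (c * eps)) ^ (M - 1) + 1))) \<le> ennreal (E * (\<rho> ^ (M - 1) * W0 x ^ M) + E * (E ^ (M - 1) + 1))"
        by (rule ennreal_leI)
      then show "ennreal K * ennreal (D * (W0 x ^ M + (2 * D / (c * eps)) ^ (M - 1) + 1)) \<le> ennreal E * ennreal (\<rho> ^ (M - 1) * W0 x ^ M) + ennreal (E * (E ^ (M - 1) + 1))"
        using K0 E0 r1 W by (simp add: ennreal_mult' ennreal_plus)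
    qed
    also have "\<dots> = ennreal E * (\<integral>\<^sup>+x. ennreal (\<rho> ^ (M - 1) * W0 x ^ M) \<partial>\<pi>) + ennreal (E * (E ^ (M - 1) + 1))"
    proof -
      have [measurable]: "W0 \<in> borel_measurable \<pi>"
        unfolding W0_def[abs_def] using k zm sm[OF k]
        by (intro borel_measurable_add borel_measurable_sum borel_measurable_times borel_measurable_const) auto
      show ?thesis by (subst nn_integral_add) (simp_all add: nn_integral_cmult \<pi>.emeasure_space_1)
    qed
    also have "\<dots> \<le> ennreal E * ennreal KW + ennreal (E * (E ^ (M - 1) + 1))"
      using IW by (intro add_right_mono mult_left_mono) auto
    also have "\<dots> = ennreal KF"
      using E0 KW0 by (simp add: KF_def ennreal_mult[symmetric] ennreal_plus[symmetric] algebra_simps del: ennreal_plus)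
    finally show ?thesis .
  qed
  have "(\<integral>\<^sup>+x. ennreal ((\<rho> * real (fst (x k))) ^ M) \<partial>\<pi>) \<le>
     (\<integral>\<^sup>+x. ennreal (4 ^ M) * ennreal ((\<rho> * f0 x) ^ M) + (ennreal (4 ^ M * real k ^ M) * ennreal (sE x) + ennreal (4 ^ M * real J ^ M) * ennreal (sS x)) \<partial>\<pi>)"
  proof (rule nn_integral_mono)
    fix x assume x: "x \<in> space \<pi>"
    define a where "a = \<rho> * f0 x"
    define b where "b = (\<Sum>j\<in>{1..k}. \<alpha> j * fst (snd (x j)))"
    define s' where "s' = (\<Sum>j\<in>{1..J}. \<mu> j * snd (snd (x j)))"
    have nb: "0 \<le> \<alpha> j * fst (snd (x j))" if "j \<in> {1..k}" for j using that k R[OF x, of j] \<alpha>_nonneg[of j] by auto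
    have ns: "0 \<le> \<mu> j * snd (snd (x j))" if "j \<in> {1..J}" for j using R[OF x that] \<mu>_pos[OF that] by auto
    have a0: "0 \<le> a" using f0_nonneg[of x] \<rho> by (simp add: a_def)
    have b0: "0 \<le> b" unfolding b_def by (rule sum_nonneg) (rule nb)
    have s0: "0 \<le> s'" unfolding s'_def by (rule sum_nonneg) (rule ns)
    have sE0: "0 \<le> sE x" unfolding sE_def by (rule sum_nonneg) (rule zero_le_power[OF nb])
    have sS0: "0 \<le> sS x" unfolding sS_def by (rule sum_nonneg) (rule zero_le_power[OF ns])
    have "real (fst (x k)) \<le> f0 x + b + s'"
      unfolding b_def s'_def using x sp by (intro Z_le_f0 uk state_ok_space) simp
    then have "\<rho> * real (fst (x k)) \<le> \<rho> * (f0 x + b + s')" using \<rho> by (intro mult_left_mono) auto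
    also have "\<dots> = a + \<rho> * (b + s')" by (simp add: a_def algebra_simps)
    also have "\<dots> \<le> a + 1 * (b + s')" using \<rho> b0 s0 by (intro add_left_mono mult_right_mono) auto
    finally have "(\<rho> * real (fst (x k))) ^ M \<le> (a + (b + s')) ^ M" using \<rho> by (intro power_mono) auto
    also have "\<dots> \<le> 2 ^ M * (a ^ M + (b + s') ^ M)" using a0 b0 s0 by (intro add_power_le) auto
    also have "\<dots> \<le> 2 ^ M * (2 ^ M * a ^ M + 2 ^ M * (b ^ M + s' ^ M))"
    proof (intro mult_left_mono add_mono add_power_le b0 s0)
      show "a ^ M \<le> 2 ^ M * a ^ M" using a0 by (simp add: mult_le_cancel_right1)
    qed simp
    also have "\<dots> = 4 ^ M * a ^ M + 4 ^ M * (b ^ M + s' ^ M)"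
    proof -
      have "(4::real) ^ M = 2 ^ M * 2 ^ M" by (simp flip: power_mult_distrib)
      then show ?thesis by (simp add: algebra_simps)
    qed
    also have "\<dots> \<le> 4 ^ M * a ^ M + 4 ^ M * (real k ^ M * sE x + real J ^ M * sS x)"
    proof (intro add_left_mono mult_left_mono add_mono)
      show "b ^ M \<le> real k ^ M * sE x"
        using sum_power_le[of "{1..k}" M "\<lambda>j. \<alpha> j * fst (snd (x j))", OF _ M0 nb] by (simp add: b_def sE_def)
      show "s' ^ M \<le> real J ^ M * sS x"
        using sum_power_le[of "{1..J}" M "\<lambda>j. \<mu> j * snd (snd (x j))", OF _ M0 ns] by (simp add: s'_def sS_def)
    qed simp
    finally have "ennreal ((\<rho> * real (fst (x k))) ^ M) \<le> ennreal (4 ^ M * a ^ M + (4 ^ M * real k ^ M * sE x + 4 ^ M * real J ^ M * sS x))"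
      by (intro ennreal_leI) (simp add: distrib_left mult.assoc)
    then show "ennreal ((\<rho> * real (fst (x k))) ^ M) \<le> ennreal (4 ^ M) * ennreal ((\<rho> * f0 x) ^ M) + (ennreal (4 ^ M * real k ^ M) * ennreal (sE x) + ennreal (4 ^ M * real J ^ M) * ennreal (sS x))"
      using a0 sE0 sS0 unfolding a_def by (simp add: ennreal_mult ennreal_plus)
  qed
  also have "\<dots> = ennreal (4 ^ M) * (\<integral>\<^sup>+x. ennreal ((\<rho> * f0 x) ^ M) \<partial>\<pi>) + (ennreal (4 ^ M * real k ^ M) * (\<integral>\<^sup>+x. ennreal (sE x) \<partial>\<pi>) + ennreal (4 ^ M * real J ^ M) * (\<integral>\<^sup>+x. ennreal (sS x) \<partial>\<pi>))"
  proof -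
    note [measurable] = f0m mE mS
    show ?thesis by (simp add: nn_integral_add nn_integral_cmult)
  qed
  also have "\<dots> \<le> ennreal (4 ^ M) * ennreal KF + (ennreal (4 ^ M * real k ^ M) * ennreal (\<Sum>j\<in>{1..k}. CE j) + ennreal (4 ^ M * real J ^ M) * ennreal (\<Sum>j\<in>{1..J}. CS j))"
    using IF IE IS by (intro add_mono mult_left_mono) auto
  also have "\<dots> = ennreal (4 ^ M * KF + (4 ^ M * real k ^ M * (\<Sum>j\<in>{1..k}. CE j) + 4 ^ M * real J ^ M * (\<Sum>j\<in>{1..J}. CS j)))"
  proof -
    have "0 \<le> (\<Sum>j\<in>{1..k}. CE j)" "0 \<le> (\<Sum>j\<in>{1..J}. CS j)" using CE CS by (auto intro!: sum_nonneg)
    then show ?thesis using KF0 by (simp add: ennreal_mult ennreal_plus)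
  qed
  also have "4 ^ M * KF + (4 ^ M * real k ^ M * (\<Sum>j\<in>{1..k}. CE j) + 4 ^ M * real J ^ M * (\<Sum>j\<in>{1..J}. CS j)) =
     4 ^ M * (E * (2 ^ M * (real k ^ M * (\<Sum>j\<in>{1..<k}. CZ j) + CS k) + E ^ (M - 1) + 1)
        + real k ^ M * (\<Sum>j\<in>{1..k}. CE j) + real J ^ M * (\<Sum>j\<in>{1..J}. CS j))"
    unfolding KF_def KW_def by (simp add: algebra_simps)
  finally show ?thesis .
qed

end

theorem theorem1:
  fixes \<Omega> :: "'a measure" and J M :: nat
    and \<alpha> lam :: "nat \<Rightarrow> real" and P w :: "nat \<Rightarrow> nat \<Rightarrow> real"
    and Te Ts :: "nat \<Rightarrow> nat \<Rightarrow> 'a \<Rightarrow> real" and rt :: "nat \<Rightarrow> nat \<Rightarrow> 'a \<Rightarrow> nat"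
  assumes prob: "prob_space \<Omega>"
    and J: "1 \<le> J" and M: "1 \<le> M"
    \<comment> \<open>measurability and support of the primitives\<close>
    and Te_meas: "\<And>j i. j \<in> {1..J} \<Longrightarrow> 1 \<le> i \<Longrightarrow> Te j i \<in> borel_measurable \<Omega>"
    and Ts_meas: "\<And>j i. j \<in> {1..J} \<Longrightarrow> 1 \<le> i \<Longrightarrow> Ts j i \<in> borel_measurable \<Omega>"
    and rt_meas: "\<And>j i. j \<in> {1..J} \<Longrightarrow> 1 \<le> i \<Longrightarrow> rt j i \<in> measurable \<Omega> (count_space UNIV)"
    and Te_nonneg: "\<And>j i \<omega>. j \<in> {1..J} \<Longrightarrow> 1 \<le> i \<Longrightarrow> \<omega> \<in> space \<Omega> \<Longrightarrow> 0 \<le> Te j i \<omega>"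
    and Ts_nonneg: "\<And>j i \<omega>. j \<in> {1..J} \<Longrightarrow> 1 \<le> i \<Longrightarrow> \<omega> \<in> space \<Omega> \<Longrightarrow> 0 \<le> Ts j i \<omega>"
    and rt_range: "\<And>j i \<omega>. j \<in> {1..J} \<Longrightarrow> 1 \<le> i \<Longrightarrow> \<omega> \<in> space \<Omega> \<Longrightarrow> rt j i \<omega> \<le> J"
    \<comment> \<open>identically distributed sequences\<close>
    and Te_id: "\<And>j i. j \<in> {1..J} \<Longrightarrow> 1 \<le> i \<Longrightarrow> distr \<Omega> borel (Te j i) = distr \<Omega> borel (Te j 1)"
    and Ts_id: "\<And>j i. j \<in> {1..J} \<Longrightarrow> 1 \<le> i \<Longrightarrow> distr \<Omega> borel (Ts j i) = distr \<Omega> borel (Ts j 1)"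
    and rt_id: "\<And>j i. j \<in> {1..J} \<Longrightarrow> 1 \<le> i \<Longrightarrow>
                  distr \<Omega> (count_space UNIV) (rt j i) = distr \<Omega> (count_space UNIV) (rt j 1)"
    \<comment> \<open>mutual independence of all 3J sequences\<close>
    and indep: "prob_space.indep_vars \<Omega> (\<lambda>_. borel)
       (\<lambda>(c, j, i). if c = (0::nat) then Te j i else if c = 1 then Ts j i else (\<lambda>\<omega>. real (rt j i \<omega>)))
       {(c, j, i). c \<le> 2 \<and> j \<in> {1..J} \<and> 1 \<le> i}"
    \<comment> \<open>unit means and routing law\<close>
    and Te_mean: "\<And>j. j \<in> {1..J} \<Longrightarrow> (\<integral>\<^sup>+ \<omega>. ennreal (Te j 1 \<omega>) \<partial>\<Omega>) = 1"
    and Ts_mean: "\<And>j. j \<in> {1..J} \<Longrightarrow> (\<integral>\<^sup>+ \<omega>. ennreal (Ts j 1 \<omega>) \<partial>\<Omega>) = 1"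
    and rt_law: "\<And>j k. j \<in> {1..J} \<Longrightarrow> k \<in> {1..J} \<Longrightarrow>
                   measure \<Omega> {\<omega> \<in> space \<Omega>. rt j 1 \<omega> = k} = P j k"
    \<comment> \<open>routing matrix: substochastic, I - P invertible\<close>
    and P_nonneg: "\<And>j k. j \<in> {1..J} \<Longrightarrow> k \<in> {1..J} \<Longrightarrow> 0 \<le> P j k"
    and P_substoch: "\<And>j. j \<in> {1..J} \<Longrightarrow> (\<Sum>k\<in>{1..J}. P j k) \<le> 1"
    and P_open: "\<exists>Q :: nat \<Rightarrow> nat \<Rightarrow> real. \<forall>i\<in>{1..J}. \<forall>k\<in>{1..J}.
        (\<Sum>l\<in>{1..J}. ((if i = l then 1 else 0) - P i l) * Q l k) = (if i = k then 1 else 0) \<and>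
        (\<Sum>l\<in>{1..J}. Q i l * ((if l = k then 1 else 0) - P l k)) = (if i = k then 1 else 0)"
    \<comment> \<open>arrival rates and nominal (traffic equation) rates\<close>
    and \<alpha>_nonneg: "\<And>j. j \<in> {1..J} \<Longrightarrow> 0 \<le> \<alpha> j"
    and lam_traffic: "\<And>j. j \<in> {1..J} \<Longrightarrow> lam j = \<alpha> j + (\<Sum>l\<in>{1..J}. lam l * P l j)"
    and lam_pos: "\<And>j. j \<in> {1..J} \<Longrightarrow> 0 < lam j"
    \<comment> \<open>the matrix w\<close>
    and w_sol: "\<And>j k. j \<in> {1..J} \<Longrightarrow> k \<in> {1..J} \<Longrightarrow>
        0 \<le> w j k \<and> w j k \<le> 1 \<and> w j k = P j k + (\<Sum>l\<in>{1..k - 1}. P j l * w l k)"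
    \<comment> \<open>stability assumption for the multi-scale family\<close>
    and stable: "\<And>r. 0 < r \<Longrightarrow> r < 1 \<Longrightarrow>
        gjn_positive_harris_recurrent \<Omega> J \<alpha> (\<lambda>j. lam j + r ^ j) Te Ts rt \<and>
        (\<exists>!\<pi>. gjn_stationary \<Omega> J \<alpha> (\<lambda>j. lam j + r ^ j) Te Ts rt \<pi>)"
    \<comment> \<open>moment conditions\<close>
    and Te_mom: "\<And>j. j \<in> {1..min M J} \<Longrightarrow> (\<integral>\<^sup>+ \<omega>. ennreal (Te j 1 \<omega> ^ (M + 1)) \<partial>\<Omega>) < \<infinity>"
    and Ts_mom: "\<And>j. j \<in> {1..J} \<Longrightarrow> (\<integral>\<^sup>+ \<omega>. ennreal (Ts j 1 \<omega> ^ (M + 1)) \<partial>\<Omega>) < \<infinity>"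
  shows "\<forall>k\<in>{1..min M J}. \<exists>C::real. 0 < C \<and>
           (\<forall>r. 0 < r \<and> r < 1 \<and> r < gjn_r0 J w \<longrightarrow>
              (\<forall>\<pi>. gjn_stationary \<Omega> J \<alpha> (\<lambda>j. lam j + r ^ j) Te Ts rt \<pi> \<longrightarrow>
                 (\<integral>\<^sup>+ x. ennreal ((r ^ k * real (fst (x k))) ^ M) \<partial>\<pi>) \<le> ennreal C))"
proof -
  interpret prob_space \<Omega> by (rule prob)
  interpret tr: gjn_traffic J \<alpha> lam P w
    using J P_open \<alpha>_nonneg lam_traffic lam_pos w_sol by unfold_locales blast+
  \<comment> \<open>Dominates every service rate of the family, since \<open>r ^ j\<close> is at
    most 1; renewal moments at this level do not depend on \<open>r\<close>.\<close>
  define \<kappa> where "\<kappa> j = lam j + 1" for j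
  have \<mu>: "lam j \<le> lam j + r ^ j" "lam j + r ^ j \<le> \<kappa> j" "0 < lam j + r ^ j" if "j \<in> {1..J}" "0 < r" "r < 1" for r j
  proof -
    have "0 < lam j" "0 < r ^ j" "r ^ j \<le> 1" using lam_pos[OF that(1)] that(2,3) by (auto intro: power_le_one)
    then show "lam j \<le> lam j + r ^ j" "lam j + r ^ j \<le> \<kappa> j" "0 < lam j + r ^ j" unfolding \<kappa>_def by linarith+
  qed
  have net: "gjn_net J \<alpha> (\<lambda>j. lam j + r ^ j) \<Omega> Te Ts rt" if "0 < r" "r < 1" for r
  proof
    show "indep_vars (\<lambda>_. borel) (prim_var Te Ts rt) (prim_index J)"
      using indep unfolding prim_var_def prim_index_def .
  qed (fact \<alpha>_nonneg tr.exists_external Te_nonneg Ts_nonneg Te_id Ts_id rt_id rt_meas Te_mean Ts_mean \<mu>(3)[OF _ that])+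
  \<comment> \<open>Facts about the primitives alone live in a locale that carries service rates;
    any admissible \<open>r\<close> gives access to them, and one half is taken.\<close>
  interpret n0: gjn_net J \<alpha> "\<lambda>j. lam j + (1 / 2) ^ j" \<Omega> Te Ts rt by (rule net) simp_all

  define mE where "mE j = enn2real (\<integral>\<^sup>+\<omega>. renewal_sum (\<lambda>i. Te j i \<omega>) (\<alpha> j) ^ Suc M \<partial>\<Omega>)" for j
  define mS where "mS j = enn2real (\<integral>\<^sup>+\<omega>. renewal_sum (\<lambda>i. Ts j i \<omega>) (\<kappa> j) ^ Suc M \<partial>\<Omega>)" for j
  have finE: "(\<integral>\<^sup>+\<omega>. renewal_sum (\<lambda>i. Te j i \<omega>) (\<alpha> j) ^ Suc M \<partial>\<Omega>) < \<infinity>" if j: "j \<in> {1..min M J}" for j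
  proof -
    have jJ: "j \<in> {1..J}" using j by auto
    show ?thesis
      unfolding renewal_sum_def using Te_mom[OF j]
      by (intro renewal_moment n0.indep_Te[OF jJ] Te_nonneg[OF jJ] Te_id[OF jJ] Te_mean[OF jJ]) simp_all
  qed
  have finS: "(\<integral>\<^sup>+\<omega>. renewal_sum (\<lambda>i. Ts j i \<omega>) (\<kappa> j) ^ Suc M \<partial>\<Omega>) < \<infinity>" if j: "j \<in> {1..J}" for j
    unfolding renewal_sum_def using Ts_mom[OF j]
    by (intro renewal_moment n0.indep_Ts[OF j] Ts_nonneg[OF j] Ts_id[OF j] Ts_mean[OF j]) simp_all
  have mE: "(\<integral>\<^sup>+\<omega>. renewal_sum (\<lambda>i. Te j i \<omega>) (\<alpha> j) ^ Suc M \<partial>\<Omega>) = ennreal (mE j)" "0 \<le> mE j" if "j \<in> {1..min M J}" for j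
    using finE[OF that] by (simp_all add: mE_def ennreal_enn2real_if less_top[symmetric] del: power_Suc)
  have mS: "(\<integral>\<^sup>+\<omega>. renewal_sum (\<lambda>i. Ts j i \<omega>) (\<kappa> j) ^ Suc M \<partial>\<Omega>) = ennreal (mS j)" "0 \<le> mS j" if "j \<in> {1..J}" for j
    using finS[OF that] by (simp_all add: mS_def ennreal_enn2real_if less_top[symmetric] del: power_Suc)
  define mT where "mT j = enn2real (\<integral>\<^sup>+\<omega>. ennreal ((Ts j 1 \<omega> / lam j) ^ M) \<partial>\<Omega>)" for j
  have mT: "(\<integral>\<^sup>+\<omega>. ennreal ((Ts j 1 \<omega> / lam j) ^ M) \<partial>\<Omega>) = ennreal (mT j)" "0 \<le> mT j" if j: "j \<in> {1..J}" for j
  proof -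
    have "(\<integral>\<^sup>+\<omega>. ennreal ((Ts j 1 \<omega> / lam j) ^ M) \<partial>\<Omega>) \<le> (\<integral>\<^sup>+\<omega>. ennreal (1 / lam j ^ M) * (1 + ennreal (Ts j 1 \<omega> ^ (M + 1))) \<partial>\<Omega>)"
    proof (rule nn_integral_mono)
      fix \<omega> assume w: "\<omega> \<in> space \<Omega>"
      have t: "0 \<le> Ts j 1 \<omega>" using Ts_nonneg[OF j _ w] by simp
      have "Ts j 1 \<omega> ^ M \<le> 1 + Ts j 1 \<omega> ^ (M + 1)"
      proof (cases "1 \<le> Ts j 1 \<omega>")
        case True
        then have "Ts j 1 \<omega> ^ M \<le> Ts j 1 \<omega> ^ (M + 1)" by (intro power_increasing) auto
        then show ?thesis by simp
      next
        case False
        then have "Ts j 1 \<omega> ^ M \<le> 1" using t by (intro power_le_one) auto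
        moreover have "0 \<le> Ts j 1 \<omega> ^ (M + 1)" using t by simp
        ultimately show ?thesis by linarith
      qed
      then have "1 / lam j ^ M * Ts j 1 \<omega> ^ M \<le> 1 / lam j ^ M * (1 + Ts j 1 \<omega> ^ (M + 1))"
        using lam_pos[OF j] by (intro mult_left_mono) auto
      then have "ennreal ((Ts j 1 \<omega> / lam j) ^ M) \<le> ennreal (1 / lam j ^ M * (1 + Ts j 1 \<omega> ^ (M + 1)))"
        by (intro ennreal_leI) (simp add: power_divide)
      also have "\<dots> = ennreal (1 / lam j ^ M) * (1 + ennreal (Ts j 1 \<omega> ^ (M + 1)))"
      proof -
        have T: "0 \<le> Ts j 1 \<omega> ^ (M + 1)" using t by simp
        have "ennreal (1 / lam j ^ M * (1 + Ts j 1 \<omega> ^ (M + 1))) = ennreal (1 / lam j ^ M) * ennreal (1 + Ts j 1 \<omega> ^ (M + 1))"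
          using T lam_pos[OF j] by (intro ennreal_mult) auto
        also have "ennreal (1 + Ts j 1 \<omega> ^ (M + 1)) = ennreal 1 + ennreal (Ts j 1 \<omega> ^ (M + 1))"
          using T by (intro ennreal_plus) auto
        finally show ?thesis by simp
      qed
      finally show "ennreal ((Ts j 1 \<omega> / lam j) ^ M) \<le> ennreal (1 / lam j ^ M) * (1 + ennreal (Ts j 1 \<omega> ^ (M + 1)))" .
    qed
    also have "\<dots> = ennreal (1 / lam j ^ M) * (1 + (\<integral>\<^sup>+\<omega>. ennreal (Ts j 1 \<omega> ^ (M + 1)) \<partial>\<Omega>))"
      using Ts_meas[OF j, of 1] by (simp add: nn_integral_cmult nn_integral_add emeasure_space_1 del: power_Suc)
    also have "\<dots> < \<infinity>" using Ts_mom[OF j] by (simp add: ennreal_mult_less_top del: power_Suc)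
    finally show "(\<integral>\<^sup>+\<omega>. ennreal ((Ts j 1 \<omega> / lam j) ^ M) \<partial>\<Omega>) = ennreal (mT j)"
      by (simp add: mT_def ennreal_enn2real_if less_top[symmetric])
  qed (simp add: mT_def)

  define CS where "CS j = \<kappa> j ^ M * (1 + mS j / lam j ^ Suc M + mT j)" for j
  \<comment> \<open>For \<alpha> equal to 0 the value is 0 because \<open>M\<close> is positive,
    matching the vanishing weighted residual, whatever the division by zero returns.\<close>
  define CE where "CE j = \<alpha> j ^ M * (1 + mE j / \<alpha> j ^ Suc M)" for j
  have CS: "0 \<le> CS j \<and> (\<integral>\<^sup>+x. ennreal (((lam j + r ^ j) * snd (snd (x j))) ^ M) \<partial>\<pi>) \<le> ennreal (CS j)"
    if j: "j \<in> {1..J}" and r: "0 < r" "r < 1" and st: "gjn_stationary \<Omega> J \<alpha> (\<lambda>j. lam j + r ^ j) Te Ts rt \<pi>" for r j \<pi>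
  proof -
    interpret n: gjn_net J \<alpha> "\<lambda>j. lam j + r ^ j" \<Omega> Te Ts rt by (rule net[OF r])
    have k0: "0 < \<kappa> j" using lam_pos[OF j] by (simp add: \<kappa>_def)
    have b0: "0 \<le> 1 + mS j / lam j ^ Suc M" using mS(2)[OF j] lam_pos[OF j] by simp
    have s: "sets \<pi> = sets (gjn_space J)" using st by (auto simp: gjn_stationary_def)
    have sp: "space \<pi> = space (gjn_space J)" using s by (rule sets_eq_imp_space_eq)
    have harris: "gjn_harris_recurrent \<Omega> J \<alpha> (\<lambda>j. lam j + r ^ j) Te Ts rt"
      using stable[OF r] by (simp add: gjn_positive_harris_recurrent_def)
    have [measurable]: "(\<lambda>x. snd (snd (x j))) \<in> borel_measurable \<pi>"
      by (rule measurable_gjn_space_parts(3)[OF j measurable_ident_sets[OF s]])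
    have "(\<integral>\<^sup>+x. ennreal (((lam j + r ^ j) * snd (snd (x j))) ^ M) \<partial>\<pi>) \<le> (\<integral>\<^sup>+x. ennreal (\<kappa> j ^ M) * ennreal (snd (snd (x j)) ^ M) \<partial>\<pi>)"
    proof (rule nn_integral_mono)
      fix x assume "x \<in> space \<pi>"
      then have R: "0 \<le> snd (snd (x j))" using n.state_ok_space[of x] sp j by (auto simp: n.state_ok_def)
      have "((lam j + r ^ j) * snd (snd (x j))) ^ M \<le> (\<kappa> j * snd (snd (x j))) ^ M"
        using R \<mu>[OF j r] by (intro power_mono mult_right_mono) auto
      then show "ennreal (((lam j + r ^ j) * snd (snd (x j))) ^ M) \<le> ennreal (\<kappa> j ^ M) * ennreal (snd (snd (x j)) ^ M)"
        using R k0 by (simp add: power_mult_distrib ennreal_mult[symmetric] ennreal_leI)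
    qed
    also have "\<dots> = ennreal (\<kappa> j ^ M) * (\<integral>\<^sup>+x. ennreal (snd (snd (x j)) ^ M) \<partial>\<pi>)"
      by (rule nn_integral_cmult) measurable
    also have "\<dots> \<le> ennreal (\<kappa> j ^ M) * (ennreal (1 + mS j / lam j ^ Suc M) + ennreal (mT j))"
      using n.srv_resid_bound[OF st harris j lam_pos[OF j] \<mu>(1,2)[OF j r] mS[OF j]] unfolding mT(1)[OF j]
      by (intro mult_left_mono) auto
    also have "\<dots> = ennreal (CS j)"
      using b0 mT(2)[OF j] k0 by (simp add: CS_def ennreal_plus[symmetric] ennreal_mult[symmetric] del: ennreal_plus power_Suc)
    finally show ?thesis using b0 mT(2)[OF j] k0 by (simp add: CS_def)
  qed
  have CE: "0 \<le> CE j \<and> (\<integral>\<^sup>+x. ennreal ((\<alpha> j * fst (snd (x j))) ^ M) \<partial>\<pi>) \<le> ennreal (CE j)"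
    if j: "j \<in> {1..min M J}" and r: "0 < r" "r < 1" and st: "gjn_stationary \<Omega> J \<alpha> (\<lambda>j. lam j + r ^ j) Te Ts rt \<pi>" for r j \<pi>
  proof (cases "0 < \<alpha> j")
    case True
    interpret n: gjn_net J \<alpha> "\<lambda>j. lam j + r ^ j" \<Omega> Te Ts rt by (rule net[OF r])
    have jJ: "j \<in> {1..J}" using j by auto
    have b0: "0 \<le> 1 + mE j / \<alpha> j ^ Suc M" using mE(2)[OF j] True by simp
    have s: "sets \<pi> = sets (gjn_space J)" using st by (auto simp: gjn_stationary_def)
    have [measurable]: "(\<lambda>x. fst (snd (x j))) \<in> borel_measurable \<pi>"
      by (rule measurable_gjn_space_parts(2)[OF jJ measurable_ident_sets[OF s]])
    have "(\<integral>\<^sup>+x. ennreal ((\<alpha> j * fst (snd (x j))) ^ M) \<partial>\<pi>) = ennreal (\<alpha> j ^ M) * (\<integral>\<^sup>+x. ennreal (fst (snd (x j)) ^ M) \<partial>\<pi>)"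
      using True by (simp add: power_mult_distrib ennreal_mult' nn_integral_cmult)
    also have "\<dots> \<le> ennreal (\<alpha> j ^ M) * ennreal (1 + mE j / \<alpha> j ^ Suc M)"
      by (intro mult_left_mono n.ext_resid_bound[OF st jJ True mE[OF j]]) simp
    also have "\<dots> = ennreal (CE j)" using b0 True by (simp add: CE_def ennreal_mult[symmetric] del: power_Suc)
    finally show ?thesis using b0 True by (simp add: CE_def)
  next
    case False
    then have "\<alpha> j = 0" using \<alpha>_nonneg[of j] j by force
    moreover have "0 < M" using M by simp
    ultimately show ?thesis by (simp add: CE_def zero_power)
  qed

  define B where "B = (\<Sum>j\<in>{1..J}. \<alpha> j) + (\<Sum>j\<in>{1..J}. \<kappa> j)"
  define Q where "Q k C \<longleftrightarrow> (\<forall>r. 0 < r \<and> r < 1 \<and> r < gjn_r0 J w \<longrightarrow>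
     (\<forall>\<pi>. gjn_stationary \<Omega> J \<alpha> (\<lambda>j. lam j + r ^ j) Te Ts rt \<pi> \<longrightarrow>
       (\<integral>\<^sup>+ x. ennreal ((r ^ k * real (fst (x k))) ^ M) \<partial>\<pi>) \<le> ennreal C))" for k and C :: real
  have main: "k \<in> {1..min M J} \<Longrightarrow> \<exists>C. 0 < C \<and> Q k C" for k
  proof (induction k rule: less_induct)
    case (less k)
    have kJ: "k \<in> {1..J}" and kM: "k \<le> M" using less.prems by auto
    have "\<forall>j\<in>{1..<k}. \<exists>C. 0 < C \<and> Q j C" using less by auto
    then obtain CZ where CZ: "\<And>j. j \<in> {1..<k} \<Longrightarrow> 0 < CZ j \<and> Q j (CZ j)" by metis
    define c0 where "c0 = (1 - w k k) / J"
    have c0: "0 < c0" using tr.w_diag_less_1[OF kJ] J by (simp add: c0_def)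
    have c01: "c0 \<le> 1"
    proof -
      have "1 - w k k \<le> 1 * real J" using w_sol[OF kJ kJ] J by simp
      then show ?thesis using J by (simp add: c0_def)
    qed
    \<comment> \<open>Agrees with \<open>g.Sr\<close> below, but is written before \<open>r\<close>
      is fixed, so that \<open>E\<close> and \<open>C\<close> are seen to be independent of
      \<open>r\<close>.\<close>
    define S where "S \<omega> = B + 1 + 2 * enn2real (event_total J k \<alpha> \<kappa> (prims J Te Ts rt \<omega>))" for \<omega>
    define E where "E = 2 * (real (Suc M) * ((B + 1) * 2 ^ M + 1 + real M * 4 ^ M) * (\<integral>\<omega>. S \<omega> ^ (M + 1) \<partial>\<Omega>)) / (real (Suc M) / 2 ^ M * c0)"
    define C where "C = 4 ^ M * (E * (2 ^ M * (real k ^ M * (\<Sum>j\<in>{1..<k}. CZ j) + CS k) + E ^ (M - 1) + 1)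
        + real k ^ M * (\<Sum>j\<in>{1..k}. CE j) + real J ^ M * (\<Sum>j\<in>{1..J}. CS j))"
    have S_mom: "(\<integral>\<^sup>+\<omega>. event_total J k \<alpha> \<kappa> (prims J Te Ts rt \<omega>) ^ (M + 1) \<partial>\<Omega>) < \<infinity>"
    proof (rule event_total_moment[OF n0.Y_q_meas])
      fix j assume j: "j \<in> {1..k}"
      then have jm: "j \<in> {1..min M J}" using less.prems by auto
      have "renewal_sum (\<lambda>i. prims J Te Ts rt \<omega> (0, j, i)) (\<alpha> j) = renewal_sum (\<lambda>i. Te j i \<omega>) (\<alpha> j)" for \<omega>
        using jm by (intro renewal_sum_cong) (simp add: prims_simps)
      then show "(\<integral>\<^sup>+\<omega>. renewal_sum (\<lambda>i. prims J Te Ts rt \<omega> (0, j, i)) (\<alpha> j) ^ (M + 1) \<partial>\<Omega>) < \<infinity>"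
        using finE[OF jm] by (simp del: power_Suc)
    next
      fix j assume j: "j \<in> {1..J}"
      have "renewal_sum (\<lambda>i. prims J Te Ts rt \<omega> (1, j, i)) (\<kappa> j) = renewal_sum (\<lambda>i. Ts j i \<omega>) (\<kappa> j)" for \<omega>
        using j by (intro renewal_sum_cong) (simp add: prims_simps)
      then show "(\<integral>\<^sup>+\<omega>. renewal_sum (\<lambda>i. prims J Te Ts rt \<omega> (1, j, i)) (\<kappa> j) ^ (M + 1) \<partial>\<Omega>) < \<infinity>"
        using finS[OF j] by (simp del: power_Suc)
    qed simp
    have bound: "(\<integral>\<^sup>+ x. ennreal ((r ^ k * real (fst (x k))) ^ M) \<partial>\<pi>) \<le> ennreal C"
      if r: "0 < r" "r < 1" "r < gjn_r0 J w" and st: "gjn_stationary \<Omega> J \<alpha> (\<lambda>j. lam j + r ^ j) Te Ts rt \<pi>" for r \<pi>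
    proof -
      interpret n: gjn_net J \<alpha> "\<lambda>j. lam j + r ^ j" \<Omega> Te Ts rt by (rule net[OF r(1,2)])
      have rk: "0 < r ^ k" "r ^ k \<le> 1" using r by (auto intro: power_le_one)
      have e1: "c0 * r ^ k \<le> 1" using c0 c01 rk by (simp add: mult_le_one)
      interpret t: gjn_test J \<alpha> "\<lambda>j. lam j + r ^ j" k M "tr.tu k" "tr.td k" B "c0 * r ^ k"
      proof
        show "k \<in> {1..J}" "1 \<le> M" by fact+
        show "0 \<le> tr.tu k j \<and> tr.tu k j \<le> 1" "\<bar>tr.td k j\<bar> \<le> 1" if "j \<in> {1..J}" for j
          using tr.tu_range[OF that kJ] tr.td_signs(1)[OF that kJ] by auto
        show "tr.tu k j = 0" if "k < j" for j using that by (simp add: tr.tu_def)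
        show "tr.td k j = 0" if "j < k" for j using that by (simp add: tr.td_def tr.tu_def)
        show "0 \<le> tr.td k j" if "k < j" "j \<le> J" for j
          using that kJ tr.td_signs(3)[of j k] w_sol[of j k] by auto
        show "(\<Sum>j\<in>{1..J}. \<alpha> j) + (\<Sum>j\<in>{1..J}. lam j + r ^ j) \<le> B"
          unfolding B_def using \<mu>(2)[OF _ r(1,2)] by (intro add_left_mono sum_mono) auto
        show "0 \<le> c0 * r ^ k" using c0 rk by simp
        show "(\<Sum>j\<in>{1..J}. \<alpha> j * tr.tu k j) + (\<Sum>j\<in>{k..J}. tr.td k j * (lam j + r ^ j)) \<le> - (c0 * r ^ k)"
          unfolding c0_def by (rule tr.drift_bound[OF r(1,3) kJ])
      qed
      interpret g: gjn_drift J \<alpha> "\<lambda>j. lam j + r ^ j" \<Omega> Te Ts rt k M "tr.tu k" "tr.td k" B "c0 * r ^ k" P \<alpha> \<kappa>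
      proof
        show "measure \<Omega> {\<omega> \<in> space \<Omega>. rt j 1 \<omega> = l} = P j l" if "j \<in> {1..J}" "l \<in> {1..J}" for j l
          using rt_law[OF that] .
        show "tr.td k j = (\<Sum>l\<in>{1..J}. P j l * tr.tu k l) - tr.tu k j" if "j \<in> {1..J}" for j
          by (rule tr.td_eq[OF that kJ])
        show "lam j + r ^ j \<le> \<kappa> j" if "j \<in> {1..J}" for j by (rule \<mu>(2)[OF that r(1,2)])
      qed (use e1 S_mom in simp_all)
      show ?thesis
        unfolding C_def
      proof (rule g.stationary_Z_moment[OF st rk c0 refl])
        show "tr.tu k k = 1" by (simp add: tr.tu_def)
        show "0 \<le> CE j \<and> (\<integral>\<^sup>+x. ennreal ((\<alpha> j * fst (snd (x j))) ^ M) \<partial>\<pi>) \<le> ennreal (CE j)" if "j \<in> {1..k}" for j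
          using that less.prems by (intro CE[OF _ r(1,2) st]) auto
        show "0 \<le> CS j \<and> (\<integral>\<^sup>+x. ennreal (((lam j + r ^ j) * snd (snd (x j))) ^ M) \<partial>\<pi>) \<le> ennreal (CS j)" if "j \<in> {1..J}" for j
          by (rule CS[OF that r(1,2) st])
        show "E = 2 * (g.Cp * (\<integral>\<omega>. g.Sr \<omega> ^ (M + 1) \<partial>\<Omega>)) / (real (Suc M) / 2 ^ M * c0)"
          unfolding E_def g.Cp_def g.Sr_def S_def ..
        show "0 \<le> CZ j \<and> (\<integral>\<^sup>+x. ennreal ((r ^ k) ^ (M - 1) * real (fst (x j)) ^ M) \<partial>\<pi>) \<le> ennreal (CZ j)" if j: "j \<in> {1..<k}" for j
        proof
          show "0 \<le> CZ j" using CZ[OF j] by simp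
          \<comment> \<open>From \<open>j \<le> k - 1\<close> and \<open>k \<le> M\<close>:
            \<open>(k - 1) * M = k * M - M \<le> k * M - k\<close>. This is the only place where
            \<open>k \<le> M\<close> enters the scaling of the lower queues.\<close>
          have "j * M \<le> (k - 1) * M" using j by (intro mult_right_mono) auto
          also have "\<dots> \<le> k * (M - 1)" using kM by (simp add: diff_mult_distrib diff_mult_distrib2)
          finally have "r ^ (k * (M - 1)) \<le> r ^ (j * M)" using r by (intro power_decreasing) auto
          then have "(r ^ k) ^ (M - 1) * real (fst (x j)) ^ M \<le> (r ^ j * real (fst (x j))) ^ M" for x :: "nat \<Rightarrow> nat \<times> real \<times> real"
            unfolding power_mult_distrib power_mult[symmetric] by (intro mult_right_mono) auto
          then have "(\<integral>\<^sup>+x. ennreal ((r ^ k) ^ (M - 1) * real (fst (x j)) ^ M) \<partial>\<pi>) \<le> (\<integral>\<^sup>+x. ennreal ((r ^ j * real (fst (x j))) ^ M) \<partial>\<pi>)"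
            by (intro nn_integral_mono ennreal_leI)
          also have "\<dots> \<le> ennreal (CZ j)" using CZ[OF j] r st unfolding Q_def by blast
          finally show "(\<integral>\<^sup>+x. ennreal ((r ^ k) ^ (M - 1) * real (fst (x j)) ^ M) \<partial>\<pi>) \<le> ennreal (CZ j)" .
        qed
      qed
    qed
    \<comment> \<open>The maximum with 1 secures a strictly positive constant.\<close>
    have "Q k (max C 1)"
      unfolding Q_def using bound by (meson ennreal_leI max.cobounded1 order_trans)
    then show ?case by (intro exI[of _ "max C 1"]) simp
  qed
  show ?thesis using main unfolding Q_def by blast
qed

end
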